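(* Let $d\ge 1$, $H>0$, let $\{X(t):t\ge 0\}$ be a non-deterministic $H$-selfsimilar additive process on $\mathbb{R}^d$, and let $g\in\mathcal{G}_1$. For $C\in[0,\infty]$ consider the law $$(\ast)_C\qquad \limsup_{t\to\infty}\frac{|X(t)|}{t^H g(\log t)}=C\quad\text{a.s.}$$ (i) There is $C\in[0,\infty]$ such that $(\ast)_C$ holds. (ii) The equality $(\ast)_C$ holds for some $C\in[0,\infty]$ if and only if (with this $C$) $$\int_0^\infty G_l(\delta g(x))\,dx=\int_{\mathbb{R}^d}g^{-1}(\delta^{-1}|x|)\,\rho_l(dx)\ \begin{cases}<\infty & \text{for }\delta>C\text{ and all }l\in\mathbb{N},\\ =\infty & \text{for }0<\delta<C\text{ and some }l=l(\delta)\in\mathbb{N}.\end{cases}$$ (iii) Suppose that $g\in\mathcal{G}_1$ and $g^{-1}(|x|)$ is submultiplicative on $\mathbb{R}^d$. Then $(\ast)_C$ holds if and only if $$\int_1^\infty\frac{K(r)-K(e^Hr)}{r}\,g^{-1}(\delta^{-1}r)\,dr\ \begin{cases}<\infty&\text{for }\delta>C,\\ =\infty&\text{for }0<\delta<C.\end{cases}$$ In the case where $\limsup_{r\to\infty}K(e^Hr)/K(r)<1$, this last condition is also equivalent to $$\int_1^\infty K(r)\,\frac{g^{-1}(\delta^{-1}r)}{r}\,dr\ \begin{cases}<\infty&\text{for }\delta>C,\\ =\infty&\text{for }0<\delta<C.\end{cases}$$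
   Context: $|x|$ is the Euclidean norm; "increasing" and "decreasing" are in the wide (non-strict) sense; $\mathbb{N}=\{1,2,\dots\}$. An $\mathbb{R}^d$-valued process $\{X(t):t\ge0\}$ is an $H$-selfsimilar additive process ($H>0$) if: (1) $\{X(ct)\}\stackrel{d}{=}\{c^HX(t)\}$ (equality of finite-dimensional distributions) for every $c>0$; (2) it has independent increments (stationarity of increments is not assumed); (3) almost surely its paths are right-continuous on $[0,\infty)$ with left limits on $(0,\infty)$. It is deterministic if $X(t)=t^Hc$ for some $c\in\mathbb{R}^d$, and non-deterministic otherwise. $\mathcal{G}_1$ is the set of positive increasing functions $g$ on $[0,\infty)$ with $\lim_{x\to\infty}g(x)=\infty$. For $g\in\mathcal{G}_1$, $g^{-1}(x):=\sup\{y:g(y)<x\}$ for $x\ge0$, with $\sup\emptyset=0$. For $l\in\mathbb{N}$: $\rho_l$ is the distribution of $X(1)-X(e^{-l})$ and $G_l(r):=P(|X(1)-X(e^{-l})|>r)$. The distribution $\mu$ of $X(1)$ is selfdecomposable (for each $b\in(0,1)$ there is a distribution $\lambda_b$ with $\widehat\mu(z)=\widehat\mu(bz)\widehat\lambda_b(z)$, where hats denote characteristic functions), hence infinitely divisible; let $\nu$ be its Lévy measure. If $\nu\ne0$, then $\nu(B)=\int_{S^{d-1}}\sigma(d\xi)\int_0^\infty 1_B(r\xi)k_\xi(r)r^{-1}dr$ for Borel $B$, where $\sigma$ is a finite non-zero measure on the unit sphere $S^{d-1}$ ($S^0=\{-1,1\}$) and $k_\xi(r)\ge0$ is measurable in $\xi$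 and decreasing in $r>0$. Put $K(r):=\int_{S^{d-1}}k_\xi(r)\,\sigma(d\xi)$ for $r>0$; $K\equiv0$ in the Gaussian case $\nu=0$. A positive measurable function $h$ on $\mathbb{R}^d$ is submultiplicative if there is $c>0$ with $h(x+y)\le c\,h(x)h(y)$ for all $x,y\in\mathbb{R}^d$. *)

theory Defs
  imports "HOL-Probability.Probability"
begin

text \<open>
  \<open>\<real>\<^sup>d\<close> is rendered as a type \<^typ>\<open>'v::euclidean_space\<close>. A process is a function
  \<^typ>\<open>real \<Rightarrow> 'w \<Rightarrow> 'v\<close> of which only the values at times \<open>t \<ge> 0\<close> matter.
\<close>

section \<open>Selfsimilar additive processes\<close>

definition selfsimilar :: "'w measure \<Rightarrow> real \<Rightarrow> (real \<Rightarrow> 'w \<Rightarrow> 'v::euclidean_space) \<Rightarrow> bool" where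
  "selfsimilar M H X \<longleftrightarrow>
     (\<forall>c>0. \<forall>J. finite J \<and> J \<subseteq> {0..} \<longrightarrow>
        distr M (Pi\<^sub>M J (\<lambda>_. borel)) (\<lambda>\<omega>. \<lambda>t\<in>J. X (c * t) \<omega>) =
        distr M (Pi\<^sub>M J (\<lambda>_. borel)) (\<lambda>\<omega>. \<lambda>t\<in>J. c powr H *\<^sub>R X t \<omega>))"

definition independent_increments :: "'w measure \<Rightarrow> (real \<Rightarrow> 'w \<Rightarrow> 'v::euclidean_space) \<Rightarrow> bool" where
  "independent_increments M X \<longleftrightarrow>
     (\<forall>n. \<forall>t :: nat \<Rightarrow> real. 0 \<le> t 0 \<and> (\<forall>i<n. t i < t (Suc i)) \<longrightarrow>
        prob_space.indep_vars M (\<lambda>_. borel) (\<lambda>i \<omega>. X (t (Suc i)) \<omega> - X (t i) \<omega>) {..<n})"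

definition cadlag_paths :: "'w measure \<Rightarrow> (real \<Rightarrow> 'w \<Rightarrow> 'v::euclidean_space) \<Rightarrow> bool" where
  "cadlag_paths M X \<longleftrightarrow>
     (AE \<omega> in M. (\<forall>t\<ge>0. ((\<lambda>s. X s \<omega>) \<longlongrightarrow> X t \<omega>) (at_right t)) \<and>
                 (\<forall>t>0. \<exists>y. ((\<lambda>s. X s \<omega>) \<longlongrightarrow> y) (at_left t)))"

definition selfsimilar_additive_process ::
    "'w measure \<Rightarrow> real \<Rightarrow> (real \<Rightarrow> 'w \<Rightarrow> 'v::euclidean_space) \<Rightarrow> bool" where
  "selfsimilar_additive_process M H X \<longleftrightarrow>
     prob_space M \<and> H > 0 \<and> (\<forall>t\<ge>0. X t \<in> borel_measurable M) \<and>
     selfsimilar M H X \<and> independent_increments M X \<and> cadlag_paths M X"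

text \<open>As usual for processes, equality with \<open>t\<^sup>H c\<close> is meant almost surely.
  Note \<open>0 powr H = 0\<close>.\<close>

definition deterministic_process ::
    "'w measure \<Rightarrow> real \<Rightarrow> (real \<Rightarrow> 'w \<Rightarrow> 'v::euclidean_space) \<Rightarrow> bool" where
  "deterministic_process M H X \<longleftrightarrow> (\<exists>c. AE \<omega> in M. \<forall>t\<ge>0. X t \<omega> = t powr H *\<^sub>R c)"

section \<open>Norming functions\<close>

definition G1 :: "(real \<Rightarrow> real) set" where
  "G1 = {g. (\<forall>x\<ge>0. g x > 0) \<and> mono_on {0..} g \<and> filterlim g at_top at_top}"

text \<open>The case distinction is needed because \<open>Sup {}\<close> is unspecified on \<^typ>\<open>real\<close>.
  For \<open>g \<in> G1\<close> the set is bounded.\<close>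

definition ginv :: "(real \<Rightarrow> real) \<Rightarrow> real \<Rightarrow> real" where
  "ginv g x = (if {y. 0 \<le> y \<and> g y < x} = {} then 0 else Sup {y. 0 \<le> y \<and> g y < x})"

definition submultiplicative :: "('v::euclidean_space \<Rightarrow> real) \<Rightarrow> bool" where
  "submultiplicative h \<longleftrightarrow>
     h \<in> borel_measurable borel \<and> (\<forall>x. h x > 0) \<and> (\<exists>c>0. \<forall>x y. h (x + y) \<le> c * h x * h y)"

text \<open>
  For \<open>g \<in> G1\<close> the function \<open>g\<^sup>-\<^sup>1(|x|)\<close> vanishes for \<open>|x| \<le> g(0)\<close>, so it is never positive on the
  whole space, and even without positivity the inequality at \<open>y = 0\<close> would force it to vanish
  identically (see \<open>not_submultiplicative_ginv\<close> below). That \<open>g\<^sup>-\<^sup>1(|x|)\<close> \<open>is submultiplicative\<close>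
  therefore has to be read up to a modification on a bounded set, which is irrelevant for
  integrability at infinity: it agrees off some ball with a submultiplicative function.
\<close>

definition submultiplicative_off_ball :: "('v::euclidean_space \<Rightarrow> real) \<Rightarrow> bool" where
  "submultiplicative_off_ball f \<longleftrightarrow>
     (\<exists>h R. submultiplicative h \<and> (\<forall>x. norm x > R \<longrightarrow> h x = f x))"

lemma submultiplicative_imp_off_ball:
  "submultiplicative f \<Longrightarrow> submultiplicative_off_ball f"
  unfolding submultiplicative_off_ball_def by blast

lemma ginv_0: "g \<in> G1 \<Longrightarrow> ginv g 0 = 0"
proof -
  assume "g \<in> G1"
  then have "{y. 0 \<le> y \<and> g y < 0} = {}"
    by (fastforce simp: G1_def)
  then show ?thesis by (simp add: ginv_def)
qed

lemma not_submultiplicative_ginv: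
  assumes "g \<in> G1"
  shows "\<not> submultiplicative (\<lambda>x::'v::euclidean_space. ginv g (norm x))"
proof
  assume "submultiplicative (\<lambda>x::'v. ginv g (norm x))"
  then have "ginv g (norm (0::'v)) > 0"
    unfolding submultiplicative_def by blast
  with ginv_0[OF assms] show False by simp
qed

section \<open>The limsup law\<close>

definition limsup_law ::
    "'w measure \<Rightarrow> real \<Rightarrow> (real \<Rightarrow> 'w \<Rightarrow> 'v::euclidean_space) \<Rightarrow> (real \<Rightarrow> real) \<Rightarrow> ennreal \<Rightarrow> bool" where
  "limsup_law M H X g C \<longleftrightarrow>
     (AE \<omega> in M. Limsup at_top (\<lambda>t. ennreal (norm (X t \<omega>) / (t powr H * g (ln t)))) = C)"

definition rho :: "'w measure \<Rightarrow> (real \<Rightarrow> 'w \<Rightarrow> 'v::euclidean_space) \<Rightarrow> nat \<Rightarrow> 'v measure" where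
  "rho M X l = distr M borel (\<lambda>\<omega>. X 1 \<omega> - X (exp (- real l)) \<omega>)"

definition G_tail :: "'w measure \<Rightarrow> (real \<Rightarrow> 'w \<Rightarrow> 'v::euclidean_space) \<Rightarrow> nat \<Rightarrow> real \<Rightarrow> real" where
  "G_tail M X l r = measure M {\<omega> \<in> space M. norm (X 1 \<omega> - X (exp (- real l)) \<omega>) > r}"

section \<open>L\'evy measures and their polar decomposition\<close>

definition char_fun :: "'v::euclidean_space measure \<Rightarrow> 'v \<Rightarrow> complex" where
  "char_fun \<mu> z = (CLINT x|\<mu>. iexp (z \<bullet> x))"

text \<open>\<open>\<nu>\<close> is the L\'evy measure of the infinitely divisible distribution \<open>\<mu>\<close>: the
  L\'evy--Khintchine formula holds with some Gaussian covariance operator \<open>A\<close> and some \<open>\<gamma>\<close>.\<close>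

definition levy_measure_of :: "'v::euclidean_space measure \<Rightarrow> 'v measure \<Rightarrow> bool" where
  "levy_measure_of \<mu> \<nu> \<longleftrightarrow>
     sets \<nu> = sets borel \<and> emeasure \<nu> {0} = 0 \<and>
     (\<integral>\<^sup>+x. ennreal (min 1 ((norm x)\<^sup>2)) \<partial>\<nu>) < \<infinity> \<and>
     (\<exists>(A :: 'v \<Rightarrow> 'v) \<gamma>.
        linear A \<and> (\<forall>x y. A x \<bullet> y = x \<bullet> A y) \<and> (\<forall>x. 0 \<le> x \<bullet> A x) \<and>
        (\<forall>z. char_fun \<mu> z =
           exp (- complex_of_real ((z \<bullet> A z) / 2) + \<i> * complex_of_real (\<gamma> \<bullet> z)
             + (CLINT x|\<nu>. iexp (z \<bullet> x) - 1
                  - (if norm x \<le> 1 then \<i> * complex_of_real (z \<bullet> x) else 0)))))"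

text \<open>Only measurability of \<open>k\<close> in the direction \<open>\<xi>\<close> is required; in \<open>r\<close> it follows from
  monotonicity.\<close>

definition polar_decomposition ::
    "'v::euclidean_space measure \<Rightarrow> 'v measure \<Rightarrow> ('v \<Rightarrow> real \<Rightarrow> real) \<Rightarrow> bool" where
  "polar_decomposition \<nu> \<sigma> k \<longleftrightarrow>
     sets \<sigma> = sets (restrict_space borel (sphere 0 1)) \<and>
     finite_measure \<sigma> \<and> emeasure \<sigma> (space \<sigma>) \<noteq> 0 \<and>
     (\<forall>r>0. (\<lambda>\<xi>. k \<xi> r) \<in> borel_measurable \<sigma>) \<and>
     (\<forall>\<xi>\<in>sphere 0 1. (\<forall>r>0. 0 \<le> k \<xi> r) \<and> antimono_on {0<..} (k \<xi>)) \<and>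
     (\<forall>B\<in>sets borel. emeasure \<nu> B =
        (\<integral>\<^sup>+\<xi>. (\<integral>\<^sup>+r\<in>{0<..}. indicator B (r *\<^sub>R \<xi>) * ennreal (k \<xi> r / r) \<partial>lborel) \<partial>\<sigma>))"

text \<open>\<open>K\<close> is the function \<open>r \<mapsto> \<integral> k\<^sub>\<xi>(r) \<sigma>(d\<xi>)\<close> on \<open>r > 0\<close> if \<open>\<nu> \<noteq> 0\<close>, for a polar decomposition
  \<open>(\<sigma>, k)\<close> of \<open>\<nu>\<close>, and \<open>0\<close> if \<open>\<nu> = 0\<close>. The integral is
  finite for every \<open>r > 0\<close> since \<open>\<nu>\<close> is finite off neighbourhoods of \<open>0\<close> and \<open>k\<close> is decreasing, so
  the Bochner integral does not fall back to its default value.\<close>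

definition radial_function ::
    "'v::euclidean_space measure \<Rightarrow> (real \<Rightarrow> real) \<Rightarrow> bool" where
  "radial_function \<nu> K \<longleftrightarrow>
     (if emeasure \<nu> (space \<nu>) = 0 then \<forall>r>0. K r = 0
      else \<exists>\<sigma> k. polar_decomposition \<nu> \<sigma> k \<and> (\<forall>r>0. K r = (\<integral>\<xi>. k \<xi> r \<partial>\<sigma>)))"

definition critical_value :: "ennreal \<Rightarrow> (real \<Rightarrow> ennreal) \<Rightarrow> bool" where
  "critical_value C I \<longleftrightarrow>
     (\<forall>\<delta>>0. (ennreal \<delta> > C \<longrightarrow> I \<delta> < \<infinity>) \<and> (ennreal \<delta> < C \<longrightarrow> I \<delta> = \<infinity>))"

end

theory Submission
  imports Defs "HOL-Real_Asymp.Real_Asymp"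
begin

text \<open>
  Write \<open>I\<^sub>l(\<delta>)\<close> for the integral of \<open>G\<^sub>l(\<delta> g(x))\<close> over \<open>x \<ge> 0\<close>. If it is finite for all \<open>l\<close>, then by
  selfsimilarity and Borel--Cantelli the increments of \<open>X\<close> over logarithmic windows of length \<open>l\<close>
  are eventually at most about \<open>\<delta> t\<^sup>H g(log t)\<close>; Ottaviani's inequality extends this to whole windows,
  and since values one window earlier carry only the factor \<open>exp (- l H)\<close>, letting \<open>l\<close> tend to infinity
  bounds the limsup by \<open>\<delta>\<close>. If \<open>I\<^sub>l(\<delta>)\<close> is infinite, so is \<open>I\<^sub>k(\<delta>')\<close> for \<open>\<delta>' < \<delta>\<close> and \<open>k > l\<close>, and
  the second Borel--Cantelli lemma for disjoint windows gives the lower bound. Hence the limsup is the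
  critical \<open>\<delta>\<close>, and no zero-one law is needed.

  For the radial test, \<open>I\<^sub>l(\<delta>)\<close> is a moment of \<open>\<rho>\<^sub>l\<close>, whose symmetrization is infinitely divisible with
  L\'evy measure read off from \<open>\<mu>(z) = \<mu>(b z) \<rho>\<^sub>l(z)\<close> (characteristic functions, \<open>b = exp (- l H)\<close>). A submultiplicative
  moment of such a law is finite iff the L\'evy measure integrates the weight over \<open>|x| > 1\<close>: approximate
  the law by a Gaussian convolved with compound Poisson approximants and pass to the limit with Gaussian
  smoothing, under which submultiplicative weights change only by constant factors.
\<close>

section \<open>Probabilistic preliminaries\<close>

text \<open>Both sides of the limsup test are monotone in the level, so an arbitrarily small change
  of \<open>\<delta>\<close> is always affordable; this slack pays for the mesh, for Ottaviani's
  inequality and for the passage to longer windows. The obstacle in the radial test is that an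
  increment law is known only through its characteristic function and may have a drift and
  infinitely many small jumps. Symmetrization removes the drift and makes the characteristic
  functions real, so that powers (1 - a/k)^k can serve as approximants. Small jumps are controlled
  by sums of hyperbolic cosines: averages over z and -z grow only by cosh - 1, which is quadratic at
  0, hence integrable for every Levy measure uniformly in the truncation. Large jumps form a finite
  measure, where submultiplicativity of the weight itself gives the bounds. The weight is
  \<open>1 + ginv g (r / \<delta>)\<close>, because \<open>ginv g\<close> vanishes near 0; the added
  1 contributes a finite amount to both sides. Finally \<open>K r - K (exp (H * l) * r)\<close>
  telescopes in \<open>l\<close>, so that the case \<open>l = 1\<close> decides for all
  \<open>l\<close>.\<close>

lemma (in prob_space) prob_norm_gt_tendsto_0:
  fixes Y :: "'a \<Rightarrow> 'v::euclidean_space"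
  assumes [measurable]: "Y \<in> borel_measurable M"
  shows "((\<lambda>r. prob {\<omega>\<in>space M. norm (Y \<omega>) > r}) \<longlongrightarrow> 0) at_top"
proof -
  have "(\<lambda>n. prob {\<omega>\<in>space M. norm (Y \<omega>) > real n}) \<longlonglongrightarrow> prob (\<Inter>n. {\<omega>\<in>space M. norm (Y \<omega>) > real n})"
    by (intro finite_Lim_measure_decseq) (auto simp: decseq_def)
  also have "(\<Inter>n. {\<omega>\<in>space M. norm (Y \<omega>) > real n}) = {}"
    using real_arch_simple by (auto simp: not_less[symmetric])
  finally have lim: "(\<lambda>n. prob {\<omega>\<in>space M. norm (Y \<omega>) > real n}) \<longlonglongrightarrow> 0" by simp
  show ?thesis
  proof (rule tendstoI)
    fix e :: real assume "e > 0"
    from tendstoD[OF lim this] obtain N where N: "prob {\<omega>\<in>space M. norm (Y \<omega>) > real N} < e"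
      by (auto simp: eventually_sequentially)
    show "\<forall>\<^sub>F r in at_top. dist (prob {\<omega>\<in>space M. norm (Y \<omega>) > r}) 0 < e"
      using eventually_ge_at_top[of "real N"]
    proof eventually_elim
      case (elim r)
      have "prob {\<omega>\<in>space M. norm (Y \<omega>) > r} \<le> prob {\<omega>\<in>space M. norm (Y \<omega>) > real N}"
        using elim by (intro finite_measure_mono) auto
      with N show ?case by simp
    qed
  qed
qed

text \<open>Ottaviani's inequality: decompose according to the first partial sum exceeding \<open>u + v\<close>.\<close>

lemma (in prob_space) ottaviani:
  fixes D :: "nat \<Rightarrow> 'a \<Rightarrow> 'v::euclidean_space"
  assumes ind: "indep_vars (\<lambda>_. borel) D {..<n}"
    and a: "\<And>k. k \<le> n \<Longrightarrow> \<alpha> \<le> prob {\<omega>\<in>space M. norm (\<Sum>i\<in>{k..<n}. D i \<omega>) \<le> v}"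
  shows "\<alpha> * prob {\<omega>\<in>space M. \<exists>k\<le>n. norm (\<Sum>i<k. D i \<omega>) > u + v}
           \<le> prob {\<omega>\<in>space M. norm (\<Sum>i<n. D i \<omega>) > u}"
proof -
  have D [measurable]: "D i \<in> borel_measurable M" if "i < n" for i
    using ind that by (auto simp: indep_vars_def)
  define S where "S k \<omega> = (\<Sum>i<k. D i \<omega>)" for k \<omega>
  define R where "R k \<omega> = (\<Sum>i\<in>{k..<n}. D i \<omega>)" for k \<omega>
  have S [measurable]: "S k \<in> borel_measurable M" if "k \<le> n" for k
    unfolding S_def using that by (intro borel_measurable_sum D) auto
  have R [measurable]: "R k \<in> borel_measurable M" if "k \<le> n" for k
    unfolding R_def using that by (intro borel_measurable_sum D) auto
  have SR: "S n \<omega> = S k \<omega> + R k \<omega>" if "k \<le> n" for k \<omega>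
    unfolding S_def R_def using that
    by (metis sum.atLeastLessThan_concat lessThan_atLeast0 zero_le)
  define A where "A k = {\<omega>\<in>space M. norm (S k \<omega>) > u + v \<and> (\<forall>j\<in>{..<k}. norm (S j \<omega>) \<le> u + v)}" for k
  define B where "B k = {\<omega>\<in>space M. norm (R k \<omega>) \<le> v}" for k
  have Am [measurable]: "A k \<in> events" if "k \<le> n" for k
  proof -
    have "S j \<in> borel_measurable M" if "j \<in> {..<k}" for j
      using that \<open>k \<le> n\<close> by (intro S) auto
    with S[OF that] show ?thesis
      unfolding A_def by measurable
  qed
  have Bm [measurable]: "B k \<in> events" if "k \<le> n" for k
    using R[OF that] unfolding B_def by measurable
  have disj: "disjoint_family_on A {..n}"
  proof (unfold disjoint_family_on_def, intro ballI impI)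
    fix i j :: nat assume "i \<noteq> j"
    then consider "i < j" | "j < i" by linarith
    then show "A i \<inter> A j = {}" unfolding A_def by cases (auto simp: not_less[symmetric])
  qed
  \<comment> \<open>\<open>A k\<close> depends on the variables of index below \<open>k\<close>,
    \<open>B k\<close> on the remaining ones; the product rule is independence of two disjoint
    blocks of coordinates.\<close>
  have prod: "prob (A k \<inter> B k) = prob (A k) * prob (B k)" if k: "k \<le> n" for k
  proof -
    let ?Xa = "{w\<in>space (PiM {..<k} (\<lambda>_. borel :: 'v measure)). norm (\<Sum>i<k. w i) > u + v \<and> (\<forall>j\<in>{..<k}. norm (\<Sum>i<j. w i) \<le> u + v)}"
    let ?Xb = "{w\<in>space (PiM {k..<n} (\<lambda>_. borel :: 'v measure)). norm (\<Sum>i\<in>{k..<n}. w i) \<le> v}"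
    have m: "(\<lambda>w. \<Sum>i<j. w i) \<in> borel_measurable (PiM {..<k} (\<lambda>_. borel :: 'v measure))" if "j \<le> k" for j
      using that by (intro borel_measurable_sum measurable_component_singleton) auto
    have Xa: "?Xa \<in> sets (PiM {..<k} (\<lambda>_. borel))"
    proof -
      have "(\<lambda>w. \<Sum>i<j. w i) \<in> borel_measurable (PiM {..<k} (\<lambda>_. borel :: 'v measure))" if "j \<in> {..<k}" for j
        using that by (intro m) auto
      with m[of k] show ?thesis by measurable
    qed
    have Xb: "?Xb \<in> sets (PiM {k..<n} (\<lambda>_. borel))"
      by measurable
    have "indep_var (PiM {..<k} (\<lambda>_. borel)) (\<lambda>\<omega>. restrict (\<lambda>i. D i \<omega>) {..<k})
                    (PiM {k..<n} (\<lambda>_. borel)) (\<lambda>\<omega>. restrict (\<lambda>i. D i \<omega>) {k..<n})"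
      using k by (intro indep_var_restrict[OF ind]) auto
    from indep_varD[OF this Xa Xb]
    have ind: "prob ((\<lambda>\<omega>. (restrict (\<lambda>i. D i \<omega>) {..<k}, restrict (\<lambda>i. D i \<omega>) {k..<n})) -` (?Xa \<times> ?Xb) \<inter> space M)
       = prob ((\<lambda>\<omega>. restrict (\<lambda>i. D i \<omega>) {..<k}) -` ?Xa \<inter> space M) * prob ((\<lambda>\<omega>. restrict (\<lambda>i. D i \<omega>) {k..<n}) -` ?Xb \<inter> space M)" .
    have A_eq: "(\<lambda>\<omega>. restrict (\<lambda>i. D i \<omega>) {..<k}) -` ?Xa \<inter> space M = A k"
      unfolding A_def S_def by (auto simp: space_PiM)
    have B_eq: "(\<lambda>\<omega>. restrict (\<lambda>i. D i \<omega>) {k..<n}) -` ?Xb \<inter> space M = B k"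
      unfolding B_def R_def by (auto simp: space_PiM)
    have "(\<lambda>\<omega>. (restrict (\<lambda>i. D i \<omega>) {..<k}, restrict (\<lambda>i. D i \<omega>) {k..<n})) -` (?Xa \<times> ?Xb) \<inter> space M
       = ((\<lambda>\<omega>. restrict (\<lambda>i. D i \<omega>) {..<k}) -` ?Xa \<inter> space M) \<inter> ((\<lambda>\<omega>. restrict (\<lambda>i. D i \<omega>) {k..<n}) -` ?Xb \<inter> space M)"
      by auto
    from ind[unfolded this A_eq B_eq] show ?thesis .
  qed
  have "{\<omega>\<in>space M. \<exists>k\<le>n. norm (\<Sum>i<k. D i \<omega>) > u + v} = (\<Union>k\<in>{..n}. A k)"
  proof (intro equalityI subsetI)
    fix \<omega> assume "\<omega> \<in> {\<omega>\<in>space M. \<exists>k\<le>n. norm (\<Sum>i<k. D i \<omega>) > u + v}"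
    then have w: "\<omega> \<in> space M" and ex: "\<exists>k\<le>n. norm (S k \<omega>) > u + v" by (simp_all add: S_def)
    define k where "k = (LEAST k. norm (S k \<omega>) > u + v)"
    have "norm (S k \<omega>) > u + v" unfolding k_def
    proof (rule LeastI_ex)
      show "\<exists>k. norm (S k \<omega>) > u + v" using ex by blast
    qed
    moreover have "k \<le> n"
    proof -
      from ex obtain k' where "k' \<le> n" "norm (S k' \<omega>) > u + v" by blast
      then have "k \<le> k'" unfolding k_def by (intro Least_le)
      with \<open>k' \<le> n\<close> show ?thesis by simp
    qed
    moreover have "norm (S j \<omega>) \<le> u + v" if "j < k" for j
      using not_less_Least[OF that[unfolded k_def]] by simp
    ultimately show "\<omega> \<in> (\<Union>k\<in>{..n}. A k)" using w by (auto simp: A_def)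
  qed (auto simp: A_def S_def)
  then have "prob {\<omega>\<in>space M. \<exists>k\<le>n. norm (\<Sum>i<k. D i \<omega>) > u + v} = (\<Sum>k\<le>n. prob (A k))"
    using disj by (simp add: finite_measure_finite_Union image_subset_iff Am)
  then have "\<alpha> * prob {\<omega>\<in>space M. \<exists>k\<le>n. norm (\<Sum>i<k. D i \<omega>) > u + v} = (\<Sum>k\<le>n. \<alpha> * prob (A k))"
    by (simp add: sum_distrib_left)
  also have "\<dots> \<le> (\<Sum>k\<le>n. prob (A k \<inter> B k))"
  proof (intro sum_mono)
    fix k assume "k \<in> {..n}"
    then have "\<alpha> \<le> prob (B k)" using a by (simp add: B_def R_def)
    then show "\<alpha> * prob (A k) \<le> prob (A k \<inter> B k)"
      using prod \<open>k \<in> {..n}\<close> by (simp add: mult_right_mono mult.commute[of "prob (A k)"])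
  qed
  also have "\<dots> = prob (\<Union>k\<in>{..n}. A k \<inter> B k)"
    using disj by (intro finite_measure_finite_Union[symmetric])
      (auto simp: disjoint_family_on_def image_subset_iff)
  also have "\<dots> \<le> prob {\<omega>\<in>space M. norm (S n \<omega>) > u}"
  proof (rule finite_measure_mono)
    show "(\<Union>k\<in>{..n}. A k \<inter> B k) \<subseteq> {\<omega>\<in>space M. norm (S n \<omega>) > u}"
    proof clarsimp
      fix k \<omega> assume k: "k \<le> n" and w: "\<omega> \<in> A k" "\<omega> \<in> B k"
      have "norm (S k \<omega>) \<le> norm (S n \<omega>) + norm (R k \<omega>)"
        unfolding SR[OF k] by (metis add_diff_cancel_right' norm_triangle_ineq4)
      with w show "\<omega> \<in> space M \<and> u < norm (S n \<omega>)" by (auto simp: A_def B_def)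
    qed
    show "{\<omega>\<in>space M. norm (S n \<omega>) > u} \<in> events" using S[OF order_refl] by measurable
  qed
  finally show ?thesis by (simp add: S_def)
qed

text \<open>By 1 - p \<le> exp (-p), the probability that none of \<open>A m\<close>, ...,
  \<open>A n\<close> occurs is at most the exponential of minus the sum of their probabilities, and
  divergence sends it to 0. Independence is phrased through the complements, the form in which the
  increments supply it.\<close>

lemma (in prob_space) borel_cantelli_2:
  fixes A :: "nat \<Rightarrow> 'a set"
  assumes meas: "\<And>n. A n \<in> events"
    and ind: "\<And>J. finite J \<Longrightarrow> J \<noteq> {} \<Longrightarrow> prob (\<Inter>i\<in>J. space M - A i) = (\<Prod>i\<in>J. prob (space M - A i))"
    and div: "(\<Sum>n. ennreal (prob (A n))) = \<infinity>"
  shows "AE \<omega> in M. \<exists>\<^sub>F n in sequentially. \<omega> \<in> A n"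
proof -
  have nsum: "\<not> summable (\<lambda>n. prob (A n))"
    using div suminf_ennreal2[of "\<lambda>n. prob (A n)"] by auto
  have "AE \<omega> in M. \<exists>i\<ge>m. \<omega> \<in> A i" for m
  proof -
    let ?N = "\<Inter>i\<in>{m..}. space M - A i"
    have N: "?N \<in> events" using meas by auto
    have le: "prob ?N \<le> exp (- (\<Sum>i=m..n. prob (A i)))" if "n \<ge> m" for n
    proof -
      have "prob ?N \<le> prob (\<Inter>i\<in>{m..n}. space M - A i)"
        using meas that by (intro finite_measure_mono) auto
      also have "\<dots> = (\<Prod>i\<in>{m..n}. prob (space M - A i))" using that by (intro ind) auto
      also have "\<dots> \<le> (\<Prod>i\<in>{m..n}. exp (- prob (A i)))"
        using exp_ge_add_one_self[of "- prob (A i)" for i] meas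
        by (intro prod_mono) (auto simp: prob_compl)
      also have "\<dots> = exp (- (\<Sum>i=m..n. prob (A i)))"
        by (simp add: exp_sum[symmetric] sum_negf)
      finally show ?thesis .
    qed
    have "prob ?N \<le> e" if "e > 0" for e
    proof (rule ccontr)
      assume "\<not> prob ?N \<le> e"
      \<comment> \<open>A probability above \<open>e\<close> would, after taking logarithms in
        \<open>le\<close>, bound all partial sums of a divergent series.\<close>
      have "(\<Sum>i<n. prob (A i)) \<le> (\<Sum>i<m. prob (A i)) - ln e" for n
      proof -
        have "exp (- (\<Sum>i=m..n+m. prob (A i))) > e" using le[of "n+m"] \<open>\<not> prob ?N \<le> e\<close> by simp
        then have "- (\<Sum>i=m..n+m. prob (A i)) > ln e" using that
          by (metis exp_gt_zero ln_exp ln_less_cancel_iff)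
        moreover have "(\<Sum>i<n. prob (A i)) \<le> (\<Sum>i<n+m+1. prob (A i))"
          by (intro sum_mono2) auto
        moreover have "(\<Sum>i<n+m+1. prob (A i)) = (\<Sum>i<m. prob (A i)) + (\<Sum>i=m..n+m. prob (A i))"
          using sum.atLeastLessThan_concat[of 0 m "n+m+1" "\<lambda>i. prob (A i)"]
          by (simp add: atLeast0LessThan[symmetric] atLeastLessThanSuc_atLeastAtMost)
        ultimately show ?thesis by simp
      qed
      then have "(\<Sum>i\<le>n. prob (A i)) \<le> (\<Sum>i<m. prob (A i)) - ln e" for n
        unfolding lessThan_Suc_atMost[symmetric] .
      then have "summable (\<lambda>n. prob (A n))" by (rule bounded_imp_summable[rotated]) simp
      with nsum show False by simp
    qed
    then have "prob ?N = 0" by (metis field_le_epsilon measure_nonneg add_0 order_antisym)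
    then have "?N \<in> null_sets M" using N by (auto simp: null_sets_def emeasure_eq_measure)
    then have "AE \<omega> in M. \<omega> \<notin> ?N" by (rule AE_not_in)
    then show ?thesis by (rule AE_mp) auto
  qed
  then have "AE \<omega> in M. \<forall>m. \<exists>i\<ge>m. \<omega> \<in> A i" by (simp add: AE_all_countable)
  then show ?thesis
    by (simp add: frequently_sequentially)
qed

section \<open>Comparing integrals and sums\<close>

lemma nn_integral_atLeast_split:
  fixes f :: "real \<Rightarrow> ennreal" and s :: real
  assumes [measurable]: "f \<in> borel_measurable lborel" and s: "s > 0"
  shows "(\<integral>\<^sup>+x\<in>{0..}. f x \<partial>lborel) = (\<Sum>n. \<integral>\<^sup>+x\<in>{real n * s..<real (Suc n) * s}. f x \<partial>lborel)"
proof -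
  have "(\<integral>\<^sup>+x\<in>{0..}. f x \<partial>lborel) = (\<integral>\<^sup>+x. (\<Sum>n. f x * indicator {real n * s..<real (Suc n) * s} x) \<partial>lborel)"
  proof (intro nn_integral_cong)
    fix x :: real
    show "f x * indicator {0..} x = (\<Sum>n. f x * indicator {real n * s..<real (Suc n) * s} x)"
    proof (cases "x \<ge> 0")
      case True
      define k where "k = nat \<lfloor>x / s\<rfloor>"
      have k: "x \<in> {real n * s..<real (Suc n) * s} \<longleftrightarrow> n = k" for n
      proof -
        have "x \<in> {real n * s..<real (Suc n) * s} \<longleftrightarrow> real n \<le> x / s \<and> x / s < real n + 1"
          using s by (auto simp: field_simps)
        also have "\<dots> \<longleftrightarrow> \<lfloor>x / s\<rfloor> = int n" by (auto simp: floor_eq_iff)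
        also have "\<dots> \<longleftrightarrow> n = k" using True s by (auto simp: k_def)
        finally show ?thesis .
      qed
      have "(\<Sum>n. f x * indicator {real n * s..<real (Suc n) * s} x) = (\<Sum>n. if n = k then f x else 0)"
        by (intro suminf_cong) (auto simp: indicator_def k[simplified])
      also have "\<dots> = f x" using sums_single[of k "\<lambda>_. f x"] by (simp add: sums_iff)
      finally show ?thesis using True by simp
    next
      case False
      then have "x \<notin> {real n * s..<real (Suc n) * s}" for n
        using s mult_nonneg_nonneg[of "real n" s] by (simp del: of_nat_Suc mult_nonneg_nonneg zero_le_mult_iff)
      then have "f x * indicator {real n * s..<real (Suc n) * s} x = 0" for n by (simp del: of_nat_Suc)
      then have "(\<Sum>n. f x * indicator {real n * s..<real (Suc n) * s} x) = (\<Sum>n. 0)" by (simp only:)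
      then show ?thesis using False by simp
    qed
  qed
  also have "\<dots> = (\<Sum>n. \<integral>\<^sup>+x\<in>{real n * s..<real (Suc n) * s}. f x \<partial>lborel)"
    by (intro nn_integral_suminf) auto
  finally show ?thesis .
qed

text \<open>On each cell of length \<open>s\<close> the function lies between its values at the two
  ends. The two sums differ only in the term at 0, so for functions with finite values they diverge
  together.\<close>

lemma antimono_integral_sum_bounds:
  fixes f :: "real \<Rightarrow> ennreal" and s :: real
  assumes m: "f \<in> borel_measurable lborel" and anti: "\<And>x y. 0 \<le> x \<Longrightarrow> x \<le> y \<Longrightarrow> f y \<le> f x" and s: "s > 0"
  shows "ennreal s * (\<Sum>n. f (real (Suc n) * s)) \<le> (\<integral>\<^sup>+x\<in>{0..}. f x \<partial>lborel)"
    and "(\<integral>\<^sup>+x\<in>{0..}. f x \<partial>lborel) \<le> ennreal s * (\<Sum>n. f (real n * s))"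
proof -
  have e: "emeasure lborel {real n * s..<real (Suc n) * s} = ennreal s" for n
    using s by (subst emeasure_lborel_Ico) (auto simp: algebra_simps)
  have c: "(\<integral>\<^sup>+x\<in>{real n * s..<real (Suc n) * s}. y \<partial>lborel) = ennreal s * y" for n y
  proof -
    have "(\<integral>\<^sup>+x\<in>{real n * s..<real (Suc n) * s}. y \<partial>lborel) = y * emeasure lborel {real n * s..<real (Suc n) * s}"
      by (rule nn_integral_cmult_indicator) simp
    then show ?thesis unfolding e by (simp only: mult.commute)
  qed
  have 1: "ennreal s * f (real (Suc n) * s) \<le> (\<integral>\<^sup>+x\<in>{real n * s..<real (Suc n) * s}. f x \<partial>lborel)" for n
  proof -
    have "ennreal s * f (real (Suc n) * s) = (\<integral>\<^sup>+x\<in>{real n * s..<real (Suc n) * s}. f (real (Suc n) * s) \<partial>lborel)"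
      by (simp only: c)
    also have "\<dots> \<le> (\<integral>\<^sup>+x\<in>{real n * s..<real (Suc n) * s}. f x \<partial>lborel)"
    proof (intro nn_integral_mono)
      fix x :: real
      have "f (real (Suc n) * s) \<le> f x" if "x \<in> {real n * s..<real (Suc n) * s}"
      proof (rule anti)
        have "0 \<le> real n * s" using s by simp
        with that show "0 \<le> x" by simp
      qed (use that in simp)
      then show "f (real (Suc n) * s) * indicator {real n * s..<real (Suc n) * s} x
          \<le> f x * indicator {real n * s..<real (Suc n) * s} x"
        by (simp add: indicator_def)
    qed
    finally show ?thesis .
  qed
  have 2: "(\<integral>\<^sup>+x\<in>{real n * s..<real (Suc n) * s}. f x \<partial>lborel) \<le> ennreal s * f (real n * s)" for n
  proof -
    have "(\<integral>\<^sup>+x\<in>{real n * s..<real (Suc n) * s}. f x \<partial>lborel) \<le> (\<integral>\<^sup>+x\<in>{real n * s..<real (Suc n) * s}. f (real n * s) \<partial>lborel)"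
    proof (intro nn_integral_mono)
      fix x :: real
      have "f x \<le> f (real n * s)" if "x \<in> {real n * s..<real (Suc n) * s}"
        using that s by (intro anti) auto
      then show "f x * indicator {real n * s..<real (Suc n) * s} x
          \<le> f (real n * s) * indicator {real n * s..<real (Suc n) * s} x"
        by (simp add: indicator_def)
    qed
    also have "\<dots> = ennreal s * f (real n * s)"
      by (simp only: c)
    finally show ?thesis .
  qed
  show "ennreal s * (\<Sum>n. f (real (Suc n) * s)) \<le> (\<integral>\<^sup>+x\<in>{0..}. f x \<partial>lborel)"
    unfolding nn_integral_atLeast_split[OF m s] ennreal_suminf_cmult[symmetric]
    by (intro suminf_le 1) auto
  show "(\<integral>\<^sup>+x\<in>{0..}. f x \<partial>lborel) \<le> ennreal s * (\<Sum>n. f (real n * s))"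
    unfolding nn_integral_atLeast_split[OF m s] ennreal_suminf_cmult[symmetric]
    by (intro suminf_le 2) auto
qed

text \<open>\<open>A / (1 - q)\<close> is the fixed point of \<open>y \<mapsto> q * y + A\<close>,
  and the deviation from it shrinks by \<open>q\<close> every \<open>p\<close> indices. Indices are
  linked only at distance \<open>p\<close>, so a whole block of \<open>p\<close> starting values has
  to be bounded.\<close>

lemma eventually_le_of_contraction:
  fixes y :: "nat \<Rightarrow> real"
  assumes rec: "\<And>n. n \<ge> N \<Longrightarrow> y (n + p) \<le> q * y n + A" and q: "0 \<le> q" "q < 1" and p: "p > 0" and e: "e > 0"
  shows "\<forall>\<^sub>F n in sequentially. y n \<le> A / (1 - q) + e"
proof -
  define z where "z n = y n - A / (1 - q)" for n
  have z: "z (n + p) \<le> q * z n" if "n \<ge> N" for n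
  proof -
    have "A = (1 - q) * (A / (1 - q))" using q by simp
    then have "A = A / (1 - q) - q * (A / (1 - q))" by (simp only: left_diff_distrib mult_1)
    then show ?thesis using rec[OF that] unfolding z_def by (simp add: right_diff_distrib)
  qed
  \<comment> \<open>The inserted \<open>0\<close> keeps \<open>Z\<close> nonnegative, so that
    multiplication by \<open>q\<close> does not increase it.\<close>
  define Z where "Z = Max (insert 0 (z ` {N..<N+p}))"
  have Z: "Z \<ge> 0" "\<And>n. N \<le> n \<Longrightarrow> n < N + p \<Longrightarrow> z n \<le> Z"
    unfolding Z_def by (auto intro!: Max_ge simp del: Max_insert)
  have 0: "z n \<le> Z" if "n \<ge> N" for n
    using that
  proof (induction n rule: less_induct)
    case (less n)
    show ?case
    proof (cases "n < N + p")
      case False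
      then have "z n \<le> q * z (n - p)" using z[of "n - p"] by simp
      also have "\<dots> \<le> q * Z" using less.IH[of "n - p"] False p q by (intro mult_left_mono) auto
      also have "\<dots> \<le> 1 * Z" using q Z by (intro mult_right_mono) auto
      finally show ?thesis by simp
    qed (use less.prems Z in auto)
  qed
  have j: "z n \<le> q ^ j * Z" if "n \<ge> N + j * p" for j n
    using that
  proof (induction j arbitrary: n)
    case (Suc j)
    then have "z n \<le> q * z (n - p)" using z[of "n - p"] by (simp add: algebra_simps)
    also have "\<dots> \<le> q * (q ^ j * Z)" using Suc.prems q by (intro mult_left_mono Suc.IH) auto
    finally show ?case by simp
  qed (use 0 in auto)
  have "(\<lambda>j. q ^ j * Z) \<longlonglongrightarrow> 0 * Z" using q by (intro tendsto_mult LIMSEQ_realpow_zero tendsto_const) auto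
  then have "\<forall>\<^sub>F j in sequentially. q ^ j * Z < e" using e by (intro order_tendstoD(2)) auto
  then obtain j where "q ^ j * Z < e" by (auto simp: eventually_sequentially)
  then have "y n \<le> A / (1 - q) + e" if "n \<ge> N + j * p" for n using j[OF that] by (simp add: z_def)
  then show ?thesis by (auto simp: eventually_sequentially)
qed

section \<open>Increments of selfsimilar additive processes\<close>

locale ss_additive = prob_space M for M :: "'w measure" +
  fixes X :: "real \<Rightarrow> 'w \<Rightarrow> 'v::euclidean_space" and H :: real
  assumes ssa: "selfsimilar_additive_process M H X"
begin

lemma H_pos: "H > 0"
  using ssa by (simp add: selfsimilar_additive_process_def)

lemma X_measurable [measurable]: "t \<ge> 0 \<Longrightarrow> X t \<in> borel_measurable M"
  using ssa by (simp add: selfsimilar_additive_process_def)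

lemma indep_increments:
  assumes "0 \<le> t 0" "\<And>i. i < n \<Longrightarrow> t i < t (Suc i)"
  shows "indep_vars (\<lambda>_. borel) (\<lambda>i \<omega>. X (t (Suc i)) \<omega> - X (t i) \<omega>) {..<n}"
  using ssa assms by (auto simp: selfsimilar_additive_process_def independent_increments_def)

lemma AE_right_continuous: "AE \<omega> in M. \<forall>t\<ge>0. ((\<lambda>s. X s \<omega>) \<longlongrightarrow> X t \<omega>) (at_right t)"
proof -
  have "cadlag_paths M X" using ssa by (simp add: selfsimilar_additive_process_def)
  then show ?thesis unfolding cadlag_paths_def by (rule AE_mp) auto
qed

text \<open>The equality of finite-dimensional distributions is pushed forward along
  \<open>f\<close>; in the uses below \<open>f\<close> is a coordinate or a difference of two
  coordinates.\<close>

lemma distr_scale: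
  assumes c: "c > 0" and J: "finite J" "J \<subseteq> {0..}"
    and f [measurable]: "f \<in> borel_measurable (PiM J (\<lambda>_. borel :: 'v measure))"
  shows "distr M borel (\<lambda>\<omega>. f (\<lambda>t\<in>J. X (c * t) \<omega>)) = distr M borel (\<lambda>\<omega>. f (\<lambda>t\<in>J. c powr H *\<^sub>R X t \<omega>))"
proof -
  have Xm: "X t \<in> borel_measurable M" "X (c * t) \<in> borel_measurable M" if "t \<in> J" for t
    using that J c by (auto intro!: X_measurable)
  have "distr M (Pi\<^sub>M J (\<lambda>_. borel)) (\<lambda>\<omega>. \<lambda>t\<in>J. X (c * t) \<omega>) =
        distr M (Pi\<^sub>M J (\<lambda>_. borel)) (\<lambda>\<omega>. \<lambda>t\<in>J. c powr H *\<^sub>R X t \<omega>)"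
    using ssa c J by (auto simp: selfsimilar_additive_process_def selfsimilar_def)
  then have "distr (distr M (Pi\<^sub>M J (\<lambda>_. borel)) (\<lambda>\<omega>. \<lambda>t\<in>J. X (c * t) \<omega>)) borel f =
        distr (distr M (Pi\<^sub>M J (\<lambda>_. borel)) (\<lambda>\<omega>. \<lambda>t\<in>J. c powr H *\<^sub>R X t \<omega>)) borel f"
    by simp
  moreover have "distr (distr M (Pi\<^sub>M J (\<lambda>_. borel)) (\<lambda>\<omega>. \<lambda>t\<in>J. Y t \<omega>)) borel f = distr M borel (\<lambda>\<omega>. f (\<lambda>t\<in>J. Y t \<omega>))"
    if "\<And>t. t \<in> J \<Longrightarrow> Y t \<in> borel_measurable M" for Y :: "real \<Rightarrow> 'w \<Rightarrow> 'v"
  proof -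
    have "(\<lambda>\<omega>. \<lambda>t\<in>J. Y t \<omega>) \<in> M \<rightarrow>\<^sub>M Pi\<^sub>M J (\<lambda>_. borel)"
      by (intro measurable_restrict that)
    from distr_distr[OF f this] show ?thesis by (simp add: comp_def)
  qed
  from this[of "\<lambda>t. X (c * t)"] this[of "\<lambda>t \<omega>. c powr H *\<^sub>R X t \<omega>"]
  have "distr (distr M (Pi\<^sub>M J (\<lambda>_. borel)) (\<lambda>\<omega>. \<lambda>t\<in>J. X (c * t) \<omega>)) borel f = distr M borel (\<lambda>\<omega>. f (\<lambda>t\<in>J. X (c * t) \<omega>))"
    "distr (distr M (Pi\<^sub>M J (\<lambda>_. borel)) (\<lambda>\<omega>. \<lambda>t\<in>J. c powr H *\<^sub>R X t \<omega>)) borel f = distr M borel (\<lambda>\<omega>. f (\<lambda>t\<in>J. c powr H *\<^sub>R X t \<omega>))"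
    using Xm by (auto intro!: borel_measurable_scaleR)
  ultimately show ?thesis by (simp only:)
qed

lemma distr_scale_increment:
  assumes "c > 0" "s \<ge> 0" "t \<ge> 0"
  shows "distr M borel (\<lambda>\<omega>. X (c * t) \<omega> - X (c * s) \<omega>) = distr M borel (\<lambda>\<omega>. c powr H *\<^sub>R (X t \<omega> - X s \<omega>))"
proof -
  have "distr M borel (\<lambda>\<omega>. (\<lambda>w. w t - w s) (\<lambda>t\<in>{s,t}. X (c * t) \<omega>)) =
        distr M borel (\<lambda>\<omega>. (\<lambda>w. w t - w s) (\<lambda>t\<in>{s,t}. c powr H *\<^sub>R X t \<omega>))"
    using assms by (intro distr_scale) auto
  then show ?thesis by (simp add: scaleR_diff_right)
qed

lemma distr_scale_value:
  assumes "c > 0"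
  shows "distr M borel (X c) = distr M borel (\<lambda>\<omega>. c powr H *\<^sub>R X 1 \<omega>)"
    and "distr M borel (X 0) = distr M borel (\<lambda>\<omega>. c powr H *\<^sub>R X 0 \<omega>)"
proof -
  have *: "distr M borel (\<lambda>\<omega>. (\<lambda>w. w t) (\<lambda>t\<in>{t}. X (c * t) \<omega>)) =
        distr M borel (\<lambda>\<omega>. (\<lambda>w. w t) (\<lambda>t\<in>{t}. c powr H *\<^sub>R X t \<omega>))" if "t \<ge> 0" for t
    using assms that by (intro distr_scale) auto
  show "distr M borel (X c) = distr M borel (\<lambda>\<omega>. c powr H *\<^sub>R X 1 \<omega>)"
    "distr M borel (X 0) = distr M borel (\<lambda>\<omega>. c powr H *\<^sub>R X 0 \<omega>)"
    using *[of 1] *[of 0] by simp_all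
qed

lemma prob_norm_eq_if_distr_eq:
  fixes Y Z :: "'w \<Rightarrow> 'v"
  assumes [measurable]: "Y \<in> borel_measurable M" "Z \<in> borel_measurable M"
    and eq: "distr M borel Y = distr M borel Z"
  shows "prob {\<omega>\<in>space M. norm (Y \<omega>) > r} = prob {\<omega>\<in>space M. norm (Z \<omega>) > r}"
proof -
  have "measure (distr M borel Y) {x. norm x > r} = measure (distr M borel Z) {x. norm x > r}"
    by (simp add: eq)
  moreover have "measure (distr M borel W) {x. norm x > r} = prob {\<omega>\<in>space M. norm (W \<omega>) > r}"
    if [measurable]: "W \<in> borel_measurable M" for W :: "'w \<Rightarrow> 'v"
    by (subst measure_distr) (auto intro!: arg_cong[where f=prob])
  ultimately show ?thesis by simp
qed

text \<open>All windows of logarithmic length \<open>l\<close> have the same increment law up to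
  scaling, so the single tail function \<open>G_tail M X l\<close> governs them wherever they
  lie.\<close>

lemma prob_increment_scale:
  assumes b: "b > 0"
  shows "prob {\<omega>\<in>space M. norm (X b \<omega> - X (b * exp (- real l)) \<omega>) > b powr H * r} = G_tail M X l r"
proof -
  have "prob {\<omega>\<in>space M. norm (X (b * 1) \<omega> - X (b * exp (- real l)) \<omega>) > b powr H * r}
      = prob {\<omega>\<in>space M. norm (b powr H *\<^sub>R (X 1 \<omega> - X (exp (- real l)) \<omega>)) > b powr H * r}"
    using b by (intro prob_norm_eq_if_distr_eq distr_scale_increment) (auto intro!: borel_measurable_diff borel_measurable_scaleR X_measurable)
  then show ?thesis using b by (simp add: G_tail_def)
qed

text \<open>Each endpoint is distributed as \<open>X 1\<close> times a factor at most
  \<open>b powr H\<close>, and half of \<open>v\<close> is allotted to each. The bound is uniform in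
  \<open>s\<close>, as the hypothesis of Ottaviani's inequality demands.\<close>

lemma prob_increment_le:
  assumes b: "0 < s" "s \<le> b"
  shows "prob {\<omega>\<in>space M. norm (X b \<omega> - X s \<omega>) \<le> v} \<ge> 1 - 2 * prob {\<omega>\<in>space M. norm (X 1 \<omega>) > v / (2 * b powr H)}"
proof -
  have [measurable]: "X b \<in> borel_measurable M" "X s \<in> borel_measurable M" "X 1 \<in> borel_measurable M"
    using b by (auto intro!: X_measurable)
  have le: "prob {\<omega>\<in>space M. norm (X t \<omega>) > v / 2} \<le> prob {\<omega>\<in>space M. norm (X 1 \<omega>) > v / (2 * b powr H)}"
    if t: "0 < t" "t \<le> b" for t
  proof -
    have "prob {\<omega>\<in>space M. norm (X t \<omega>) > v / 2} = prob {\<omega>\<in>space M. norm (t powr H *\<^sub>R X 1 \<omega>) > v / 2}"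
      using t by (intro prob_norm_eq_if_distr_eq distr_scale_value) (auto intro!: X_measurable)
    also have "\<dots> \<le> prob {\<omega>\<in>space M. norm (X 1 \<omega>) > v / (2 * b powr H)}"
    proof (intro finite_measure_mono subsetI)
      fix \<omega> assume w: "\<omega> \<in> {\<omega>\<in>space M. norm (t powr H *\<^sub>R X 1 \<omega>) > v / 2}"
      have "t powr H * norm (X 1 \<omega>) \<le> b powr H * norm (X 1 \<omega>)"
        using t H_pos by (intro mult_right_mono powr_mono2) auto
      with w have "v / 2 < b powr H * norm (X 1 \<omega>)" by simp
      then show "\<omega> \<in> {\<omega>\<in>space M. norm (X 1 \<omega>) > v / (2 * b powr H)}"
        using w t by (simp add: field_simps)
    qed measurable
    finally show ?thesis .
  qed
  have "prob {\<omega>\<in>space M. norm (X b \<omega> - X s \<omega>) > v}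
     \<le> prob ({\<omega>\<in>space M. norm (X b \<omega>) > v / 2} \<union> {\<omega>\<in>space M. norm (X s \<omega>) > v / 2})"
  proof (intro finite_measure_mono subsetI)
    fix \<omega> assume w: "\<omega> \<in> {\<omega>\<in>space M. norm (X b \<omega> - X s \<omega>) > v}"
    then show "\<omega> \<in> {\<omega>\<in>space M. norm (X b \<omega>) > v / 2} \<union> {\<omega>\<in>space M. norm (X s \<omega>) > v / 2}"
      using norm_triangle_ineq4[of "X b \<omega>" "X s \<omega>"] by auto
  qed measurable
  also have "\<dots> \<le> prob {\<omega>\<in>space M. norm (X b \<omega>) > v / 2} + prob {\<omega>\<in>space M. norm (X s \<omega>) > v / 2}"
    by (intro measure_Un_le) measurable
  also have "\<dots> \<le> 2 * prob {\<omega>\<in>space M. norm (X 1 \<omega>) > v / (2 * b powr H)}"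
    using le[of b] le[of s] b by simp
  finally have "prob {\<omega>\<in>space M. norm (X b \<omega> - X s \<omega>) > v} \<le> 2 * prob {\<omega>\<in>space M. norm (X 1 \<omega>) > v / (2 * b powr H)}" .
  moreover have "prob {\<omega>\<in>space M. norm (X b \<omega> - X s \<omega>) \<le> v} = 1 - prob {\<omega>\<in>space M. norm (X b \<omega> - X s \<omega>) > v}"
    by (subst prob_compl[symmetric]) (auto intro!: arg_cong[where f=prob])
  ultimately show ?thesis by simp
qed

text \<open>\<open>excess c b w\<close> is the event that the path leaves the ball of radius \<open>w\<close> around \<open>X c\<close> at a
  dyadic time of \<open>[c, b]\<close>; by right-continuity, these times suffice.\<close>

definition dyadic_time :: "real \<Rightarrow> real \<Rightarrow> nat \<Rightarrow> nat \<Rightarrow> real" where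
  "dyadic_time c b m k = c + (b - c) * (real k / 2 ^ m)"

definition excess :: "real \<Rightarrow> real \<Rightarrow> real \<Rightarrow> 'w set" where
  "excess c b w = {\<omega>\<in>space M. \<exists>m. \<exists>k\<le>2 ^ m. norm (X (dyadic_time c b m k) \<omega> - X c \<omega>) > w}"

lemma dyadic_time_bounds:
  assumes "c \<le> b" "k \<le> 2 ^ m"
  shows "c \<le> dyadic_time c b m k" "dyadic_time c b m k \<le> b"
proof -
  have "real k \<le> 2 ^ m" using assms(2) by (metis of_nat_le_iff of_nat_numeral of_nat_power)
  then have "(b - c) * (real k / 2 ^ m) \<le> (b - c) * 1"
    using assms(1) by (intro mult_left_mono) (auto simp: divide_le_eq_1)
  then show "c \<le> dyadic_time c b m k" "dyadic_time c b m k \<le> b"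
    using assms(1) by (auto simp: dyadic_time_def)
qed

lemma excess_measurable [measurable]: "0 \<le> c \<Longrightarrow> c \<le> b \<Longrightarrow> excess c b w \<in> events"
proof -
  assume c: "0 \<le> c" "c \<le> b"
  have "{\<omega>\<in>space M. norm (X (dyadic_time c b m k) \<omega> - X c \<omega>) > w} \<in> events" if "k \<le> 2 ^ m" for m k
  proof -
    have "dyadic_time c b m k \<ge> 0" using dyadic_time_bounds[OF c(2) that] c by simp
    then have [measurable]: "X (dyadic_time c b m k) \<in> borel_measurable M" "X c \<in> borel_measurable M"
      using c by auto
    show ?thesis by measurable
  qed
  then have "(\<Union>m. \<Union>k\<in>{..2^m}. {\<omega>\<in>space M. norm (X (dyadic_time c b m k) \<omega> - X c \<omega>) > w}) \<in> events"
    by auto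
  also have "(\<Union>m. \<Union>k\<in>{..2^m}. {\<omega>\<in>space M. norm (X (dyadic_time c b m k) \<omega> - X c \<omega>) > w}) = excess c b w"
    by (auto simp: excess_def)
  finally show ?thesis .
qed

text \<open>Ottaviani's inequality on the dyadic grid of level \<open>m\<close> holds with a
  constant independent of \<open>m\<close>. The grids are nested, so the events increase to
  \<open>excess\<close> and the bound survives in the limit.\<close>

lemma prob_excess:
  assumes cb: "0 \<le> c" "c < b"
    and a: "\<And>s. c \<le> s \<Longrightarrow> s \<le> b \<Longrightarrow> \<alpha> \<le> prob {\<omega>\<in>space M. norm (X b \<omega> - X s \<omega>) \<le> v}"
  shows "\<alpha> * prob (excess c b (u + v)) \<le> prob {\<omega>\<in>space M. norm (X b \<omega> - X c \<omega>) > u}"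
proof -
  define E where "E m = {\<omega>\<in>space M. \<exists>k\<le>2 ^ m. norm (X (dyadic_time c b m k) \<omega> - X c \<omega>) > u + v}" for m
  have Eeq: "excess c b (u + v) = (\<Union>m. E m)" by (auto simp: excess_def E_def)
  have E: "E m \<in> events" for m
  proof -
    have "{\<omega>\<in>space M. norm (X (dyadic_time c b m k) \<omega> - X c \<omega>) > u + v} \<in> events" if "k \<le> 2 ^ m" for k
    proof -
      have "dyadic_time c b m k \<ge> 0" using dyadic_time_bounds[of c b k m] that cb by simp
      then have [measurable]: "X (dyadic_time c b m k) \<in> borel_measurable M" "X c \<in> borel_measurable M"
        using cb by auto
      show ?thesis by measurable
    qed
    then have "(\<Union>k\<in>{..2^m}. {\<omega>\<in>space M. norm (X (dyadic_time c b m k) \<omega> - X c \<omega>) > u + v}) \<in> events"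
      by auto
    also have "(\<Union>k\<in>{..2^m}. {\<omega>\<in>space M. norm (X (dyadic_time c b m k) \<omega> - X c \<omega>) > u + v}) = E m"
      by (auto simp: E_def)
    finally show ?thesis .
  qed
  have le: "\<alpha> * prob (E m) \<le> prob {\<omega>\<in>space M. norm (X b \<omega> - X c \<omega>) > u}" for m
  proof -
    define t where "t = dyadic_time c b m"
    define D where "D i \<omega> = X (t (Suc i)) \<omega> - X (t i) \<omega>" for i \<omega>
    have t0: "t 0 = c" and tn: "t (2 ^ m) = b" by (simp_all add: t_def dyadic_time_def)
    have ind: "indep_vars (\<lambda>_. borel) D {..<2 ^ m}"
      unfolding D_def
    proof (rule indep_increments)
      show "0 \<le> t 0" using cb t0 by simp
      show "t i < t (Suc i)" for i using cb by (simp add: t_def dyadic_time_def divide_strict_right_mono)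
    qed
    have S: "(\<Sum>i<k. D i \<omega>) = X (t k) \<omega> - X c \<omega>" for k \<omega>
      unfolding D_def t0[symmetric] by (rule sum_lessThan_telescope)
    have R: "(\<Sum>i\<in>{k..<2^m}. D i \<omega>) = X b \<omega> - X (t k) \<omega>" if "k \<le> 2 ^ m" for k \<omega>
      unfolding D_def tn[symmetric] using that by (rule sum_Suc_diff')
    have "\<alpha> * prob {\<omega>\<in>space M. \<exists>k\<le>2 ^ m. norm (\<Sum>i<k. D i \<omega>) > u + v}
           \<le> prob {\<omega>\<in>space M. norm (\<Sum>i<2 ^ m. D i \<omega>) > u}"
    proof (rule ottaviani[OF ind])
      fix k :: nat assume "k \<le> 2 ^ m"
      then show "\<alpha> \<le> prob {\<omega> \<in> space M. norm (\<Sum>i = k..<2 ^ m. D i \<omega>) \<le> v}"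
        using dyadic_time_bounds[of c b k m] cb unfolding R[OF \<open>k \<le> 2 ^ m\<close>] by (intro a) (auto simp: t_def)
    qed
    then show ?thesis unfolding S tn by (simp add: E_def t_def)
  qed
  have "incseq E"
  proof (rule incseq_SucI)
    show "E m \<subseteq> E (Suc m)" for m
    proof
      fix \<omega> assume "\<omega> \<in> E m"
      then obtain k where k: "\<omega> \<in> space M" "k \<le> 2 ^ m" "norm (X (dyadic_time c b m k) \<omega> - X c \<omega>) > u + v"
        by (auto simp: E_def)
      have "dyadic_time c b m k = dyadic_time c b (Suc m) (2 * k)" by (simp add: dyadic_time_def)
      with k show "\<omega> \<in> E (Suc m)" by (auto simp: E_def intro!: exI[of _ "2 * k"])
    qed
  qed
  then have "(\<lambda>m. prob (E m)) \<longlonglongrightarrow> prob (excess c b (u + v))"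
    unfolding Eeq using E by (intro finite_Lim_measure_incseq) auto
  then have "(\<lambda>m. \<alpha> * prob (E m)) \<longlonglongrightarrow> \<alpha> * prob (excess c b (u + v))"
    by (intro tendsto_intros)
  then show ?thesis by (rule LIMSEQ_le_const2) (use le in auto)
qed

text \<open>By right-continuity a value above \<open>w\<close> at \<open>t < b\<close> persists on
  an interval to the right of \<open>t\<close>, which contains a dyadic time. The endpoint
  \<open>b\<close> is itself a dyadic time, of level 0.\<close>

lemma le_of_not_excess:
  assumes rc: "\<forall>t\<ge>0. ((\<lambda>s. X s \<omega>) \<longlongrightarrow> X t \<omega>) (at_right t)"
    and w: "\<omega> \<in> space M" "\<omega> \<notin> excess c b w" and cb: "0 \<le> c" "c < b" and t: "c \<le> t" "t \<le> b"
  shows "norm (X t \<omega> - X c \<omega>) \<le> w"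
proof (rule ccontr)
  assume "\<not> norm (X t \<omega> - X c \<omega>) \<le> w"
  then have gt: "norm (X t \<omega> - X c \<omega>) > w" by simp
  have dy: "norm (X (dyadic_time c b m k) \<omega> - X c \<omega>) \<le> w" if "k \<le> 2 ^ m" for m k
    using w that by (auto simp: excess_def not_less)
  show False
  proof (cases "t = b")
    case True
    have "dyadic_time c b 0 1 = b" by (simp add: dyadic_time_def)
    with dy[of 1 0] gt True show False by simp
  next
    case False
    with t have "t < b" by simp
    have "((\<lambda>s. norm (X s \<omega> - X c \<omega>)) \<longlongrightarrow> norm (X t \<omega> - X c \<omega>)) (at_right t)"
      using rc t cb by (intro tendsto_intros) auto
    then have "\<forall>\<^sub>F s in at_right t. norm (X s \<omega> - X c \<omega>) > w"
      using gt by (rule order_tendstoD)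
    then obtain b' where b': "b' > t" "\<And>s. t < s \<Longrightarrow> s < b' \<Longrightarrow> norm (X s \<omega> - X c \<omega>) > w"
      by (auto simp: eventually_at_right[OF \<open>t < b\<close>])
    define b'' where "b'' = min b b'"
    have "t < b''" using b' \<open>t < b\<close> by (simp add: b''_def)
    define x where "x = (t - c) / (b - c)"
    define y where "y = (b'' - c) / (b - c)"
    have xy: "0 \<le> x" "x < y" "y \<le> 1" using cb t \<open>t < b''\<close>
      by (auto simp: x_def y_def b''_def divide_strict_right_mono)
    \<comment> \<open>The grid of level \<open>m\<close> is finer than \<open>y - x\<close>, so the
      first grid point after \<open>x\<close> still falls before \<open>y\<close>.\<close>
    obtain m where m: "1 / (y - x) < 2 ^ m" using real_arch_pow[of 2] by force
    define k where "k = nat (\<lfloor>x * 2 ^ m\<rfloor> + 1)"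
    have k: "real k > x * 2 ^ m" "real k \<le> x * 2 ^ m + 1"
      using xy by (auto simp: k_def)
    have "1 < (y - x) * 2 ^ m" using m xy by (simp add: field_simps)
    then have "real k < y * 2 ^ m" using k by (simp add: algebra_simps)
    moreover have "y * 2 ^ m \<le> 1 * 2 ^ m" using xy by (intro mult_right_mono) auto
    ultimately have "real k < 2 ^ m" by linarith
    then have "k \<le> 2 ^ m" by simp
    have "x < real k / 2 ^ m" "real k / 2 ^ m < y"
      using k \<open>real k < y * 2 ^ m\<close> by (auto simp: field_simps)
    then have "c + (b - c) * x < dyadic_time c b m k" "dyadic_time c b m k < c + (b - c) * y"
      using cb by (auto simp: dyadic_time_def simp del: times_divide_eq_right)
    moreover have "c + (b - c) * x = t" "c + (b - c) * y = b''" using cb by (simp_all add: x_def y_def)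
    ultimately have "norm (X (dyadic_time c b m k) \<omega> - X c \<omega>) > w"
      by (intro b') (auto simp: b''_def)
    with dy[OF \<open>k \<le> 2 ^ m\<close>] show False by simp
  qed
qed

end

section \<open>From oscillation bounds on windows to a bound on the path\<close>

lemma G1_pos: "g \<in> G1 \<Longrightarrow> x \<ge> 0 \<Longrightarrow> g x > 0"
  and G1_mono: "g \<in> G1 \<Longrightarrow> 0 \<le> x \<Longrightarrow> x \<le> y \<Longrightarrow> g x \<le> g y"
  and G1_at_top: "g \<in> G1 \<Longrightarrow> filterlim g at_top at_top"
  by (auto simp: G1_def mono_on_def)

text \<open>The deterministic part of the upper bound: oscillation bounds over windows of
  logarithmic length \<open>l\<close>, starting at every grid point of logarithmic mesh \<open>1/m\<close>, control the path.\<close>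

lemma path_bound_of_window_bound:
  fixes f :: "real \<Rightarrow> 'v::real_normed_vector"
  assumes g: "g \<in> G1" and H: "H > 0" and l: "l \<ge> (1::nat)" and m: "m \<ge> (1::nat)" and A: "A \<ge> 0" and e: "e > 0"
    and q: "q = exp (- (H * real l))"
    and win: "\<And>n t. n \<ge> N \<Longrightarrow> exp (real (Suc n) / real m) * exp (- real l) \<le> t \<Longrightarrow> t \<le> exp (real (Suc n) / real m) \<Longrightarrow>
      norm (f t - f (exp (real (Suc n) / real m) * exp (- real l))) \<le> A * exp (real (Suc n) / real m) powr H * g (real n / real m)"
  shows "\<forall>\<^sub>F t in at_top. norm (f t) \<le> (A + q * (A / (1 - q) + e)) * exp (H / real m) * (t powr H * g (ln t))"
proof -
  define p where "p = l * m"
  define E where "E n = exp (H * (real n / real m))" for n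
  \<comment> \<open>The size at grid points relative to the norming function. One window, that is
    \<open>p\<close> grid steps, earlier it counts only with the factor \<open>q\<close>, which
    makes \<open>y\<close> a contraction up to the constant \<open>A\<close>.\<close>
  define y where "y n = norm (f (exp (real n / real m))) / (E n * g (real n / real m))" for n
  have p: "p > 0" using l m by (simp add: p_def)
  have q01: "0 < q" "q < 1" using H l by (auto simp: q)
  have Epos: "E n > 0" for n by (simp add: E_def)
  have gpos: "g (real n / real m) > 0" for n using g by (intro G1_pos) auto
  have gmono: "g (real n / real m) \<le> g (real k / real m)" if "n \<le> k" for n k
    using that m by (intro G1_mono[OF g]) (auto simp: divide_right_mono)
  have powE: "exp (real n / real m) powr H = E n" for n by (simp add: powr_def E_def)
  have Ep: "E k = q * E (k + p)" for k
    using m by (simp add: E_def q p_def exp_add[symmetric] field_simps)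
  have start: "exp (real (k + p) / real m) * exp (- real l) = exp (real k / real m)" for k
    using m by (simp add: exp_add[symmetric] p_def field_simps)
  have fy: "norm (f (exp (real n / real m))) = y n * (E n * g (real n / real m))" for n
    using Epos[of n] gpos[of n] by (simp add: y_def)
  have step: "norm (f t) \<le> norm (f (exp (real k / real m))) + A * E (k + p) * g (real (k + p - 1) / real m)"
    if k: "k \<ge> N" and t: "exp (real k / real m) \<le> t" "t \<le> exp (real (k + p) / real m)" for k t
  proof -
    \<comment> \<open>The hypothesis attaches \<open>g (n / m)\<close> to the window that ends at
      grid point \<open>Suc n\<close>; the window starting at grid point \<open>k\<close> therefore
      has index \<open>k + p - 1\<close>.\<close>
    define n where "n = k + p - 1"
    have n: "Suc n = k + p" "n \<ge> N" using p k by (auto simp: n_def)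
    from win[of n t] n start[of k] t have "norm (f t - f (exp (real k / real m))) \<le> A * exp (real (k + p) / real m) powr H * g (real n / real m)"
      by simp
    then have "norm (f t - f (exp (real k / real m))) \<le> A * E (k + p) * g (real (k + p - 1) / real m)"
      by (simp only: powE n_def)
    moreover have "norm (f t) \<le> norm (f (exp (real k / real m))) + norm (f t - f (exp (real k / real m)))"
      by (metis add.commute diff_add_cancel norm_triangle_ineq)
    ultimately show ?thesis by simp
  qed
  have rec: "y (k + p) \<le> q * y k + A" if "k \<ge> N" for k
  proof -
    let ?W = "E (k + p) * g (real (k + p) / real m)"
    have W: "?W > 0" using Epos gpos by (rule mult_pos_pos)
    have "y (k + p) * ?W \<le> norm (f (exp (real k / real m))) + A * E (k + p) * g (real (k + p - 1) / real m)"
      unfolding fy[of "k + p", symmetric] by (rule step[OF that]) (auto simp: divide_right_mono)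
    also have "\<dots> \<le> y k * (E k * g (real (k + p) / real m)) + A * E (k + p) * g (real (k + p) / real m)"
      unfolding fy[of k] using A Epos[of k] Epos[of "k+p"] gpos[of k]
      by (intro add_mono mult_left_mono gmono) (auto simp: y_def)
    also have "\<dots> = (q * y k + A) * ?W" by (simp add: Ep[of k] algebra_simps)
    finally show ?thesis by (rule mult_right_le_imp_le[OF _ W])
  qed
  have "\<forall>\<^sub>F n in sequentially. y n \<le> A / (1 - q) + e"
    using q01 p e rec by (intro eventually_le_of_contraction[where N=N and p=p]) auto
  then obtain N' where N': "\<And>n. n \<ge> N' \<Longrightarrow> y n \<le> A / (1 - q) + e"
    by (auto simp: eventually_sequentially)
  define N'' where "N'' = max N N'"
  show ?thesis
    using eventually_ge_at_top[of "exp (real (N'' + p) / real m)"]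
  proof eventually_elim
    case (elim t)
    have t0: "t > 0" using elim by (rule less_le_trans[OF exp_gt_zero])
    have lnt: "ln t \<ge> real (N'' + p) / real m"
      using elim t0 by (simp add: ln_ge_iff)
    define n where "n = nat \<lfloor>real m * ln t\<rfloor>"
    have mlnt: "real m * ln t \<ge> real (N'' + p)" using lnt m by (simp add: field_simps)
    have n1: "real n \<le> real m * ln t" "real m * ln t < real n + 1"
      using mlnt by (auto simp: n_def)
    have n2: "n \<ge> N'' + p" using mlnt n1 by linarith
    \<comment> \<open>This window ends at the first grid point above \<open>t\<close> and so
      contains \<open>t\<close>. Its bound carries \<open>g (n / m)\<close> with
      \<open>n / m \<le> ln t\<close>, which monotonicity compares with \<open>g (ln t)\<close>; the
      index shift in the hypothesis is made for this comparison.\<close>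
    define k where "k = Suc n - p"
    have k: "k + p = Suc n" "k \<ge> N''" "k \<ge> N" "k \<ge> N'" "k \<le> n" "k + p - 1 = n"
      using n2 p by (auto simp: k_def N''_def)
    have tl: "exp (real n / real m) \<le> t"
    proof -
      have "real n / real m \<le> ln t" using n1 m by (simp add: field_simps)
      then show ?thesis using t0 by (simp add: ln_ge_iff)
    qed
    have tu: "t \<le> exp (real (k + p) / real m)"
    proof -
      have "ln t \<le> real (Suc n) / real m" using n1 m by (simp add: field_simps)
      then show ?thesis using t0 by (simp only: k) (metis exp_le_cancel_iff exp_ln)
    qed
    have "exp (real k / real m) \<le> exp (real n / real m)" using k(5) by (simp add: divide_right_mono)
    then have tk: "exp (real k / real m) \<le> t" using tl by (rule order_trans)
    have "norm (f t) \<le> y k * (E k * g (real k / real m)) + A * E (Suc n) * g (real n / real m)"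
      using step[OF k(3) tk tu] k(6,1) unfolding fy[of k] by simp
    also have "\<dots> \<le> (A / (1 - q) + e) * (E k * g (real n / real m)) + A * E (Suc n) * g (real n / real m)"
      using N'[OF k(4)] Epos[of k] gpos[of k] gmono[OF k(5)] q01 A e
      by (intro add_mono mult_mono order_refl) (auto intro!: add_nonneg_nonneg divide_nonneg_nonneg)
    also have "\<dots> = (A + q * (A / (1 - q) + e)) * (E (Suc n) * g (real n / real m))"
      using Ep[of k] by (simp add: k algebra_simps)
    also have "\<dots> \<le> (A + q * (A / (1 - q) + e)) * ((exp (H / real m) * t powr H) * g (ln t))"
    proof (intro mult_left_mono mult_mono)
      \<comment> \<open>Replacing \<open>t\<close> by the next grid point costs the factor
        \<open>exp (H / m)\<close>.\<close>
      have "E (Suc n) = exp (H / real m) * exp (H * (real n / real m))"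
        using m by (simp add: E_def exp_add[symmetric] field_simps)
      also have "exp (H * (real n / real m)) \<le> t powr H"
        using tl H by (metis powE E_def powr_mono2 exp_ge_zero less_imp_le)
      finally show "E (Suc n) \<le> exp (H / real m) * t powr H" by simp
      show "g (real n / real m) \<le> g (ln t)"
        using n1 m by (intro G1_mono[OF g]) (auto simp: field_simps)
      show "0 \<le> g (real n / real m)" using gpos[of n] by simp
      show "0 \<le> A + q * (A / (1 - q) + e)" using A q01 e by (intro add_nonneg_nonneg mult_nonneg_nonneg) auto
    qed auto
    finally show ?case by (simp add: mult_ac)
  qed
qed

section \<open>Borel-Cantelli along windows: almost sure upper and lower bounds\<close>

context ss_additive
begin

lemma G_tail_nonneg [simp]: "0 \<le> G_tail M X l r" and G_tail_le_1: "G_tail M X l r \<le> 1"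
  by (simp_all add: G_tail_def)

lemma G_tail_antimono: "r \<le> s \<Longrightarrow> G_tail M X l s \<le> G_tail M X l r"
  unfolding G_tail_def
proof (rule finite_measure_mono)
  have [measurable]: "X 1 \<in> borel_measurable M" "X (exp (- real l)) \<in> borel_measurable M"
    by (auto intro!: X_measurable)
  show "{\<omega>\<in>space M. norm (X 1 \<omega> - X (exp (- real l)) \<omega>) > r} \<in> events" by measurable
qed auto

definition tail_integral :: "(real \<Rightarrow> real) \<Rightarrow> nat \<Rightarrow> real \<Rightarrow> ennreal" where
  "tail_integral g l \<delta> = (\<integral>\<^sup>+x\<in>{0..}. ennreal (G_tail M X l (\<delta> * g x)) \<partial>lborel)"

lemma tail_integral_antimono:
  assumes "g \<in> G1" "\<delta> \<le> \<delta>'"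
  shows "tail_integral g l \<delta>' \<le> tail_integral g l \<delta>"
  unfolding tail_integral_def using assms
  by (intro nn_integral_mono) (auto simp: indicator_def intro!: ennreal_leI G_tail_antimono mult_right_mono dest: G1_pos less_imp_le)

text \<open>Only the values of \<open>g\<close> on \<open>[0, \<infinity>)\<close> are controlled, hence the \<open>max 0\<close>.\<close>

lemma
  assumes g: "g \<in> G1" and d: "\<delta> > 0"
  shows tail_measurable: "(\<lambda>x. ennreal (G_tail M X l (\<delta> * g (max 0 x)))) \<in> borel_measurable lborel"
    and tail_antimono: "x \<le> y \<Longrightarrow> G_tail M X l (\<delta> * g (max 0 y)) \<le> G_tail M X l (\<delta> * g (max 0 x))"
    and tail_integral_max: "tail_integral g l \<delta> = (\<integral>\<^sup>+x\<in>{0..}. ennreal (G_tail M X l (\<delta> * g (max 0 x))) \<partial>lborel)"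
proof -
  show anti: "G_tail M X l (\<delta> * g (max 0 y)) \<le> G_tail M X l (\<delta> * g (max 0 x))" if "x \<le> y" for x y
    using that d by (intro G_tail_antimono mult_left_mono G1_mono[OF g]) auto
  then have "mono (\<lambda>x. - G_tail M X l (\<delta> * g (max 0 x)))" by (auto intro!: monoI)
  then have "(\<lambda>x. - (- G_tail M X l (\<delta> * g (max 0 x)))) \<in> borel_measurable borel"
    by (intro borel_measurable_uminus borel_measurable_mono)
  then show "(\<lambda>x. ennreal (G_tail M X l (\<delta> * g (max 0 x)))) \<in> borel_measurable lborel" by simp
  show "tail_integral g l \<delta> = (\<integral>\<^sup>+x\<in>{0..}. ennreal (G_tail M X l (\<delta> * g (max 0 x))) \<partial>lborel)"
    unfolding tail_integral_def by (intro nn_integral_cong) (auto simp: indicator_def)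
qed

lemma tail_integral_sum:
  assumes g: "g \<in> G1" and d: "\<delta> > 0" and s: "s > 0"
  shows "ennreal s * (\<Sum>n. ennreal (G_tail M X l (\<delta> * g (real (Suc n) * s)))) \<le> tail_integral g l \<delta>"
    and "tail_integral g l \<delta> \<le> ennreal s * (\<Sum>n. ennreal (G_tail M X l (\<delta> * g (real n * s))))"
proof -
  have e: "max 0 (real n * s) = real n * s" for n using s by simp
  have "ennreal (G_tail M X l (\<delta> * g (max 0 y))) \<le> ennreal (G_tail M X l (\<delta> * g (max 0 x)))" if "0 \<le> x" "x \<le> y" for x y
    using that by (intro ennreal_leI tail_antimono[OF g d])
  note anti = this
  note bounds = antimono_integral_sum_bounds[OF tail_measurable[OF g d] _ s, unfolded e]
  show "ennreal s * (\<Sum>n. ennreal (G_tail M X l (\<delta> * g (real (Suc n) * s)))) \<le> tail_integral g l \<delta>"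
    unfolding tail_integral_max[OF g d] by (rule bounds(1)) (rule anti)
  show "tail_integral g l \<delta> \<le> ennreal s * (\<Sum>n. ennreal (G_tail M X l (\<delta> * g (real n * s))))"
    unfolding tail_integral_max[OF g d] by (rule bounds(2)) (rule anti)
qed

text \<open>Ottaviani's inequality bounds the oscillation on a window by its total increment at the
  price of the extra \<open>\<eta>\<close>: since \<open>g\<close> tends to infinity,
  \<open>\<eta> * g\<close> eventually exceeds any fixed quantile of \<open>norm (X 1)\<close>. The
  integral controls the sum over all grid points of mesh \<open>1 / m\<close>. The windows overlap,
  which is harmless because this half of Borel-Cantelli works without independence.\<close>

lemma AE_window_bound:
  assumes g: "g \<in> G1" and l: "l \<ge> 1" and m: "m \<ge> (1::nat)" and d: "\<delta> > 0" and \<eta>: "\<eta> > 0"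
    and fin: "tail_integral g l \<delta> < \<infinity>"
  shows "AE \<omega> in M. \<exists>N. \<forall>n\<ge>N. \<forall>t. exp (real (Suc n) / real m) * exp (- real l) \<le> t \<and> t \<le> exp (real (Suc n) / real m) \<longrightarrow>
      norm (X t \<omega> - X (exp (real (Suc n) / real m) * exp (- real l)) \<omega>) \<le> (\<delta> + \<eta>) * exp (real (Suc n) / real m) powr H * g (real n / real m)"
proof -
  define b where "b n = exp (real (Suc n) / real m)" for n
  define c where "c n = b n * exp (- real l)" for n
  define u where "u n = b n powr H * (\<delta> * g (real n / real m))" for n
  define v where "v n = b n powr H * (\<eta> * g (real n / real m))" for n
  have bpos: "b n > 0" and cpos: "c n > 0" and cb: "c n < b n" for n
    using l by (auto simp: b_def c_def)
  have glim: "filterlim (\<lambda>n. g (real n / real m)) at_top sequentially"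
    using m by (intro filterlim_compose[OF G1_at_top[OF g]]) real_asymp
  have "filterlim (\<lambda>n. \<eta> / 2 * g (real n / real m)) at_top sequentially"
    using \<eta> by (intro filterlim_tendsto_pos_mult_at_top[OF tendsto_const _ glim]) auto
  then have "filterlim (\<lambda>n. v n / (2 * b n powr H)) at_top sequentially"
    using bpos by (simp add: v_def less_imp_neq[symmetric])
  from filterlim_compose[OF prob_norm_gt_tendsto_0[OF X_measurable[of 1]] this]
  have "(\<lambda>n. prob {\<omega>\<in>space M. norm (X 1 \<omega>) > v n / (2 * b n powr H)}) \<longlonglongrightarrow> 0" by simp
  \<comment> \<open>The threshold is 1/4 because \<open>prob_increment_le\<close> subtracts twice
    this probability and 1/2 has to remain.\<close>
  then have "\<forall>\<^sub>F n in sequentially. prob {\<omega>\<in>space M. norm (X 1 \<omega>) > v n / (2 * b n powr H)} < 1 / 4"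
    by (intro order_tendstoD(2)) auto
  then have ev: "\<forall>\<^sub>F n in sequentially. prob (excess (c n) (b n) (u n + v n)) \<le> 2 * G_tail M X l (\<delta> * g (real n / real m))"
  proof eventually_elim
    case (elim n)
    have "1/2 * prob (excess (c n) (b n) (u n + v n)) \<le> prob {\<omega>\<in>space M. norm (X (b n) \<omega> - X (c n) \<omega>) > u n}"
    proof (rule prob_excess)
      fix s assume "c n \<le> s" "s \<le> b n"
      then show "1/2 \<le> prob {\<omega>\<in>space M. norm (X (b n) \<omega> - X s \<omega>) \<le> v n}"
        using prob_increment_le[of s "b n" "v n"] elim cpos[of n] by linarith
    qed (use cpos[of n] cb[of n] in simp_all)
    also have "\<dots> = G_tail M X l (\<delta> * g (real n / real m))"
      unfolding u_def c_def by (rule prob_increment_scale[OF bpos])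
    finally show ?case by simp
  qed
  have "summable (\<lambda>n. G_tail M X l (\<delta> * g (real (Suc n) / real m)))"
  proof (rule summable_suminf_not_top)
    have "real (Suc n) * (1 / real m) = real (Suc n) / real m" for n by simp
    note bound = tail_integral_sum(1)[OF g d, of "1 / real m" l, unfolded this]
    have "ennreal (1 / real m) * (\<Sum>n. ennreal (G_tail M X l (\<delta> * g (real (Suc n) / real m)))) < \<infinity>"
      by (rule le_less_trans[OF bound fin]) (use m in simp)
    moreover have "ennreal (1 / real m) * \<top> = \<top>"
      using m by (simp add: ennreal_mult_top)
    ultimately show "(\<Sum>n. ennreal (G_tail M X l (\<delta> * g (real (Suc n) / real m)))) \<noteq> \<top>"
      by (metis infinity_ennreal_def less_irrefl)
  qed (rule G_tail_nonneg)
  then have "summable (\<lambda>n. G_tail M X l (\<delta> * g (real n / real m)))"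
    by (subst (asm) summable_Suc_iff)
  then have "summable (\<lambda>n. 2 * G_tail M X l (\<delta> * g (real n / real m)))"
    by (rule summable_mult)
  then have "summable (\<lambda>n. prob (excess (c n) (b n) (u n + v n)))"
    by (rule summable_comparison_test_ev[rotated]) (use ev in simp)
  then have "AE \<omega> in M. \<forall>\<^sub>F n in sequentially. \<omega> \<in> space M - excess (c n) (b n) (u n + v n)"
    using cpos cb by (intro borel_cantelli_AE1) (auto intro!: excess_measurable simp: less_imp_le emeasure_eq_measure)
  with AE_right_continuous show ?thesis
  proof eventually_elim
    case (elim \<omega>)
    from elim(2) obtain N where N: "\<And>n. n \<ge> N \<Longrightarrow> \<omega> \<in> space M - excess (c n) (b n) (u n + v n)"
      by (auto simp: eventually_sequentially)
    have "norm (X t \<omega> - X (c n) \<omega>) \<le> (\<delta> + \<eta>) * b n powr H * g (real n / real m)"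
      if "n \<ge> N" "c n \<le> t" "t \<le> b n" for n t
    proof -
      have "norm (X t \<omega> - X (c n) \<omega>) \<le> u n + v n"
        using N[OF that(1)] cpos[of n] cb[of n] that by (intro le_of_not_excess[OF elim(1)]) auto
      then show ?thesis by (simp add: u_def v_def algebra_simps)
    qed
    then show ?case unfolding b_def c_def by blast
  qed
qed

text \<open>With window length \<open>N\<close>, mesh \<open>1 / N\<close> and slack
  \<open>1 / N\<close> the constant of the path bound is \<open>B N\<close>, which tends to
  \<open>\<delta>\<close>. One sufficiently large \<open>N\<close> is enough; its size depends on
  the gap to \<open>\<kappa>\<close>, whence finiteness is assumed for every
  \<open>l\<close>.\<close>

lemma AE_eventually_le:
  assumes g: "g \<in> G1" and d: "\<delta> > 0" "\<delta> < \<kappa>"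
    and fin: "\<And>l. l \<ge> 1 \<Longrightarrow> tail_integral g l \<delta> < \<infinity>"
  shows "AE \<omega> in M. \<forall>\<^sub>F t in at_top. norm (X t \<omega>) \<le> \<kappa> * (t powr H * g (ln t))"
proof -
  define B where "B N = ((\<delta> + 1 / real N) + exp (- (H * real N)) * ((\<delta> + 1 / real N) / (1 - exp (- (H * real N))) + 1 / real N)) * exp (H / real N)" for N
  have "B \<longlonglongrightarrow> \<delta>" unfolding B_def using H_pos d by real_asymp
  then have "\<forall>\<^sub>F N in sequentially. B N < \<kappa>" using d by (intro order_tendstoD(2))
  then have "\<forall>\<^sub>F N in sequentially. B N < \<kappa> \<and> N \<ge> 1" using eventually_ge_at_top[of "1::nat"] by eventually_elim simp
  then obtain N where N: "B N < \<kappa>" "N \<ge> 1" using eventually_happens'[OF sequentially_bot] by blast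
  from AE_window_bound[OF g N(2) N(2) d(1) _ fin[OF N(2)], of "1 / real N"] N(2)
  have "AE \<omega> in M. \<exists>K. \<forall>n\<ge>K. \<forall>t. exp (real (Suc n) / real N) * exp (- real N) \<le> t \<and> t \<le> exp (real (Suc n) / real N) \<longrightarrow>
      norm (X t \<omega> - X (exp (real (Suc n) / real N) * exp (- real N)) \<omega>) \<le> (\<delta> + 1 / real N) * exp (real (Suc n) / real N) powr H * g (real n / real N)"
    by simp
  then show ?thesis
  proof eventually_elim
    case (elim \<omega>)
    then obtain K where K: "\<And>n t. n \<ge> K \<Longrightarrow> exp (real (Suc n) / real N) * exp (- real N) \<le> t \<Longrightarrow> t \<le> exp (real (Suc n) / real N) \<Longrightarrow>
      norm (X t \<omega> - X (exp (real (Suc n) / real N) * exp (- real N)) \<omega>) \<le> (\<delta> + 1 / real N) * exp (real (Suc n) / real N) powr H * g (real n / real N)"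
      by blast
    have "\<forall>\<^sub>F t in at_top. norm (X t \<omega>) \<le> B N * (t powr H * g (ln t))"
      unfolding B_def
      by (rule path_bound_of_window_bound[OF g H_pos N(2) N(2) _ _ refl K]) (use d N in auto)
    then show ?case
      using eventually_ge_at_top[of 1]
    proof eventually_elim
      case (elim t)
      have "B N * (t powr H * g (ln t)) \<le> \<kappa> * (t powr H * g (ln t))"
        using N elim G1_pos[OF g, of "ln t"] by (intro mult_right_mono) auto
      with elim show ?case by linarith
    qed
  qed
qed

text \<open>The longer increment is the shorter one, \<open>Z\<close>, plus an earlier independent
  part \<open>Y\<close>. Far out \<open>Y\<close> stays below the difference
  \<open>(\<delta> - \<delta>') * g x\<close> with probability at least 1/2, so lengthening the
  window costs a factor 2 and the passage to \<open>\<delta>'\<close>.\<close>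

lemma tail_integral_infinite_larger_window:
  assumes g: "g \<in> G1" and d: "0 < \<delta>'" "\<delta>' < \<delta>" and l: "l0 < l"
    and inf: "tail_integral g l0 \<delta> = \<infinity>"
  shows "tail_integral g l \<delta>' = \<infinity>"
proof -
  define Y where "Y \<omega> = X (exp (- real l0)) \<omega> - X (exp (- real l)) \<omega>" for \<omega>
  define Z where "Z \<omega> = X 1 \<omega> - X (exp (- real l0)) \<omega>" for \<omega>
  have [measurable]: "Y \<in> borel_measurable M" "Z \<in> borel_measurable M"
    unfolding Y_def[abs_def] Z_def[abs_def] by (auto intro!: borel_measurable_diff X_measurable)
  \<comment> \<open>Increments number 1 and 2 of this sequence of times are \<open>Y\<close> and
    \<open>Z\<close>; from index 3 on it merely continues upwards from 1.\<close>
  define t where "t i = (if i = 0 then 0 else if i = 1 then exp (- real l) else if i = 2 then exp (- real l0) else (1::real) + real (i - 3))" for i :: nat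
  \<comment> \<open>An empty window has a vanishing tail and a finite integral. The times
    \<open>t\<close> increase strictly only if \<open>exp (- real l0) < 1\<close>.\<close>
  have "l0 \<noteq> 0"
  proof
    assume "l0 = 0"
    have "G_tail M X 0 (\<delta> * g x) = 0" if "x \<ge> 0" for x
    proof -
      have "\<delta> * g x > 0" using G1_pos[OF g that] d by simp
      then have e: "{\<omega>\<in>space M. \<delta> * g x < 0} = {}" by auto
      show ?thesis by (simp add: G_tail_def e)
    qed
    then have "tail_integral g 0 \<delta> = (\<integral>\<^sup>+x. 0 \<partial>(lborel :: real measure))"
      unfolding tail_integral_def by (intro nn_integral_cong) (auto simp: indicator_def)
    with inf \<open>l0 = 0\<close> show False by simp
  qed
  have ind: "indep_vars (\<lambda>_. borel) (\<lambda>i \<omega>. X (t (Suc i)) \<omega> - X (t i) \<omega>) {..<3}"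
    using l \<open>l0 \<noteq> 0\<close> by (intro indep_increments) (auto simp: t_def less_Suc_eq numeral_3_eq_3)
  have prod: "prob {\<omega>\<in>space M. norm (Y \<omega>) \<le> a \<and> norm (Z \<omega>) > r} = prob {\<omega>\<in>space M. norm (Y \<omega>) \<le> a} * prob {\<omega>\<in>space M. norm (Z \<omega>) > r}" for a r
  proof -
    have "prob (\<Inter>i\<in>{1,2}. (\<lambda>\<omega>. X (t (Suc i)) \<omega> - X (t i) \<omega>) -` (if i = 1 then {x. norm x \<le> a} else {x. norm x > r}) \<inter> space M)
      = (\<Prod>i\<in>{1,2}. prob ((\<lambda>\<omega>. X (t (Suc i)) \<omega> - X (t i) \<omega>) -` (if i = 1 then {x. norm x \<le> a} else {x. norm x > r}) \<inter> space M))"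
      by (intro indep_varsD[OF ind]) auto
    moreover have "t 1 = exp (- real l)" "t 2 = exp (- real l0)" "t (Suc 1) = exp (- real l0)" "t (Suc 2) = 1" by (simp_all add: t_def)
    ultimately have "prob (((Y -` {x. norm x \<le> a}) \<inter> space M) \<inter> (Z -` {x. norm x > r} \<inter> space M))
        = prob (Y -` {x. norm x \<le> a} \<inter> space M) * prob (Z -` {x. norm x > r} \<inter> space M)"
      by (simp add: Y_def[abs_def] Z_def[abs_def])
    moreover have "((Y -` {x. norm x \<le> a}) \<inter> space M) \<inter> (Z -` {x. norm x > r} \<inter> space M) = {\<omega>\<in>space M. norm (Y \<omega>) \<le> a \<and> norm (Z \<omega>) > r}"
      "Y -` {x. norm x \<le> a} \<inter> space M = {\<omega>\<in>space M. norm (Y \<omega>) \<le> a}"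
      "Z -` {x. norm x > r} \<inter> space M = {\<omega>\<in>space M. norm (Z \<omega>) > r}" by auto
    ultimately show ?thesis by simp
  qed
  have "filterlim (\<lambda>x. (\<delta> - \<delta>') * g x) at_top at_top"
    using d by (intro filterlim_tendsto_pos_mult_at_top[OF tendsto_const _ G1_at_top[OF g]]) auto
  from filterlim_compose[OF prob_norm_gt_tendsto_0[of Y] this]
  have "((\<lambda>x. prob {\<omega>\<in>space M. norm (Y \<omega>) > (\<delta> - \<delta>') * g x}) \<longlongrightarrow> 0) at_top" by simp
  then have "\<forall>\<^sub>F x in at_top. prob {\<omega>\<in>space M. norm (Y \<omega>) > (\<delta> - \<delta>') * g x} < 1 / 2"
    by (intro order_tendstoD(2)) auto
  then obtain x0 where x0: "\<And>x. x \<ge> x0 \<Longrightarrow> prob {\<omega>\<in>space M. norm (Y \<omega>) > (\<delta> - \<delta>') * g x} < 1 / 2"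
    by (auto simp: eventually_at_top_linorder)
  have half: "G_tail M X l0 (\<delta> * g x) \<le> 2 * G_tail M X l (\<delta>' * g x)" if "x \<ge> x0" for x
  proof -
    have "prob {\<omega>\<in>space M. norm (Y \<omega>) \<le> (\<delta> - \<delta>') * g x} = 1 - prob {\<omega>\<in>space M. norm (Y \<omega>) > (\<delta> - \<delta>') * g x}"
      by (subst prob_compl[symmetric]) (auto intro!: arg_cong[where f=prob])
    then have "1 / 2 * prob {\<omega>\<in>space M. norm (Z \<omega>) > \<delta> * g x}
        \<le> prob {\<omega>\<in>space M. norm (Y \<omega>) \<le> (\<delta> - \<delta>') * g x} * prob {\<omega>\<in>space M. norm (Z \<omega>) > \<delta> * g x}"
      using x0[OF that] by (intro mult_right_mono) auto
    also have "\<dots> = prob {\<omega>\<in>space M. norm (Y \<omega>) \<le> (\<delta> - \<delta>') * g x \<and> norm (Z \<omega>) > \<delta> * g x}"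
      by (rule prod[symmetric])
    also have "\<dots> \<le> prob {\<omega>\<in>space M. norm (X 1 \<omega> - X (exp (- real l)) \<omega>) > \<delta>' * g x}"
    proof (rule finite_measure_mono)
      show "{\<omega>\<in>space M. norm (Y \<omega>) \<le> (\<delta> - \<delta>') * g x \<and> norm (Z \<omega>) > \<delta> * g x} \<subseteq> {\<omega>\<in>space M. norm (X 1 \<omega> - X (exp (- real l)) \<omega>) > \<delta>' * g x}"
      proof clarsimp
        fix \<omega> assume w: "norm (Y \<omega>) \<le> (\<delta> - \<delta>') * g x" "\<delta> * g x < norm (Z \<omega>)"
        have "X 1 \<omega> - X (exp (- real l)) \<omega> = Z \<omega> + Y \<omega>" by (simp add: Y_def Z_def)
        moreover have "norm (Z \<omega>) - norm (Y \<omega>) \<le> norm (Z \<omega> + Y \<omega>)" by (rule norm_diff_ineq)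
        ultimately show "\<delta>' * g x < norm (X 1 \<omega> - X (exp (- real l)) \<omega>)"
          using w by (simp add: algebra_simps)
      qed
      have [measurable]: "X 1 \<in> borel_measurable M" "X (exp (- real l)) \<in> borel_measurable M"
        by (auto intro!: X_measurable)
      show "{\<omega>\<in>space M. norm (X 1 \<omega> - X (exp (- real l)) \<omega>) > \<delta>' * g x} \<in> events" by measurable
    qed
    finally show ?thesis by (simp add: G_tail_def Z_def)
  qed
  have m1: "(\<lambda>x. ennreal (G_tail M X l (\<delta>' * g (max 0 x)))) \<in> borel_measurable lborel"
    using tail_measurable[OF g d(1)] .
  have "\<infinity> = tail_integral g l0 \<delta>" by (simp add: inf)
  \<comment> \<open>The comparison \<open>half\<close> holds only beyond \<open>x0\<close>; before
    that the tail is at most 1 and contributes at most the length of the interval.\<close>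
  also have "\<dots> \<le> (\<integral>\<^sup>+x. indicator {0..max 0 x0} x + 2 * (ennreal (G_tail M X l (\<delta>' * g (max 0 x))) * indicator {0..} x) \<partial>lborel)"
    unfolding tail_integral_def
  proof (intro nn_integral_mono)
    fix x :: real
    show "ennreal (G_tail M X l0 (\<delta> * g x)) * indicator {0..} x \<le> indicator {0..max 0 x0} x + 2 * (ennreal (G_tail M X l (\<delta>' * g (max 0 x))) * indicator {0..} x)"
    proof (cases "x \<ge> 0")
      case True
      show ?thesis
      proof (cases "x \<le> x0")
        case True
        with \<open>x \<ge> 0\<close> show ?thesis using G_tail_le_1[of l0 "\<delta> * g x"]
          by (intro add_increasing2) (auto intro: ennreal_leI[of _ 1, simplified])
      next
        case False
        have "ennreal (G_tail M X l0 (\<delta> * g x)) \<le> ennreal (2 * G_tail M X l (\<delta>' * g x))"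
          using False by (intro ennreal_leI half) auto
        then show ?thesis using True False by (simp add: ennreal_mult add_increasing)
      qed
    qed simp
  qed
  also have "\<dots> = ennreal (max 0 x0) + 2 * tail_integral g l \<delta>'"
    unfolding tail_integral_max[OF g d(1)] using m1
    by (subst nn_integral_add) (auto simp: nn_integral_cmult)
  finally show ?thesis
    by (auto simp: top_unique ennreal_add_eq_top ennreal_mult_eq_top_iff)
qed

text \<open>If the path stayed below the level \<open>\<kappa>\<close>, every increment over a
  window would be at most \<open>\<kappa> * (1 + exp (- (H * l)))\<close> times the norming at its
  right end. For large \<open>l\<close> this is less than \<open>\<delta>'\<close>, which
  independent increments over disjoint windows exceed infinitely often. That
  \<open>\<delta>' < \<delta>\<close> pays for the passage from \<open>l0\<close> to such an
  \<open>l\<close>.\<close>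

lemma AE_frequently_gt:
  assumes g: "g \<in> G1" and d: "0 < \<kappa>" "\<kappa> < \<delta>" and inf: "tail_integral g l0 \<delta> = \<infinity>"
  shows "AE \<omega> in M. \<exists>\<^sub>F t in at_top. norm (X t \<omega>) > \<kappa> * (t powr H * g (ln t))"
proof -
  define \<delta>' where "\<delta>' = (\<kappa> + \<delta>) / 2"
  have d': "\<kappa> < \<delta>'" "\<delta>' < \<delta>" "0 < \<delta>'" using d by (auto simp: \<delta>'_def)
  have "(\<lambda>l. \<kappa> * (1 + exp (- (H * real l)))) \<longlonglongrightarrow> \<kappa>" using H_pos by real_asymp
  then have "\<forall>\<^sub>F l in sequentially. \<kappa> * (1 + exp (- (H * real l))) < \<delta>'"
    using d' by (intro order_tendstoD(2))
  then have "\<forall>\<^sub>F l in sequentially. \<kappa> * (1 + exp (- (H * real l))) < \<delta>' \<and> l > l0"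
    using eventually_gt_at_top[of l0] by eventually_elim simp
  then obtain l where l: "\<kappa> * (1 + exp (- (H * real l))) < \<delta>'" "l > l0"
    using eventually_happens'[OF sequentially_bot] by blast
  then have l1: "l \<ge> 1" by simp
  have infl: "tail_integral g l \<delta>' = \<infinity>"
    by (rule tail_integral_infinite_larger_window[OF g d'(3) d'(2) l(2) inf])
  define t where "t i = exp (real l * real i)" for i :: nat
  have tpos: "t i > 0" for i by (simp add: t_def)
  have tS: "t i = t (Suc i) * exp (- real l)" for i by (simp add: t_def exp_add[symmetric] algebra_simps)
  define D where "D i \<omega> = X (t (Suc i)) \<omega> - X (t i) \<omega>" for i \<omega>
  define r where "r i = t (Suc i) powr H * (\<delta>' * g (real (Suc i) * real l))" for i
  define A where "A i = {\<omega>\<in>space M. norm (D i \<omega>) > r i}" for i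
  have ind: "indep_vars (\<lambda>_. borel) D {..<n}" for n
    unfolding D_def using l1 by (intro indep_increments) (auto simp: t_def)
  have [measurable]: "D i \<in> borel_measurable M" for i
    unfolding D_def[abs_def] using tpos by (intro borel_measurable_diff X_measurable) (auto intro: less_imp_le)
  have pA: "prob (A i) = G_tail M X l (\<delta>' * g (real (Suc i) * real l))" for i
    unfolding A_def D_def r_def by (subst (2) tS) (rule prob_increment_scale[OF tpos])
  have "AE \<omega> in M. \<exists>\<^sub>F n in sequentially. \<omega> \<in> A n"
  proof (rule borel_cantelli_2)
    show "A n \<in> events" for n unfolding A_def by measurable
    show "prob (\<Inter>i\<in>J. space M - A i) = (\<Prod>i\<in>J. prob (space M - A i))" if J: "finite J" "J \<noteq> {}" for J
    proof -
      have eq: "space M - A i = D i -` {x. norm x \<le> r i} \<inter> space M" for i by (auto simp: A_def)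
      have "J \<subseteq> {..<Suc (Max J)}" using J by (auto simp: less_Suc_eq_le)
      then show ?thesis unfolding eq using J by (intro indep_varsD[OF ind]) auto
    qed
    let ?G = "\<lambda>n. ennreal (G_tail M X l (\<delta>' * g (real n * real l)))"
    have "\<infinity> \<le> ennreal (real l) * (\<Sum>n. ?G n)"
      unfolding infl[symmetric] by (rule tail_integral_sum(2)[OF g d'(3)]) (use l1 in simp)
    then have "(\<Sum>n. ?G n) = \<infinity>"
      by (auto simp: top_unique ennreal_mult_eq_top_iff)
    \<comment> \<open>The Riemann sum starts at 0 but the events \<open>A n\<close> evaluate
      \<open>g\<close> at the right end of their window; dropping one finite term keeps the
      divergence.\<close>
    moreover have "(\<Sum>n. ?G n) = (\<Sum>n. ?G (n + 1)) + sum ?G {..<1}"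
      by (rule suminf_offset[OF summableI])
    moreover have "sum ?G {..<1} \<noteq> \<infinity>" by simp
    ultimately have "(\<Sum>n. ?G (n + 1)) = \<infinity>" by (metis ennreal_add_eq_top infinity_ennreal_def)
    then show "(\<Sum>n. ennreal (prob (A n))) = \<infinity>" by (simp only: pA Suc_eq_plus1)
  qed
  moreover have "AE \<omega> in M. \<omega> \<in> space M" by simp
  ultimately show ?thesis
  proof eventually_elim
    case (elim \<omega>)
    show ?case unfolding frequently_def
    proof
      assume "\<forall>\<^sub>F t in at_top. \<not> norm (X t \<omega>) > \<kappa> * (t powr H * g (ln t))"
      then obtain T where T: "\<And>t. t \<ge> T \<Longrightarrow> norm (X t \<omega>) \<le> \<kappa> * (t powr H * g (ln t))"
        by (auto simp: eventually_at_top_linorder not_less)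
      have "filterlim t at_top sequentially" unfolding t_def using l1 by real_asymp
      then have "\<forall>\<^sub>F n in sequentially. t n \<ge> T" by (simp add: filterlim_at_top)
      then obtain n0 where n0: "\<And>n. n \<ge> n0 \<Longrightarrow> t n \<ge> T" by (auto simp: eventually_sequentially)
      obtain n where "n \<ge> n0" "\<omega> \<in> A n" using elim(1) unfolding frequently_sequentially by blast
      with n0 have n: "\<omega> \<in> A n" "t n \<ge> T" by auto
      have "t n \<le> t (Suc n)" unfolding t_def by (intro exp_le_cancel_iff[THEN iffD2] mult_left_mono) simp_all
      have ln_t: "ln (t i) = real i * real l" for i by (simp add: t_def)
      have q: "t n powr H = exp (- (H * real l)) * t (Suc n) powr H"
        by (simp add: t_def powr_def exp_add[symmetric] algebra_simps)
      let ?W = "t (Suc n) powr H * g (real (Suc n) * real l)"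
      have "norm (D n \<omega>) \<le> norm (X (t (Suc n)) \<omega>) + norm (X (t n) \<omega>)"
        unfolding D_def by (rule norm_triangle_ineq4)
      also have "\<dots> \<le> \<kappa> * ?W + \<kappa> * (t n powr H * g (real n * real l))"
      proof -
        have "T \<le> t (Suc n)" using n \<open>t n \<le> t (Suc n)\<close> by linarith
        from T[OF this] T[OF n(2)] show ?thesis unfolding ln_t by linarith
      qed
      also have "\<dots> \<le> \<kappa> * ?W + \<kappa> * (t n powr H * g (real (Suc n) * real l))"
      proof -
        have "real n * real l \<le> real (Suc n) * real l" by (intro mult_right_mono) simp_all
        then have "g (real n * real l) \<le> g (real (Suc n) * real l)" by (intro G1_mono[OF g]) simp_all
        then show ?thesis using d by (intro add_mono order_refl mult_left_mono) auto
      qed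
      also have "\<dots> = \<kappa> * (1 + exp (- (H * real l))) * ?W" by (simp add: q algebra_simps)
      also have "\<dots> \<le> \<delta>' * ?W"
        using l(1) G1_pos[OF g, of "real (Suc n) * real l"] by (intro mult_right_mono) auto
      also have "\<dots> = r n" by (simp add: r_def)
      also have "\<dots> < norm (D n \<omega>)" using n by (simp add: A_def)
      finally show False by simp
    qed
  qed
qed

end

section \<open>The generalized inverse\<close>

lemma G1_sublevel_bdd: "g \<in> G1 \<Longrightarrow> bdd_above {y. 0 \<le> y \<and> g y < r}"
proof -
  assume g: "g \<in> G1"
  from G1_at_top[OF g] have "\<forall>\<^sub>F y in at_top. r \<le> g y" by (simp add: filterlim_at_top)
  then obtain b where "\<And>y. y \<ge> b \<Longrightarrow> r \<le> g y" by (auto simp: eventually_at_top_linorder)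
  then have "y \<le> b" if "g y < r" for y using that by (meson linorder_not_le less_imp_le)
  then show ?thesis by (intro bdd_aboveI[of _ b]) simp
qed

lemma ginv_nonneg: "g \<in> G1 \<Longrightarrow> ginv g r \<ge> 0"
  unfolding ginv_def using G1_sublevel_bdd[of g r] by (auto intro: cSup_upper2)

lemma ginv_mono: "g \<in> G1 \<Longrightarrow> r \<le> s \<Longrightarrow> ginv g r \<le> ginv g s"
proof -
  assume g: "g \<in> G1" and rs: "r \<le> s"
  show ?thesis
  proof (cases "{y. 0 \<le> y \<and> g y < r} = {}")
    case True
    then show ?thesis using ginv_nonneg[OF g, of s] by (simp add: ginv_def)
  next
    case False
    moreover have sub: "{y. 0 \<le> y \<and> g y < r} \<subseteq> {y. 0 \<le> y \<and> g y < s}" using rs by auto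
    ultimately have "{y. 0 \<le> y \<and> g y < s} \<noteq> {}" by blast
    with False show ?thesis
      unfolding ginv_def using sub by (simp only: if_False) (intro cSup_subset_mono G1_sublevel_bdd[OF g])
  qed
qed

lemma ginv_measurable [measurable]: "g \<in> G1 \<Longrightarrow> ginv g \<in> borel_measurable borel"
  by (intro borel_measurable_mono monoI ginv_mono)

lemma G1_measurable: "g \<in> G1 \<Longrightarrow> (\<lambda>x. g (max 0 x)) \<in> borel_measurable borel"
  by (rule borel_measurable_mono, rule monoI, rule G1_mono) simp_all

text \<open>By monotonicity the set is an interval starting at 0, with or without its right end
  \<open>ginv g r\<close>, or it is empty. This is the layer representation of \<open>ginv\<close>
  behind the identity between tail integral and moment.\<close>

lemma emeasure_sublevel:
  assumes g: "g \<in> G1"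
  shows "emeasure lborel {y. 0 \<le> y \<and> g y < r} = ennreal (ginv g r)"
proof -
  let ?S = "{y. 0 \<le> y \<and> g y < r}"
  have "?S = {0..} \<inter> {x. g (max 0 x) < r}" by auto
  also have "\<dots> \<in> sets lborel"
  proof -
    have [measurable]: "(\<lambda>x. g (max 0 x)) \<in> borel_measurable borel" by (rule G1_measurable[OF g])
    show ?thesis by measurable
  qed
  finally have meas: "?S \<in> sets lborel" .
  show ?thesis
  proof (cases "?S = {}")
    case True
    then have "ginv g r = 0" unfolding ginv_def by (rule if_P)
    then show ?thesis by (simp only: True emeasure_empty ennreal_0)
  next
    case False
    then have eq: "ginv g r = Sup ?S" unfolding ginv_def by (rule if_not_P)
    have "ginv g r \<ge> 0" by (rule ginv_nonneg[OF g])
    have "{0..<ginv g r} \<subseteq> ?S"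
    proof
      fix y assume y: "y \<in> {0..<ginv g r}"
      then obtain z where "z \<in> ?S" "y < z"
        using less_cSup_iff[OF False G1_sublevel_bdd[OF g], of y] by (auto simp: eq)
      with y show "y \<in> ?S" using G1_mono[OF g, of y z] by auto
    qed
    then have "ennreal (ginv g r) \<le> emeasure lborel ?S"
      using emeasure_mono[OF _ meas, of "{0..<ginv g r}"] \<open>ginv g r \<ge> 0\<close> by simp
    moreover have "?S \<subseteq> {0..ginv g r}"
      unfolding eq using G1_sublevel_bdd[OF g, of r] by (auto intro: cSup_upper)
    then have "emeasure lborel ?S \<le> ennreal (ginv g r)"
      using emeasure_mono[of ?S "{0..ginv g r}" lborel] \<open>ginv g r \<ge> 0\<close> by simp
    ultimately show ?thesis by (rule antisym[rotated])
  qed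
qed

lemma pos_if_less_ennreal: "x < ennreal r \<Longrightarrow> r > 0"
  by (rule ccontr) (simp add: ennreal_neg)

section \<open>The limsup law and its integral test\<close>

context ss_additive
begin

lemma rho_prob_space: "prob_space (rho M X l)"
  unfolding rho_def by (intro prob_space_distr borel_measurable_diff X_measurable) auto

text \<open>\<open>ginv g\<close> at a level is the length of the corresponding sublevel set of
  \<open>g\<close>, so both sides measure the same set of pairs of a sample point and a time,
  integrated in either order.\<close>

lemma tail_integral_eq_rho_integral:
  assumes g: "g \<in> G1" and d: "\<delta> > 0"
  shows "tail_integral g l \<delta> = (\<integral>\<^sup>+x. ennreal (ginv g (norm x / \<delta>)) \<partial>(rho M X l))"
proof -
  define Y where "Y \<omega> = X 1 \<omega> - X (exp (- real l)) \<omega>" for \<omega>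
  have [measurable]: "Y \<in> borel_measurable M"
    unfolding Y_def[abs_def] by (intro borel_measurable_diff X_measurable) auto
  have [measurable]: "ginv g \<in> borel_measurable borel" "(\<lambda>x. g (max 0 x)) \<in> borel_measurable borel"
    using g by (auto intro: ginv_measurable G1_measurable)
  interpret P: pair_sigma_finite M lborel ..
  have "(\<integral>\<^sup>+x. ennreal (ginv g (norm x / \<delta>)) \<partial>(rho M X l)) = (\<integral>\<^sup>+\<omega>. ennreal (ginv g (norm (Y \<omega>) / \<delta>)) \<partial>M)"
    unfolding rho_def Y_def[symmetric] by (subst nn_integral_distr) auto
  also have "\<dots> = (\<integral>\<^sup>+\<omega>. (\<integral>\<^sup>+x. indicator {(\<omega>, x). 0 \<le> x \<and> g (max 0 x) < norm (Y \<omega>) / \<delta>} (\<omega>, x) \<partial>lborel) \<partial>M)"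
  proof (intro nn_integral_cong)
    fix \<omega>
    have "(\<integral>\<^sup>+x. indicator {(\<omega>, x). 0 \<le> x \<and> g (max 0 x) < norm (Y \<omega>) / \<delta>} (\<omega>, x) \<partial>lborel)
        = (\<integral>\<^sup>+x. indicator {y. 0 \<le> y \<and> g y < norm (Y \<omega>) / \<delta>} x \<partial>lborel)"
      by (intro nn_integral_cong) (auto simp: indicator_def)
    also have "\<dots> = ennreal (ginv g (norm (Y \<omega>) / \<delta>))"
      unfolding emeasure_sublevel[OF g, symmetric]
    proof (rule nn_integral_indicator)
      have "{y. 0 \<le> y \<and> g y < norm (Y \<omega>) / \<delta>} = {y. 0 \<le> y \<and> g (max 0 y) < norm (Y \<omega>) / \<delta>}" by auto
      also have "\<dots> \<in> sets lborel" by measurable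
      finally show "{y. 0 \<le> y \<and> g y < norm (Y \<omega>) / \<delta>} \<in> sets lborel" .
    qed
    finally show "ennreal (ginv g (norm (Y \<omega>) / \<delta>)) = (\<integral>\<^sup>+x. indicator {(\<omega>, x). 0 \<le> x \<and> g (max 0 x) < norm (Y \<omega>) / \<delta>} (\<omega>, x) \<partial>lborel)" by simp
  qed
  also have "\<dots> = (\<integral>\<^sup>+x. (\<integral>\<^sup>+\<omega>. indicator {(\<omega>, x). 0 \<le> x \<and> g (max 0 x) < norm (Y \<omega>) / \<delta>} (\<omega>, x) \<partial>M) \<partial>lborel)"
    by (rule P.Fubini'[symmetric]) measurable
  also have "\<dots> = (\<integral>\<^sup>+x\<in>{0..}. ennreal (G_tail M X l (\<delta> * g x)) \<partial>lborel)"
  proof (intro nn_integral_cong)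
    fix x :: real
    have "(\<integral>\<^sup>+\<omega>. indicator {(\<omega>, x). 0 \<le> x \<and> g (max 0 x) < norm (Y \<omega>) / \<delta>} (\<omega>, x) \<partial>M)
      = (\<integral>\<^sup>+\<omega>. indicator {\<omega>\<in>space M. norm (Y \<omega>) > \<delta> * g (max 0 x)} \<omega> * indicator {0..} x \<partial>M)"
      using d by (intro nn_integral_cong) (auto simp: indicator_def field_simps)
    also have "\<dots> = ennreal (G_tail M X l (\<delta> * g x)) * indicator {0..} x"
      by (cases "x \<ge> 0") (simp_all add: G_tail_def Y_def[symmetric] emeasure_eq_measure)
    finally show "(\<integral>\<^sup>+\<omega>. indicator {(\<omega>, x). 0 \<le> x \<and> g (max 0 x) < norm (Y \<omega>) / \<delta>} (\<omega>, x) \<partial>M)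
      = ennreal (G_tail M X l (\<delta> * g x)) * indicator {0..} x" .
  qed
  finally show ?thesis by (simp add: tail_integral_def)
qed

definition tail_critical :: "(real \<Rightarrow> real) \<Rightarrow> ennreal \<Rightarrow> bool" where
  "tail_critical g C \<longleftrightarrow> (\<forall>\<delta>>0. ennreal \<delta> > C \<longrightarrow> (\<forall>l\<ge>1. tail_integral g l \<delta> < \<infinity>)) \<and>
     (\<forall>\<delta>>0. ennreal \<delta> < C \<longrightarrow> (\<exists>l\<ge>1. tail_integral g l \<delta> = \<infinity>))"

text \<open>Every tail integral decreases in \<open>\<delta>\<close>, so the divergent levels form
  an initial segment, and its supremum separates the two cases. If no level diverges, the supremum
  in \<open>ennreal\<close> is 0.\<close>

lemma ex_tail_critical:
  assumes g: "g \<in> G1"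
  shows "\<exists>C. tail_critical g C"
proof -
  define C where "C = Sup {ennreal \<delta> | \<delta>. \<delta> > 0 \<and> (\<exists>l\<ge>1. tail_integral g l \<delta> = \<infinity>)}"
  have "tail_integral g l \<delta> < \<infinity>" if "\<delta> > 0" "ennreal \<delta> > C" "l \<ge> 1" for \<delta> l
  proof (rule ccontr)
    assume "\<not> tail_integral g l \<delta> < \<infinity>"
    then have "tail_integral g l \<delta> = \<infinity>" by (simp add: not_less top_unique)
    then have "ennreal \<delta> \<le> C" unfolding C_def using that by (intro Sup_upper) blast
    with that show False by simp
  qed
  moreover have "\<exists>l\<ge>1. tail_integral g l \<delta> = \<infinity>" if "\<delta> > 0" "ennreal \<delta> < C" for \<delta>
  proof -
    from that(2) obtain \<delta>' l where "\<delta>' > 0" "l \<ge> 1" "tail_integral g l \<delta>' = \<infinity>" "ennreal \<delta> < ennreal \<delta>'"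
      unfolding C_def less_Sup_iff by auto
    moreover from this have "\<delta> \<le> \<delta>'" using that(1) by (simp add: ennreal_less_iff)
    ultimately have "tail_integral g l \<delta> = \<infinity>"
      using tail_integral_antimono[OF g, of \<delta> \<delta>' l] by (simp add: top_unique)
    with \<open>l \<ge> 1\<close> show ?thesis by blast
  qed
  ultimately show ?thesis unfolding tail_critical_def by blast
qed

lemma limsup_law_unique: "limsup_law M H X g C \<Longrightarrow> limsup_law M H X g C' \<Longrightarrow> C = C'"
proof -
  assume "limsup_law M H X g C" "limsup_law M H X g C'"
  then have "AE \<omega> in M. C = C'" unfolding limsup_law_def by eventually_elim simp
  then show ?thesis by simp
qed

text \<open>Each level comes with its own null set. Rational levels are countable and dense in
  \<open>ennreal\<close>, so almost surely all comparisons hold together and force the limsup to be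
  \<open>C\<close>.\<close>

lemma limsup_law_if_tail_critical:
  assumes g: "g \<in> G1" and C: "tail_critical g C"
  shows "limsup_law M H X g C"
proof -
  define L where "L \<omega> = Limsup at_top (\<lambda>t. ennreal (norm (X t \<omega>) / (t powr H * g (ln t))))" for \<omega>
  have den: "t powr H * g (ln t) > 0" if "t \<ge> 1" for t
    using that G1_pos[OF g, of "ln t"] by simp
  have upper: "AE \<omega> in M. L \<omega> \<le> ennreal (real_of_rat r)" if r: "C < ennreal (real_of_rat r)" for r
  proof -
    \<comment> \<open>The path estimates need a strict gap between the level of the integral and the
      level of the bound, so the integral is taken at an intermediate rational.\<close>
    obtain s where s: "C < ennreal (real_of_rat s)" "ennreal (real_of_rat s) < ennreal (real_of_rat r)"
      using ennreal_rat_dense[OF r] by blast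
    have s0: "real_of_rat s > 0" using s(1) by (rule pos_if_less_ennreal)
    then have sr: "real_of_rat s < real_of_rat r" using s(2) by (simp add: ennreal_less_iff)
    have "AE \<omega> in M. \<forall>\<^sub>F t in at_top. norm (X t \<omega>) \<le> real_of_rat r * (t powr H * g (ln t))"
      using C s s0 by (intro AE_eventually_le[OF g s0 sr]) (auto simp: tail_critical_def)
    then show ?thesis
    proof eventually_elim
      case (elim \<omega>)
      have "\<forall>\<^sub>F t in at_top. ennreal (norm (X t \<omega>) / (t powr H * g (ln t))) \<le> ennreal (real_of_rat r)"
        using elim eventually_ge_at_top[of 1]
        by eventually_elim (auto intro!: ennreal_leI simp: den pos_divide_le_eq)
      then show ?case unfolding L_def by (rule Limsup_bounded)
    qed
  qed
  have lower: "AE \<omega> in M. L \<omega> \<ge> ennreal (real_of_rat r)" if r: "ennreal (real_of_rat r) < C" "real_of_rat r > 0" for r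
  proof -
    obtain s where s: "ennreal (real_of_rat s) < C" "ennreal (real_of_rat r) < ennreal (real_of_rat s)"
      using ennreal_rat_dense[OF r(1)] by blast
    have sr: "real_of_rat r < real_of_rat s" using s(2) r by (simp add: ennreal_less_iff)
    then have "real_of_rat s > 0" using r(2) by linarith
    then obtain l where "tail_integral g l (real_of_rat s) = \<infinity>"
      using C s(1) unfolding tail_critical_def by blast
    from AE_frequently_gt[OF g r(2) sr this] show ?thesis
    proof eventually_elim
      case (elim \<omega>)
      show ?case
      proof (rule ccontr)
        assume "\<not> ennreal (real_of_rat r) \<le> L \<omega>"
        then have "L \<omega> < ennreal (real_of_rat r)" by simp
        then have "\<forall>\<^sub>F t in at_top. ennreal (norm (X t \<omega>) / (t powr H * g (ln t))) < ennreal (real_of_rat r)"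
          unfolding L_def by (rule Limsup_lessD)
        then have "\<forall>\<^sub>F t in at_top. \<not> norm (X t \<omega>) > real_of_rat r * (t powr H * g (ln t))"
          using eventually_ge_at_top[of 1]
        proof eventually_elim
          case (elim t)
          then have "norm (X t \<omega>) / (t powr H * g (ln t)) < real_of_rat r"
            using den[of t] by (subst (asm) ennreal_less_iff) auto
          then show ?case using den[OF elim(2)] by (simp only: pos_divide_less_eq not_less)
        qed
        with elim show False by (simp add: frequently_def)
      qed
    qed
  qed
  have "AE \<omega> in M. \<forall>r. C < ennreal (real_of_rat r) \<longrightarrow> L \<omega> \<le> ennreal (real_of_rat r)"
    using upper by (subst AE_all_countable) (auto intro: AE_impI)
  moreover have "AE \<omega> in M. \<forall>r. ennreal (real_of_rat r) < C \<and> real_of_rat r > 0 \<longrightarrow> L \<omega> \<ge> ennreal (real_of_rat r)"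
    using lower by (subst AE_all_countable) (auto intro: AE_impI)
  ultimately have "AE \<omega> in M. L \<omega> = C"
  proof eventually_elim
    case (elim \<omega>)
    have "L \<omega> \<le> C"
    proof (rule ccontr)
      assume "\<not> L \<omega> \<le> C"
      then have "C < L \<omega>" by simp
      from ennreal_rat_dense[OF this] obtain r
        where "C < ennreal (real_of_rat r)" "ennreal (real_of_rat r) < L \<omega>" by blast
      with elim(1) show False by (meson not_le)
    qed
    moreover have "C \<le> L \<omega>"
    proof (rule ccontr)
      assume "\<not> C \<le> L \<omega>"
      then have "L \<omega> < C" by simp
      from ennreal_rat_dense[OF this] obtain r
        where r: "L \<omega> < ennreal (real_of_rat r)" "ennreal (real_of_rat r) < C" by blast
      have "real_of_rat r > 0" using r(1) by (rule pos_if_less_ennreal)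
      with elim(2) r show False by (meson not_le)
    qed
    ultimately show ?case by simp
  qed
  then show ?thesis by (simp add: limsup_law_def L_def)
qed

text \<open>The converse comes from existence for the integrals and uniqueness for the limsup: the
  law also holds with some critical value, which must then be the given \<open>C\<close>.\<close>

lemma limsup_law_iff_tail_critical: "g \<in> G1 \<Longrightarrow> limsup_law M H X g C \<longleftrightarrow> tail_critical g C"
  by (metis limsup_law_if_tail_critical limsup_law_unique ex_tail_critical)

end

section \<open>Characteristic functions and convolutions\<close>

definition borel_prob :: "'v::euclidean_space measure \<Rightarrow> bool" where
  "borel_prob P \<longleftrightarrow> prob_space P \<and> sets P = sets borel"

lemma borel_probD:
  assumes "borel_prob P"
  shows "prob_space P" "sets P = sets borel" "space P = UNIV"
  using assms sets_eq_imp_space_eq[of P borel] by (auto simp: borel_prob_def)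

lemma borel_prob_distr: "borel_prob P \<Longrightarrow> f \<in> borel_measurable borel \<Longrightarrow> borel_prob (distr P borel f)"
proof -
  assume P: "borel_prob P" and f: "f \<in> borel_measurable borel"
  then have "f \<in> borel_measurable P" by (subst measurable_cong_sets[OF borel_probD(2)[OF P] refl])
  with P show ?thesis unfolding borel_prob_def by (simp add: prob_space.prob_space_distr)
qed

lemma borel_prob_return: "borel_prob (return borel x)"
  by (simp add: borel_prob_def prob_space_return)

definition conv :: "'v::euclidean_space measure \<Rightarrow> 'v measure \<Rightarrow> 'v measure" where
  "conv P Q = distr (P \<Otimes>\<^sub>M Q) borel (\<lambda>(x, y). x + y)"

lemma borel_prob_conv: "borel_prob P \<Longrightarrow> borel_prob Q \<Longrightarrow> borel_prob (conv P Q)"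
proof -
  assume PQ: "borel_prob P" "borel_prob Q"
  interpret P: prob_space P by (rule borel_probD[OF PQ(1)])
  interpret Q: prob_space Q by (rule borel_probD[OF PQ(2)])
  interpret PQ: pair_prob_space P Q ..
  have [measurable_cong]: "sets P = sets borel" "sets Q = sets borel" using PQ by (auto simp: borel_prob_def)
  have "(\<lambda>(x, y). x + y) \<in> borel_measurable (P \<Otimes>\<^sub>M Q)" by measurable
  then show ?thesis unfolding borel_prob_def conv_def by (auto intro!: PQ.prob_space_distr)
qed

lemma nn_integral_conv:
  assumes PQ: "borel_prob P" "borel_prob Q" and [measurable]: "f \<in> borel_measurable borel"
  shows "(\<integral>\<^sup>+z. f z \<partial>conv P Q) = (\<integral>\<^sup>+x. \<integral>\<^sup>+y. f (x + y) \<partial>Q \<partial>P)"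
proof -
  interpret P: prob_space P by (rule borel_probD[OF PQ(1)])
  interpret Q: prob_space Q by (rule borel_probD[OF PQ(2)])
  have [measurable_cong]: "sets P = sets borel" "sets Q = sets borel" using PQ by (auto simp: borel_prob_def)
  have "(\<integral>\<^sup>+z. f z \<partial>conv P Q) = (\<integral>\<^sup>+z. f (case z of (x, y) \<Rightarrow> x + y) \<partial>(P \<Otimes>\<^sub>M Q))"
    unfolding conv_def by (rule nn_integral_distr) measurable
  also have "\<dots> = (\<integral>\<^sup>+x. \<integral>\<^sup>+y. f (case (x, y) of (x, y) \<Rightarrow> x + y) \<partial>Q \<partial>P)"
    by (rule Q.nn_integral_fst[symmetric]) measurable
  finally show ?thesis by simp
qed

lemma integrable_iexp:
  assumes "borel_prob P" and [measurable]: "f \<in> borel_measurable borel"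
  shows "integrable P (\<lambda>x. iexp (f x))"
proof -
  interpret P: prob_space P by (rule borel_probD[OF assms(1)])
  have [measurable_cong]: "sets P = sets borel" using assms by (auto simp: borel_prob_def)
  show ?thesis by (rule P.integrable_const_bound[of _ 1]) auto
qed

lemma char_fun_measurable [measurable]:
  "borel_prob P \<Longrightarrow> char_fun P \<in> borel_measurable borel"
proof -
  assume P: "borel_prob P"
  interpret P: prob_space P by (rule borel_probD[OF P])
  have [measurable_cong]: "sets P = sets borel" using P by (auto simp: borel_prob_def)
  show ?thesis unfolding char_fun_def[abs_def] by measurable
qed

lemma norm_char_fun_le_1:
  assumes P: "borel_prob P"
  shows "norm (char_fun P z) \<le> 1"
proof -
  interpret P: prob_space P by (rule borel_probD[OF P])
  have "norm (char_fun P z) \<le> (\<integral>x. norm (iexp (z \<bullet> x)) \<partial>P)"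
    unfolding char_fun_def by (rule integral_norm_bound)
  then show ?thesis by (simp add: P.prob_space)
qed

lemma char_fun_conv:
  assumes PQ: "borel_prob P" "borel_prob Q"
  shows "char_fun (conv P Q) z = char_fun P z * char_fun Q z"
proof -
  interpret P: prob_space P by (rule borel_probD[OF PQ(1)])
  interpret Q: prob_space Q by (rule borel_probD[OF PQ(2)])
  interpret PQ: pair_prob_space P Q ..
  have [measurable_cong]: "sets P = sets borel" "sets Q = sets borel" using PQ by (auto simp: borel_prob_def)
  have "char_fun (conv P Q) z = (\<integral>w. iexp (z \<bullet> (case w of (x, y) \<Rightarrow> x + y)) \<partial>(P \<Otimes>\<^sub>M Q))"
    unfolding char_fun_def conv_def by (rule integral_distr) measurable
  also have "\<dots> = (\<integral>w. (case w of (x, y) \<Rightarrow> iexp (z \<bullet> x) * iexp (z \<bullet> y)) \<partial>(P \<Otimes>\<^sub>M Q))"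
    by (intro Bochner_Integration.integral_cong) (auto simp: inner_add_right exp_add[symmetric] algebra_simps)
  also have "\<dots> = (\<integral>x. \<integral>y. iexp (z \<bullet> x) * iexp (z \<bullet> y) \<partial>Q \<partial>P)"
  proof -
    have "integrable (P \<Otimes>\<^sub>M Q) (\<lambda>w. (case w of (x, y) \<Rightarrow> iexp (z \<bullet> x) * iexp (z \<bullet> y)))"
      by (rule PQ.integrable_const_bound[of _ 1]) (auto simp: norm_mult)
    from PQ.integral_fst'[OF this] show ?thesis by simp
  qed
  also have "\<dots> = char_fun P z * char_fun Q z"
    unfolding char_fun_def by simp
  finally show ?thesis .
qed

lemma char_fun_return: "char_fun (return borel 0) z = 1"
  unfolding char_fun_def by (subst integral_return) auto

lemma char_fun_uminus:
  assumes P: "borel_prob P"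
  shows "char_fun (distr P borel uminus) z = cnj (char_fun P z)"
proof -
  have [measurable_cong]: "sets P = sets borel" using P by (auto simp: borel_prob_def)
  have "char_fun (distr P borel uminus) z = (\<integral>x. iexp (z \<bullet> (- x)) \<partial>P)"
    unfolding char_fun_def by (rule integral_distr) measurable
  also have "\<dots> = (\<integral>x. cnj (iexp (z \<bullet> x)) \<partial>P)"
    by (intro Bochner_Integration.integral_cong) (auto simp: exp_cnj)
  finally show ?thesis by (simp add: char_fun_def)
qed

lemma Re_char_fun:
  assumes P: "borel_prob P"
  shows "Re (char_fun P z) = (\<integral>x. cos (z \<bullet> x) \<partial>P)"
proof -
  have "Re (char_fun P z) = (\<integral>x. Re (iexp (z \<bullet> x)) \<partial>P)"
    unfolding char_fun_def by (intro integral_Re[symmetric] integrable_iexp P) measurable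
  then show ?thesis by (simp add: Re_exp)
qed

section \<open>Gaussian smoothing\<close>

text \<open>Since the kernel \<open>exp (- |x|\<^sup>2)\<close> is itself a characteristic function, pointwise convergence of
  characteristic functions passes to the smoothed measures by Fubini's theorem and dominated
  convergence. This replaces the continuity theorem, which the library only has in dimension one.\<close>

definition gauss_kernel :: "'v::euclidean_space \<Rightarrow> real" where
  "gauss_kernel v = exp (- (norm v)\<^sup>2)"

lemma gauss_kernel_simps [simp]:
  "0 < gauss_kernel v" "0 \<le> gauss_kernel v" "gauss_kernel v \<le> 1" "gauss_kernel (- v) = gauss_kernel v"
  by (auto simp: gauss_kernel_def)

lemma gauss_kernel_measurable [measurable]: "gauss_kernel \<in> borel_measurable borel"
  unfolding gauss_kernel_def[abs_def] by measurable

text \<open>A form of Parseval's relation: the kernel is written as the characteristic function of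
  \<open>W\<close> and the two integrals are exchanged. The kernel average then depends on
  \<open>P\<close> only through its characteristic function.\<close>

lemma gauss_kernel_integral_char_fun:
  fixes W P :: "'v::euclidean_space measure"
  assumes P: "borel_prob P" and W: "borel_prob W" "\<And>y. char_fun W y = of_real (gauss_kernel y)"
  shows "of_real (\<integral>x. gauss_kernel (x - u) \<partial>P) = (\<integral>w. char_fun P w * iexp (- (w \<bullet> u)) \<partial>W)"
proof -
  interpret P: prob_space P by (rule borel_probD[OF P])
  interpret W: prob_space W by (rule borel_probD[OF W(1)])
  interpret PW: pair_prob_space P W ..
  have [measurable_cong]: "sets P = sets borel" "sets W = sets borel" using P W by (auto simp: borel_prob_def)
  have "complex_of_real (\<integral>x. gauss_kernel (x - u) \<partial>P) = (\<integral>x. of_real (gauss_kernel (x - u)) \<partial>P)"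
    by simp
  also have "\<dots> = (\<integral>x. \<integral>w. iexp ((x - u) \<bullet> w) \<partial>W \<partial>P)"
    unfolding W(2)[symmetric] char_fun_def ..
  also have "\<dots> = (\<integral>w. \<integral>x. iexp ((x - u) \<bullet> w) \<partial>P \<partial>W)"
  proof (rule PW.Fubini_integral[symmetric])
    show "integrable (P \<Otimes>\<^sub>M W) (\<lambda>(x, w). iexp ((x - u) \<bullet> w))"
      by (rule PW.integrable_const_bound[of _ 1]) auto
  qed
  also have "\<dots> = (\<integral>w. char_fun P w * iexp (- (w \<bullet> u)) \<partial>W)"
  proof (intro Bochner_Integration.integral_cong refl)
    fix w
    have "(\<integral>x. iexp ((x - u) \<bullet> w) \<partial>P) = (\<integral>x. iexp (w \<bullet> x) * iexp (- (w \<bullet> u)) \<partial>P)"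
      by (intro Bochner_Integration.integral_cong refl)
         (simp add: exp_add[symmetric] inner_diff_left inner_commute algebra_simps)
    then show "(\<integral>x. iexp ((x - u) \<bullet> w) \<partial>P) = char_fun P w * iexp (- (w \<bullet> u))"
      by (simp add: char_fun_def)
  qed
  finally show ?thesis .
qed

lemma gauss_kernel_integral_tendsto:
  fixes W P' :: "'v::euclidean_space measure"
  assumes P: "\<And>n. borel_prob (P n)" "borel_prob P'" and W: "borel_prob W" "\<And>y. char_fun W y = of_real (gauss_kernel y)"
    and lim: "\<And>z. (\<lambda>n. char_fun (P n) z) \<longlonglongrightarrow> char_fun P' z"
  shows "(\<lambda>n. \<integral>x. gauss_kernel (x - u) \<partial>P n) \<longlonglongrightarrow> (\<integral>x. gauss_kernel (x - u) \<partial>P')"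
proof -
  interpret W: prob_space W by (rule borel_probD[OF W(1)])
  have [measurable_cong]: "sets W = sets borel" using W by (auto simp: borel_prob_def)
  have [measurable]: "char_fun (P n) \<in> borel_measurable borel" "char_fun P' \<in> borel_measurable borel" for n
    using P by auto
  have "(\<lambda>n. \<integral>w. char_fun (P n) w * iexp (- (w \<bullet> u)) \<partial>W) \<longlonglongrightarrow> (\<integral>w. char_fun P' w * iexp (- (w \<bullet> u)) \<partial>W)"
    by (rule integral_dominated_convergence[where w="\<lambda>_. 1"])
       (auto intro!: tendsto_intros lim AE_I2 simp: norm_mult norm_char_fun_le_1 P)
  then have "(\<lambda>n. complex_of_real (\<integral>x. gauss_kernel (x - u) \<partial>P n)) \<longlonglongrightarrow> of_real (\<integral>x. gauss_kernel (x - u) \<partial>P')"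
    by (simp only: gauss_kernel_integral_char_fun[OF _ W] P)
  then show ?thesis by (simp only: tendsto_of_real_iff)
qed

text \<open>The kernel is left unnormalized; smoothed functions are compared with the original ones
  only up to constant factors.\<close>

definition smooth :: "('v::euclidean_space \<Rightarrow> ennreal) \<Rightarrow> 'v \<Rightarrow> ennreal" where
  "smooth f x = (\<integral>\<^sup>+v. f (x + v) * ennreal (gauss_kernel v) \<partial>lborel)"

lemma smooth_measurable [measurable]:
  assumes [measurable]: "f \<in> borel_measurable borel"
  shows "smooth f \<in> borel_measurable borel"
  unfolding smooth_def[abs_def] by measurable

text \<open>Translation invariance and Fubini move the smoothing from \<open>f\<close> to
  \<open>P\<close>: the right-hand side involves \<open>P\<close> only through a kernel density,
  which converges when characteristic functions do.\<close>

lemma nn_integral_smooth: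
  assumes P: "borel_prob P" and [measurable]: "f \<in> borel_measurable borel"
  shows "(\<integral>\<^sup>+x. smooth f x \<partial>P) = (\<integral>\<^sup>+u. f u * ennreal (\<integral>x. gauss_kernel (x - u) \<partial>P) \<partial>lborel)"
proof -
  interpret P: prob_space P by (rule borel_probD[OF P])
  interpret PL: pair_sigma_finite P "lborel :: 'a measure" ..
  have [measurable_cong]: "sets P = sets borel" using P by (auto simp: borel_prob_def)
  have "smooth f x = (\<integral>\<^sup>+u. f u * ennreal (gauss_kernel (x - u)) \<partial>lborel)" for x
  proof -
    have "(\<integral>\<^sup>+u. f u * ennreal (gauss_kernel (x - u)) \<partial>lborel)
        = (\<integral>\<^sup>+u. f u * ennreal (gauss_kernel (x - u)) \<partial>distr lborel borel ((+) x))"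
      by (simp add: lborel_distr_plus)
    also have "\<dots> = (\<integral>\<^sup>+v. f (x + v) * ennreal (gauss_kernel (x - (x + v))) \<partial>lborel)"
      by (rule nn_integral_distr) measurable
    finally show ?thesis by (simp add: smooth_def)
  qed
  then have "(\<integral>\<^sup>+x. smooth f x \<partial>P) = (\<integral>\<^sup>+x. (\<integral>\<^sup>+u. f u * ennreal (gauss_kernel (x - u)) \<partial>lborel) \<partial>P)" by simp
  also have "\<dots> = (\<integral>\<^sup>+u. (\<integral>\<^sup>+x. f u * ennreal (gauss_kernel (x - u)) \<partial>P) \<partial>lborel)"
    by (rule PL.Fubini'[symmetric]) measurable
  also have "\<dots> = (\<integral>\<^sup>+u. f u * ennreal (\<integral>x. gauss_kernel (x - u) \<partial>P) \<partial>lborel)"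
  proof (intro nn_integral_cong)
    fix u
    have "(\<integral>\<^sup>+x. f u * ennreal (gauss_kernel (x - u)) \<partial>P) = f u * (\<integral>\<^sup>+x. ennreal (gauss_kernel (x - u)) \<partial>P)"
      by (rule nn_integral_cmult) measurable
    also have "(\<integral>\<^sup>+x. ennreal (gauss_kernel (x - u)) \<partial>P) = ennreal (\<integral>x. gauss_kernel (x - u) \<partial>P)"
      by (rule nn_integral_eq_integral) (auto intro!: P.integrable_const_bound[of _ 1])
    finally show "(\<integral>\<^sup>+x. f u * ennreal (gauss_kernel (x - u)) \<partial>P) = f u * ennreal (\<integral>x. gauss_kernel (x - u) \<partial>P)" .
  qed
  finally show ?thesis .
qed

text \<open>The smoothed densities converge pointwise and are at most 1, so a bounded
  \<open>f\<close> with bounded support supplies an integrable majorant. Unbounded weights are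
  therefore truncated before this is applied.\<close>

lemma nn_integral_smooth_tendsto:
  fixes W P' :: "'v::euclidean_space measure"
  assumes P: "\<And>n. borel_prob (P n)" "borel_prob P'" and W: "borel_prob W" "\<And>y. char_fun W y = of_real (gauss_kernel y)"
    and lim: "\<And>z. (\<lambda>n. char_fun (P n) z) \<longlonglongrightarrow> char_fun P' z"
    and f [measurable]: "f \<in> borel_measurable borel"
    and bdd: "\<And>x. f x \<le> ennreal B" "\<And>x. norm x > R \<Longrightarrow> f x = 0"
  shows "(\<lambda>n. \<integral>\<^sup>+x. smooth f x \<partial>P n) \<longlonglongrightarrow> (\<integral>\<^sup>+x. smooth f x \<partial>P')"
  unfolding nn_integral_smooth[OF P(1) f] nn_integral_smooth[OF P(2) f]
proof (rule nn_integral_dominated_convergence[where w="\<lambda>u. ennreal B * indicator (cball (0::'v) R) u"])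
  have kernel_measurable: "(\<lambda>u. \<integral>x. gauss_kernel (x - u) \<partial>Q) \<in> borel_measurable borel" if Q: "borel_prob Q" for Q :: "'v measure"
  proof -
    interpret Q: prob_space Q by (rule borel_probD[OF Q])
    have [measurable_cong]: "sets Q = sets borel" using Q by (auto simp: borel_prob_def)
    show ?thesis by measurable
  qed
  have kernel_le: "(\<integral>x. gauss_kernel (x - u) \<partial>Q) \<le> 1" if Q: "borel_prob Q" for Q and u :: 'v
  proof -
    interpret Q: prob_space Q by (rule borel_probD[OF Q])
    have [measurable_cong]: "sets Q = sets borel" using Q by (auto simp: borel_prob_def)
    have "(\<integral>x. gauss_kernel (x - u) \<partial>Q) \<le> (\<integral>x. 1 \<partial>Q)"
      by (intro integral_mono Q.integrable_const_bound[of _ 1]) auto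
    then show ?thesis by (simp add: Q.prob_space)
  qed
  show "(\<lambda>u. f u * ennreal (\<integral>x. gauss_kernel (x - u) \<partial>P n)) \<in> borel_measurable lborel" for n
    using kernel_measurable[OF P(1)[of n]] by measurable
  show "(\<lambda>u. f u * ennreal (\<integral>x. gauss_kernel (x - u) \<partial>P')) \<in> borel_measurable lborel"
    using kernel_measurable[OF P(2)] by measurable
  show "(\<lambda>u. ennreal B * indicator (cball (0::'v) R) u) \<in> borel_measurable lborel"
    by (intro borel_measurable_times_ennreal borel_measurable_indicator) auto
  show "AE u in lborel. f u * ennreal (\<integral>x. gauss_kernel (x - u) \<partial>P n) \<le> ennreal B * indicator (cball (0::'v) R) u" for n
  proof (intro AE_I2)
    fix u :: 'v
    show "f u * ennreal (\<integral>x. gauss_kernel (x - u) \<partial>P n) \<le> ennreal B * indicator (cball (0::'v) R) u"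
    proof (cases "norm u > R")
      case False
      have "f u * ennreal (\<integral>x. gauss_kernel (x - u) \<partial>P n) \<le> ennreal B * ennreal 1"
        using kernel_le[OF P(1)] by (intro mult_mono bdd ennreal_leI) auto
      with False show ?thesis by simp
    qed (simp add: bdd)
  qed
  show "(\<integral>\<^sup>+u. ennreal B * indicator (cball (0::'v) R) u \<partial>lborel) < \<infinity>"
    using emeasure_lborel_cball_finite[of "0::'v" R] by (simp add: nn_integral_cmult_indicator ennreal_mult_less_top)
  show "AE u in lborel. (\<lambda>n. f u * ennreal (\<integral>x. gauss_kernel (x - u) \<partial>P n)) \<longlonglongrightarrow> f u * ennreal (\<integral>x. gauss_kernel (x - u) \<partial>P')"
  proof (intro AE_I2 ennreal_tendsto_cmult tendsto_ennrealI gauss_kernel_integral_tendsto[OF P W lim])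
    show "f u < \<top>" for u using le_less_trans[OF bdd(1) ennreal_less_top] .
  qed
qed

section \<open>Compound Poisson approximants\<close>

text \<open>\<open>mixsym p P\<close> is the law of \<open>\<xi> Z\<close> for \<open>Z\<close> distributed as \<open>P\<close> and an independent \<open>\<xi>\<close> with values
  \<open>0\<close>, \<open>1\<close>, \<open>-1\<close> taken with probabilities \<open>1 - p\<close>, \<open>p/2\<close>, \<open>p/2\<close>.\<close>

definition mixsym :: "real \<Rightarrow> 'v::euclidean_space measure \<Rightarrow> 'v measure" where
  "mixsym p P = distr (measure_pmf (bernoulli_pmf p) \<Otimes>\<^sub>M (measure_pmf (bernoulli_pmf (1/2)) \<Otimes>\<^sub>M P)) borel
     (\<lambda>(b, s, x). if b then (if s then x else - x) else 0)"

lemma mixsym_map_measurable: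
  assumes P: "borel_prob P"
  shows "(\<lambda>(b, s, x). if b then (if s then x else - x) else 0) \<in>
    borel_measurable (measure_pmf (bernoulli_pmf p) \<Otimes>\<^sub>M (measure_pmf (bernoulli_pmf (1/2)) \<Otimes>\<^sub>M P))"
proof -
  have [measurable_cong]: "sets P = sets borel" using P by (auto simp: borel_prob_def)
  have [measurable]: "fst \<in> measurable (measure_pmf (bernoulli_pmf p) \<Otimes>\<^sub>M Q) (count_space UNIV)" for p and Q :: "'b measure"
    using measurable_fst[of "measure_pmf (bernoulli_pmf p)" Q] by simp
  show ?thesis by measurable
qed

lemma borel_prob_mixsym: "borel_prob P \<Longrightarrow> borel_prob (mixsym p P)"
proof -
  assume P: "borel_prob P"
  interpret P: prob_space P by (rule borel_probD[OF P])
  interpret S: pair_prob_space "measure_pmf (bernoulli_pmf (1/2))" P ..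
  interpret B: pair_prob_space "measure_pmf (bernoulli_pmf p)" "measure_pmf (bernoulli_pmf (1/2)) \<Otimes>\<^sub>M P" ..
  show ?thesis unfolding borel_prob_def mixsym_def
    using B.prob_space_distr[OF mixsym_map_measurable[OF P]] by simp
qed

lemma nn_integral_mixsym:
  assumes P: "borel_prob P" and p: "0 \<le> p" "p \<le> 1" and [measurable]: "f \<in> borel_measurable borel"
  shows "(\<integral>\<^sup>+x. f x \<partial>mixsym p P) = ennreal (1 - p) * f 0 + ennreal (p / 2) * (\<integral>\<^sup>+x. f x + f (- x) \<partial>P)"
proof -
  interpret P: prob_space P by (rule borel_probD[OF P])
  interpret S: pair_prob_space "measure_pmf (bernoulli_pmf (1/2))" P ..
  interpret B: pair_prob_space "measure_pmf (bernoulli_pmf p)" "measure_pmf (bernoulli_pmf (1/2)) \<Otimes>\<^sub>M P" ..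
  have [measurable_cong]: "sets P = sets borel" using P by (auto simp: borel_prob_def)
  let ?h = "\<lambda>(b, s, x). if b then (if s then x else - x) else (0::'a)"
  have m [measurable]: "?h \<in> borel_measurable (measure_pmf (bernoulli_pmf p) \<Otimes>\<^sub>M (measure_pmf (bernoulli_pmf (1/2)) \<Otimes>\<^sub>M P))"
    by (rule mixsym_map_measurable[OF P])
  have m2: "(\<lambda>y. f (?h (b, y))) \<in> borel_measurable (measure_pmf (bernoulli_pmf (1/2)) \<Otimes>\<^sub>M P)" for b
    by (rule measurable_compose[OF _ assms(4)], rule measurable_compose[OF _ m]) simp
  have "(\<integral>\<^sup>+x. f x \<partial>mixsym p P) = (\<integral>\<^sup>+w. f (?h w) \<partial>(measure_pmf (bernoulli_pmf p) \<Otimes>\<^sub>M (measure_pmf (bernoulli_pmf (1/2)) \<Otimes>\<^sub>M P)))"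
    unfolding mixsym_def by (rule nn_integral_distr) measurable
  also have "\<dots> = (\<integral>\<^sup>+b. \<integral>\<^sup>+y. f (?h (b, y)) \<partial>(measure_pmf (bernoulli_pmf (1/2)) \<Otimes>\<^sub>M P) \<partial>measure_pmf (bernoulli_pmf p))"
    by (rule S.nn_integral_fst[symmetric]) measurable
  also have "\<dots> = (\<integral>\<^sup>+b. \<integral>\<^sup>+s. \<integral>\<^sup>+x. f (?h (b, s, x)) \<partial>P \<partial>measure_pmf (bernoulli_pmf (1/2)) \<partial>measure_pmf (bernoulli_pmf p))"
    by (intro nn_integral_cong P.nn_integral_fst[symmetric] m2)
  also have "\<dots> = ennreal p * (\<integral>\<^sup>+s. \<integral>\<^sup>+x. f (?h (True, s, x)) \<partial>P \<partial>measure_pmf (bernoulli_pmf (1/2))) + ennreal (1 - p) * f 0"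
    using p by (subst nn_integral_bernoulli_pmf) (auto simp: mult.commute measure_pmf.emeasure_space_1 P.emeasure_space_1)
  also have "(\<integral>\<^sup>+s. \<integral>\<^sup>+x. f (?h (True, s, x)) \<partial>P \<partial>measure_pmf (bernoulli_pmf (1/2))) = ennreal (1/2) * (\<integral>\<^sup>+x. f x + f (- x) \<partial>P)"
    by (subst nn_integral_bernoulli_pmf) (auto simp: mult.commute nn_integral_add distrib_left)
  also have "ennreal p * (ennreal (1/2) * (\<integral>\<^sup>+x. f x + f (- x) \<partial>P)) = ennreal (p / 2) * (\<integral>\<^sup>+x. f x + f (- x) \<partial>P)"
  proof -
    have "ennreal p * ennreal (1/2) = ennreal (p / 2)"
      using p by (subst ennreal_mult[symmetric]) auto
    then show ?thesis by (metis mult.assoc)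
  qed
  finally show ?thesis by (simp add: add.commute)
qed

text \<open>Averaging over the random sign turns the exponential into a cosine. The result is real,
  so limits of convolution powers reduce to limits of powers of real numbers.\<close>

lemma char_fun_mixsym:
  assumes P: "borel_prob P" and p: "0 \<le> p" "p \<le> 1"
  shows "char_fun (mixsym p P) z = of_real (1 - p * (\<integral>x. 1 - cos (z \<bullet> x) \<partial>P))"
proof -
  interpret P: prob_space P by (rule borel_probD[OF P])
  interpret S: pair_prob_space "measure_pmf (bernoulli_pmf (1/2))" P ..
  interpret B: pair_prob_space "measure_pmf (bernoulli_pmf p)" "measure_pmf (bernoulli_pmf (1/2)) \<Otimes>\<^sub>M P" ..
  have [measurable_cong]: "sets P = sets borel" using P by (auto simp: borel_prob_def)
  let ?h = "\<lambda>(b, s, x). if b then (if s then x else - x) else (0::'a)"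
  let ?f = "\<lambda>x. iexp (z \<bullet> x)"
  have m [measurable]: "?h \<in> borel_measurable (measure_pmf (bernoulli_pmf p) \<Otimes>\<^sub>M (measure_pmf (bernoulli_pmf (1/2)) \<Otimes>\<^sub>M P))"
    by (rule mixsym_map_measurable[OF P])
  have fm: "?f \<in> borel_measurable borel" by measurable
  have m2: "(\<lambda>y. ?f (?h (b, y))) \<in> borel_measurable (measure_pmf (bernoulli_pmf (1/2)) \<Otimes>\<^sub>M P)" for b
    by (rule measurable_compose[OF _ fm], rule measurable_compose[OF _ m]) simp
  have bern: "(\<integral>b. F b \<partial>measure_pmf (bernoulli_pmf q)) = q *\<^sub>R F True + (1 - q) *\<^sub>R F False"
    if "0 \<le> q" "q \<le> 1" for q and F :: "bool \<Rightarrow> complex"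
    using that by (subst integral_measure_pmf[of UNIV]) (auto simp: UNIV_bool)
  have "char_fun (mixsym p P) z = (\<integral>w. ?f (?h w) \<partial>(measure_pmf (bernoulli_pmf p) \<Otimes>\<^sub>M (measure_pmf (bernoulli_pmf (1/2)) \<Otimes>\<^sub>M P)))"
    unfolding char_fun_def mixsym_def by (rule integral_distr[OF m fm])
  also have "\<dots> = (\<integral>b. \<integral>y. ?f (?h (b, y)) \<partial>(measure_pmf (bernoulli_pmf (1/2)) \<Otimes>\<^sub>M P) \<partial>measure_pmf (bernoulli_pmf p))"
    by (rule B.integral_fst'[symmetric], rule B.integrable_const_bound[of _ 1])
       (auto intro!: measurable_compose[OF m fm])
  also have "\<dots> = (\<integral>b. \<integral>s. \<integral>x. ?f (?h (b, s, x)) \<partial>P \<partial>measure_pmf (bernoulli_pmf (1/2)) \<partial>measure_pmf (bernoulli_pmf p))"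
    by (intro Bochner_Integration.integral_cong refl S.integral_fst'[symmetric] S.integrable_const_bound[of _ 1] m2) auto
  also have "\<dots> = p *\<^sub>R (\<integral>s. \<integral>x. ?f (?h (True, s, x)) \<partial>P \<partial>measure_pmf (bernoulli_pmf (1/2))) + (1 - p) *\<^sub>R 1"
    using p by (subst bern) (auto simp: measure_pmf.prob_space P.prob_space)
  also have "(\<integral>s. \<integral>x. ?f (?h (True, s, x)) \<partial>P \<partial>measure_pmf (bernoulli_pmf (1/2)))
     = (1/2) *\<^sub>R (\<integral>x. ?f x \<partial>P) + (1/2) *\<^sub>R (\<integral>x. ?f (- x) \<partial>P)"
    by (subst bern) auto
  also have "(\<integral>x. ?f (- x) \<partial>P) = cnj (\<integral>x. ?f x \<partial>P)"
  proof -
    have "(\<integral>x. ?f (- x) \<partial>P) = (\<integral>x. cnj (?f x) \<partial>P)"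
      by (intro Bochner_Integration.integral_cong) (auto simp: exp_cnj)
    then show ?thesis by simp
  qed
  also have "(1/2) *\<^sub>R (\<integral>x. ?f x \<partial>P) + (1/2) *\<^sub>R cnj (\<integral>x. ?f x \<partial>P) = of_real (Re (char_fun P z))"
    unfolding char_fun_def by (simp add: complex_eq_iff)
  also have "Re (char_fun P z) = 1 - (\<integral>x. 1 - cos (z \<bullet> x) \<partial>P)"
    unfolding Re_char_fun[OF P] by (subst Bochner_Integration.integral_diff) (auto intro!: P.integrable_const_bound[of _ 1] simp: P.prob_space)
  finally show ?thesis by (simp add: complex_eq_iff algebra_simps)
qed

section \<open>Convolution powers and their growth factors\<close>

primrec cpow :: "'v::euclidean_space measure \<Rightarrow> nat \<Rightarrow> 'v measure" where
  "cpow Q 0 = return borel 0"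
| "cpow Q (Suc n) = conv Q (cpow Q n)"

lemma borel_prob_cpow: "borel_prob Q \<Longrightarrow> borel_prob (cpow Q n)"
  by (induction n) (auto intro: borel_prob_return borel_prob_conv)

lemma char_fun_cpow: "borel_prob Q \<Longrightarrow> char_fun (cpow Q n) z = char_fun Q z ^ n"
  by (induction n) (auto simp: char_fun_return char_fun_conv borel_prob_cpow)

text \<open>The bound is demanded at every shift \<open>x\<close>, and not only for the integral of
  \<open>f\<close>, because then the constants multiply under convolution and become powers under
  convolution powers.\<close>

definition growth_bound :: "('v::euclidean_space \<Rightarrow> ennreal) \<Rightarrow> 'v measure \<Rightarrow> ennreal \<Rightarrow> bool" where
  "growth_bound f Q K \<longleftrightarrow> (\<forall>x. (\<integral>\<^sup>+z. f (z + x) \<partial>Q) \<le> K * f x)"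

lemma growth_bound_conv:
  assumes PQ: "borel_prob P" "borel_prob Q" and [measurable]: "f \<in> borel_measurable borel"
    and 1: "growth_bound f P K" and 2: "growth_bound f Q L"
  shows "growth_bound f (conv P Q) (K * L)"
  unfolding growth_bound_def
proof
  fix x
  interpret P: prob_space P by (rule borel_probD[OF PQ(1)])
  interpret Q: prob_space Q by (rule borel_probD[OF PQ(2)])
  interpret PQ: pair_sigma_finite P Q ..
  have [measurable_cong]: "sets P = sets borel" "sets Q = sets borel" using PQ by (auto simp: borel_prob_def)
  have "(\<integral>\<^sup>+z. f (z + x) \<partial>conv P Q) = (\<integral>\<^sup>+z. \<integral>\<^sup>+y. f (z + y + x) \<partial>Q \<partial>P)"
    by (rule nn_integral_conv[OF PQ]) measurable
  also have "\<dots> = (\<integral>\<^sup>+y. \<integral>\<^sup>+z. f (z + y + x) \<partial>P \<partial>Q)"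
    by (rule PQ.Fubini'[symmetric]) measurable
  also have "\<dots> \<le> (\<integral>\<^sup>+y. K * f (y + x) \<partial>Q)"
    using 1 unfolding growth_bound_def by (intro nn_integral_mono) (simp add: add.assoc)
  also have "\<dots> = K * (\<integral>\<^sup>+y. f (y + x) \<partial>Q)" by (rule nn_integral_cmult) measurable
  also have "\<dots> \<le> K * (L * f x)"
    using 2 unfolding growth_bound_def by (intro mult_left_mono) auto
  finally show "(\<integral>\<^sup>+z. f (z + x) \<partial>conv P Q) \<le> K * L * f x" by (simp add: mult.assoc)
qed

lemma growth_bound_return: "f \<in> borel_measurable borel \<Longrightarrow> growth_bound f (return borel 0) 1"
  unfolding growth_bound_def by (subst nn_integral_return) auto

lemma growth_bound_cpow:
  assumes "borel_prob Q" "f \<in> borel_measurable borel" "growth_bound f Q K"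
  shows "growth_bound f (cpow Q n) (K ^ n)"
  by (induction n) (auto intro: growth_bound_return growth_bound_conv assms borel_prob_cpow)

lemma growth_boundD0: "growth_bound f Q K \<Longrightarrow> (\<integral>\<^sup>+z. f z \<partial>Q) \<le> K * f 0"
  unfolding growth_bound_def by (metis (no_types, lifting) add.right_neutral nn_integral_cong)

lemma growth_bound_mono: "growth_bound f Q K \<Longrightarrow> K \<le> L \<Longrightarrow> growth_bound f Q L"
  unfolding growth_bound_def by (meson mult_right_mono order_trans zero_le)

text \<open>A substitute for an exponential of the norm. The addition formula for cosh holds exactly
  in each coordinate, so a symmetric shift multiplies it by a factor whose excess over 1 is
  quadratic for small shifts; an exponential of the norm would give a linear excess.\<close>

definition cosh_sum :: "real \<Rightarrow> 'v::euclidean_space \<Rightarrow> real" where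
  "cosh_sum \<beta> x = (\<Sum>b\<in>Basis. cosh (\<beta> * (x \<bullet> b)))"

lemma cosh_sum_nonneg: "cosh_sum \<beta> x \<ge> 0"
  unfolding cosh_sum_def by (intro sum_nonneg) auto

lemma cosh_measurable [measurable]: "(cosh :: real \<Rightarrow> real) \<in> borel_measurable borel"
  by (intro borel_measurable_continuous_onI continuous_on_cosh continuous_on_id)

lemma cosh_sum_measurable [measurable]: "cosh_sum \<beta> \<in> borel_measurable borel"
  unfolding cosh_sum_def[abs_def] by measurable

lemma cosh_abs_mono: "\<bar>s\<bar> \<le> \<bar>t\<bar> \<Longrightarrow> cosh s \<le> cosh (t::real)"
  using cosh_real_nonneg_le_iff[of "\<bar>s\<bar>" "\<bar>t\<bar>"] by (auto simp: abs_if split: if_splits)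

text \<open>The norm is at most \<open>DIM('v)\<close> times the largest coordinate in absolute
  value, which explains the enlarged exponent; a single summand already dominates.\<close>

lemma exp_norm_le_cosh_sum:
  fixes x :: "'v::euclidean_space"
  assumes "b \<ge> 0"
  shows "exp (b * norm x) \<le> 2 * cosh_sum (b * DIM('v)) x"
proof -
  obtain i :: 'v where i: "i \<in> Basis" "\<And>j. j \<in> Basis \<Longrightarrow> \<bar>x \<bullet> j\<bar> \<le> \<bar>x \<bullet> i\<bar>"
  proof -
    have "finite ((\<lambda>j. \<bar>x \<bullet> j\<bar>) ` (Basis::'v set))" "(\<lambda>j. \<bar>x \<bullet> j\<bar>) ` (Basis::'v set) \<noteq> {}" by auto
    from Max_in[OF this] obtain i where i: "Max ((\<lambda>j. \<bar>x \<bullet> j\<bar>) ` (Basis::'v set)) = \<bar>x \<bullet> i\<bar>" "i \<in> Basis"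
      by (elim imageE)
    show ?thesis
    proof (rule that[OF i(2)])
      show "\<bar>x \<bullet> j\<bar> \<le> \<bar>x \<bullet> i\<bar>" if "j \<in> Basis" for j
        unfolding i(1)[symmetric] using that by (intro Max_ge) auto
    qed
  qed
  have "norm x \<le> (\<Sum>j\<in>Basis. \<bar>x \<bullet> j\<bar>)" by (rule norm_le_l1)
  also have "\<dots> \<le> (\<Sum>j\<in>(Basis::'v set). \<bar>x \<bullet> i\<bar>)" by (intro sum_mono i)
  finally have "b * norm x \<le> b * (DIM('v) * \<bar>x \<bullet> i\<bar>)" using assms by (intro mult_left_mono) auto
  then have "exp (b * norm x) \<le> exp (\<bar>b * DIM('v) * (x \<bullet> i)\<bar>)"
    using assms by (simp add: abs_mult mult.assoc)
  also have "\<dots> \<le> 2 * cosh (b * DIM('v) * (x \<bullet> i))"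
    by (auto simp: cosh_def abs_if)
  also have "\<dots> \<le> 2 * cosh_sum (b * DIM('v)) x"
    unfolding cosh_sum_def using i(1) by (intro mult_left_mono member_le_sum) auto
  finally show ?thesis .
qed

text \<open>In each coordinate cosh (s + t) + cosh (s - t) = 2 cosh s cosh t, and every coordinate
  of \<open>z\<close> is at most \<open>norm z\<close> in absolute value.\<close>

lemma cosh_sum_add_symmetric:
  "cosh_sum \<beta> (z + x) + cosh_sum \<beta> (- z + x) \<le> 2 * cosh (\<beta> * norm z) * cosh_sum \<beta> x"
proof -
  have "cosh_sum \<beta> (z + x) + cosh_sum \<beta> (- z + x) = (\<Sum>b\<in>Basis. 2 * cosh (\<beta> * (z \<bullet> b)) * cosh (\<beta> * (x \<bullet> b)))"
    unfolding cosh_sum_def sum.distrib[symmetric]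
  proof (intro sum.cong refl)
    fix b :: 'a
    have "\<beta> * ((z + x) \<bullet> b) = \<beta> * (z \<bullet> b) + \<beta> * (x \<bullet> b)" "\<beta> * ((- z + x) \<bullet> b) = \<beta> * (x \<bullet> b) - \<beta> * (z \<bullet> b)"
      by (simp_all add: inner_add_left inner_diff_left algebra_simps)
    then show "cosh (\<beta> * ((z + x) \<bullet> b)) + cosh (\<beta> * ((- z + x) \<bullet> b)) = 2 * cosh (\<beta> * (z \<bullet> b)) * cosh (\<beta> * (x \<bullet> b))"
      by (simp only: cosh_add cosh_diff) (simp add: mult_ac)
  qed
  also have "\<dots> \<le> (\<Sum>b\<in>Basis. 2 * cosh (\<beta> * norm z) * cosh (\<beta> * (x \<bullet> b)))"
    by (intro sum_mono mult_right_mono mult_left_mono cosh_abs_mono)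
       (auto simp: abs_mult Basis_le_norm intro!: mult_left_mono)
  finally show ?thesis by (simp add: cosh_sum_def sum_distrib_left)
qed

lemma growth_bound_cosh_mixsym:
  assumes P: "borel_prob P" and p: "0 \<le> p" "p \<le> 1"
  shows "growth_bound (\<lambda>x. ennreal (cosh_sum \<beta> x)) (mixsym p P)
    (ennreal (1 - p) + ennreal p * (\<integral>\<^sup>+z. ennreal (cosh (\<beta> * norm z)) \<partial>P))"
  unfolding growth_bound_def
proof
  fix x :: 'a
  have [measurable_cong]: "sets P = sets borel" using P by (auto simp: borel_prob_def)
  have "(\<integral>\<^sup>+z. ennreal (cosh_sum \<beta> (z + x)) \<partial>mixsym p P) = ennreal (1 - p) * ennreal (cosh_sum \<beta> (0 + x))
      + ennreal (p / 2) * (\<integral>\<^sup>+z. ennreal (cosh_sum \<beta> (z + x)) + ennreal (cosh_sum \<beta> (- z + x)) \<partial>P)"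
    by (rule nn_integral_mixsym[OF P p]) measurable
  also have "(\<integral>\<^sup>+z. ennreal (cosh_sum \<beta> (z + x)) + ennreal (cosh_sum \<beta> (- z + x)) \<partial>P)
     \<le> (\<integral>\<^sup>+z. ennreal (cosh (\<beta> * norm z)) * ennreal (2 * cosh_sum \<beta> x) \<partial>P)"
  proof (intro nn_integral_mono)
    fix z
    have "ennreal (cosh_sum \<beta> (z + x)) + ennreal (cosh_sum \<beta> (- z + x)) = ennreal (cosh_sum \<beta> (z + x) + cosh_sum \<beta> (- z + x))"
      by (simp add: cosh_sum_nonneg)
    also have "\<dots> \<le> ennreal (cosh (\<beta> * norm z) * (2 * cosh_sum \<beta> x))"
      using cosh_sum_add_symmetric[of \<beta> z x] by (intro ennreal_leI) (simp add: mult_ac)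
    finally show "ennreal (cosh_sum \<beta> (z + x)) + ennreal (cosh_sum \<beta> (- z + x)) \<le> ennreal (cosh (\<beta> * norm z)) * ennreal (2 * cosh_sum \<beta> x)"
      by (simp add: ennreal_mult cosh_sum_nonneg)
  qed
  also have "\<dots> = (\<integral>\<^sup>+z. ennreal (cosh (\<beta> * norm z)) \<partial>P) * ennreal (2 * cosh_sum \<beta> x)"
    by (rule nn_integral_multc) measurable
  also have "ennreal (p / 2) * ((\<integral>\<^sup>+z. ennreal (cosh (\<beta> * norm z)) \<partial>P) * ennreal (2 * cosh_sum \<beta> x))
      = ennreal p * (\<integral>\<^sup>+z. ennreal (cosh (\<beta> * norm z)) \<partial>P) * ennreal (cosh_sum \<beta> x)"
  proof -
    have "ennreal (p / 2) * ennreal (2 * cosh_sum \<beta> x) = ennreal p * ennreal (cosh_sum \<beta> x)"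
      using p by (simp add: ennreal_mult[symmetric] cosh_sum_nonneg)
    then show ?thesis by (metis mult.assoc mult.commute)
  qed
  finally show "(\<integral>\<^sup>+z. ennreal (cosh_sum \<beta> (z + x)) \<partial>mixsym p P)
     \<le> (ennreal (1 - p) + ennreal p * (\<integral>\<^sup>+z. ennreal (cosh (\<beta> * norm z)) \<partial>P)) * ennreal (cosh_sum \<beta> x)"
    by (simp add: distrib_right mult_left_mono)
qed

text \<open>The first bound keeps only the event that all \<open>n\<close> summands vanish. The
  second keeps the \<open>n\<close> disjoint events that exactly one summand is nonzero, each sign
  having probability \<open>p / 2\<close>. Both follow by splitting off one summand.\<close>

lemma nn_integral_cpow_mixsym_ge:
  fixes h :: "'v::euclidean_space \<Rightarrow> ennreal"
  assumes P: "borel_prob P" and p: "0 \<le> p" "p \<le> 1" and [measurable]: "h \<in> borel_measurable borel"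
  shows "ennreal ((1 - p) ^ n) * h x \<le> (\<integral>\<^sup>+y. h (x + y) \<partial>cpow (mixsym p P) n)"
    and "ennreal (real n * (p * (1 - p) ^ (n - 1)) / 2) * (\<integral>\<^sup>+x. h x + h (- x) \<partial>P) \<le> (\<integral>\<^sup>+y. h y \<partial>cpow (mixsym p P) n)"
proof -
  interpret P: prob_space P by (rule borel_probD[OF P])
  note prob = borel_prob_mixsym[OF P] borel_prob_cpow[OF borel_prob_mixsym[OF P]]
  have [measurable_cong]: "sets P = sets borel" using P by (auto simp: borel_prob_def)
  have [measurable_cong]: "sets (cpow (mixsym p P) n) = sets borel" for n using prob(2) by (auto simp: borel_prob_def)
  have sf: "sigma_finite_measure (cpow (mixsym p P) n)" for n
    using borel_probD(1)[OF prob(2)] by (intro finite_measure.sigma_finite_measure prob_space.finite_measure)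
  have m: "(\<lambda>x. \<integral>\<^sup>+y. h (x + y) \<partial>cpow (mixsym p P) n) \<in> borel_measurable borel" for n
    by (rule sigma_finite_measure.borel_measurable_nn_integral[OF sf]) measurable
  have step: "(\<integral>\<^sup>+y. h (x + y) \<partial>cpow (mixsym p P) (Suc n)) = ennreal (1 - p) * (\<integral>\<^sup>+y. h (x + y) \<partial>cpow (mixsym p P) n)
      + ennreal (p / 2) * (\<integral>\<^sup>+z. (\<integral>\<^sup>+y. h (x + z + y) \<partial>cpow (mixsym p P) n) + (\<integral>\<^sup>+y. h (x - z + y) \<partial>cpow (mixsym p P) n) \<partial>P)" for n x
  proof -
    have "(\<integral>\<^sup>+y. h (x + y) \<partial>cpow (mixsym p P) (Suc n)) = (\<integral>\<^sup>+z. \<integral>\<^sup>+y. h (x + (z + y)) \<partial>cpow (mixsym p P) n \<partial>mixsym p P)"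
      unfolding cpow.simps by (rule nn_integral_conv[OF prob]) measurable
    also have "\<dots> = (\<integral>\<^sup>+z. (\<lambda>z. \<integral>\<^sup>+y. h (x + z + y) \<partial>cpow (mixsym p P) n) z \<partial>mixsym p P)"
      by (simp add: add.assoc)
    also have "\<dots> = ennreal (1 - p) * (\<lambda>z. \<integral>\<^sup>+y. h (x + z + y) \<partial>cpow (mixsym p P) n) 0 + ennreal (p / 2) *
        (\<integral>\<^sup>+z. (\<lambda>z. \<integral>\<^sup>+y. h (x + z + y) \<partial>cpow (mixsym p P) n) z + (\<lambda>z. \<integral>\<^sup>+y. h (x + z + y) \<partial>cpow (mixsym p P) n) (- z) \<partial>P)"
      by (rule nn_integral_mixsym[OF P p], rule measurable_compose[OF _ m]) measurable
    finally show ?thesis by simp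
  qed
  have A: "ennreal ((1 - p) ^ n) * h x \<le> (\<integral>\<^sup>+y. h (x + y) \<partial>cpow (mixsym p P) n)" for n x
  proof (induction n arbitrary: x)
    case 0
    show ?case by (subst cpow.simps, subst nn_integral_return) auto
  next
    case (Suc n)
    have "ennreal ((1 - p) ^ Suc n) * h x = ennreal (1 - p) * (ennreal ((1 - p) ^ n) * h x)"
      using p by (simp add: ennreal_mult mult.assoc)
    also have "\<dots> \<le> ennreal (1 - p) * (\<integral>\<^sup>+y. h (x + y) \<partial>cpow (mixsym p P) n)"
      by (intro mult_left_mono Suc.IH) auto
    finally show ?case unfolding step[of n x] by (rule add_increasing2[rotated]) simp
  qed
  show "ennreal ((1 - p) ^ n) * h x \<le> (\<integral>\<^sup>+y. h (x + y) \<partial>cpow (mixsym p P) n)" by (rule A)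
  show "ennreal (real n * (p * (1 - p) ^ (n - 1)) / 2) * (\<integral>\<^sup>+x. h x + h (- x) \<partial>P) \<le> (\<integral>\<^sup>+y. h y \<partial>cpow (mixsym p P) n)"
  proof (induction n)
    case (Suc n)
    let ?S = "\<integral>\<^sup>+x. h x + h (- x) \<partial>P"
    have "ennreal (real n * (p * (1 - p) ^ n) / 2) * ?S \<le> ennreal (1 - p) * (\<integral>\<^sup>+y. h y \<partial>cpow (mixsym p P) n)"
    \<comment> \<open>The exponent \<open>n - 1\<close> is truncated at 0, but for
      \<open>n = 0\<close> the left side vanishes anyway.\<close>
    proof (cases n)
      case (Suc k)
      have "real n * (p * (1 - p) ^ n) / 2 = (1 - p) * (real n * (p * (1 - p) ^ (n - 1)) / 2)" using Suc by simp
      then have "ennreal (real n * (p * (1 - p) ^ n) / 2) = ennreal (1 - p) * ennreal (real n * (p * (1 - p) ^ (n - 1)) / 2)"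
        using p by (simp only:) (rule ennreal_mult, auto)
      then have "ennreal (real n * (p * (1 - p) ^ n) / 2) * ?S = ennreal (1 - p) * (ennreal (real n * (p * (1 - p) ^ (n - 1)) / 2) * ?S)"
        by (simp only: mult.assoc)
      also have "\<dots> \<le> ennreal (1 - p) * (\<integral>\<^sup>+y. h y \<partial>cpow (mixsym p P) n)"
        by (intro mult_left_mono Suc.IH) auto
      finally show ?thesis .
    qed simp
    moreover have "ennreal (p * (1 - p) ^ n / 2) * ?S \<le> ennreal (p / 2) *
       (\<integral>\<^sup>+z. (\<integral>\<^sup>+y. h (z + y) \<partial>cpow (mixsym p P) n) + (\<integral>\<^sup>+y. h (- z + y) \<partial>cpow (mixsym p P) n) \<partial>P)"
    proof -
      have "ennreal (p * (1 - p) ^ n / 2) * ?S = ennreal (p / 2) * (ennreal ((1 - p) ^ n) * ?S)"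
        using p by (simp add: ennreal_mult[symmetric] mult.assoc[symmetric])
      also have "ennreal ((1 - p) ^ n) * ?S = (\<integral>\<^sup>+z. ennreal ((1 - p) ^ n) * (h z + h (- z)) \<partial>P)"
        by (rule nn_integral_cmult[symmetric]) measurable
      also have "\<dots> \<le> (\<integral>\<^sup>+z. (\<integral>\<^sup>+y. h (z + y) \<partial>cpow (mixsym p P) n) + (\<integral>\<^sup>+y. h (- z + y) \<partial>cpow (mixsym p P) n) \<partial>P)"
        by (intro nn_integral_mono) (auto simp: distrib_left simp del: uminus_add_conv_diff intro!: add_mono A)
      finally show ?thesis by (simp add: mult_left_mono)
    qed
    moreover have "ennreal (real (Suc n) * (p * (1 - p) ^ n) / 2) * ?S
       = ennreal (real n * (p * (1 - p) ^ n) / 2) * ?S + ennreal (p * (1 - p) ^ n / 2) * ?S"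
      using p by (subst distrib_right[symmetric], subst ennreal_plus[symmetric]) (auto simp: field_simps)
    ultimately show ?case using step[of n 0] by (simp add: add_mono)
  qed simp
qed

section \<open>Gaussian laws with a prescribed quadratic form\<close>

lemma nn_integral_exp_std_normal:
  "(\<integral>\<^sup>+t. ennreal (exp (c * t)) \<partial>std_normal_distribution) = ennreal (exp (c\<^sup>2 / 2))"
proof -
  interpret prob_space "density lborel (normal_density c 1)"
    by (rule prob_space_normal_density) simp
  have 1: "(\<integral>\<^sup>+t. ennreal (normal_density c 1 t) \<partial>lborel) = 1"
    using emeasure_space_1 by (subst (asm) emeasure_density) auto
  have "(\<integral>\<^sup>+t. ennreal (exp (c * t)) \<partial>std_normal_distribution)
      = (\<integral>\<^sup>+t. ennreal (std_normal_density t) * ennreal (exp (c * t)) \<partial>lborel)"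
    by (subst nn_integral_density) auto
  \<comment> \<open>Completing the square: the exponential tilt of the standard normal density is a
    multiple of the normal density with mean \<open>c\<close>.\<close>
  also have "\<dots> = (\<integral>\<^sup>+t. ennreal (exp (c\<^sup>2 / 2)) * ennreal (normal_density c 1 t) \<partial>lborel)"
  proof (intro nn_integral_cong)
    fix t :: real
    have "std_normal_density t * exp (c * t) = exp (c\<^sup>2 / 2) * normal_density c 1 t"
      by (simp add: normal_density_def exp_add[symmetric] power2_eq_square field_simps)
    then show "ennreal (std_normal_density t) * ennreal (exp (c * t)) = ennreal (exp (c\<^sup>2 / 2)) * ennreal (normal_density c 1 t)"
      by (simp add: ennreal_mult[symmetric])
  qed
  also have "\<dots> = ennreal (exp (c\<^sup>2 / 2))"
    by (subst nn_integral_cmult) (auto simp: 1)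
  finally show ?thesis .
qed

text \<open>The factor \<open>sqrt 2\<close> cancels the 1/2 in the Gaussian exponent. Passing to
  \<open>mixsym 1 P\<close> leaves the characteristic function of this symmetric law unchanged and
  makes the growth bound for \<open>mixsym\<close> applicable.\<close>

lemma ex_gaussian_line:
  fixes b :: "'v::euclidean_space"
  shows "\<exists>G. borel_prob G \<and> (\<forall>z. char_fun G z = of_real (exp (- (z \<bullet> b)\<^sup>2))) \<and>
    (\<forall>\<beta>. \<exists>K<\<infinity>. growth_bound (\<lambda>x. ennreal (cosh_sum \<beta> x)) G K)"
proof -
  define P where "P = distr std_normal_distribution borel (\<lambda>t. (sqrt 2 * t) *\<^sub>R b)"
  interpret N: real_distribution std_normal_distribution by (rule real_dist_normal_dist)
  have P: "borel_prob P" unfolding P_def borel_prob_def by (auto intro!: N.prob_space_distr)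
  show ?thesis
  proof (intro exI[of _ "mixsym 1 P"] conjI allI)
  show "borel_prob (mixsym 1 P)" by (rule borel_prob_mixsym[OF P])
  fix z
  have "char_fun P z = (CLINT t|std_normal_distribution. iexp ((sqrt 2 * (z \<bullet> b)) * t))"
    unfolding char_fun_def P_def by (subst integral_distr) (auto simp: mult_ac)
  also have "\<dots> = of_real (exp (- (sqrt 2 * (z \<bullet> b))\<^sup>2 / 2))"
    using fun_cong[OF char_std_normal_distribution, of "sqrt 2 * (z \<bullet> b)"] by (simp add: char_def)
  finally have char_P: "char_fun P z = of_real (exp (- (z \<bullet> b)\<^sup>2))" by (simp add: power_mult_distrib)
  interpret P: prob_space P by (rule borel_probD[OF P])
  have [measurable_cong]: "sets P = sets borel" using P by (auto simp: borel_prob_def)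
  have "(\<integral>x. 1 - cos (z \<bullet> x) \<partial>P) = 1 - Re (char_fun P z)"
    unfolding Re_char_fun[OF P] by (subst Bochner_Integration.integral_diff) (auto intro!: P.integrable_const_bound[of _ 1] simp: P.prob_space)
  then show "char_fun (mixsym 1 P) z = of_real (exp (- (z \<bullet> b)\<^sup>2))"
    by (subst char_fun_mixsym[OF P]) (simp_all add: char_P)
  next
  fix \<beta> :: real
  let ?K = "ennreal (1 - 1) + ennreal 1 * (\<integral>\<^sup>+z. ennreal (cosh (\<beta> * norm z)) \<partial>P)"
  let ?c = "\<beta> * sqrt 2 * norm b"
  have "growth_bound (\<lambda>x. ennreal (cosh_sum \<beta> x)) (mixsym 1 P) ?K"
    by (rule growth_bound_cosh_mixsym[OF P]) auto
  moreover have "?K < \<infinity>"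
  proof -
    have "(\<integral>\<^sup>+z. ennreal (cosh (\<beta> * norm z)) \<partial>P) = (\<integral>\<^sup>+t. ennreal (cosh (\<beta> * norm ((sqrt 2 * t) *\<^sub>R b))) \<partial>std_normal_distribution)"
      unfolding P_def by (rule nn_integral_distr) auto
    also have "\<dots> \<le> (\<integral>\<^sup>+t. ennreal (exp (?c * t)) + ennreal (exp ((- ?c) * t)) \<partial>std_normal_distribution)"
    proof (intro nn_integral_mono)
      fix t :: real
      have "cosh (\<beta> * norm ((sqrt 2 * t) *\<^sub>R b)) = cosh (?c * t)"
        by (cases "t \<ge> 0") (auto simp: abs_mult mult_ac)
      also have "\<dots> \<le> exp (?c * t) + exp ((- ?c) * t)"
        by (simp add: cosh_def field_simps)
      finally show "ennreal (cosh (\<beta> * norm ((sqrt 2 * t) *\<^sub>R b))) \<le> ennreal (exp (?c * t)) + ennreal (exp ((- ?c) * t))"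
        by (simp add: ennreal_plus[symmetric] ennreal_leI del: ennreal_plus)
    qed
    also have "\<dots> = ennreal (exp (?c\<^sup>2 / 2)) + ennreal (exp ((- ?c)\<^sup>2 / 2))"
      unfolding nn_integral_exp_std_normal[symmetric] by (rule nn_integral_add) auto
    also have "\<dots> < \<infinity>" by (simp add: ennreal_plus[symmetric] del: ennreal_plus)
    finally show ?thesis by simp
  qed
  ultimately show "\<exists>K<\<infinity>. growth_bound (\<lambda>x. ennreal (cosh_sum \<beta> x)) (mixsym 1 P) K" by blast
  qed
qed

lemma ex_gaussian:
  fixes bs :: "'v::euclidean_space list"
  shows "\<exists>G. borel_prob G \<and> (\<forall>z. char_fun G z = of_real (exp (- (\<Sum>b\<leftarrow>bs. (z \<bullet> b)\<^sup>2)))) \<and>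
    (\<forall>\<beta>. \<exists>K<\<infinity>. growth_bound (\<lambda>x. ennreal (cosh_sum \<beta> x)) G K)"
proof (induction bs)
  case Nil
  have "growth_bound (\<lambda>x::'v. ennreal (cosh_sum \<beta> x)) (return borel 0) 1" for \<beta>
    by (rule growth_bound_return) measurable
  then show ?case
    by (intro exI[of _ "return borel 0"]) (auto simp: borel_prob_return char_fun_return intro!: exI[of _ 1])
next
  case (Cons b bs)
  from Cons.IH obtain G where G: "borel_prob G" "\<And>z. char_fun G z = of_real (exp (- (\<Sum>b\<leftarrow>bs. (z \<bullet> b)\<^sup>2)))"
    "\<And>\<beta>. \<exists>K<\<infinity>. growth_bound (\<lambda>x. ennreal (cosh_sum \<beta> x)) G K" by blast
  from ex_gaussian_line[of b] obtain L where L: "borel_prob L" "\<And>z. char_fun L z = of_real (exp (- (z \<bullet> b)\<^sup>2))"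
    "\<And>\<beta>. \<exists>K<\<infinity>. growth_bound (\<lambda>x. ennreal (cosh_sum \<beta> x)) L K" by blast
  show ?case
  proof (intro exI[of _ "conv L G"] conjI allI)
    show "borel_prob (conv L G)" by (rule borel_prob_conv[OF L(1) G(1)])
    show "char_fun (conv L G) z = of_real (exp (- (\<Sum>b\<leftarrow>b # bs. (z \<bullet> b)\<^sup>2)))" for z
      by (simp add: char_fun_conv[OF L(1) G(1)] L(2) G(2) of_real_mult[symmetric] exp_add[symmetric] del: of_real_mult)
    fix \<beta>
    obtain K K' where "K < \<infinity>" "growth_bound (\<lambda>x. ennreal (cosh_sum \<beta> x)) L K"
      "K' < \<infinity>" "growth_bound (\<lambda>x. ennreal (cosh_sum \<beta> x)) G K'" using L(3)[of \<beta>] G(3)[of \<beta>] by blast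
    then show "\<exists>K<\<infinity>. growth_bound (\<lambda>x. ennreal (cosh_sum \<beta> x)) (conv L G) K"
      by (intro exI[of _ "K * K'"]) (auto intro!: growth_bound_conv L(1) G(1) simp: ennreal_mult_less_top)
  qed
qed

lemma ex_char_fun_gauss_kernel:
  "\<exists>W :: 'v::euclidean_space measure. borel_prob W \<and> (\<forall>y. char_fun W y = of_real (gauss_kernel y))"
proof -
  obtain bs :: "'v list" where bs: "set bs = Basis" "distinct bs" using finite_distinct_list[of "Basis :: 'v set"] by auto
  have "(\<Sum>b\<leftarrow>bs. (z \<bullet> b)\<^sup>2) = (norm z)\<^sup>2" for z :: 'v
    unfolding power2_norm_eq_inner by (subst euclidean_inner) (simp add: sum_list_distinct_conv_sum_set bs power2_eq_square)
  then show ?thesis using ex_gaussian[of bs] by (auto simp: gauss_kernel_def)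
qed

lemma psd_form_eq_sum_squares:
  fixes A :: "'v::euclidean_space \<Rightarrow> 'v"
  assumes A: "linear A" "\<And>x y. A x \<bullet> y = x \<bullet> A y" "\<And>x. 0 \<le> x \<bullet> A x"
  shows "\<exists>bs. \<forall>z. z \<bullet> A z = (\<Sum>b\<leftarrow>bs. (z \<bullet> b)\<^sup>2)"
proof -
  text \<open>Gaussian elimination of one basis vector at a time.\<close>
  have "\<exists>A' bs. linear A' \<and> (\<forall>x y. A' x \<bullet> y = x \<bullet> A' y) \<and> (\<forall>x. 0 \<le> x \<bullet> A' x) \<and>
      (\<forall>z. z \<bullet> A z = z \<bullet> A' z + (\<Sum>b\<leftarrow>bs. (z \<bullet> b)\<^sup>2)) \<and> (\<forall>e\<in>S. A' e = 0)" if "finite S" for S :: "'v set"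
    using that
  proof induction
    case empty
    show ?case using A by (intro exI[of _ A] exI[of _ "[]"]) auto
  next
    case (insert e S)
    then obtain A' bs where A': "linear A'" "\<And>x y. A' x \<bullet> y = x \<bullet> A' y" "\<And>x. 0 \<le> x \<bullet> A' x"
      "\<And>z. z \<bullet> A z = z \<bullet> A' z + (\<Sum>b\<leftarrow>bs. (z \<bullet> b)\<^sup>2)" "\<And>e. e \<in> S \<Longrightarrow> A' e = 0" by blast
    interpret A': linear A' by (rule A'(1))
    have quad: "(y + t *\<^sub>R e) \<bullet> A' (y + t *\<^sub>R e) = y \<bullet> A' y + 2 * t * (y \<bullet> A' e) + t\<^sup>2 * (e \<bullet> A' e)" for y t
      using A'(2)[of e y] by (simp add: A'.add A'.scale inner_add_left inner_add_right power2_eq_square inner_commute algebra_simps)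
    show ?case
    proof (cases "e \<bullet> A' e = 0")
      case True
      have "A' e = 0"
      proof (rule ccontr)
        assume "A' e \<noteq> 0"
        then have pos: "A' e \<bullet> A' e > 0" by simp
        \<comment> \<open>Since \<open>e \<bullet> A' e = 0\<close>, the form at
          \<open>A' e + t *\<^sub>R e\<close> is affine in \<open>t\<close> with nonzero slope; this
          \<open>t\<close> makes its value -1.\<close>
        define t where "t = - (A' e \<bullet> A' (A' e) + 1) / (2 * (A' e \<bullet> A' e))"
        have "2 * t * (A' e \<bullet> A' e) = - (A' e \<bullet> A' (A' e) + 1)" using pos by (simp add: t_def)
        then show False using A'(3)[of "A' e + t *\<^sub>R e"] unfolding quad True by simp
      qed
      then show ?thesis using A' by (intro exI[of _ A'] exI[of _ bs]) auto
    next
      case False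
      define q where "q = e \<bullet> A' e"
      have q: "q > 0" using False A'(3)[of e] by (simp add: q_def)
      define b where "b = (1 / sqrt q) *\<^sub>R A' e"
      define A'' where "A'' z = A' z - (b \<bullet> z) *\<^sub>R b" for z
      have bb: "(b \<bullet> z) * (b \<bullet> w) = (A' e \<bullet> z) * (A' e \<bullet> w) / q" for z w
        using q by (simp add: b_def)
      show ?thesis
      proof (intro exI[of _ A''] exI[of _ "b # bs"] conjI allI ballI)
        show "linear A''" unfolding A''_def[abs_def]
          by (intro linear_compose_sub A'(1)) (auto intro!: linearI simp: inner_add_right algebra_simps)
        show "A'' x \<bullet> y = x \<bullet> A'' y" for x y
          using A'(2)[of x y] by (simp add: A''_def inner_diff_left inner_diff_right inner_commute mult_ac)
        show "0 \<le> x \<bullet> A'' x" for x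
        proof -
          have "x \<bullet> A'' x = x \<bullet> A' x - (A' e \<bullet> x) * (A' e \<bullet> x) / q"
            using bb[of x x] by (simp add: A''_def inner_diff_right inner_commute)
          \<comment> \<open>The reduced form at \<open>x\<close> is the old form at its minimum
            along the line through \<open>x\<close> in direction \<open>e\<close>, hence still
            nonnegative.\<close>
          also have "\<dots> = (x + (- (A' e \<bullet> x) / q) *\<^sub>R e) \<bullet> A' (x + (- (A' e \<bullet> x) / q) *\<^sub>R e)"
            unfolding quad q_def[symmetric] using q by (simp add: field_simps power2_eq_square inner_commute)
          also have "\<dots> \<ge> 0" by (rule A'(3))
          finally show ?thesis .
        qed
        show "z \<bullet> A z = z \<bullet> A'' z + (\<Sum>b\<leftarrow>b # bs. (z \<bullet> b)\<^sup>2)" for z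
          by (simp add: A'(4) A''_def inner_diff_right power2_eq_square inner_commute)
        show "A'' u = 0" if "u \<in> insert e S" for u
        proof (cases "u = e")
          case True
          have "(b \<bullet> e) *\<^sub>R b = ((A' e \<bullet> e) / q) *\<^sub>R A' e" using q by (simp add: b_def)
          also have "\<dots> = A' e" using q by (simp add: q_def inner_commute)
          finally show ?thesis by (simp add: A''_def True)
        next
          case False
          with that have "A' u = 0" using A'(5) by simp
          moreover from this have "b \<bullet> u = 0" by (simp add: b_def A'(2))
          ultimately show ?thesis by (simp add: A''_def)
        qed
      qed
    qed
  qed
  from this[OF finite_Basis] obtain A' :: "'v \<Rightarrow> 'v" and bs where A': "linear A'"
    "\<And>z. z \<bullet> A z = z \<bullet> A' z + (\<Sum>b\<leftarrow>bs. (z \<bullet> b)\<^sup>2)" "\<And>e. e \<in> Basis \<Longrightarrow> A' e = 0" by blast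
  have "A' = (\<lambda>_. 0)"
    using A'(3) by (intro linear_eq_stdbasis A'(1)) (auto simp: linear_zero)
  then show ?thesis using A'(2) by (intro exI[of _ bs]) simp
qed

section \<open>Approximants built from a finite jump measure\<close>

definition normalized :: "'v::euclidean_space measure \<Rightarrow> 'v measure" where
  "normalized \<Lambda> = (if measure \<Lambda> UNIV = 0 then return borel 0 else density \<Lambda> (\<lambda>_. ennreal (1 / measure \<Lambda> UNIV)))"

lemma
  assumes fin: "finite_measure \<Lambda>" and s: "sets \<Lambda> = sets borel"
  shows borel_prob_normalized: "borel_prob (normalized \<Lambda>)"
    and nn_integral_normalized: "f \<in> borel_measurable borel \<Longrightarrow>
      ennreal (measure \<Lambda> UNIV) * (\<integral>\<^sup>+x. f x \<partial>normalized \<Lambda>) = (\<integral>\<^sup>+x. f x \<partial>\<Lambda>)"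
    and integral_normalized: "h \<in> borel_measurable borel \<Longrightarrow>
      measure \<Lambda> UNIV * (\<integral>x. h x \<partial>normalized \<Lambda>) = (\<integral>x. (h x :: real) \<partial>\<Lambda>)"
proof -
  interpret finite_measure \<Lambda> by fact
  have sp: "space \<Lambda> = UNIV" using sets_eq_imp_space_eq[OF s] by simp
  have em: "emeasure \<Lambda> UNIV = ennreal (measure \<Lambda> UNIV)" by (simp add: emeasure_eq_measure)
  have [measurable_cong]: "sets \<Lambda> = sets borel" by (rule s)
  have pos: "measure \<Lambda> UNIV > 0" if "measure \<Lambda> UNIV \<noteq> 0" using that by (simp add: less_le)
  have null: "AE x in \<Lambda>. False" if "measure \<Lambda> UNIV = 0"
    using that em by (intro AE_I'[of UNIV]) (auto simp: null_sets_def sp s)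
  have sets_norm: "sets (normalized \<Lambda>) = sets borel" by (simp add: normalized_def s)
  have "prob_space (normalized \<Lambda>)"
  proof (cases "measure \<Lambda> UNIV = 0")
    case False
    show ?thesis
    proof
      show "emeasure (normalized \<Lambda>) (space (normalized \<Lambda>)) = 1"
        using pos[OF False] by (simp add: normalized_def False sp emeasure_density s nn_integral_const em ennreal_mult[symmetric])
    qed
  qed (simp add: normalized_def prob_space_return)
  then show "borel_prob (normalized \<Lambda>)" by (simp add: borel_prob_def sets_norm)
  show "ennreal (measure \<Lambda> UNIV) * (\<integral>\<^sup>+x. f x \<partial>normalized \<Lambda>) = (\<integral>\<^sup>+x. f x \<partial>\<Lambda>)"
    if [measurable]: "f \<in> borel_measurable borel" for f
  proof (cases "measure \<Lambda> UNIV = 0")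
    \<comment> \<open>For the zero measure the value of \<open>normalized\<close> is immaterial: it
      enters with the total mass 0 as weight.\<close>
    case True
    have "(\<integral>\<^sup>+x. f x \<partial>\<Lambda>) = (\<integral>\<^sup>+x. 0 \<partial>\<Lambda>)" using null[OF True] by (intro nn_integral_cong_AE) auto
    with True show ?thesis by simp
  next
    case False
    have "(\<integral>\<^sup>+x. f x \<partial>normalized \<Lambda>) = ennreal (1 / measure \<Lambda> UNIV) * (\<integral>\<^sup>+x. f x \<partial>\<Lambda>)"
      using False by (simp add: normalized_def nn_integral_density nn_integral_cmult del: ennreal_1)
    then have "ennreal (measure \<Lambda> UNIV) * (\<integral>\<^sup>+x. f x \<partial>normalized \<Lambda>) = ennreal (measure \<Lambda> UNIV) * ennreal (1 / measure \<Lambda> UNIV) * (\<integral>\<^sup>+x. f x \<partial>\<Lambda>)"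
      by (simp only: mult.assoc)
    also have "ennreal (measure \<Lambda> UNIV) * ennreal (1 / measure \<Lambda> UNIV) = 1"
      using pos[OF False] by (subst ennreal_mult[symmetric]) auto
    finally show ?thesis by simp
  qed
  show "measure \<Lambda> UNIV * (\<integral>x. h x \<partial>normalized \<Lambda>) = (\<integral>x. (h x :: real) \<partial>\<Lambda>)"
    if [measurable]: "h \<in> borel_measurable borel" for h
  proof (cases "measure \<Lambda> UNIV = 0")
    case True
    have "(\<integral>x. h x \<partial>\<Lambda>) = 0" using null[OF True] by (intro integral_eq_zero_AE) auto
    with True show ?thesis by simp
  next
    case False
    have "(\<integral>x. h x \<partial>normalized \<Lambda>) = (\<integral>x. (1 / measure \<Lambda> UNIV) *\<^sub>R h x \<partial>\<Lambda>)"
      unfolding normalized_def using False pos[OF False] by (simp only: if_False) (rule integral_density, auto)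
    with False show ?thesis by simp
  qed
qed

text \<open>At least \<open>n\<close>, to reach the limit; at least four times the total mass, so
  that the jump probability in \<open>cp_approx\<close> is at most 1/2; and the final 1 makes it
  positive.\<close>

definition cp_steps :: "'v::euclidean_space measure \<Rightarrow> nat \<Rightarrow> nat" where
  "cp_steps \<Lambda> n = n + nat \<lceil>4 * measure \<Lambda> UNIV\<rceil> + 1"

text \<open>The limit for large \<open>n\<close> is the symmetrization of the compound Poisson law
  with Levy measure \<open>\<Lambda>\<close>, whose exponent is minus twice the integral of
  \<open>1 - cos (z \<bullet> x)\<close>; this is the origin of the factor 2.\<close>

definition cp_approx :: "'v::euclidean_space measure \<Rightarrow> nat \<Rightarrow> 'v measure" where
  "cp_approx \<Lambda> n = cpow (mixsym (2 * measure \<Lambda> UNIV / real (cp_steps \<Lambda> n)) (normalized \<Lambda>)) (cp_steps \<Lambda> n)"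

lemma cp_steps_bounds:
  "real (cp_steps \<Lambda> n) > 0" "0 \<le> 2 * measure \<Lambda> UNIV / real (cp_steps \<Lambda> n)" "2 * measure \<Lambda> UNIV / real (cp_steps \<Lambda> n) \<le> 1/2"
  "real n \<le> real (cp_steps \<Lambda> n)"
proof -
  show 1: "real (cp_steps \<Lambda> n) > 0" unfolding cp_steps_def by (simp only: of_nat_0_less_iff)
  then show "0 \<le> 2 * measure \<Lambda> UNIV / real (cp_steps \<Lambda> n)" by simp
  have "4 * measure \<Lambda> UNIV \<le> real (cp_steps \<Lambda> n)" unfolding cp_steps_def by simp linarith
  with 1 show "2 * measure \<Lambda> UNIV / real (cp_steps \<Lambda> n) \<le> 1/2" by (simp add: field_simps)
  have "n \<le> cp_steps \<Lambda> n" by (simp only: cp_steps_def add.assoc le_add1)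
  then show "real n \<le> real (cp_steps \<Lambda> n)" by (simp only: of_nat_le_iff)
qed

lemma one_plus_div_power_le_exp: "k > 0 \<Longrightarrow> 0 \<le> x \<Longrightarrow> (1 + x / real k) ^ k \<le> exp x"
proof -
  assume k: "k > 0" "0 \<le> x"
  have "(1 + x / real k) ^ k \<le> exp (x / real k) ^ k" using k by (intro power_mono exp_ge_add_one_self) auto
  also have "\<dots> = exp x" using k by (simp add: exp_of_nat_mult[symmetric])
  finally show ?thesis .
qed

context
  fixes \<Lambda> :: "'v::euclidean_space measure"
  assumes fin: "finite_measure \<Lambda>" and sets_\<Lambda>: "sets \<Lambda> = sets borel"
begin

interpretation finite_measure \<Lambda> by (rule fin)

lemma borel_prob_cp_approx: "borel_prob (cp_approx \<Lambda> n)"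
  unfolding cp_approx_def by (intro borel_prob_cpow borel_prob_mixsym borel_prob_normalized fin sets_\<Lambda>)

lemma char_fun_cp_approx:
  "char_fun (cp_approx \<Lambda> n) z = of_real ((1 - 2 * (\<integral>x. 1 - cos (z \<bullet> x) \<partial>\<Lambda>) / real (cp_steps \<Lambda> n)) ^ cp_steps \<Lambda> n)"
proof -
  let ?k = "cp_steps \<Lambda> n"
  let ?p = "2 * measure \<Lambda> UNIV / real ?k"
  note N = borel_prob_normalized[OF fin sets_\<Lambda>]
  have p: "0 \<le> ?p" "?p \<le> 1" using cp_steps_bounds[where \<Lambda>=\<Lambda> and n=n] by auto
  have "?p * (\<integral>x. 1 - cos (z \<bullet> x) \<partial>normalized \<Lambda>) = 2 * (measure \<Lambda> UNIV * (\<integral>x. 1 - cos (z \<bullet> x) \<partial>normalized \<Lambda>)) / real ?k"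
    by simp
  also have "measure \<Lambda> UNIV * (\<integral>x. 1 - cos (z \<bullet> x) \<partial>normalized \<Lambda>) = (\<integral>x. 1 - cos (z \<bullet> x) \<partial>\<Lambda>)"
    by (rule integral_normalized[OF fin sets_\<Lambda>]) measurable
  finally have eq: "?p * (\<integral>x. 1 - cos (z \<bullet> x) \<partial>normalized \<Lambda>) = 2 * (\<integral>x. 1 - cos (z \<bullet> x) \<partial>\<Lambda>) / real ?k" .
  have "char_fun (cp_approx \<Lambda> n) z = of_real (1 - ?p * (\<integral>x. 1 - cos (z \<bullet> x) \<partial>normalized \<Lambda>)) ^ ?k"
    unfolding cp_approx_def char_fun_cpow[OF borel_prob_mixsym[OF N]] char_fun_mixsym[OF N p] ..
  then show ?thesis unfolding eq by (simp only: of_real_power)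
qed

text \<open>One factor multiplies \<open>f\<close> by at most \<open>1 + 2 * I / k\<close>, so all
  \<open>k\<close> factors together by at most \<open>exp (2 * I)\<close>, whatever \<open>n\<close>
  is.\<close>

lemma growth_bound_cp_approx_aux:
  assumes [measurable]: "f \<in> borel_measurable borel" "F \<in> borel_measurable borel"
    and K: "growth_bound f (mixsym (2 * measure \<Lambda> UNIV / real (cp_steps \<Lambda> n)) (normalized \<Lambda>))
      (1 + ennreal (2 * measure \<Lambda> UNIV / real (cp_steps \<Lambda> n)) * (\<integral>\<^sup>+x. F x \<partial>normalized \<Lambda>))"
    and I: "(\<integral>\<^sup>+x. F x \<partial>\<Lambda>) \<le> ennreal I" "I \<ge> 0"
  shows "growth_bound f (cp_approx \<Lambda> n) (ennreal (exp (2 * I)))"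
proof -
  let ?k = "cp_steps \<Lambda> n"
  note k = cp_steps_bounds[where \<Lambda>=\<Lambda> and n=n]
  have "ennreal (2 * measure \<Lambda> UNIV / real ?k) = ennreal (2 / real ?k) * ennreal (measure \<Lambda> UNIV)"
    using k by (subst ennreal_mult[symmetric]) auto
  then have "ennreal (2 * measure \<Lambda> UNIV / real ?k) * (\<integral>\<^sup>+x. F x \<partial>normalized \<Lambda>)
      = ennreal (2 / real ?k) * (ennreal (measure \<Lambda> UNIV) * (\<integral>\<^sup>+x. F x \<partial>normalized \<Lambda>))"
    by (simp only: mult.assoc)
  also have "\<dots> \<le> ennreal (2 / real ?k) * ennreal I"
    unfolding nn_integral_normalized[OF fin sets_\<Lambda> assms(2)] by (intro mult_left_mono I) auto
  also have "\<dots> = ennreal (2 * I / real ?k)"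
    using k I by (subst ennreal_mult[symmetric]) auto
  finally have "1 + ennreal (2 * measure \<Lambda> UNIV / real ?k) * (\<integral>\<^sup>+x. F x \<partial>normalized \<Lambda>) \<le> 1 + ennreal (2 * I / real ?k)"
    by (rule add_left_mono)
  also have "\<dots> = ennreal (1 + 2 * I / real ?k)" using I k by (subst ennreal_plus) auto
  finally have "growth_bound f (mixsym (2 * measure \<Lambda> UNIV / real ?k) (normalized \<Lambda>)) (ennreal (1 + 2 * I / real ?k))"
    by (rule growth_bound_mono[OF K])
  then have "growth_bound f (cp_approx \<Lambda> n) (ennreal (1 + 2 * I / real ?k) ^ ?k)"
    unfolding cp_approx_def
    by (intro growth_bound_cpow borel_prob_mixsym borel_prob_normalized fin sets_\<Lambda> assms)
  moreover have "ennreal (1 + 2 * I / real ?k) ^ ?k \<le> ennreal (exp (2 * I))"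
    using I k one_plus_div_power_le_exp[of ?k "2 * I"] by (subst ennreal_power) (auto intro!: ennreal_leI)
  ultimately show ?thesis by (rule growth_bound_mono)
qed

text \<open>The weight \<open>1 - p\<close> of no jump and the constant part of cosh recombine to 1,
  and only \<open>cosh - 1\<close> remains under the integral. The bound thus stays under control
  even when the total mass of \<open>\<Lambda>\<close> grows with the inclusion of smaller and
  smaller jumps.\<close>

lemma growth_bound_cosh_cp_approx:
  assumes I: "(\<integral>\<^sup>+x. ennreal (cosh (\<beta> * norm x) - 1) \<partial>\<Lambda>) \<le> ennreal I" "I \<ge> 0"
  shows "growth_bound (\<lambda>x. ennreal (cosh_sum \<beta> x)) (cp_approx \<Lambda> n) (ennreal (exp (2 * I)))"
proof (rule growth_bound_cp_approx_aux[OF _ _ _ I])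
  let ?p = "2 * measure \<Lambda> UNIV / real (cp_steps \<Lambda> n)"
  note p = cp_steps_bounds[where \<Lambda>=\<Lambda> and n=n]
  note N = borel_prob_normalized[OF fin sets_\<Lambda>]
  interpret N: prob_space "normalized \<Lambda>" by (rule borel_probD[OF N])
  have [measurable_cong]: "sets (normalized \<Lambda>) = sets borel" using N by (simp add: borel_prob_def)
  have "(\<integral>\<^sup>+z. ennreal (cosh (\<beta> * norm z)) \<partial>normalized \<Lambda>) = (\<integral>\<^sup>+z. 1 + ennreal (cosh (\<beta> * norm z) - 1) \<partial>normalized \<Lambda>)"
    by (intro nn_integral_cong) (auto simp: ennreal_plus[symmetric] cosh_real_ge_1 simp del: ennreal_plus ennreal_1 simp flip: ennreal_1)
  also have "\<dots> = 1 + (\<integral>\<^sup>+z. ennreal (cosh (\<beta> * norm z) - 1) \<partial>normalized \<Lambda>)"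
    by (subst nn_integral_add) (auto simp: N.emeasure_space_1)
  finally have "ennreal (1 - ?p) + ennreal ?p * (\<integral>\<^sup>+z. ennreal (cosh (\<beta> * norm z)) \<partial>normalized \<Lambda>)
     = (ennreal (1 - ?p) + ennreal ?p) + ennreal ?p * (\<integral>\<^sup>+z. ennreal (cosh (\<beta> * norm z) - 1) \<partial>normalized \<Lambda>)"
    by (simp add: distrib_left add.assoc)
  also have "ennreal (1 - ?p) + ennreal ?p = 1" using p by (subst ennreal_plus[symmetric]) auto
  finally show "growth_bound (\<lambda>x. ennreal (cosh_sum \<beta> x)) (mixsym ?p (normalized \<Lambda>))
     (1 + ennreal ?p * (\<integral>\<^sup>+z. ennreal (cosh (\<beta> * norm z) - 1) \<partial>normalized \<Lambda>))"
    using growth_bound_cosh_mixsym[OF N, of ?p \<beta>] p by simp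
qed measurable

text \<open>The counterpart for large jumps: \<open>1 - p\<close> is simply bounded by 1, and each
  jump \<open>z\<close>, of either sign, multiplies \<open>f\<close> by at most
  \<open>F z\<close>.\<close>

lemma growth_bound_submult_cp_approx:
  assumes [measurable]: "f \<in> borel_measurable borel" "F \<in> borel_measurable borel"
    and F: "\<And>z x. f (z + x) \<le> F z * f x" "\<And>z x. f (- z + x) \<le> F z * f x"
    and I: "(\<integral>\<^sup>+x. F x \<partial>\<Lambda>) \<le> ennreal I" "I \<ge> 0"
  shows "growth_bound f (cp_approx \<Lambda> n) (ennreal (exp (2 * I)))"
proof (rule growth_bound_cp_approx_aux[OF assms(1,2) _ I])
  let ?p = "2 * measure \<Lambda> UNIV / real (cp_steps \<Lambda> n)"
  note p = cp_steps_bounds[where \<Lambda>=\<Lambda> and n=n]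
  note N = borel_prob_normalized[OF fin sets_\<Lambda>]
  have [measurable_cong]: "sets (normalized \<Lambda>) = sets borel" using N by (simp add: borel_prob_def)
  show "growth_bound f (mixsym ?p (normalized \<Lambda>)) (1 + ennreal ?p * (\<integral>\<^sup>+z. F z \<partial>normalized \<Lambda>))"
    unfolding growth_bound_def
  proof
    fix x
    have "(\<integral>\<^sup>+z. f (z + x) \<partial>mixsym ?p (normalized \<Lambda>)) = ennreal (1 - ?p) * f (0 + x)
        + ennreal (?p / 2) * (\<integral>\<^sup>+z. f (z + x) + f (- z + x) \<partial>normalized \<Lambda>)"
      using p by (intro nn_integral_mixsym[OF N]) auto
    also have "\<dots> \<le> 1 * f x + ennreal (?p / 2) * (\<integral>\<^sup>+z. F z * (2 * f x) \<partial>normalized \<Lambda>)"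
    proof (intro add_mono mult_mono mult_left_mono nn_integral_mono)
      show "ennreal (1 - ?p) \<le> 1" using p ennreal_leI[of "1 - ?p" 1] by simp
      show "f (z + x) + f (- z + x) \<le> F z * (2 * f x)" for z
        using add_mono[OF F[of z x]] by (simp add: mult_2 distrib_left)
    qed auto
    also have "(\<integral>\<^sup>+z. F z * (2 * f x) \<partial>normalized \<Lambda>) = (\<integral>\<^sup>+z. F z \<partial>normalized \<Lambda>) * (2 * f x)"
      by (rule nn_integral_multc) measurable
    also have "ennreal (?p / 2) * ((\<integral>\<^sup>+z. F z \<partial>normalized \<Lambda>) * (2 * f x)) = ennreal ?p * (\<integral>\<^sup>+z. F z \<partial>normalized \<Lambda>) * f x"
    proof -
      have "ennreal (?p / 2) * 2 = ennreal ?p"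
        using p by (metis ennreal_mult'' ennreal_numeral nonzero_eq_divide_eq zero_le_numeral zero_neq_numeral)
      then show ?thesis by (metis mult.assoc mult.commute)
    qed
    finally show "(\<integral>\<^sup>+z. f (z + x) \<partial>mixsym ?p (normalized \<Lambda>)) \<le> (1 + ennreal ?p * (\<integral>\<^sup>+z. F z \<partial>normalized \<Lambda>)) * f x"
      by (simp add: distrib_right)
  qed
qed

text \<open>Only outcomes with exactly one jump are kept. Their weight is the mass of
  \<open>\<Lambda>\<close> times \<open>(1 - p) ^ (k - 1)\<close>, and the latter is at least
  \<open>exp (- (4 * measure \<Lambda> UNIV))\<close>, so the bound is uniform in \<open>n\<close>.
  Evenness of \<open>h\<close> merges the two signs into the factor 2.\<close>

lemma cp_approx_ge:
  assumes [measurable]: "h \<in> borel_measurable borel" and even: "\<And>x. h (- x) = h x"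
  shows "ennreal (2 * exp (- (4 * measure \<Lambda> UNIV))) * (\<integral>\<^sup>+x. h x \<partial>\<Lambda>) \<le> (\<integral>\<^sup>+x. h x \<partial>cp_approx \<Lambda> n)"
proof -
  let ?k = "cp_steps \<Lambda> n"
  let ?p = "2 * measure \<Lambda> UNIV / real ?k"
  note p = cp_steps_bounds[where \<Lambda>=\<Lambda> and n=n]
  note N = borel_prob_normalized[OF fin sets_\<Lambda>]
  have [measurable_cong]: "sets (normalized \<Lambda>) = sets borel" using N by (simp add: borel_prob_def)
  \<comment> \<open>This uses that the jump probability is at most 1/2, the inequality being
    equivalent to \<open>?p * (1 - 2 * ?p) \<ge> 0\<close> once the exponential is replaced by
    \<open>1 / (1 + 2 * ?p)\<close>.\<close>
  have "exp (- (2 * ?p)) \<le> 1 - ?p"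
  proof -
    have "exp (- (2 * ?p)) \<le> 1 / (1 + 2 * ?p)"
    proof -
      have "0 < 1 + 2 * ?p" using p by linarith
      from le_imp_inverse_le[OF exp_ge_add_one_self[of "2 * ?p"] this]
      show ?thesis by (simp only: exp_minus inverse_eq_divide)
    qed
    also have "\<dots> \<le> 1 - ?p"
    proof -
      have "?p * (1 - 2 * ?p) \<ge> 0" using p by (intro mult_nonneg_nonneg) auto
      then have "1 \<le> (1 - ?p) * (1 + 2 * ?p)" by (simp add: algebra_simps)
      moreover have "0 < 1 + 2 * ?p" using p by linarith
      ultimately show ?thesis by (simp only: pos_divide_le_eq)
    qed
    finally show ?thesis .
  qed
  then have "exp (- (2 * ?p)) ^ (?k - 1) \<le> (1 - ?p) ^ (?k - 1)" by (intro power_mono) auto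
  moreover have "exp (- (4 * measure \<Lambda> UNIV)) \<le> exp (- (2 * ?p)) ^ (?k - 1)"
  proof -
    have "real (?k - 1) * (2 * ?p) \<le> real ?k * (2 * ?p)" using p by (intro mult_right_mono) auto
    also have "\<dots> = 4 * measure \<Lambda> UNIV" using p by simp
    finally show ?thesis by (simp add: exp_of_nat_mult[symmetric])
  qed
  ultimately have lower: "exp (- (4 * measure \<Lambda> UNIV)) \<le> (1 - ?p) ^ (?k - 1)" by linarith
  have "ennreal (2 * exp (- (4 * measure \<Lambda> UNIV))) * (\<integral>\<^sup>+x. h x \<partial>\<Lambda>)
      = ennreal (2 * exp (- (4 * measure \<Lambda> UNIV))) * (ennreal (measure \<Lambda> UNIV) * (\<integral>\<^sup>+x. h x \<partial>normalized \<Lambda>))"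
    by (simp only: nn_integral_normalized[OF fin sets_\<Lambda> assms(1)])
  also have "\<dots> = ennreal (measure \<Lambda> UNIV * exp (- (4 * measure \<Lambda> UNIV))) * (2 * (\<integral>\<^sup>+x. h x \<partial>normalized \<Lambda>))"
    by (simp add: ennreal_mult mult_ac)
  also have "\<dots> \<le> ennreal (measure \<Lambda> UNIV * (1 - ?p) ^ (?k - 1)) * (2 * (\<integral>\<^sup>+x. h x \<partial>normalized \<Lambda>))"
    by (intro mult_right_mono ennreal_leI mult_left_mono lower) auto
  also have "2 * (\<integral>\<^sup>+x. h x \<partial>normalized \<Lambda>) = (\<integral>\<^sup>+x. h x + h (- x) \<partial>normalized \<Lambda>)"
    by (simp add: even mult_2[symmetric] nn_integral_cmult)
  also have "measure \<Lambda> UNIV * (1 - ?p) ^ (?k - 1) = real ?k * (?p * (1 - ?p) ^ (?k - 1)) / 2"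
    using p by simp
  also have "ennreal (real ?k * (?p * (1 - ?p) ^ (?k - 1)) / 2) * (\<integral>\<^sup>+x. h x + h (- x) \<partial>normalized \<Lambda>) \<le> (\<integral>\<^sup>+x. h x \<partial>cp_approx \<Lambda> n)"
    unfolding cp_approx_def using p by (intro nn_integral_cpow_mixsym_ge(2)[OF N]) auto
  finally show ?thesis .
qed

end

text \<open>Numerator and exponent vary together. Powers with bases in the unit interval satisfy
  |x^k - y^k| \<le> k |x - y|, which reduces the claim to the constant numerator
  \<open>a'\<close>.\<close>

lemma power_one_minus_div_tendsto_exp:
  fixes a :: "nat \<Rightarrow> real" and k :: "nat \<Rightarrow> nat"
  assumes a: "a \<longlonglongrightarrow> a'" and k: "filterlim k at_top sequentially" and bd: "\<And>n. 0 \<le> a n" "\<And>n. a n \<le> real (k n)"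
  shows "(\<lambda>n. (1 - a n / real (k n)) ^ k n) \<longlonglongrightarrow> exp (- a')"
proof -
  have a'0: "a' \<ge> 0" using a bd(1) by (intro LIMSEQ_le_const[OF a]) auto
  have "(\<lambda>m. (1 + (- a') / real m) ^ m) \<longlonglongrightarrow> exp (- a')" by (rule tendsto_exp_limit_sequentially)
  then have lim: "(\<lambda>n. (1 - a' / real (k n)) ^ k n) \<longlonglongrightarrow> exp (- a')"
    using filterlim_compose[OF _ k, of "\<lambda>m. (1 + (- a') / real m) ^ m"] by simp
  have "\<forall>\<^sub>F m in sequentially. real m > 0 \<and> a' \<le> real m"
    using eventually_ge_at_top[of "nat \<lceil>a'\<rceil> + 1"] by eventually_elim (auto; linarith)
  then have "\<forall>\<^sub>F n in sequentially. real (k n) > 0 \<and> a' \<le> real (k n)"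
    using k by (rule eventually_compose_filterlim)
  then have "\<forall>\<^sub>F n in sequentially. norm ((1 - a n / real (k n)) ^ k n - (1 - a' / real (k n)) ^ k n) \<le> \<bar>a n - a'\<bar>"
  proof eventually_elim
    case (elim n)
    have 1: "norm (1 - a n / real (k n)) \<le> 1" "norm (1 - a' / real (k n)) \<le> 1"
      using elim bd[of n] a'0 by (auto simp: field_simps abs_le_iff)
    have "norm ((1 - a n / real (k n)) ^ k n - (1 - a' / real (k n)) ^ k n) \<le> real (k n) * norm ((1 - a n / real (k n)) - (1 - a' / real (k n)))"
      by (rule norm_power_diff[OF 1])
    also have "(1 - a n / real (k n)) - (1 - a' / real (k n)) = (a' - a n) / real (k n)" by (simp add: diff_divide_distrib)
    also have "real (k n) * norm ((a' - a n) / real (k n)) = \<bar>a n - a'\<bar>" using elim by (simp add: abs_minus_commute)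
    finally show ?case .
  qed
  moreover have "(\<lambda>n. \<bar>a n - a'\<bar>) \<longlonglongrightarrow> 0" using a by (simp add: LIM_zero tendsto_rabs_zero)
  ultimately have "(\<lambda>n. (1 - a n / real (k n)) ^ k n - (1 - a' / real (k n)) ^ k n) \<longlonglongrightarrow> 0"
    by (rule Lim_null_comparison)
  from tendsto_add[OF this lim] show ?thesis by simp
qed

section \<open>Submultiplicative moments of infinitely divisible distributions\<close>

lemma ex_finite_value:
  assumes "(\<integral>\<^sup>+x. f x \<partial>M) < \<infinity>" "emeasure M (space M) \<noteq> 0"
  shows "\<exists>x. f x < \<infinity>"
proof (rule ccontr)
  assume "\<not> (\<exists>x. f x < \<infinity>)"
  then have "f x = \<infinity>" for x by (simp add: not_less top_unique)
  then have "(\<integral>\<^sup>+x. f x \<partial>M) = \<infinity>" using assms(2) by (simp add: ennreal_top_mult)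
  with assms(1) show False by simp
qed

text \<open>The radial profile of a weight. Monotonicity lets the triangle inequality carry
  submultiplicativity over to \<open>\<phi> (norm x)\<close>, and the lower bound 1 permits division
  by the weight.\<close>

locale submult_weight =
  fixes \<phi> :: "real \<Rightarrow> real" and c :: real
  assumes mono_\<phi>: "mono \<phi>" and \<phi>_ge_1: "1 \<le> \<phi> r" and c_pos: "c > 0"
    and submult: "0 \<le> r \<Longrightarrow> 0 \<le> s \<Longrightarrow> \<phi> (r + s) \<le> c * \<phi> r * \<phi> s"
begin

lemma \<phi>_pos: "\<phi> r > 0"
  using \<phi>_ge_1[of r] by linarith

lemma \<phi>_measurable [measurable]: "\<phi> \<in> borel_measurable borel"
  by (rule borel_measurable_mono[OF mono_\<phi>])

text \<open>Unit steps in \<open>submult\<close> give geometric growth at the integers, and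
  monotonicity fills the gaps. The \<open>max 2\<close> in the ratio makes its logarithm
  positive.\<close>

lemma exp_bound: "\<exists>a b. a > 0 \<and> b > 0 \<and> (\<forall>r\<ge>0. \<phi> r \<le> a * exp (b * r))"
proof -
  define q where "q = max 2 (c * \<phi> 1)"
  have q: "q \<ge> 2" "c * \<phi> 1 \<le> q" by (auto simp: q_def)
  have n: "\<phi> (real n) \<le> \<phi> 0 * q ^ n" for n
  proof (induction n)
    case (Suc n)
    have "\<phi> (real (Suc n)) \<le> c * \<phi> 1 * \<phi> (real n)" using submult[of 1 "real n"] by (simp add: add.commute)
    also have "\<dots> \<le> q * \<phi> (real n)" using q(2) \<phi>_pos[of "real n"] by (intro mult_right_mono) auto
    also have "\<dots> \<le> q * (\<phi> 0 * q ^ n)" using q Suc.IH by (intro mult_left_mono) auto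
    finally show ?case by (simp add: mult_ac)
  qed simp
  have "\<phi> r \<le> (\<phi> 0 * q) * exp (ln q * r)" if r: "r \<ge> 0" for r
  proof -
    define m where "m = nat \<lceil>r\<rceil>"
    have m: "r \<le> real m" "real m \<le> r + 1" using r by (auto simp: m_def)
    have "\<phi> r \<le> \<phi> (real m)" using m mono_\<phi> by (auto dest: monoD)
    also have "\<dots> \<le> \<phi> 0 * q ^ m" by (rule n)
    also have "q ^ m = exp (ln q * real m)" using q by (simp add: exp_of_nat2_mult)
    also have "\<dots> \<le> exp (ln q * (r + 1))" using m q by (intro exp_le_cancel_iff[THEN iffD2] mult_left_mono) auto
    also have "exp (ln q * (r + 1)) = q * exp (ln q * r)" using q by (simp add: ring_distribs exp_add)
    finally show ?thesis using \<phi>_pos[of 0] by (simp add: mult_ac)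
  qed
  moreover have "\<phi> 0 * q > 0" "ln q > 0" using \<phi>_pos[of 0] q by auto
  ultimately show ?thesis by blast
qed

definition wt :: "'v::euclidean_space \<Rightarrow> ennreal" where
  "wt x = ennreal (\<phi> (norm x))"

lemma wt_measurable [measurable]: "wt \<in> borel_measurable borel"
  unfolding wt_def[abs_def] by measurable

lemma wt_minus [simp]: "wt (- x) = wt x"
  by (simp add: wt_def)

lemma wt_bounds: "1 \<le> wt x" "wt x < \<infinity>" "wt x \<noteq> 0"
  using \<phi>_ge_1[of "norm x"] ennreal_leI[OF \<phi>_ge_1[of "norm x"]] \<phi>_pos[of "norm x"] by (auto simp: wt_def)

lemma wt_add: "wt (x + y) \<le> ennreal c * wt x * wt y"
proof -
  have "\<phi> (norm (x + y)) \<le> \<phi> (norm x + norm y)" using mono_\<phi> norm_triangle_ineq by (auto dest: monoD)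
  also have "\<dots> \<le> c * \<phi> (norm x) * \<phi> (norm y)" by (rule submult) auto
  finally show ?thesis
    using c_pos \<phi>_pos[of "norm x"] \<phi>_pos[of "norm y"] by (simp add: wt_def ennreal_mult[symmetric] ennreal_leI)
qed

lemma wt_le_shift: "wt x \<le> ennreal c * wt y * wt (x + y)"
  using wt_add[of "x + y" "- y"] by (simp add: mult_ac)

lemma wt_integral_conv_le:
  assumes PQ: "borel_prob P" "borel_prob Q"
  shows "(\<integral>\<^sup>+x. wt x \<partial>conv P Q) \<le> ennreal c * (\<integral>\<^sup>+x. wt x \<partial>P) * (\<integral>\<^sup>+x. wt x \<partial>Q)"
proof -
  have [measurable_cong]: "sets P = sets borel" "sets Q = sets borel" using PQ by (auto simp: borel_prob_def)
  have "(\<integral>\<^sup>+x. wt x \<partial>conv P Q) = (\<integral>\<^sup>+x. \<integral>\<^sup>+y. wt (x + y) \<partial>Q \<partial>P)" by (rule nn_integral_conv[OF PQ]) measurable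
  also have "\<dots> \<le> (\<integral>\<^sup>+x. \<integral>\<^sup>+y. (ennreal c * wt x) * wt y \<partial>Q \<partial>P)" by (intro nn_integral_mono wt_add)
  also have "\<dots> = ennreal c * (\<integral>\<^sup>+x. wt x \<partial>P) * (\<integral>\<^sup>+x. wt x \<partial>Q)"
    by (simp add: nn_integral_cmult nn_integral_multc)
  finally show ?thesis .
qed

lemma wt_integral_finite_if_shift:
  assumes P: "sets P = sets borel" and fin: "(\<integral>\<^sup>+x. wt (x + y) \<partial>P) < \<infinity>"
  shows "(\<integral>\<^sup>+x. wt x \<partial>P) < \<infinity>"
proof -
  have [measurable_cong]: "sets P = sets borel" by (rule P)
  have "(\<integral>\<^sup>+x. wt x \<partial>P) \<le> (\<integral>\<^sup>+x. ennreal c * wt y * wt (x + y) \<partial>P)" by (intro nn_integral_mono wt_le_shift)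
  also have "\<dots> = ennreal c * wt y * (\<integral>\<^sup>+x. wt (x + y) \<partial>P)" by (rule nn_integral_cmult) measurable
  also have "\<dots> < \<infinity>" using fin wt_bounds(2)[of y] by (simp add: ennreal_mult_less_top)
  finally show ?thesis .
qed

text \<open>A finite moment of the symmetrized law gives, by Fubini, a finite moment of the
  reflected law shifted by some fixed point, and a fixed shift changes the weight by at most a
  constant factor. The converse is submultiplicativity.\<close>

lemma wt_integral_symmetrization:
  assumes P: "borel_prob P"
  shows "(\<integral>\<^sup>+x. wt x \<partial>conv P (distr P borel uminus)) < \<infinity> \<longleftrightarrow> (\<integral>\<^sup>+x. wt x \<partial>P) < \<infinity>"
proof -
  have [measurable_cong]: "sets P = sets borel" using P by (auto simp: borel_prob_def)
  interpret P: prob_space P by (rule borel_probD[OF P])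
  have Q: "borel_prob (distr P borel uminus)" by (rule borel_prob_distr[OF P]) measurable
  have PQ: "(\<integral>\<^sup>+x. wt x \<partial>distr P borel uminus) = (\<integral>\<^sup>+x. wt x \<partial>P)"
    by (subst nn_integral_distr) auto
  show ?thesis
  proof
    assume "(\<integral>\<^sup>+x. wt x \<partial>conv P (distr P borel uminus)) < \<infinity>"
    then have "(\<integral>\<^sup>+x. \<integral>\<^sup>+y. wt (x + y) \<partial>distr P borel uminus \<partial>P) < \<infinity>"
      by (subst (asm) nn_integral_conv[OF P Q]) auto
    then obtain x where "(\<integral>\<^sup>+y. wt (y + x) \<partial>distr P borel uminus) < \<infinity>"
      using ex_finite_value[of P] by (auto simp: P.emeasure_space_1 add.commute)
    then show "(\<integral>\<^sup>+x. wt x \<partial>P) < \<infinity>"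
      unfolding PQ[symmetric] by (intro wt_integral_finite_if_shift) auto
  next
    assume "(\<integral>\<^sup>+x. wt x \<partial>P) < \<infinity>"
    then show "(\<integral>\<^sup>+x. wt x \<partial>conv P (distr P borel uminus)) < \<infinity>"
      using wt_integral_conv_le[OF P Q] unfolding PQ by (simp add: ennreal_mult_less_top le_less_trans)
  qed
qed

text \<open>The weight grows at most exponentially, and b |v| - |v|^2 is at most (b^2 - |v|^2) / 2,
  so the integrand is dominated by a product of one-dimensional Gaussian integrands.\<close>

lemma wt_gauss_integral_finite: "(\<integral>\<^sup>+v. wt v * ennreal (gauss_kernel (v::'v::euclidean_space)) \<partial>lborel) < \<infinity>"
proof -
  obtain a b where ab: "a > 0" "b > 0" "\<And>r. r \<ge> 0 \<Longrightarrow> \<phi> r \<le> a * exp (b * r)" using exp_bound by blast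
  have bound: "\<phi> (norm v) * gauss_kernel v \<le> a * exp (b\<^sup>2 / 2) * (\<Prod>i\<in>Basis. exp (- (v \<bullet> i)\<^sup>2 / 2))" for v :: 'v
  proof -
    have "\<phi> (norm v) * gauss_kernel v \<le> (a * exp (b * norm v)) * gauss_kernel v"
      by (intro mult_right_mono ab) auto
    also have "\<dots> = a * exp (b * norm v - (norm v)\<^sup>2)" by (simp add: gauss_kernel_def exp_diff exp_minus field_simps)
    also have "\<dots> \<le> a * exp (b\<^sup>2 / 2 - (norm v)\<^sup>2 / 2)"
    proof -
      have "0 \<le> (b - norm v)\<^sup>2" by simp
      then have "b * norm v - (norm v)\<^sup>2 \<le> b\<^sup>2 / 2 - (norm v)\<^sup>2 / 2" by (simp add: power2_eq_square algebra_simps)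
      then show ?thesis using ab by simp
    qed
    also have "(norm v)\<^sup>2 / 2 = (\<Sum>i\<in>Basis. (v \<bullet> i)\<^sup>2 / 2)"
      unfolding power2_norm_eq_inner by (subst euclidean_inner) (simp add: power2_eq_square sum_divide_distrib)
    also have "exp (b\<^sup>2 / 2 - (\<Sum>i\<in>Basis. (v \<bullet> i)\<^sup>2 / 2)) = exp (b\<^sup>2 / 2) * (\<Prod>i\<in>Basis. exp (- (v \<bullet> i)\<^sup>2 / 2))"
    proof -
      have "b\<^sup>2 / 2 - (\<Sum>i\<in>Basis. (v \<bullet> i)\<^sup>2 / 2) = b\<^sup>2 / 2 + (\<Sum>i\<in>Basis. - (v \<bullet> i)\<^sup>2 / 2)"
        by (simp add: sum_negf)
      then show ?thesis by (simp only: exp_add exp_sum[OF finite_Basis])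
    qed
    finally show ?thesis by simp
  qed
  have line: "(\<integral>\<^sup>+t. ennreal (exp (- t\<^sup>2 / 2)) \<partial>lborel) < \<infinity>"
  proof -
    interpret prob_space "density lborel std_normal_density"
      by (rule prob_space_normal_density) simp
    have 1: "(\<integral>\<^sup>+t. ennreal (std_normal_density t) \<partial>lborel) = 1"
      using emeasure_space_1 by (subst (asm) emeasure_density) auto
    have "(\<integral>\<^sup>+t. ennreal (exp (- t\<^sup>2 / 2)) \<partial>lborel) = (\<integral>\<^sup>+t. ennreal (sqrt (2 * pi)) * ennreal (std_normal_density t) \<partial>lborel)"
      by (intro nn_integral_cong) (simp add: std_normal_density_def ennreal_mult[symmetric])
    also have "\<dots> = ennreal (sqrt (2 * pi))" by (subst nn_integral_cmult) (auto simp: 1)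
    finally show ?thesis by simp
  qed
  have "(\<integral>\<^sup>+(v::'v). wt v * ennreal (gauss_kernel v) \<partial>lborel) \<le> (\<integral>\<^sup>+(v::'v). ennreal (a * exp (b\<^sup>2 / 2)) * (\<Prod>i\<in>Basis. ennreal (exp (- (v \<bullet> i)\<^sup>2 / 2))) \<partial>lborel)"
  proof (intro nn_integral_mono)
    fix v :: 'v
    have "wt v * ennreal (gauss_kernel v) = ennreal (\<phi> (norm v) * gauss_kernel v)"
      using \<phi>_pos[of "norm v"] by (simp add: wt_def ennreal_mult)
    also have "\<dots> \<le> ennreal (a * exp (b\<^sup>2 / 2) * (\<Prod>i\<in>Basis. exp (- (v \<bullet> i)\<^sup>2 / 2)))" by (rule ennreal_leI[OF bound])
    also have "\<dots> = ennreal (a * exp (b\<^sup>2 / 2)) * (\<Prod>i\<in>Basis. ennreal (exp (- (v \<bullet> i)\<^sup>2 / 2)))"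
    proof -
      have "(\<Prod>i\<in>Basis. ennreal (exp (- (v \<bullet> i)\<^sup>2 / 2))) = ennreal (\<Prod>i\<in>Basis. exp (- (v \<bullet> i)\<^sup>2 / 2))"
        by (rule prod_ennreal) simp
      then show ?thesis using ab by (simp only:) (rule ennreal_mult, auto intro!: prod_nonneg)
    qed
    finally show "wt v * ennreal (gauss_kernel v) \<le> ennreal (a * exp (b\<^sup>2 / 2)) * (\<Prod>i\<in>Basis. ennreal (exp (- (v \<bullet> i)\<^sup>2 / 2)))" .
  qed
  also have "\<dots> = ennreal (a * exp (b\<^sup>2 / 2)) * (\<integral>\<^sup>+(v::'v). (\<Prod>i\<in>Basis. ennreal (exp (- (v \<bullet> i)\<^sup>2 / 2))) \<partial>lborel)"
    by (rule nn_integral_cmult) measurable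
  also have "(\<integral>\<^sup>+(v::'v). (\<Prod>i\<in>Basis. ennreal (exp (- (v \<bullet> i)\<^sup>2 / 2))) \<partial>lborel) = (\<Prod>i\<in>(Basis::'v set). \<integral>\<^sup>+t. ennreal (exp (- t\<^sup>2 / 2)) \<partial>lborel)"
    by (rule nn_integral_lborel_prod) auto
  also have "\<dots> = (\<integral>\<^sup>+t. ennreal (exp (- t\<^sup>2 / 2)) \<partial>lborel) ^ DIM('v)" by simp
  also have "ennreal (a * exp (b\<^sup>2 / 2)) * \<dots> < \<infinity>" using line by (simp add: ennreal_mult_less_top power_less_top_ennreal)
  finally show ?thesis .
qed

lemma wt_smooth_le:
  fixes x :: "'v::euclidean_space"
  shows "smooth wt x \<le> ennreal c * (\<integral>\<^sup>+(v::'v). wt v * ennreal (gauss_kernel v) \<partial>lborel) * wt x"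
proof -
  have "smooth wt x \<le> (\<integral>\<^sup>+(v::'v). (ennreal c * wt x) * (wt v * ennreal (gauss_kernel v)) \<partial>lborel)"
    unfolding smooth_def
  proof (intro nn_integral_mono)
    fix v :: 'v
    have "wt (x + v) * ennreal (gauss_kernel v) \<le> (ennreal c * wt x * wt v) * ennreal (gauss_kernel v)"
      by (intro mult_right_mono wt_add) auto
    then show "wt (x + v) * ennreal (gauss_kernel v) \<le> (ennreal c * wt x) * (wt v * ennreal (gauss_kernel v))"
      by (simp add: mult.assoc)
  qed
  also have "\<dots> = (ennreal c * wt x) * (\<integral>\<^sup>+(v::'v). wt v * ennreal (gauss_kernel v) \<partial>lborel)"
    by (rule nn_integral_cmult) measurable
  finally show ?thesis by (simp add: mult_ac)
qed

text \<open>By Fubini some shift \<open>v\<close> has a finite shifted moment, and the shift can be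
  undone at the cost of a constant.\<close>

lemma wt_integral_finite_if_smooth:
  assumes P: "borel_prob P" and fin: "(\<integral>\<^sup>+x. smooth wt x \<partial>P) < \<infinity>"
  shows "(\<integral>\<^sup>+x. wt x \<partial>P) < \<infinity>"
proof -
  have [measurable_cong]: "sets P = sets borel" using P by (auto simp: borel_prob_def)
  interpret P: prob_space P by (rule borel_probD[OF P])
  interpret PL: pair_sigma_finite P "lborel :: 'a measure" ..
  have "(\<integral>\<^sup>+x. smooth wt x \<partial>P) = (\<integral>\<^sup>+v. (\<integral>\<^sup>+x. wt (x + v) * ennreal (gauss_kernel v) \<partial>P) \<partial>lborel)"
    unfolding smooth_def by (rule PL.Fubini'[symmetric]) measurable
  also have "\<dots> = (\<integral>\<^sup>+v. (\<integral>\<^sup>+x. wt (x + v) \<partial>P) * ennreal (gauss_kernel v) \<partial>lborel)"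
    by (intro nn_integral_cong nn_integral_multc) measurable
  finally obtain v where "(\<integral>\<^sup>+x. wt (x + v) \<partial>P) * ennreal (gauss_kernel v) < \<infinity>"
    using ex_finite_value[of lborel "\<lambda>v. (\<integral>\<^sup>+x. wt (x + v) \<partial>P) * ennreal (gauss_kernel v)"] fin by auto
  then have "(\<integral>\<^sup>+x. wt (x + v) \<partial>P) < \<infinity>"
    using gauss_kernel_simps(1)[of v] by (auto simp: ennreal_mult_less_top)
  then show ?thesis by (rule wt_integral_finite_if_shift[rotated]) (use P in \<open>simp add: borel_prob_def\<close>)
qed

end

section \<open>Estimates near the origin and integrability for Levy measures\<close>

lemma cosh_le_interpolation:
  fixes \<beta> r :: real
  assumes r: "0 \<le> r" "r \<le> 1"
  shows "cosh (\<beta> * r) - 1 \<le> r\<^sup>2 * cosh \<beta>"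
proof -
  let ?s = "\<lambda>x n. if even n then x ^ n /\<^sub>R fact n else (0::real)"
  have 1: "?s (\<beta> * r) sums cosh (\<beta> * r)" "(\<lambda>n. (if n = 0 then 1 else 0) + r\<^sup>2 * ?s \<beta> n) sums (1 + r\<^sup>2 * cosh \<beta>)"
    using cosh_converges[of "\<beta> * r"] cosh_converges[of \<beta>] sums_single[of 0 "\<lambda>_. 1::real"]
    by (auto intro!: sums_add sums_mult)
  have "cosh (\<beta> * r) \<le> 1 + r\<^sup>2 * cosh \<beta>"
  proof (rule sums_le[OF _ 1])
    fix n
    show "?s (\<beta> * r) n \<le> (if n = 0 then 1 else 0) + r\<^sup>2 * ?s \<beta> n"
    proof (cases "even n \<and> n \<noteq> 0")
      case True
      then have "n \<ge> 2" by (cases n) (auto elim!: oddE)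
      \<comment> \<open>The power series are compared term by term: beyond the constant term only
        even exponents of at least 2 occur.\<close>
      have "r ^ n \<le> r ^ 2" using r \<open>n \<ge> 2\<close> by (intro power_decreasing) auto
      moreover have "\<beta> ^ n \<ge> 0" using True by (simp add: zero_le_even_power)
      ultimately have "\<beta> ^ n * r ^ n \<le> \<beta> ^ n * r\<^sup>2" by (intro mult_left_mono)
      then show ?thesis using True by (simp add: power_mult_distrib field_simps)
    qed (use r in auto)
  qed
  then show ?thesis by simp
qed

lemma one_minus_cos_le: "1 - cos (t::real) \<le> t\<^sup>2 / 2" "0 \<le> 1 - cos t" "1 - cos t \<le> 2"
proof -
  have "1 - cos t = 2 * (sin (t/2))\<^sup>2" using cos_double_sin[of "t/2"] by simp
  also have "\<dots> \<le> 2 * (t/2)\<^sup>2"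
    using abs_sin_x_le_abs_x[of "t/2"] by (intro mult_left_mono) (auto simp: abs_le_square_iff[symmetric])
  finally show "1 - cos t \<le> t\<^sup>2 / 2" by (simp add: power2_eq_square)
  show "0 \<le> 1 - cos t" by simp
  show "1 - cos t \<le> 2" using cos_ge_minus_one[of t] by linarith
qed

lemma one_minus_cos_inner_le:
  "1 - cos (z \<bullet> x) \<le> (2 + (norm z)\<^sup>2) * min 1 ((norm x)\<^sup>2)"
proof (cases "norm x \<le> 1")
  case True
  have "1 - cos (z \<bullet> x) \<le> (z \<bullet> x)\<^sup>2 / 2" by (rule one_minus_cos_le)
  also have "(z \<bullet> x)\<^sup>2 \<le> (norm z * norm x)\<^sup>2"
    using Cauchy_Schwarz_ineq2[of z x] by (simp add: abs_le_square_iff[symmetric])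
  finally have "1 - cos (z \<bullet> x) \<le> (norm z * norm x)\<^sup>2 / 2" by simp
  also have "\<dots> \<le> (norm z)\<^sup>2 * (norm x)\<^sup>2" by (simp add: power_mult_distrib)
  also have "\<dots> \<le> (2 + (norm z)\<^sup>2) * (norm x)\<^sup>2" by (intro mult_right_mono) auto
  finally have "1 - cos (z \<bullet> x) \<le> (2 + (norm z)\<^sup>2) * (norm x)\<^sup>2" .
  moreover have "min 1 ((norm x)\<^sup>2) = (norm x)\<^sup>2" using True by (intro min_absorb2 power_le_one) auto
  ultimately show ?thesis by simp
next
  case False
  then have "min 1 ((norm x)\<^sup>2) = 1" by (simp add: min_def)
  then show ?thesis using one_minus_cos_le(3)[of "z \<bullet> x"] by (simp add: add_increasing2)
qed

definition restr :: "'v::euclidean_space measure \<Rightarrow> 'v set \<Rightarrow> 'v measure" where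
  "restr \<nu> S = density \<nu> (\<lambda>x. ennreal (indicator S x))"

lemma
  fixes \<nu> :: "'v::euclidean_space measure"
  assumes s: "sets \<nu> = sets borel" and S [measurable]: "S \<in> sets borel"
  shows sets_restr: "sets (restr \<nu> S) = sets borel"
    and nn_integral_restr: "f \<in> borel_measurable borel \<Longrightarrow> (\<integral>\<^sup>+x. f x \<partial>restr \<nu> S) = (\<integral>\<^sup>+x\<in>S. f x \<partial>\<nu>)"
    and integral_restr: "h \<in> borel_measurable borel \<Longrightarrow> (\<integral>x. (h x :: real) \<partial>restr \<nu> S) = (\<integral>x. indicator S x * h x \<partial>\<nu>)"
proof -
  have [measurable_cong]: "sets \<nu> = sets borel" by (rule s)
  show "sets (restr \<nu> S) = sets borel" by (simp add: restr_def s)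
  show "(\<integral>\<^sup>+x. f x \<partial>restr \<nu> S) = (\<integral>\<^sup>+x\<in>S. f x \<partial>\<nu>)" if [measurable]: "f \<in> borel_measurable borel" for f
    unfolding restr_def by (subst nn_integral_density) (auto intro!: nn_integral_cong simp: indicator_def)
  show "(\<integral>x. (h x :: real) \<partial>restr \<nu> S) = (\<integral>x. indicator S x * h x \<partial>\<nu>)" if [measurable]: "h \<in> borel_measurable borel" for h
    unfolding restr_def by (subst integral_density) auto
qed

lemma levy_tail_finite:
  fixes \<nu> :: "'v::euclidean_space measure"
  assumes s: "sets \<nu> = sets borel" and S: "S \<in> sets borel"
    and levy: "(\<integral>\<^sup>+x. ennreal (min 1 ((norm x)\<^sup>2)) \<partial>\<nu>) < \<infinity>"
    and e: "e > 0" "\<And>x. x \<in> S \<Longrightarrow> norm x \<ge> e"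
  shows "emeasure \<nu> S < \<infinity>"
proof -
  have [measurable_cong]: "sets \<nu> = sets borel" by (rule s)
  have "emeasure \<nu> S = (\<integral>\<^sup>+x. indicator S x \<partial>\<nu>)" using S s by simp
  also have "\<dots> \<le> (\<integral>\<^sup>+x. ennreal (1 / min 1 (e\<^sup>2)) * ennreal (min 1 ((norm x)\<^sup>2)) \<partial>\<nu>)"
  proof (intro nn_integral_mono)
    fix x
    have "1 \<le> ennreal (1 / min 1 (e\<^sup>2)) * ennreal (min 1 ((norm x)\<^sup>2))" if "x \<in> S"
    proof -
      have "e\<^sup>2 \<le> (norm x)\<^sup>2" using e that by (intro power_mono) auto
      then have "min 1 (e\<^sup>2) \<le> min 1 ((norm x)\<^sup>2)" by auto
      then have "1 \<le> 1 / min 1 (e\<^sup>2) * min 1 ((norm x)\<^sup>2)" using e(1) by (simp add: min_def split: if_splits)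
      then have "ennreal 1 \<le> ennreal (1 / min 1 (e\<^sup>2) * min 1 ((norm x)\<^sup>2))" by (rule ennreal_leI)
      then show ?thesis by (subst (asm) ennreal_mult) (auto simp: e(1))
    qed
    then show "indicator S x \<le> ennreal (1 / min 1 (e\<^sup>2)) * ennreal (min 1 ((norm x)\<^sup>2))"
      by (auto simp: indicator_def)
  qed
  also have "\<dots> = ennreal (1 / min 1 (e\<^sup>2)) * (\<integral>\<^sup>+x. ennreal (min 1 ((norm x)\<^sup>2)) \<partial>\<nu>)"
    by (rule nn_integral_cmult) measurable
  also have "\<dots> < \<infinity>" using levy by (simp add: ennreal_mult_less_top)
  finally show ?thesis .
qed

lemma finite_measure_restr:
  fixes \<nu> :: "'v::euclidean_space measure"
  assumes s: "sets \<nu> = sets borel" and S [measurable]: "S \<in> sets borel"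
    and levy: "(\<integral>\<^sup>+x. ennreal (min 1 ((norm x)\<^sup>2)) \<partial>\<nu>) < \<infinity>"
    and e: "e > 0" "\<And>x. x \<in> S \<Longrightarrow> norm x \<ge> e"
  shows "finite_measure (restr \<nu> S)"
proof
  have "emeasure (restr \<nu> S) (space (restr \<nu> S)) = (\<integral>\<^sup>+x. 1 \<partial>restr \<nu> S)" by simp
  also have "\<dots> = (\<integral>\<^sup>+x\<in>S. 1 \<partial>\<nu>)" by (rule nn_integral_restr[OF s S]) auto
  also have "\<dots> = emeasure \<nu> S" using S s by simp
  also have "\<dots> < \<infinity>" by (rule levy_tail_finite[OF s S levy e])
  finally show "emeasure (restr \<nu> S) (space (restr \<nu> S)) \<noteq> \<infinity>" by simp
qed

lemma levy_integrable:
  fixes \<nu> :: "'v::euclidean_space measure"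
  assumes s: "sets \<nu> = sets borel" and levy: "(\<integral>\<^sup>+x. ennreal (min 1 ((norm x)\<^sup>2)) \<partial>\<nu>) < \<infinity>"
  shows "integrable \<nu> (\<lambda>x. (2 + (norm z)\<^sup>2) * min 1 ((norm x)\<^sup>2))"
    and "integrable \<nu> (\<lambda>x. 1 - cos (z \<bullet> x))"
proof -
  have [measurable_cong]: "sets \<nu> = sets borel" by (rule s)
  have "integrable \<nu> (\<lambda>x. min 1 ((norm x)\<^sup>2))"
    using levy by (subst integrable_iff_bounded) (auto simp: abs_of_nonneg)
  then show 1: "integrable \<nu> (\<lambda>x. (2 + (norm z)\<^sup>2) * min 1 ((norm x)\<^sup>2))" by (intro integrable_mult_right)
  show "integrable \<nu> (\<lambda>x. 1 - cos (z \<bullet> x))"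
  proof (rule Bochner_Integration.integrable_bound[OF 1])
    show "AE x in \<nu>. norm (1 - cos (z \<bullet> x)) \<le> norm ((2 + (norm z)\<^sup>2) * min 1 ((norm x)\<^sup>2))"
    proof (rule AE_I2)
      fix x
      show "norm (1 - cos (z \<bullet> x)) \<le> norm ((2 + (norm z)\<^sup>2) * min 1 ((norm x)\<^sup>2))"
        using one_minus_cos_inner_le[of z x] one_minus_cos_le(2)[of "z \<bullet> x"] by (simp add: abs_of_nonneg)
    qed
  qed measurable
qed

section \<open>Weighted moments and the Levy measure\<close>

context submult_weight
begin

text \<open>The Gaussian part and the jumps of size at most 1 make up \<open>U n\<close>, whose
  exponential moments are bounded uniformly in \<open>n\<close>; the jumps larger than 1 form the
  fixed finite measure \<open>\<Lambda>b\<close>. If the weight is integrable over large jumps, the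
  weighted moments of \<open>R n\<close> are bounded. Conversely, \<open>U n\<close> stays in a
  fixed ball with probability at least 1/2, and a single large jump then already carries the
  weight.\<close>

theorem levy_moment:
  fixes \<nu> \<rho> :: "'v::euclidean_space measure"
  assumes \<rho>: "borel_prob \<rho>" and s: "sets \<nu> = sets borel"
    and levy: "(\<integral>\<^sup>+x. ennreal (min 1 ((norm x)\<^sup>2)) \<partial>\<nu>) < \<infinity>"
    and char: "\<And>z. char_fun \<rho> z = of_real (exp (- (\<Sum>b\<leftarrow>bs. (z \<bullet> b)\<^sup>2) - 2 * (\<integral>x. 1 - cos (z \<bullet> x) \<partial>\<nu>)))"
  shows "(\<integral>\<^sup>+x. wt x \<partial>\<rho>) < \<infinity> \<longleftrightarrow> (\<integral>\<^sup>+x\<in>{x. norm x > 1}. wt x \<partial>\<nu>) < \<infinity>"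
proof -
  have [measurable_cong]: "sets \<nu> = sets borel" "sets \<rho> = sets borel" using s \<rho> by (auto simp: borel_prob_def)
  interpret \<rho>: prob_space \<rho> by (rule borel_probD[OF \<rho>])
  define Sb where "Sb = {x::'v. norm x > 1}"
  define Ss where "Ss n = {x::'v. 1 / real (Suc n) < norm x \<and> norm x \<le> 1}" for n
  have Sm [measurable]: "Sb \<in> sets borel" "Ss n \<in> sets borel" for n unfolding Sb_def Ss_def by measurable
  define \<Lambda>b where "\<Lambda>b = restr \<nu> Sb"
  define \<Lambda>s where "\<Lambda>s n = restr \<nu> (Ss n)" for n
  have \<Lambda>b: "finite_measure \<Lambda>b" "sets \<Lambda>b = sets borel"
    unfolding \<Lambda>b_def using finite_measure_restr[OF s Sm(1) levy, of 1] sets_restr[OF s Sm(1)] by (simp_all add: Sb_def)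
  have \<Lambda>s: "finite_measure (\<Lambda>s n)" "sets (\<Lambda>s n) = sets borel" for n
    unfolding \<Lambda>s_def using finite_measure_restr[OF s Sm(2) levy, of "1 / real (Suc n)" n] sets_restr[OF s Sm(2)]
    by (simp_all add: Ss_def)
  obtain G where G: "borel_prob G" "\<And>z. char_fun G z = of_real (exp (- (\<Sum>b\<leftarrow>bs. (z \<bullet> b)\<^sup>2)))"
    "\<And>\<beta>. \<exists>K<\<infinity>. growth_bound (\<lambda>x::'v. ennreal (cosh_sum \<beta> x)) G K" using ex_gaussian[of bs] by blast
  obtain W :: "'v measure" where W: "borel_prob W" "\<And>y. char_fun W y = of_real (gauss_kernel y)"
    using ex_char_fun_gauss_kernel by blast
  define U where "U n = conv G (cp_approx (\<Lambda>s n) n)" for n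
  define R where "R n = conv (cp_approx \<Lambda>b n) (U n)" for n
  note cp = borel_prob_cp_approx[OF \<Lambda>b] borel_prob_cp_approx[OF \<Lambda>s]
  have U: "borel_prob (U n)" for n unfolding U_def by (intro borel_prob_conv G cp)
  have R: "borel_prob (R n)" for n unfolding R_def by (intro borel_prob_conv U cp)
  have [measurable_cong]: "sets (U n) = sets borel" for n using U by (simp add: borel_prob_def)
  have [measurable_cong]: "sets (cp_approx \<Lambda>b n) = sets borel" for n using cp(1) by (simp add: borel_prob_def)

  have char_lim: "(\<lambda>n. char_fun (R n) z) \<longlonglongrightarrow> char_fun \<rho> z" for z
  proof -
    let ?f = "\<lambda>x. 1 - cos (z \<bullet> x)"
    have fm: "?f \<in> borel_measurable borel" by measurable
    define as where "as n = 2 * (\<integral>x. ?f x \<partial>\<Lambda>s n)" for n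
    define ab where "ab = 2 * (\<integral>x. ?f x \<partial>\<Lambda>b)"
    have bd: "0 \<le> 2 * (\<integral>x. ?f x \<partial>\<Lambda>) \<and> 2 * (\<integral>x. ?f x \<partial>\<Lambda>) \<le> real (cp_steps \<Lambda> n)"
      if L: "finite_measure \<Lambda>" "sets \<Lambda> = sets borel" for \<Lambda> :: "'v measure" and n
    proof
      interpret finite_measure \<Lambda> by (rule L)
      have [measurable_cong]: "sets \<Lambda> = sets borel" by (rule L)
      have "space \<Lambda> = UNIV" using sets_eq_imp_space_eq[OF L(2)] by simp
      show "0 \<le> 2 * (\<integral>x. ?f x \<partial>\<Lambda>)" using one_minus_cos_le(2) by (intro mult_nonneg_nonneg integral_nonneg_AE) auto
      have "(\<integral>x. ?f x \<partial>\<Lambda>) \<le> (\<integral>x. 2 \<partial>\<Lambda>)"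
        using one_minus_cos_le by (intro integral_mono integrable_const_bound[of _ 2]) auto
      also have "\<dots> = 2 * measure \<Lambda> UNIV" using \<open>space \<Lambda> = UNIV\<close> by simp
      finally have "2 * (\<integral>x. ?f x \<partial>\<Lambda>) \<le> 4 * measure \<Lambda> UNIV" by simp
      also have "\<dots> \<le> real (cp_steps \<Lambda> n)"
        using cp_steps_bounds(1,3)[where \<Lambda>=\<Lambda> and n=n] by (simp add: divide_le_eq)
      finally show "2 * (\<integral>x. ?f x \<partial>\<Lambda>) \<le> real (cp_steps \<Lambda> n)" .
    qed
    have steps: "filterlim (\<lambda>n. cp_steps (\<Lambda> n) n) at_top sequentially" for \<Lambda> :: "nat \<Rightarrow> 'v measure"
    proof (rule filterlim_at_top_mono[OF filterlim_ident])
      show "\<forall>\<^sub>F n in sequentially. n \<le> cp_steps (\<Lambda> n) n"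
        by (intro always_eventually allI) (simp only: cp_steps_def add.assoc le_add1)
    qed
    have as_lim: "as \<longlonglongrightarrow> 2 * (\<integral>x. indicator {x. 0 < norm x \<and> norm x \<le> 1} x * ?f x \<partial>\<nu>)"
      unfolding as_def \<Lambda>s_def integral_restr[OF s Sm(2) fm]
    proof (intro tendsto_mult tendsto_const integral_dominated_convergence[where w="\<lambda>x. (2 + (norm z)\<^sup>2) * min 1 ((norm x)\<^sup>2)"])
      show "integrable \<nu> (\<lambda>x. (2 + (norm z)\<^sup>2) * min 1 ((norm x)\<^sup>2))" by (rule levy_integrable[OF s levy])
      show "AE x in \<nu>. (\<lambda>n. indicator (Ss n) x * ?f x) \<longlonglongrightarrow> indicator {x. 0 < norm x \<and> norm x \<le> 1} x * ?f x"
      proof (intro AE_I2 tendsto_eventually)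
        fix x
        show "\<forall>\<^sub>F n in sequentially. indicator (Ss n) x * ?f x = indicator {x. 0 < norm x \<and> norm x \<le> 1} x * ?f x"
        proof (cases "x = 0")
          case False
          have "(\<lambda>n. 1 / real (Suc n)) \<longlonglongrightarrow> 0" by (rule LIMSEQ_Suc[OF lim_1_over_n])
          then have "\<forall>\<^sub>F n in sequentially. 1 / real (Suc n) < norm x"
            by (rule order_tendstoD(2)) (use False in simp)
          then show ?thesis by eventually_elim (use False in \<open>auto simp: Ss_def indicator_def\<close>)
        qed simp
      qed
      show "AE x in \<nu>. norm (indicator (Ss n) x * ?f x) \<le> (2 + (norm z)\<^sup>2) * min 1 ((norm x)\<^sup>2)" for n
      proof (rule AE_I2)
        fix x
        show "norm (indicator (Ss n) x * ?f x) \<le> (2 + (norm z)\<^sup>2) * min 1 ((norm x)\<^sup>2)"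
          using one_minus_cos_inner_le[of z x] one_minus_cos_le(2)[of "z \<bullet> x"] by (auto simp: indicator_def)
      qed
    qed measurable
    \<comment> \<open>The two regions leave out the origin, where
      \<open>1 - cos (z \<bullet> x)\<close> vanishes.\<close>
    have split: "ab + 2 * (\<integral>x. indicator {x. 0 < norm x \<and> norm x \<le> 1} x * ?f x \<partial>\<nu>) = 2 * (\<integral>x. ?f x \<partial>\<nu>)"
    proof -
      have i: "integrable \<nu> (\<lambda>x. indicator S x * ?f x)" if [measurable]: "S \<in> sets borel" for S
        by (rule Bochner_Integration.integrable_bound[OF levy_integrable(2)[OF s levy, of z]]) (auto simp: indicator_def)
      have "ab = 2 * (\<integral>x. indicator Sb x * ?f x \<partial>\<nu>)" unfolding ab_def \<Lambda>b_def integral_restr[OF s Sm(1) fm] ..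
      then have "ab + 2 * (\<integral>x. indicator {x. 0 < norm x \<and> norm x \<le> 1} x * ?f x \<partial>\<nu>)
         = 2 * ((\<integral>x. indicator Sb x * ?f x \<partial>\<nu>) + (\<integral>x. indicator {x. 0 < norm x \<and> norm x \<le> 1} x * ?f x \<partial>\<nu>))"
        by simp
      also have "\<dots> = 2 * (\<integral>x. indicator Sb x * ?f x + indicator {x. 0 < norm x \<and> norm x \<le> 1} x * ?f x \<partial>\<nu>)"
        by (subst Bochner_Integration.integral_add[OF i i]) measurable
      also have "(\<integral>x. indicator Sb x * ?f x + indicator {x. 0 < norm x \<and> norm x \<le> 1} x * ?f x \<partial>\<nu>) = (\<integral>x. ?f x \<partial>\<nu>)"
        by (intro Bochner_Integration.integral_cong refl) (auto simp: indicator_def Sb_def)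
      finally show ?thesis .
    qed
    have l1: "(\<lambda>n. (1 - as n / real (cp_steps (\<Lambda>s n) n)) ^ cp_steps (\<Lambda>s n) n) \<longlonglongrightarrow> exp (- (2 * (\<integral>x. indicator {x. 0 < norm x \<and> norm x \<le> 1} x * ?f x \<partial>\<nu>)))"
      using bd[OF \<Lambda>s] by (intro power_one_minus_div_tendsto_exp as_lim steps) (auto simp: as_def)
    have l2: "(\<lambda>n. (1 - ab / real (cp_steps \<Lambda>b n)) ^ cp_steps \<Lambda>b n) \<longlonglongrightarrow> exp (- ab)"
      using bd[OF \<Lambda>b] by (intro power_one_minus_div_tendsto_exp tendsto_const steps) (auto simp: ab_def)
    have char_R: "char_fun (R n) z = of_real ((1 - ab / real (cp_steps \<Lambda>b n)) ^ cp_steps \<Lambda>b n * (exp (- (\<Sum>b\<leftarrow>bs. (z \<bullet> b)\<^sup>2)) * (1 - as n / real (cp_steps (\<Lambda>s n) n)) ^ cp_steps (\<Lambda>s n) n))" for n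
      unfolding R_def U_def char_fun_conv[OF cp(1) borel_prob_conv[OF G(1) cp(2)]] char_fun_conv[OF G(1) cp(2)] G(2)
        char_fun_cp_approx[OF \<Lambda>b] char_fun_cp_approx[OF \<Lambda>s] ab_def as_def by (simp only: of_real_mult)
    have "exp (- (\<Sum>b\<leftarrow>bs. (z \<bullet> b)\<^sup>2) - 2 * (\<integral>x. ?f x \<partial>\<nu>)) = exp (- ab) * (exp (- (\<Sum>b\<leftarrow>bs. (z \<bullet> b)\<^sup>2)) * exp (- (2 * (\<integral>x. indicator {x. 0 < norm x \<and> norm x \<le> 1} x * ?f x \<partial>\<nu>))))"
      unfolding split[symmetric] exp_add[symmetric] by (simp add: algebra_simps)
    then show ?thesis unfolding char_R char
      by (simp only:) (intro tendsto_of_real tendsto_mult tendsto_const l1 l2)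
  qed

  obtain a b where ab: "a > 0" "b > 0" "\<And>r. r \<ge> 0 \<Longrightarrow> \<phi> r \<le> a * exp (b * r)" using exp_bound by blast
  \<comment> \<open>The growth factor of the small jumps is governed by the integral of
    \<open>cosh - 1\<close> over \<open>Ss n\<close>, which the Levy integral bounds independently
    of the inner cutoff.\<close>
  have exp_U: "\<exists>B<\<infinity>. \<forall>n. (\<integral>\<^sup>+x. ennreal (exp (b * norm x)) \<partial>U n) \<le> B"
  proof -
    let ?\<beta> = "b * DIM('v)"
    obtain K where K: "K < \<infinity>" "growth_bound (\<lambda>x::'v. ennreal (cosh_sum ?\<beta> x)) G K" using G(3) by blast
    define I where "I = enn2real (ennreal (cosh ?\<beta>) * (\<integral>\<^sup>+x. ennreal (min 1 ((norm x)\<^sup>2)) \<partial>\<nu>))"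
    have I: "(\<integral>\<^sup>+x. ennreal (cosh (?\<beta> * norm x) - 1) \<partial>\<Lambda>s n) \<le> ennreal I" for n
    proof -
      have "(\<integral>\<^sup>+x. ennreal (cosh (?\<beta> * norm x) - 1) \<partial>\<Lambda>s n) = (\<integral>\<^sup>+x\<in>Ss n. ennreal (cosh (?\<beta> * norm x) - 1) \<partial>\<nu>)"
        unfolding \<Lambda>s_def by (rule nn_integral_restr[OF s Sm(2)]) measurable
      also have "\<dots> \<le> (\<integral>\<^sup>+x. ennreal (cosh ?\<beta>) * ennreal (min 1 ((norm x)\<^sup>2)) \<partial>\<nu>)"
      proof (intro nn_integral_mono)
        fix x
        show "ennreal (cosh (?\<beta> * norm x) - 1) * indicator (Ss n) x \<le> ennreal (cosh ?\<beta>) * ennreal (min 1 ((norm x)\<^sup>2))"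
        proof (cases "x \<in> Ss n")
          case True
          then have x: "norm x \<le> 1" by (simp add: Ss_def)
          then have "min 1 ((norm x)\<^sup>2) = (norm x)\<^sup>2" by (intro min_absorb2 power_le_one) auto
          moreover have "cosh (?\<beta> * norm x) - 1 \<le> (norm x)\<^sup>2 * cosh ?\<beta>" by (rule cosh_le_interpolation) (use x in auto)
          ultimately show ?thesis using True by (simp add: ennreal_mult[symmetric] ennreal_leI mult.commute)
        qed simp
      qed
      also have "\<dots> = ennreal (cosh ?\<beta>) * (\<integral>\<^sup>+x. ennreal (min 1 ((norm x)\<^sup>2)) \<partial>\<nu>)"
        by (rule nn_integral_cmult) measurable
      also have "\<dots> = ennreal I" unfolding I_def using levy by (simp add: ennreal_enn2real ennreal_mult_less_top)
      finally show ?thesis .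
    qed
    have "growth_bound (\<lambda>x. ennreal (cosh_sum ?\<beta> x)) (U n) (K * ennreal (exp (2 * I)))" for n
      unfolding U_def by (intro growth_bound_conv G(1) cp K growth_bound_cosh_cp_approx[OF \<Lambda>s I]) (auto simp: I_def)
    from growth_boundD0[OF this] have U0: "(\<integral>\<^sup>+x. ennreal (cosh_sum ?\<beta> x) \<partial>U n) \<le> K * ennreal (exp (2 * I)) * ennreal (cosh_sum ?\<beta> (0::'v))" for n .
    show ?thesis
    proof (intro exI[of _ "2 * (K * ennreal (exp (2 * I)) * ennreal (cosh_sum ?\<beta> (0::'v)))"] conjI allI)
      show "2 * (K * ennreal (exp (2 * I)) * ennreal (cosh_sum ?\<beta> (0::'v))) < \<infinity>"
        using K by (simp add: ennreal_mult_less_top)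
      fix n
      have "(\<integral>\<^sup>+x. ennreal (exp (b * norm x)) \<partial>U n) \<le> (\<integral>\<^sup>+x. 2 * ennreal (cosh_sum ?\<beta> x) \<partial>U n)"
      proof (intro nn_integral_mono)
        fix x :: 'v
        have "ennreal (exp (b * norm x)) \<le> ennreal (2 * cosh_sum ?\<beta> x)" using ab by (intro ennreal_leI exp_norm_le_cosh_sum) auto
        then show "ennreal (exp (b * norm x)) \<le> 2 * ennreal (cosh_sum ?\<beta> x)" by (simp add: ennreal_mult cosh_sum_nonneg)
      qed
      also have "\<dots> = 2 * (\<integral>\<^sup>+x. ennreal (cosh_sum ?\<beta> x) \<partial>U n)" by (rule nn_integral_cmult) measurable
      also have "\<dots> \<le> 2 * (K * ennreal (exp (2 * I)) * ennreal (cosh_sum ?\<beta> (0::'v)))" by (intro mult_left_mono U0) auto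
      finally show "(\<integral>\<^sup>+x. ennreal (exp (b * norm x)) \<partial>U n) \<le> \<dots>" .
    qed
  qed
  then obtain B where B: "B < \<infinity>" "\<And>n. (\<integral>\<^sup>+x. ennreal (exp (b * norm x)) \<partial>U n) \<le> B" by blast

  \<comment> \<open>Truncations of the weight, bounded and of bounded support, so that smoothed
    integrals converge along \<open>R n\<close>; they increase to \<open>wt\<close>.\<close>
  define f where "f N x = wt x * indicator {x::'v. norm x \<le> real N} x" for N x
  have fm [measurable]: "f N \<in> borel_measurable borel" for N unfolding f_def[abs_def] by measurable
  have f_lim: "(\<lambda>n. \<integral>\<^sup>+x. smooth (f N) x \<partial>R n) \<longlonglongrightarrow> (\<integral>\<^sup>+x. smooth (f N) x \<partial>\<rho>)" for N
  proof (rule nn_integral_smooth_tendsto[OF R \<rho> W char_lim fm])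
    show "f N x \<le> ennreal (\<phi> (real N))" for x
      using mono_\<phi> \<phi>_pos[of "real N"] by (auto simp: f_def wt_def indicator_def intro!: ennreal_leI dest: monoD)
    show "f N x = 0" if "norm x > real N" for x using that by (simp add: f_def)
  qed
  have smooth_f_le: "smooth (f N) x \<le> smooth wt x" for N x
    unfolding smooth_def by (intro nn_integral_mono) (auto simp: f_def indicator_def)
  have f_SUP: "(SUP N. f N x) = wt x" for x
  proof (rule antisym)
    show "(SUP N. f N x) \<le> wt x" by (intro SUP_least) (simp add: f_def indicator_def)
    obtain N where "norm x \<le> real N" using real_arch_simple by blast
    then have "wt x \<le> f N x" by (simp add: f_def)
    then show "wt x \<le> (SUP N. f N x)" by (intro SUP_upper2) auto
  qed
  have f_incseq: "incseq (\<lambda>N. f N x)" for x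
    by (intro incseq_SucI) (auto simp: f_def indicator_def)
  define \<gamma> where "\<gamma> = (\<integral>\<^sup>+v. wt v * ennreal (gauss_kernel (v::'v)) \<partial>lborel)"
  have \<gamma>: "\<gamma> < \<infinity>" unfolding \<gamma>_def by (rule wt_gauss_integral_finite)
  have smooth_le: "(\<integral>\<^sup>+x. smooth wt x \<partial>P) \<le> ennreal c * \<gamma> * (\<integral>\<^sup>+x. wt x \<partial>P)" if P: "borel_prob P" for P :: "'v measure"
  proof -
    have [measurable_cong]: "sets P = sets borel" using P by (simp add: borel_prob_def)
    have "(\<integral>\<^sup>+x. smooth wt x \<partial>P) \<le> (\<integral>\<^sup>+x. (ennreal c * \<gamma>) * wt x \<partial>P)"
      unfolding \<gamma>_def by (intro nn_integral_mono wt_smooth_le)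
    also have "\<dots> = ennreal c * \<gamma> * (\<integral>\<^sup>+x. wt x \<partial>P)" by (rule nn_integral_cmult) measurable
    finally show ?thesis .
  qed

  show ?thesis
  proof
    assume fin: "(\<integral>\<^sup>+x\<in>{x. norm x > 1}. wt x \<partial>\<nu>) < \<infinity>"
    define I where "I = enn2real (ennreal c * (\<integral>\<^sup>+x. wt x \<partial>\<Lambda>b))"
    have "(\<integral>\<^sup>+x. wt x \<partial>\<Lambda>b) = (\<integral>\<^sup>+x\<in>Sb. wt x \<partial>\<nu>)" unfolding \<Lambda>b_def by (rule nn_integral_restr[OF s Sm(1)]) measurable
    then have "(\<integral>\<^sup>+x. wt x \<partial>\<Lambda>b) < \<infinity>" using fin by (simp add: Sb_def)
    then have I': "ennreal c * (\<integral>\<^sup>+x. wt x \<partial>\<Lambda>b) = ennreal I"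
      unfolding I_def by (simp add: ennreal_enn2real ennreal_mult_less_top)
    have [measurable_cong]: "sets \<Lambda>b = sets borel" by (rule \<Lambda>b)
    have "(\<integral>\<^sup>+x. ennreal c * wt x \<partial>\<Lambda>b) = ennreal c * (\<integral>\<^sup>+x. wt x \<partial>\<Lambda>b)"
      by (rule nn_integral_cmult) measurable
    then have I: "(\<integral>\<^sup>+x. ennreal c * wt x \<partial>\<Lambda>b) \<le> ennreal I" unfolding I' by simp
    have g1: "growth_bound (wt :: 'v \<Rightarrow> ennreal) (cp_approx \<Lambda>b n) (ennreal (exp (2 * I)))" for n
    proof (rule growth_bound_submult_cp_approx[OF \<Lambda>b _ _ _ _ I])
      show "wt (z + x) \<le> ennreal c * wt z * wt x" for z x :: 'v by (rule wt_add)
      show "wt (- z + x) \<le> ennreal c * wt z * wt x" for z x :: 'v using wt_add[of "- z" x] by simp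
    qed (auto simp: I_def)
    have wtU: "(\<integral>\<^sup>+x. wt x \<partial>U n) \<le> ennreal a * B" for n
    proof -
      have "(\<integral>\<^sup>+x. wt x \<partial>U n) \<le> (\<integral>\<^sup>+x. ennreal a * ennreal (exp (b * norm x)) \<partial>U n)"
        using ab by (intro nn_integral_mono) (auto simp: wt_def ennreal_mult[symmetric] intro!: ennreal_leI)
      also have "\<dots> = ennreal a * (\<integral>\<^sup>+x. ennreal (exp (b * norm x)) \<partial>U n)" by (rule nn_integral_cmult) measurable
      also have "\<dots> \<le> ennreal a * B" by (intro mult_left_mono B) auto
      finally show ?thesis .
    qed
    define B2 where "B2 = ennreal (exp (2 * I)) * (ennreal c * (ennreal a * B)) * wt (0::'v)"
    have "B2 < \<infinity>" unfolding B2_def using B wt_bounds(2)[of "0::'v"] by (simp add: ennreal_mult_less_top)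
    have wtR: "(\<integral>\<^sup>+x. wt x \<partial>R n) \<le> B2" for n
    proof -
      \<comment> \<open>Submultiplicativity upgrades the moment bound \<open>wtU\<close> to a bound
        at all shifts, which can be combined with that of the large jumps under convolution.\<close>
      have "growth_bound (wt :: 'v \<Rightarrow> ennreal) (U n) (ennreal c * (ennreal a * B))"
        unfolding growth_bound_def
      proof
        fix x :: 'v
        have "(\<integral>\<^sup>+z. wt (z + x) \<partial>U n) \<le> (\<integral>\<^sup>+z. (ennreal c * wt x) * wt z \<partial>U n)"
          using wt_add by (intro nn_integral_mono) (simp add: mult_ac)
        also have "\<dots> = ennreal c * wt x * (\<integral>\<^sup>+z. wt z \<partial>U n)" by (rule nn_integral_cmult) measurable
        also have "\<dots> \<le> ennreal c * wt x * (ennreal a * B)" by (intro mult_left_mono wtU) auto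
        finally show "(\<integral>\<^sup>+z. wt (z + x) \<partial>U n) \<le> ennreal c * (ennreal a * B) * wt x" by (simp add: mult_ac)
      qed
      from growth_bound_conv[OF cp(1) U wt_measurable g1 this] growth_boundD0
      show ?thesis unfolding R_def B2_def by blast
    qed
    \<comment> \<open>The limit in \<open>n\<close> is taken for each fixed truncation, and the
      truncation is removed only afterwards, by monotone convergence; the bound depends on
      neither.\<close>
    have "(\<integral>\<^sup>+x. smooth (f N) x \<partial>\<rho>) \<le> ennreal c * \<gamma> * B2" for N
    proof (rule LIMSEQ_le_const2[OF f_lim], intro exI allI impI)
      fix n
      have "(\<integral>\<^sup>+x. smooth (f N) x \<partial>R n) \<le> (\<integral>\<^sup>+x. smooth wt x \<partial>R n)" by (intro nn_integral_mono smooth_f_le)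
      also have "\<dots> \<le> ennreal c * \<gamma> * (\<integral>\<^sup>+x. wt x \<partial>R n)" by (rule smooth_le[OF R])
      also have "\<dots> \<le> ennreal c * \<gamma> * B2" by (intro mult_left_mono wtR) auto
      finally show "(\<integral>\<^sup>+x. smooth (f N) x \<partial>R n) \<le> ennreal c * \<gamma> * B2" .
    qed
    moreover have "(\<integral>\<^sup>+x. smooth wt x \<partial>\<rho>) = (SUP N. \<integral>\<^sup>+x. smooth (f N) x \<partial>\<rho>)"
      unfolding nn_integral_smooth[OF \<rho> fm] nn_integral_smooth[OF \<rho> wt_measurable]
    proof (subst nn_integral_monotone_convergence_SUP[symmetric])
      show "incseq (\<lambda>N u. f N u * ennreal (\<integral>x. gauss_kernel (x - u) \<partial>\<rho>))"
        using f_incseq by (auto simp: incseq_def le_fun_def intro!: mult_right_mono)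
      show "(\<lambda>u. f N u * ennreal (\<integral>x. gauss_kernel (x - u) \<partial>\<rho>)) \<in> borel_measurable lborel" for N by measurable
      show "(\<integral>\<^sup>+u. wt u * ennreal (\<integral>x. gauss_kernel (x - u) \<partial>\<rho>) \<partial>lborel) = (\<integral>\<^sup>+u. (SUP N. f N u * ennreal (\<integral>x. gauss_kernel (x - u) \<partial>\<rho>)) \<partial>lborel)"
        by (simp add: SUP_mult_right_ennreal[symmetric] f_SUP)
    qed
    ultimately have "(\<integral>\<^sup>+x. smooth wt x \<partial>\<rho>) \<le> ennreal c * \<gamma> * B2" by (simp add: SUP_le_iff)
    also have "\<dots> < \<infinity>" using \<gamma> \<open>B2 < \<infinity>\<close> by (simp add: ennreal_mult_less_top)
    finally show "(\<integral>\<^sup>+x. wt x \<partial>\<rho>) < \<infinity>" by (rule wt_integral_finite_if_smooth[OF \<rho>])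
  next
    assume fin: "(\<integral>\<^sup>+x. wt x \<partial>\<rho>) < \<infinity>"
    define B3 where "B3 = ennreal c * \<gamma> * (\<integral>\<^sup>+x. wt x \<partial>\<rho>)"
    have B3: "B3 < \<infinity>" "(\<integral>\<^sup>+x. smooth wt x \<partial>\<rho>) \<le> B3"
      unfolding B3_def using fin \<gamma> smooth_le[OF \<rho>] by (auto simp: ennreal_mult_less_top)
    obtain B' where B': "B = ennreal B'" "B' \<ge> 0" using B(1) by (cases B) auto
    \<comment> \<open>Markov's inequality with \<open>exp (b * norm u) \<ge> b * norm u\<close>
      bounds the probability of \<open>norm u > r\<close> by \<open>B' / (2 * B' + 1)\<close>, which
      is at most 1/2.\<close>
    define r where "r = (2 * B' + 1) / b"
    have r: "r > 0" using ab B' by (simp add: r_def)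
    have half: "emeasure (U n) {u. norm u \<le> r} \<ge> ennreal (1/2)" for n
    proof -
      interpret U: prob_space "U n" by (rule borel_probD[OF U])
      have spU: "space (U n) = UNIV" by (rule borel_probD[OF U])
      have "ennreal (b * r) * emeasure (U n) {u. norm u > r} = (\<integral>\<^sup>+u. ennreal (b * r) * indicator {u. norm u > r} u \<partial>U n)"
        by (subst nn_integral_cmult_indicator) auto
      also have "\<dots> \<le> (\<integral>\<^sup>+u. ennreal (exp (b * norm u)) \<partial>U n)"
      proof (intro nn_integral_mono)
        fix u :: 'v
        have "b * r \<le> exp (b * norm u)" if "norm u > r"
        proof -
          have "b * r \<le> b * norm u" using ab that by (intro mult_left_mono) auto
          also have "\<dots> \<le> exp (b * norm u)" using exp_ge_add_one_self[of "b * norm u"] by linarith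
          finally show ?thesis .
        qed
        then show "ennreal (b * r) * indicator {u. norm u > r} u \<le> ennreal (exp (b * norm u))"
          by (auto simp: indicator_def intro: ennreal_leI)
      qed
      also have "\<dots> \<le> ennreal B'" using B(2) by (simp add: B')
      finally have "b * r * measure (U n) {u. norm u > r} \<le> B'"
        using ab r B' by (simp add: U.emeasure_eq_measure ennreal_mult[symmetric])
      moreover have "b * r = 2 * B' + 1" using ab by (simp add: r_def)
      ultimately have "(2 * B' + 1) * measure (U n) {u. norm u > r} \<le> B'" by simp
      then have "measure (U n) {u. norm u > r} \<le> B' / (2 * B' + 1)" using B' by (simp add: field_simps)
      also have "\<dots> \<le> 1/2" using B' by (simp add: field_simps)
      finally have "measure (U n) {u. norm u > r} \<le> 1/2" .
      moreover have "measure (U n) {u. norm u \<le> r} = 1 - measure (U n) {u. norm u > r}"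
        by (subst U.prob_compl[symmetric]) (auto simp: spU intro!: arg_cong[where f="measure (U n)"])
      ultimately have "1/2 \<le> measure (U n) {u. norm u \<le> r}" by linarith
      from ennreal_leI[OF this] show ?thesis by (simp only: U.emeasure_eq_measure)
    qed
    \<comment> \<open>On the unit ball the kernel is at least \<open>exp (-1)\<close>, whence the
      volume; the denominator is the loss from undoing the shift by \<open>u + v\<close>, of norm at
      most \<open>r + 1\<close>.\<close>
    define \<kappa> where "\<kappa> = exp (-1) * measure lborel (cball (0::'v) 1) / (c * \<phi> (r + 1))"
    have vol: "measure lborel (cball (0::'v) 1) > 0" "emeasure lborel (cball (0::'v) 1) = ennreal (measure lborel (cball (0::'v) 1))"
      using content_cball_pos[of 1 "0::'v"] emeasure_lborel_cball_finite[of "0::'v" 1] by (auto simp: emeasure_eq_ennreal_measure)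
    have \<kappa>: "\<kappa> > 0" unfolding \<kappa>_def using vol c_pos \<phi>_pos by simp
    have lower: "wt x * ennreal \<kappa> \<le> smooth (f N) (x + u)" if xu: "norm x \<le> real N - r - 1" "norm u \<le> r" for N and x u :: 'v
    proof -
      have "(wt x * ennreal (exp (-1) / (c * \<phi> (r + 1)))) * indicator (cball (0::'v) 1) v \<le> f N (x + u + v) * ennreal (gauss_kernel v)" for v
      proof (cases "norm v \<le> 1")
        case True
        have nuv: "norm (u + v) \<le> r + 1" using xu(2) True norm_triangle_ineq[of u v] by linarith
        have "norm (x + u + v) \<le> norm x + norm (u + v)" using norm_triangle_ineq[of x "u + v"] by (simp add: add.assoc)
        then have fN: "f N (x + u + v) = wt (x + u + v)" using xu(1) nuv by (simp add: f_def)
        have "\<phi> (norm x) \<le> \<phi> (norm (x + u + v) + norm (u + v))"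
          using mono_\<phi> norm_triangle_ineq4[of "x + u + v" "u + v"] by (auto simp: add.assoc dest: monoD)
        also have "\<dots> \<le> c * \<phi> (norm (x + u + v)) * \<phi> (norm (u + v))" by (rule submult) auto
        also have "\<dots> \<le> c * \<phi> (norm (x + u + v)) * \<phi> (r + 1)"
          using nuv mono_\<phi> c_pos \<phi>_pos[of "norm (x + u + v)"] by (intro mult_left_mono) (auto dest: monoD)
        finally have "\<phi> (norm x) / (c * \<phi> (r + 1)) \<le> \<phi> (norm (x + u + v))"
          using c_pos \<phi>_pos[of "r + 1"] by (simp add: field_simps)
        moreover have "exp (-1) \<le> gauss_kernel v" using True by (simp add: gauss_kernel_def power_le_one)
        ultimately have "\<phi> (norm x) / (c * \<phi> (r + 1)) * exp (-1) \<le> \<phi> (norm (x + u + v)) * gauss_kernel v"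
          using c_pos \<phi>_pos less_imp_le by (intro mult_mono) (auto intro: less_imp_le)
        then have "ennreal (\<phi> (norm x) * (exp (-1) / (c * \<phi> (r + 1)))) \<le> ennreal (\<phi> (norm (x + u + v)) * gauss_kernel v)"
          by (intro ennreal_leI) (simp add: mult_ac)
        moreover have "ennreal (\<phi> (norm x) * (exp (-1) / (c * \<phi> (r + 1)))) = wt x * ennreal (exp (-1) / (c * \<phi> (r + 1)))"
          unfolding wt_def using \<phi>_pos[of "norm x"] \<phi>_pos[of "r + 1"] c_pos by (intro ennreal_mult) auto
        moreover have "ennreal (\<phi> (norm (x + u + v)) * gauss_kernel v) = wt (x + u + v) * ennreal (gauss_kernel v)"
          unfolding wt_def using \<phi>_pos[of "norm (x + u + v)"] by (intro ennreal_mult) auto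
        ultimately show ?thesis using True by (simp add: fN)
      qed simp
      then have "(\<integral>\<^sup>+v. (wt x * ennreal (exp (-1) / (c * \<phi> (r + 1)))) * indicator (cball (0::'v) 1) v \<partial>lborel) \<le> smooth (f N) (x + u)"
        unfolding smooth_def by (intro nn_integral_mono)
      moreover have "(\<integral>\<^sup>+v. (wt x * ennreal (exp (-1) / (c * \<phi> (r + 1)))) * indicator (cball (0::'v) 1) v \<partial>lborel)
          = wt x * (ennreal (exp (-1) / (c * \<phi> (r + 1))) * ennreal (measure lborel (cball (0::'v) 1)))"
        by (subst nn_integral_cmult_indicator) (auto simp: vol mult.assoc)
      moreover have "ennreal (exp (-1) / (c * \<phi> (r + 1))) * ennreal (measure lborel (cball (0::'v) 1)) = ennreal \<kappa>"
        unfolding \<kappa>_def using c_pos \<phi>_pos[of "r + 1"] by (subst ennreal_mult[symmetric]) auto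
      ultimately show ?thesis by simp
    qed
    \<comment> \<open>The support radius is \<open>r + 1\<close> smaller than that of
      \<open>f N\<close>, so that a shift by \<open>u\<close> and by a point of the unit ball stays
      inside the truncation.\<close>
    define h where "h N x = wt x * indicator {x::'v. norm x \<le> real N - r - 1} x" for N x
    have hm [measurable]: "h N \<in> borel_measurable borel" for N unfolding h_def[abs_def] by measurable
    define q where "q = ennreal (2 * exp (- (4 * measure \<Lambda>b UNIV))) "
    have R_ge: "ennreal \<kappa> * ennreal (1/2) * (q * (\<integral>\<^sup>+x. h N x \<partial>\<Lambda>b)) \<le> (\<integral>\<^sup>+x. smooth (f N) x \<partial>R n)" for N n
    proof -
      have "ennreal \<kappa> * ennreal (1/2) * (q * (\<integral>\<^sup>+x. h N x \<partial>\<Lambda>b)) \<le> ennreal \<kappa> * ennreal (1/2) * (\<integral>\<^sup>+x. h N x \<partial>cp_approx \<Lambda>b n)"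
        unfolding q_def by (intro mult_left_mono cp_approx_ge[OF \<Lambda>b]) (auto simp: h_def indicator_def)
      also have "\<dots> = (\<integral>\<^sup>+x. (ennreal \<kappa> * ennreal (1/2)) * h N x \<partial>cp_approx \<Lambda>b n)"
        by (rule nn_integral_cmult[symmetric]) measurable
      also have "\<dots> \<le> (\<integral>\<^sup>+x. \<integral>\<^sup>+u. smooth (f N) (x + u) \<partial>U n \<partial>cp_approx \<Lambda>b n)"
      proof (intro nn_integral_mono)
        fix x :: 'v
        show "(ennreal \<kappa> * ennreal (1/2)) * h N x \<le> (\<integral>\<^sup>+u. smooth (f N) (x + u) \<partial>U n)"
        proof (cases "norm x \<le> real N - r - 1")
          case True
          have "(ennreal \<kappa> * ennreal (1/2)) * h N x = (wt x * ennreal \<kappa>) * ennreal (1/2)" using True by (simp add: h_def mult_ac)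
          also have "\<dots> \<le> (wt x * ennreal \<kappa>) * emeasure (U n) {u. norm u \<le> r}" by (intro mult_left_mono half) auto
          also have "\<dots> = (\<integral>\<^sup>+u. (wt x * ennreal \<kappa>) * indicator {u. norm u \<le> r} u \<partial>U n)"
            by (rule nn_integral_cmult_indicator[symmetric]) measurable
          also have "\<dots> \<le> (\<integral>\<^sup>+u. smooth (f N) (x + u) \<partial>U n)"
            using lower[OF True] by (intro nn_integral_mono) (auto simp: indicator_def)
          finally show ?thesis .
        qed (simp add: h_def)
      qed
      also have "\<dots> = (\<integral>\<^sup>+x. smooth (f N) x \<partial>R n)"
        unfolding R_def by (rule nn_integral_conv[OF cp(1) U, symmetric]) measurable
      finally show ?thesis .
    qed
    have hN: "ennreal \<kappa> * ennreal (1/2) * (q * (\<integral>\<^sup>+x. h N x \<partial>\<Lambda>b)) \<le> B3" for N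
    proof -
      have "ennreal \<kappa> * ennreal (1/2) * (q * (\<integral>\<^sup>+x. h N x \<partial>\<Lambda>b)) \<le> (\<integral>\<^sup>+x. smooth (f N) x \<partial>\<rho>)"
        by (rule LIMSEQ_le_const[OF f_lim]) (use R_ge in auto)
      also have "\<dots> \<le> (\<integral>\<^sup>+x. smooth wt x \<partial>\<rho>)" by (intro nn_integral_mono smooth_f_le)
      also have "\<dots> \<le> B3" by (rule B3)
      finally show ?thesis .
    qed
    have [measurable_cong]: "sets \<Lambda>b = sets borel" by (rule \<Lambda>b)
    have "(\<integral>\<^sup>+x. wt x \<partial>\<Lambda>b) = (\<integral>\<^sup>+x. (SUP N. h N x) \<partial>\<Lambda>b)"
    proof (intro nn_integral_cong antisym)
      fix x :: 'v
      obtain N where "norm x + r + 1 \<le> real N" using real_arch_simple by blast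
      then have "wt x \<le> h N x" by (simp add: h_def)
      then show "wt x \<le> (SUP N. h N x)" by (intro SUP_upper2) auto
      show "(SUP N. h N x) \<le> wt x" by (intro SUP_least) (simp add: h_def indicator_def)
    qed
    also have "\<dots> = (SUP N. \<integral>\<^sup>+x. h N x \<partial>\<Lambda>b)"
      by (rule nn_integral_monotone_convergence_SUP) (auto simp: incseq_def le_fun_def h_def indicator_def)
    finally have "ennreal \<kappa> * ennreal (1/2) * q * (\<integral>\<^sup>+x. wt x \<partial>\<Lambda>b) = (SUP N. ennreal \<kappa> * ennreal (1/2) * (q * (\<integral>\<^sup>+x. h N x \<partial>\<Lambda>b)))"
      by (simp add: SUP_mult_left_ennreal mult.assoc)
    also have "\<dots> \<le> B3" by (intro SUP_least hN)
    finally have "ennreal \<kappa> * ennreal (1/2) * q * (\<integral>\<^sup>+x. wt x \<partial>\<Lambda>b) < \<infinity>" using B3(1) by (rule le_less_trans)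
    moreover have "ennreal \<kappa> * ennreal (1/2) * q \<noteq> 0" using \<kappa> by (auto simp: q_def)
    ultimately have "(\<integral>\<^sup>+x. wt x \<partial>\<Lambda>b) < \<infinity>" by (auto simp: ennreal_mult_less_top)
    moreover have "(\<integral>\<^sup>+x. wt x \<partial>\<Lambda>b) = (\<integral>\<^sup>+x\<in>Sb. wt x \<partial>\<nu>)" unfolding \<Lambda>b_def by (rule nn_integral_restr[OF s Sm(1)]) measurable
    ultimately show "(\<integral>\<^sup>+x\<in>{x. norm x > 1}. wt x \<partial>\<nu>) < \<infinity>" by (simp add: Sb_def)
  qed
qed

end

section \<open>Polar decompositions\<close>

lemma countable_real_AE_lborel: "countable N \<Longrightarrow> AE r in lborel. (r::real) \<notin> N"
  by (rule AE_not_in[OF countable_imp_null_set_lborel])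

text \<open>In a polar decomposition only measurability of \<open>k \<xi> r\<close> in \<open>\<xi>\<close> is known. Its right limit in \<open>r\<close>,
  computed along the rationals, is jointly measurable and agrees with \<open>k\<close> for almost all \<open>r\<close>.\<close>

definition right_limit :: "('v \<Rightarrow> real \<Rightarrow> real) \<Rightarrow> 'v \<Rightarrow> real \<Rightarrow> ennreal" where
  "right_limit k \<xi> r = (SUP q\<in>{q::rat. 0 < q}. ennreal (k \<xi> (real_of_rat q)) * indicator {..<real_of_rat q} r)"

lemma right_limit_measurable:
  assumes "\<And>r. r > 0 \<Longrightarrow> (\<lambda>\<xi>. k \<xi> r) \<in> borel_measurable \<sigma>"
  shows "(\<lambda>(\<xi>, r). right_limit k \<xi> r) \<in> borel_measurable (\<sigma> \<Otimes>\<^sub>M borel)"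
proof -
  have "(\<lambda>x. ennreal (k (fst x) (real_of_rat q)) * indicator {..<real_of_rat q} (snd x)) \<in> borel_measurable (\<sigma> \<Otimes>\<^sub>M borel)"
    if "0 < q" for q :: rat
  proof -
    have [measurable]: "(\<lambda>\<xi>. k \<xi> (real_of_rat q)) \<in> borel_measurable \<sigma>" using that by (intro assms) simp
    show ?thesis by measurable
  qed
  then have "(\<lambda>x. SUP q\<in>{q::rat. 0 < q}. ennreal (k (fst x) (real_of_rat q)) * indicator {..<real_of_rat q} (snd x)) \<in> borel_measurable (\<sigma> \<Otimes>\<^sub>M borel)"
    by (intro borel_measurable_SUP) auto
  then show ?thesis by (simp add: right_limit_def case_prod_beta')
qed

lemma right_limit_antimono: "r \<le> s \<Longrightarrow> right_limit k \<xi> s \<le> right_limit k \<xi> r"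
  unfolding right_limit_def by (intro SUP_mono) (auto simp: indicator_def intro!: exI)

lemma right_limit_le:
  assumes "antimono_on {0<..} (k \<xi>)" "r > 0"
  shows "right_limit k \<xi> r \<le> ennreal (k \<xi> r)"
  unfolding right_limit_def
proof (intro SUP_least)
  fix q :: rat assume "q \<in> {q. 0 < q}"
  show "ennreal (k \<xi> (real_of_rat q)) * indicator {..<real_of_rat q} r \<le> ennreal (k \<xi> r)"
  proof (cases "r < real_of_rat q")
    case True
    then have "k \<xi> (real_of_rat q) \<le> k \<xi> r"
      using monotone_onD[OF assms(1), of r "real_of_rat q"] assms(2) \<open>q \<in> {q. 0 < q}\<close> by simp
    then show ?thesis using True by (simp add: ennreal_leI)
  qed simp
qed

lemma right_limit_ge:
  assumes "antimono_on {0<..} (k \<xi>)" "0 < r" "r < s"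
  shows "ennreal (k \<xi> s) \<le> right_limit k \<xi> r"
proof -
  obtain q where q: "r < real_of_rat q" "real_of_rat q < s" using of_rat_dense[OF assms(3)] by blast
  have "0 < real_of_rat q" using q assms by linarith
  then have "0 < q" by simp
  have "k \<xi> s \<le> k \<xi> (real_of_rat q)"
    using monotone_onD[OF assms(1), of "real_of_rat q" s] q assms(2,3) \<open>0 < q\<close> by simp
  then have "ennreal (k \<xi> s) \<le> ennreal (k \<xi> (real_of_rat q)) * indicator {..<real_of_rat q} r"
    using q by (simp add: ennreal_leI)
  also have "\<dots> \<le> right_limit k \<xi> r" unfolding right_limit_def using \<open>0 < q\<close> by (intro SUP_upper) auto
  finally show ?thesis .
qed

text \<open>\<open>F\<close> is squeezed between the values of \<open>f\<close> to the right of
  \<open>r\<close> and the value at \<open>r\<close>, so the two agree wherever \<open>f\<close> is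
  continuous; a monotone function has only countably many discontinuities. It is applied both to a
  kernel in one direction and to \<open>K\<close>.\<close>

lemma antimono_squeeze_countable:
  fixes f :: "real \<Rightarrow> real" and F :: "real \<Rightarrow> ennreal"
  assumes anti: "antimono_on {0<..} f"
    and F: "\<And>r. r > 0 \<Longrightarrow> F r \<le> ennreal (f r)" "\<And>r s. 0 < r \<Longrightarrow> r < s \<Longrightarrow> ennreal (f s) \<le> F r"
  shows "\<exists>N. countable N \<and> (\<forall>r>0. r \<notin> N \<longrightarrow> F r = ennreal (f r))"
proof (intro exI conjI allI impI)
  let ?N = "{a\<in>{0<..}. \<not> continuous (at a within {0<..}) (\<lambda>r. - f r)}"
  show "countable ?N"
    using anti by (intro mono_on_ctble_discont) (auto simp: monotone_on_def)
  fix r :: real assume r: "r > 0" "r \<notin> ?N"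
  then have "continuous (at r within {0<..}) (\<lambda>r. - f r)" by simp
  from continuous_minus[OF this] have "continuous (at r within {0<..}) f" by simp
  then have "(f \<longlongrightarrow> f r) (at r within {0<..})" by (simp add: continuous_within)
  then have "(f \<longlongrightarrow> f r) (at r)" using r by (simp add: at_within_open[of r "{0<..}"])
  then have "(f \<longlongrightarrow> f r) (at_right r)" by (rule filterlim_mono[OF _ order_refl at_le]) simp
  then have "((\<lambda>s. ennreal (f s)) \<longlongrightarrow> ennreal (f r)) (at_right r)" by (rule tendsto_ennrealI)
  moreover have "\<forall>\<^sub>F s in at_right r. ennreal (f s) \<le> F r"
    using eventually_at_right_less[of r] by eventually_elim (use F(2) r in auto)
  ultimately have "ennreal (f r) \<le> F r" by (intro tendsto_upperbound) auto
  with F(1)[OF r(1)] show "F r = ennreal (f r)" by (rule antisym)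
qed

text \<open>Meant for jointly measurable kernels: the product measure with a density then gives
  access to Fubini's theorem, while values in \<open>ennreal\<close> fit the right limits.\<close>

definition polar_measure :: "'v::euclidean_space measure \<Rightarrow> ('v \<Rightarrow> real \<Rightarrow> ennreal) \<Rightarrow> 'v measure" where
  "polar_measure \<sigma> u = distr (density (\<sigma> \<Otimes>\<^sub>M lborel) (\<lambda>(\<xi>, r). u \<xi> r * (ennreal (1 / r) * indicator {0<..} r))) borel
     (\<lambda>(\<xi>, r). r *\<^sub>R \<xi>)"

context
  fixes \<sigma> :: "'v::euclidean_space measure"
  assumes sets_\<sigma>: "sets \<sigma> = sets (restrict_space borel (sphere 0 1))" and fin_\<sigma>: "finite_measure \<sigma>"
begin

lemma id_measurable_sphere: "(\<lambda>\<xi>. \<xi>) \<in> borel_measurable \<sigma>"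
  by (subst measurable_cong_sets[OF sets_\<sigma> refl]) (rule measurable_restrict_space1, simp)

lemma space_sphere: "space \<sigma> = sphere 0 1"
  using sets_eq_imp_space_eq[OF sets_\<sigma>] by (simp add: space_restrict_space)

lemma nn_integral_polar_measure:
  assumes u: "(\<lambda>(\<xi>, r). u \<xi> r) \<in> borel_measurable (\<sigma> \<Otimes>\<^sub>M borel)" and fm [measurable]: "f \<in> borel_measurable borel"
  shows "(\<integral>\<^sup>+x. f x \<partial>polar_measure \<sigma> u) = (\<integral>\<^sup>+\<xi>. \<integral>\<^sup>+r. f (r *\<^sub>R \<xi>) * (u \<xi> r * (ennreal (1 / r) * indicator {0<..} r)) \<partial>lborel \<partial>\<sigma>)"
proof -
  interpret finite_measure \<sigma> by (rule fin_\<sigma>)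
  have "sets (\<sigma> \<Otimes>\<^sub>M lborel) = sets (\<sigma> \<Otimes>\<^sub>M (borel :: real measure))" by (rule sets_pair_measure_cong) simp_all
  from measurable_cong_sets[OF this refl] u
  have [measurable]: "(\<lambda>x. u (fst x) (snd x)) \<in> borel_measurable (\<sigma> \<Otimes>\<^sub>M lborel)"
    by (simp add: case_prod_beta')
  have md: "(\<lambda>(\<xi>, r). u \<xi> r * (ennreal (1 / r) * indicator {0<..} r)) \<in> borel_measurable (\<sigma> \<Otimes>\<^sub>M lborel)"
    by (simp add: case_prod_beta') measurable
  note id_measurable_sphere [measurable]
  have m: "(\<lambda>(\<xi>, r). r *\<^sub>R \<xi>) \<in> borel_measurable (\<sigma> \<Otimes>\<^sub>M lborel)" by measurable
  have m': "(\<lambda>(\<xi>, r). r *\<^sub>R \<xi>) \<in> borel_measurable (density (\<sigma> \<Otimes>\<^sub>M lborel) (\<lambda>(\<xi>, r). u \<xi> r * (ennreal (1 / r) * indicator {0<..} r)))"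
    using m by simp
  have "(\<integral>\<^sup>+x. f x \<partial>polar_measure \<sigma> u) = (\<integral>\<^sup>+x. f (case x of (\<xi>, r) \<Rightarrow> r *\<^sub>R \<xi>) \<partial>density (\<sigma> \<Otimes>\<^sub>M lborel) (\<lambda>(\<xi>, r). u \<xi> r * (ennreal (1 / r) * indicator {0<..} r)))"
    unfolding polar_measure_def by (rule nn_integral_distr[OF m']) (simp add: fm)
  also have "\<dots> = (\<integral>\<^sup>+x. (case x of (\<xi>, r) \<Rightarrow> u \<xi> r * (ennreal (1 / r) * indicator {0<..} r)) * f (case x of (\<xi>, r) \<Rightarrow> r *\<^sub>R \<xi>) \<partial>(\<sigma> \<Otimes>\<^sub>M lborel))"
    by (rule nn_integral_density[OF md measurable_compose[OF m fm]])
  also have "\<dots> = (\<integral>\<^sup>+x. (\<lambda>(\<xi>, r). f (r *\<^sub>R \<xi>) * (u \<xi> r * (ennreal (1 / r) * indicator {0<..} r))) x \<partial>(\<sigma> \<Otimes>\<^sub>M lborel))"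
    by (intro nn_integral_cong) (auto simp: mult.commute)
  also have "\<dots> = (\<integral>\<^sup>+\<xi>. \<integral>\<^sup>+r. f (r *\<^sub>R \<xi>) * (u \<xi> r * (ennreal (1 / r) * indicator {0<..} r)) \<partial>lborel \<partial>\<sigma>)"
    by (subst lborel.nn_integral_fst[symmetric]) (auto simp: case_prod_beta')
  finally show ?thesis .
qed

lemma nn_integral_polar_measure_radial:
  assumes u: "(\<lambda>(\<xi>, r). u \<xi> r) \<in> borel_measurable (\<sigma> \<Otimes>\<^sub>M borel)" and [measurable]: "F \<in> borel_measurable borel"
  shows "(\<integral>\<^sup>+x. F (norm x) \<partial>polar_measure \<sigma> u) = (\<integral>\<^sup>+r. F r * (ennreal (1 / r) * indicator {0<..} r) * (\<integral>\<^sup>+\<xi>. u \<xi> r \<partial>\<sigma>) \<partial>lborel)"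
proof -
  interpret finite_measure \<sigma> by (rule fin_\<sigma>)
  interpret P: pair_sigma_finite \<sigma> "lborel :: real measure" ..
  have "sets (\<sigma> \<Otimes>\<^sub>M lborel) = sets (\<sigma> \<Otimes>\<^sub>M (borel :: real measure))" by (rule sets_pair_measure_cong) simp_all
  from measurable_cong_sets[OF this refl] u
  have [measurable]: "(\<lambda>x. u (fst x) (snd x)) \<in> borel_measurable (\<sigma> \<Otimes>\<^sub>M lborel)"
    by (simp add: case_prod_beta')
  have "(\<integral>\<^sup>+x. F (norm x) \<partial>polar_measure \<sigma> u) = (\<integral>\<^sup>+\<xi>. \<integral>\<^sup>+r. F (norm (r *\<^sub>R \<xi>)) * (u \<xi> r * (ennreal (1 / r) * indicator {0<..} r)) \<partial>lborel \<partial>\<sigma>)"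
    by (rule nn_integral_polar_measure[OF u]) measurable
  also have "\<dots> = (\<integral>\<^sup>+\<xi>. \<integral>\<^sup>+r. F r * (u \<xi> r * (ennreal (1 / r) * indicator {0<..} r)) \<partial>lborel \<partial>\<sigma>)"
    by (intro nn_integral_cong) (auto simp: space_sphere indicator_def)
  also have "\<dots> = (\<integral>\<^sup>+r. \<integral>\<^sup>+\<xi>. F r * (u \<xi> r * (ennreal (1 / r) * indicator {0<..} r)) \<partial>\<sigma> \<partial>lborel)"
    by (rule P.Fubini'[symmetric]) (simp add: case_prod_beta', measurable)
  also have "\<dots> = (\<integral>\<^sup>+r. F r * (ennreal (1 / r) * indicator {0<..} r) * (\<integral>\<^sup>+\<xi>. u \<xi> r \<partial>\<sigma>) \<partial>lborel)"
  proof (intro nn_integral_cong)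
    fix r :: real
    have "(\<lambda>\<xi>. u \<xi> r) \<in> borel_measurable \<sigma>" using measurable_compose[OF measurable_Pair2'[of r borel \<sigma>] u] by simp
    then have "(\<integral>\<^sup>+\<xi>. (F r * (ennreal (1 / r) * indicator {0<..} r)) * u \<xi> r \<partial>\<sigma>) = F r * (ennreal (1 / r) * indicator {0<..} r) * (\<integral>\<^sup>+\<xi>. u \<xi> r \<partial>\<sigma>)"
      by (rule nn_integral_cmult)
    then show "(\<integral>\<^sup>+\<xi>. F r * (u \<xi> r * (ennreal (1 / r) * indicator {0<..} r)) \<partial>\<sigma>) = F r * (ennreal (1 / r) * indicator {0<..} r) * (\<integral>\<^sup>+\<xi>. u \<xi> r \<partial>\<sigma>)"
      by (simp add: mult_ac)
  qed
  finally show ?thesis .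
qed

text \<open>The measure dr / r is invariant under scaling, so scaling by \<open>b\<close> replaces
  \<open>u \<xi> r\<close> by \<open>u \<xi> (r / b)\<close>. Monotonicity of the kernel makes the
  truncated subtraction of \<open>ennreal\<close> a true one.\<close>

lemma polar_measure_split:
  assumes b: "0 < b" "b < 1"
    and u: "(\<lambda>(\<xi>, r). u \<xi> r) \<in> borel_measurable (\<sigma> \<Otimes>\<^sub>M borel)"
    and anti: "\<And>\<xi> r s. \<xi> \<in> sphere 0 1 \<Longrightarrow> 0 < r \<Longrightarrow> r \<le> s \<Longrightarrow> u \<xi> s \<le> u \<xi> r"
    and f [measurable]: "f \<in> borel_measurable borel"
  shows "(\<integral>\<^sup>+x. f x \<partial>polar_measure \<sigma> u) = (\<integral>\<^sup>+x. f x \<partial>polar_measure \<sigma> (\<lambda>\<xi> r. u \<xi> r - u \<xi> (r / b))) + (\<integral>\<^sup>+x. f (b *\<^sub>R x) \<partial>polar_measure \<sigma> u)"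
proof -
  interpret finite_measure \<sigma> by (rule fin_\<sigma>)
  have id [measurable]: "(\<lambda>\<xi>. \<xi>) \<in> borel_measurable \<sigma>" by (rule id_measurable_sphere)
  have u1 [measurable]: "(\<lambda>x. u (fst x) (snd x)) \<in> borel_measurable (\<sigma> \<Otimes>\<^sub>M borel)"
    using u by (simp add: case_prod_beta')
  have "(\<lambda>x. (fst x, snd x / b)) \<in> \<sigma> \<Otimes>\<^sub>M borel \<rightarrow>\<^sub>M \<sigma> \<Otimes>\<^sub>M borel" by measurable
  from measurable_compose[OF this u1] have u2 [measurable]: "(\<lambda>x. u (fst x) (snd x / b)) \<in> borel_measurable (\<sigma> \<Otimes>\<^sub>M borel)" by simp
  have uD: "(\<lambda>(\<xi>, r). u \<xi> r - u \<xi> (r / b)) \<in> borel_measurable (\<sigma> \<Otimes>\<^sub>M borel)"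
    by (simp add: case_prod_beta') measurable
  have sec: "(\<lambda>r. v \<xi> r) \<in> borel_measurable borel" if "(\<lambda>(\<xi>, r). v \<xi> r) \<in> borel_measurable (\<sigma> \<Otimes>\<^sub>M borel)" "\<xi> \<in> space \<sigma>" for v :: "'v \<Rightarrow> real \<Rightarrow> ennreal" and \<xi>
    using measurable_compose[OF measurable_Pair1'[OF that(2)] that(1)] by simp
  have scale: "(\<integral>\<^sup>+r. f (b *\<^sub>R r *\<^sub>R \<xi>) * (u \<xi> r * (ennreal (1 / r) * indicator {0<..} r)) \<partial>lborel)
     = (\<integral>\<^sup>+r. f (r *\<^sub>R \<xi>) * (u \<xi> (r / b) * (ennreal (1 / r) * indicator {0<..} r)) \<partial>lborel)" if "\<xi> \<in> space \<sigma>" for \<xi>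
  proof -
    have [measurable]: "(\<lambda>r. u \<xi> r) \<in> borel_measurable borel" by (rule sec[OF u that])
    have "(\<integral>\<^sup>+r. f (r *\<^sub>R \<xi>) * (u \<xi> (r / b) * (ennreal (1 / r) * indicator {0<..} r)) \<partial>lborel)
        = ennreal \<bar>b\<bar> * (\<integral>\<^sup>+r. f ((0 + b * r) *\<^sub>R \<xi>) * (u \<xi> ((0 + b * r) / b) * (ennreal (1 / (0 + b * r)) * indicator {0<..} (0 + b * r))) \<partial>lborel)"
      using b by (intro nn_integral_real_affine) auto
    also have "\<dots> = (\<integral>\<^sup>+r. ennreal b * (f ((b * r) *\<^sub>R \<xi>) * (u \<xi> r * (ennreal (1 / (b * r)) * indicator {0<..} (b * r)))) \<partial>lborel)"
      using b by (subst nn_integral_cmult) auto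
    also have "\<dots> = (\<integral>\<^sup>+r. f (b *\<^sub>R r *\<^sub>R \<xi>) * (u \<xi> r * (ennreal (1 / r) * indicator {0<..} r)) \<partial>lborel)"
    proof (intro nn_integral_cong)
      fix r :: real
      show "ennreal b * (f ((b * r) *\<^sub>R \<xi>) * (u \<xi> r * (ennreal (1 / (b * r)) * indicator {0<..} (b * r)))) = f (b *\<^sub>R r *\<^sub>R \<xi>) * (u \<xi> r * (ennreal (1 / r) * indicator {0<..} r))"
      proof (cases "r > 0")
        case True
        have "ennreal b * ennreal (1 / (b * r)) = ennreal (1 / r)"
          using b True by (subst ennreal_mult[symmetric]) auto
        then have "ennreal b * (f ((b * r) *\<^sub>R \<xi>) * (u \<xi> r * ennreal (1 / (b * r)))) = f ((b * r) *\<^sub>R \<xi>) * (u \<xi> r * ennreal (1 / r))"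
          by (metis mult.left_commute)
        then show ?thesis using b True by simp
      qed (use b in \<open>auto simp: zero_less_mult_iff\<close>)
    qed
    finally show ?thesis by simp
  qed
  have fb: "(\<lambda>x. f (b *\<^sub>R x)) \<in> borel_measurable borel" by measurable
  have "(\<integral>\<^sup>+x. f x \<partial>polar_measure \<sigma> (\<lambda>\<xi> r. u \<xi> r - u \<xi> (r / b))) + (\<integral>\<^sup>+x. f (b *\<^sub>R x) \<partial>polar_measure \<sigma> u)
      = (\<integral>\<^sup>+\<xi>. \<integral>\<^sup>+r. f (r *\<^sub>R \<xi>) * ((u \<xi> r - u \<xi> (r / b)) * (ennreal (1 / r) * indicator {0<..} r)) \<partial>lborel \<partial>\<sigma>)
      + (\<integral>\<^sup>+\<xi>. \<integral>\<^sup>+r. f (r *\<^sub>R \<xi>) * (u \<xi> (r / b) * (ennreal (1 / r) * indicator {0<..} r)) \<partial>lborel \<partial>\<sigma>)"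
    unfolding nn_integral_polar_measure[OF uD f] nn_integral_polar_measure[OF u fb]
    by (intro arg_cong2[where f="(+)"] refl nn_integral_cong scale)
  also have "\<dots> = (\<integral>\<^sup>+\<xi>. (\<integral>\<^sup>+r. f (r *\<^sub>R \<xi>) * ((u \<xi> r - u \<xi> (r / b)) * (ennreal (1 / r) * indicator {0<..} r)) \<partial>lborel)
      + (\<integral>\<^sup>+r. f (r *\<^sub>R \<xi>) * (u \<xi> (r / b) * (ennreal (1 / r) * indicator {0<..} r)) \<partial>lborel) \<partial>\<sigma>)"
    by (rule nn_integral_add[symmetric]) measurable
  also have "\<dots> = (\<integral>\<^sup>+\<xi>. \<integral>\<^sup>+r. f (r *\<^sub>R \<xi>) * (u \<xi> r * (ennreal (1 / r) * indicator {0<..} r)) \<partial>lborel \<partial>\<sigma>)"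
  proof (intro nn_integral_cong)
    fix \<xi> assume \<xi>: "\<xi> \<in> space \<sigma>"
    have [measurable]: "(\<lambda>r. u \<xi> r) \<in> borel_measurable borel" by (rule sec[OF u \<xi>])
    have "(\<integral>\<^sup>+r. f (r *\<^sub>R \<xi>) * ((u \<xi> r - u \<xi> (r / b)) * (ennreal (1 / r) * indicator {0<..} r)) \<partial>lborel)
      + (\<integral>\<^sup>+r. f (r *\<^sub>R \<xi>) * (u \<xi> (r / b) * (ennreal (1 / r) * indicator {0<..} r)) \<partial>lborel)
      = (\<integral>\<^sup>+r. f (r *\<^sub>R \<xi>) * ((u \<xi> r - u \<xi> (r / b)) * (ennreal (1 / r) * indicator {0<..} r))
       + f (r *\<^sub>R \<xi>) * (u \<xi> (r / b) * (ennreal (1 / r) * indicator {0<..} r)) \<partial>lborel)"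
      by (rule nn_integral_add[symmetric]) measurable
    also have "\<dots> = (\<integral>\<^sup>+r. f (r *\<^sub>R \<xi>) * (u \<xi> r * (ennreal (1 / r) * indicator {0<..} r)) \<partial>lborel)"
    proof (intro nn_integral_cong)
      fix r :: real
      show "f (r *\<^sub>R \<xi>) * ((u \<xi> r - u \<xi> (r / b)) * (ennreal (1 / r) * indicator {0<..} r))
       + f (r *\<^sub>R \<xi>) * (u \<xi> (r / b) * (ennreal (1 / r) * indicator {0<..} r)) = f (r *\<^sub>R \<xi>) * (u \<xi> r * (ennreal (1 / r) * indicator {0<..} r))"
      proof (cases "r > 0")
        case True
        have "r \<le> r / b" using b True by (simp add: field_simps)
        then have "u \<xi> (r / b) \<le> u \<xi> r" using anti \<xi> True by (simp add: space_sphere)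
        then have "u \<xi> r - u \<xi> (r / b) + u \<xi> (r / b) = u \<xi> r" by (rule diff_add_cancel_ennreal)
        then show ?thesis by (metis distrib_left distrib_right)
      qed simp
    qed
    finally show "(\<integral>\<^sup>+r. f (r *\<^sub>R \<xi>) * ((u \<xi> r - u \<xi> (r / b)) * (ennreal (1 / r) * indicator {0<..} r)) \<partial>lborel)
      + (\<integral>\<^sup>+r. f (r *\<^sub>R \<xi>) * (u \<xi> (r / b) * (ennreal (1 / r) * indicator {0<..} r)) \<partial>lborel)
      = (\<integral>\<^sup>+r. f (r *\<^sub>R \<xi>) * (u \<xi> r * (ennreal (1 / r) * indicator {0<..} r)) \<partial>lborel)" .
  qed
  also have "\<dots> = (\<integral>\<^sup>+x. f x \<partial>polar_measure \<sigma> u)" by (rule nn_integral_polar_measure[OF u f, symmetric])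
  finally show ?thesis ..
qed

end

text \<open>Between \<open>r / 2\<close> and \<open>r\<close> the radial density is at least
  \<open>k \<xi> r / r\<close>, so half of the integral is at most the mass that
  \<open>\<nu>\<close> gives to points of norm at least \<open>r / 2\<close>, which is
  finite.\<close>

lemma nonneg_kernel_section_finite:
  fixes \<nu> \<sigma> :: "'v::euclidean_space measure"
  assumes s: "sets \<nu> = sets borel" and levy: "(\<integral>\<^sup>+x. ennreal (min 1 ((norm x)\<^sup>2)) \<partial>\<nu>) < \<infinity>"
    and pol: "polar_decomposition \<nu> \<sigma> k" and r: "r > 0"
  shows "(\<integral>\<^sup>+\<xi>. ennreal (k \<xi> r) \<partial>\<sigma>) < \<infinity>"
proof -
  have [measurable_cong]: "sets \<nu> = sets borel" by (rule s)
  have p: "sets \<sigma> = sets (restrict_space borel (sphere 0 1))" "(\<lambda>\<xi>. k \<xi> r) \<in> borel_measurable \<sigma>"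
    "\<And>\<xi>. \<xi> \<in> sphere 0 1 \<Longrightarrow> antimono_on {0<..} (k \<xi>)" "\<And>\<xi> r. \<xi> \<in> sphere 0 1 \<Longrightarrow> r > 0 \<Longrightarrow> 0 \<le> k \<xi> r"
    "\<And>B. B \<in> sets borel \<Longrightarrow> emeasure \<nu> B = (\<integral>\<^sup>+\<xi>. (\<integral>\<^sup>+r\<in>{0<..}. indicator B (r *\<^sub>R \<xi>) * ennreal (k \<xi> r / r) \<partial>lborel) \<partial>\<sigma>)"
    using pol r unfolding polar_decomposition_def by auto
  have sp: "space \<sigma> = sphere 0 1" using sets_eq_imp_space_eq[OF p(1)] by (simp add: space_restrict_space)
  define B where "B = {x::'v. norm x \<ge> r / 2}"
  have B: "B \<in> sets borel" unfolding B_def by measurable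
  have "ennreal (1/2) * (\<integral>\<^sup>+\<xi>. ennreal (k \<xi> r) \<partial>\<sigma>) = (\<integral>\<^sup>+\<xi>. ennreal (1/2) * ennreal (k \<xi> r) \<partial>\<sigma>)"
    using p(2) by (intro nn_integral_cmult[symmetric]) measurable
  also have "\<dots> \<le> (\<integral>\<^sup>+\<xi>. (\<integral>\<^sup>+r\<in>{0<..}. indicator B (r *\<^sub>R \<xi>) * ennreal (k \<xi> r / r) \<partial>lborel) \<partial>\<sigma>)"
  proof (intro nn_integral_mono)
    fix \<xi> assume "\<xi> \<in> space \<sigma>"
    then have \<xi>: "\<xi> \<in> sphere 0 1" by (simp add: sp)
    have "ennreal (1/2) * ennreal (k \<xi> r) = ennreal (1/2 * k \<xi> r)"
      using p(4)[OF \<xi> r] by (intro ennreal_mult[symmetric]) auto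
    also have "1/2 * k \<xi> r = k \<xi> r / r * (r / 2)" using r by simp
    also have "ennreal (k \<xi> r / r * (r / 2)) = ennreal (k \<xi> r / r) * ennreal (r / 2)"
      using p(4)[OF \<xi> r] r by (intro ennreal_mult) auto
    also have "\<dots> = (\<integral>\<^sup>+t. ennreal (k \<xi> r / r) * indicator {r/2..r} t \<partial>lborel)"
      using r by (subst nn_integral_cmult_indicator) auto
    also have "\<dots> \<le> (\<integral>\<^sup>+r\<in>{0<..}. indicator B (r *\<^sub>R \<xi>) * ennreal (k \<xi> r / r) \<partial>lborel)"
    proof (intro nn_integral_mono)
      fix t :: real
      show "ennreal (k \<xi> r / r) * indicator {r/2..r} t \<le> indicator B (t *\<^sub>R \<xi>) * ennreal (k \<xi> t / t) * indicator {0<..} t"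
      proof (cases "t \<in> {r/2..r}")
        case True
        then have "t > 0" using r by simp
        then have "k \<xi> r \<le> k \<xi> t" using p(3)[OF \<xi>] r True by (auto simp: monotone_on_def)
        then have "k \<xi> r / r \<le> k \<xi> t / t" using p(4)[OF \<xi> r] \<open>t > 0\<close> True by (intro frac_le) auto
        moreover have "t *\<^sub>R \<xi> \<in> B" using \<xi> True \<open>t > 0\<close> by (simp add: B_def)
        ultimately show ?thesis using True \<open>t > 0\<close> by (simp add: ennreal_leI)
      qed simp
    qed
    finally show "ennreal (1/2) * ennreal (k \<xi> r) \<le> (\<integral>\<^sup>+r\<in>{0<..}. indicator B (r *\<^sub>R \<xi>) * ennreal (k \<xi> r / r) \<partial>lborel)" .
  qed
  also have "\<dots> = emeasure \<nu> B" by (rule p(5)[OF B, symmetric])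
  also have "\<dots> < \<infinity>" using r by (intro levy_tail_finite[OF s B levy, of "r / 2"]) (auto simp: B_def)
  finally show ?thesis by (auto simp: ennreal_mult_less_top)
qed

text \<open>Replaces a polar decomposition by a jointly measurable one. The integral of the new
  kernel may differ from \<open>K\<close> at countably many radii, invisible to Lebesgue measure. If
  \<open>\<nu>\<close> is null there is no decomposition to start from, and a zero kernel
  serves.\<close>

lemma radial_function_kernel:
  fixes \<nu> :: "'v::euclidean_space measure"
  assumes s: "sets \<nu> = sets borel" and levy: "(\<integral>\<^sup>+x. ennreal (min 1 ((norm x)\<^sup>2)) \<partial>\<nu>) < \<infinity>"
    and K: "radial_function \<nu> K"
  obtains \<sigma> u where "sets \<sigma> = sets (restrict_space borel (sphere (0::'v) 1))" "finite_measure \<sigma>"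
    "(\<lambda>(\<xi>, r). u \<xi> r) \<in> borel_measurable (\<sigma> \<Otimes>\<^sub>M borel)"
    "\<And>\<xi> r s. \<xi> \<in> sphere 0 1 \<Longrightarrow> 0 < r \<Longrightarrow> r \<le> s \<Longrightarrow> u \<xi> s \<le> u \<xi> r"
    "\<nu> = polar_measure \<sigma> u"
    "\<exists>N. countable N \<and> (\<forall>r>0. r \<notin> N \<longrightarrow> (\<integral>\<^sup>+\<xi>. u \<xi> r \<partial>\<sigma>) = ennreal (K r))"
    "\<And>r. r > 0 \<Longrightarrow> K r \<ge> 0" "antimono_on {0<..} K"
proof (cases "emeasure \<nu> (space \<nu>) = 0")
  case True
  let ?\<sigma> = "null_measure (restrict_space borel (sphere (0::'v) 1))"
  let ?u = "\<lambda>(\<xi>::'v) (r::real). 0::ennreal"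
  have fin: "finite_measure ?\<sigma>" by standard simp
  have um: "(\<lambda>(\<xi>, r). ?u \<xi> r) \<in> borel_measurable (?\<sigma> \<Otimes>\<^sub>M borel)" by simp
  have "\<nu> = polar_measure ?\<sigma> ?u"
  proof (rule measure_eqI)
    show "sets \<nu> = sets (polar_measure ?\<sigma> ?u)" by (simp add: s polar_measure_def)
    fix B assume "B \<in> sets \<nu>"
    then have B: "B \<in> sets borel" by (simp add: s)
    have "emeasure \<nu> B = 0" using True emeasure_mono[OF sets.sets_into_space, of B \<nu> \<nu>] \<open>B \<in> sets \<nu>\<close> by (metis emeasure_space le_zero_eq)
    moreover have "emeasure (polar_measure ?\<sigma> ?u) B = (\<integral>\<^sup>+x. indicator B x \<partial>polar_measure ?\<sigma> ?u)"
      using B by (simp add: polar_measure_def)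
    moreover have "\<dots> = 0" by (subst nn_integral_polar_measure[OF _ fin um]) (use B in auto)
    ultimately show "emeasure \<nu> B = emeasure (polar_measure ?\<sigma> ?u) B" by simp
  qed
  moreover have "K r = 0" if "r > 0" for r using K True that by (simp add: radial_function_def)
  ultimately show ?thesis
    using fin um by (intro that[of ?\<sigma> ?u]) (auto simp: monotone_on_def intro!: exI[of _ "{}"])
next
  case False
  then obtain \<sigma> k where pol: "polar_decomposition \<nu> \<sigma> k" and Kk: "\<And>r. r > 0 \<Longrightarrow> K r = (\<integral>\<xi>. k \<xi> r \<partial>\<sigma>)"
    using K by (auto simp: radial_function_def)
  have p: "sets \<sigma> = sets (restrict_space borel (sphere 0 1))" "finite_measure \<sigma>"
    "\<And>r. r > 0 \<Longrightarrow> (\<lambda>\<xi>. k \<xi> r) \<in> borel_measurable \<sigma>"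
    "\<And>\<xi>. \<xi> \<in> sphere 0 1 \<Longrightarrow> antimono_on {0<..} (k \<xi>)" "\<And>\<xi> r. \<xi> \<in> sphere 0 1 \<Longrightarrow> r > 0 \<Longrightarrow> 0 \<le> k \<xi> r"
    "\<And>B. B \<in> sets borel \<Longrightarrow> emeasure \<nu> B = (\<integral>\<^sup>+\<xi>. (\<integral>\<^sup>+r\<in>{0<..}. indicator B (r *\<^sub>R \<xi>) * ennreal (k \<xi> r / r) \<partial>lborel) \<partial>\<sigma>)"
    using pol unfolding polar_decomposition_def by auto
  interpret \<sigma>: finite_measure \<sigma> by (rule p(2))
  note sp = space_sphere[OF p(1,2)]
  let ?u = "right_limit k"
  have um: "(\<lambda>(\<xi>, r). ?u \<xi> r) \<in> borel_measurable (\<sigma> \<Otimes>\<^sub>M borel)" by (rule right_limit_measurable[OF p(3)])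
  have eqAE: "AE r in lborel. r > 0 \<longrightarrow> ?u \<xi> r = ennreal (k \<xi> r)" if \<xi>: "\<xi> \<in> sphere 0 1" for \<xi>
  proof -
    obtain N where N: "countable N" "\<And>r. r > 0 \<Longrightarrow> r \<notin> N \<Longrightarrow> ?u \<xi> r = ennreal (k \<xi> r)"
      using antimono_squeeze_countable[of "k \<xi>" "?u \<xi>", OF p(4)[OF \<xi>] right_limit_le[where k=k and \<xi>=\<xi>, OF p(4)[OF \<xi>]] right_limit_ge[where k=k and \<xi>=\<xi>, OF p(4)[OF \<xi>]]] by blast
    show ?thesis using countable_real_AE_lborel[OF N(1)] by eventually_elim (use N(2) in auto)
  qed
  have \<nu>: "\<nu> = polar_measure \<sigma> ?u"
  proof (rule measure_eqI)
    show "sets \<nu> = sets (polar_measure \<sigma> ?u)" by (simp add: s polar_measure_def)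
    fix B assume "B \<in> sets \<nu>"
    then have B: "B \<in> sets borel" by (simp add: s)
    have "emeasure (polar_measure \<sigma> ?u) B = (\<integral>\<^sup>+x. indicator B x \<partial>polar_measure \<sigma> ?u)"
      using B by (simp add: polar_measure_def)
    also have "\<dots> = (\<integral>\<^sup>+\<xi>. \<integral>\<^sup>+r. indicator B (r *\<^sub>R \<xi>) * (?u \<xi> r * (ennreal (1 / r) * indicator {0<..} r)) \<partial>lborel \<partial>\<sigma>)"
      by (rule nn_integral_polar_measure[OF p(1,2) um]) (use B in simp)
    also have "\<dots> = emeasure \<nu> B"
      unfolding p(6)[OF B]
    proof (rule nn_integral_cong, rule nn_integral_cong_AE)
      fix \<xi> assume "\<xi> \<in> space \<sigma>"
      then have \<xi>: "\<xi> \<in> sphere 0 1" by (simp add: sp)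
      show "AE r in lborel. indicator B (r *\<^sub>R \<xi>) * (?u \<xi> r * (ennreal (1 / r) * indicator {0<..} r)) = indicator B (r *\<^sub>R \<xi>) * ennreal (k \<xi> r / r) * indicator {0<..} r"
        using eqAE[OF \<xi>]
      proof eventually_elim
        case (elim r)
        show ?case
        proof (cases "r > 0")
          case True
          have "ennreal (k \<xi> r) * ennreal (1 / r) = ennreal (k \<xi> r / r)"
            using p(5)[OF \<xi> True] True by (simp add: ennreal_mult[symmetric])
          then show ?thesis using elim True by simp
        qed simp
      qed
    qed
    finally show "emeasure \<nu> B = emeasure (polar_measure \<sigma> ?u) B" ..
  qed
  have int: "integrable \<sigma> (\<lambda>\<xi>. k \<xi> r)" and Kr: "ennreal (K r) = (\<integral>\<^sup>+\<xi>. ennreal (k \<xi> r) \<partial>\<sigma>)" and K0: "K r \<ge> 0" if r: "r > 0" for r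
  proof -
    have nn: "AE \<xi> in \<sigma>. 0 \<le> k \<xi> r" using p(5)[OF _ r] by (intro AE_I2) (simp add: sp)
    show int: "integrable \<sigma> (\<lambda>\<xi>. k \<xi> r)"
      using nonneg_kernel_section_finite[OF s levy pol r] nn p(3)[OF r]
      by (intro integrableI_nonneg) auto
    show "ennreal (K r) = (\<integral>\<^sup>+\<xi>. ennreal (k \<xi> r) \<partial>\<sigma>)" unfolding Kk[OF r] by (rule nn_integral_eq_integral[OF int nn, symmetric])
    show "K r \<ge> 0" unfolding Kk[OF r] by (rule integral_nonneg_AE[OF nn])
  qed
  have Kanti: "antimono_on {0<..} K"
  proof (rule monotone_onI)
    fix r s :: real assume "r \<in> {0<..}" "s \<in> {0<..}" "r \<le> s"
    then show "K s \<le> K r" using p(4) by (auto simp: Kk sp monotone_on_def intro!: integral_mono int)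
  qed
  have N: "\<exists>N. countable N \<and> (\<forall>r>0. r \<notin> N \<longrightarrow> (\<integral>\<^sup>+\<xi>. ?u \<xi> r \<partial>\<sigma>) = ennreal (K r))"
  proof (rule antimono_squeeze_countable[OF Kanti])
    show "(\<integral>\<^sup>+\<xi>. ?u \<xi> r \<partial>\<sigma>) \<le> ennreal (K r)" if "r > 0" for r
      unfolding Kr[OF that] using p(4) that by (intro nn_integral_mono right_limit_le) (auto simp: sp)
    show "ennreal (K s) \<le> (\<integral>\<^sup>+\<xi>. ?u \<xi> r \<partial>\<sigma>)" if "0 < r" "r < s" for r s
      using Kr[of s] p(4) that by (auto intro!: nn_integral_mono right_limit_ge simp: sp)
  qed
  have anti: "?u \<xi> s \<le> ?u \<xi> r" if "\<xi> \<in> sphere 0 1" "0 < r" "r \<le> s" for \<xi> r s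
    by (rule right_limit_antimono[OF that(3)])
  show ?thesis by (rule that[OF p(1,2) um anti \<nu> N K0 Kanti])
qed

text \<open>\<open>\<nu>'\<close> is \<open>\<nu>\<close> minus its image under scaling by
  \<open>b\<close>; with \<open>b = exp (- (H * real l))\<close> it becomes the Levy measure of the
  increment law. The relation is stated additively because both measures may be infinite.\<close>

lemma radial_function_split:
  fixes \<nu> :: "'v::euclidean_space measure"
  assumes s: "sets \<nu> = sets borel" and levy: "(\<integral>\<^sup>+x. ennreal (min 1 ((norm x)\<^sup>2)) \<partial>\<nu>) < \<infinity>"
    and K: "radial_function \<nu> K" and b: "0 < b" "b < 1"
  obtains \<nu>' where "sets \<nu>' = sets borel"
    "\<And>f. f \<in> borel_measurable borel \<Longrightarrow> (\<integral>\<^sup>+x. f x \<partial>\<nu>) = (\<integral>\<^sup>+x. f x \<partial>\<nu>') + (\<integral>\<^sup>+x. f (b *\<^sub>R x) \<partial>\<nu>)"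
    "\<And>F. F \<in> borel_measurable borel \<Longrightarrow> (\<integral>\<^sup>+x\<in>{x. norm x > 1}. F (norm x) \<partial>\<nu>') = (\<integral>\<^sup>+r\<in>{1..}. F r * ennreal ((K r - K (r / b)) / r) \<partial>lborel)"
    "\<And>r. r > 0 \<Longrightarrow> K r \<ge> 0" "antimono_on {0<..} K"
proof -
  obtain \<sigma> u where *: "sets \<sigma> = sets (restrict_space borel (sphere (0::'v) 1))" "finite_measure \<sigma>"
    "(\<lambda>(\<xi>, r). u \<xi> r) \<in> borel_measurable (\<sigma> \<Otimes>\<^sub>M borel)"
    "\<And>\<xi> r s. \<xi> \<in> sphere 0 1 \<Longrightarrow> 0 < r \<Longrightarrow> r \<le> s \<Longrightarrow> u \<xi> s \<le> u \<xi> r"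
    "\<nu> = polar_measure \<sigma> u"
    and exN: "\<exists>N. countable N \<and> (\<forall>r>0. r \<notin> N \<longrightarrow> (\<integral>\<^sup>+\<xi>. u \<xi> r \<partial>\<sigma>) = ennreal (K r))"
    and K0: "\<And>r. r > 0 \<Longrightarrow> K r \<ge> 0" and Kanti: "antimono_on {0<..} K"
    by (rule radial_function_kernel[OF s levy K]) (rule that)
  from exN obtain N where N: "countable N" "\<And>r. r > 0 \<Longrightarrow> r \<notin> N \<Longrightarrow> (\<integral>\<^sup>+\<xi>. u \<xi> r \<partial>\<sigma>) = ennreal (K r)" by blast
  let ?D = "\<lambda>\<xi> r. u \<xi> r - u \<xi> (r / b)"
  note sp = space_sphere[OF *(1,2)]
  have u1: "(\<lambda>x. u (fst x) (snd x)) \<in> borel_measurable (\<sigma> \<Otimes>\<^sub>M borel)" using *(3) by (simp add: case_prod_beta')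
  have "(\<lambda>x. (fst x, snd x / b)) \<in> \<sigma> \<Otimes>\<^sub>M borel \<rightarrow>\<^sub>M \<sigma> \<Otimes>\<^sub>M borel" by measurable
  from measurable_compose[OF this u1] have u2: "(\<lambda>x. u (fst x) (snd x / b)) \<in> borel_measurable (\<sigma> \<Otimes>\<^sub>M borel)" by simp
  have Dm: "(\<lambda>(\<xi>, r). ?D \<xi> r) \<in> borel_measurable (\<sigma> \<Otimes>\<^sub>M borel)"
    unfolding case_prod_beta' using u1 u2 by measurable
  have sec: "(\<lambda>\<xi>. v \<xi> r) \<in> borel_measurable \<sigma>" if "(\<lambda>(\<xi>, r). v \<xi> r) \<in> borel_measurable (\<sigma> \<Otimes>\<^sub>M borel)" for v :: "'v \<Rightarrow> real \<Rightarrow> ennreal" and r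
    using measurable_compose[OF measurable_Pair2'[of r borel \<sigma>] that] by simp
  have D: "(\<integral>\<^sup>+\<xi>. ?D \<xi> r \<partial>\<sigma>) = ennreal (K r - K (r / b))" if r: "r > 0" "r \<notin> N" "r / b \<notin> N" for r
  proof -
    have "r \<le> r / b" "r / b > 0" using b r by (auto simp: field_simps)
    have "(\<integral>\<^sup>+\<xi>. ?D \<xi> r \<partial>\<sigma>) + ennreal (K (r / b)) = (\<integral>\<^sup>+\<xi>. ?D \<xi> r + u \<xi> (r / b) \<partial>\<sigma>)"
      unfolding N(2)[OF \<open>r / b > 0\<close> r(3), symmetric] by (rule nn_integral_add[symmetric]) (rule sec[OF Dm], rule sec[OF *(3)])
    also have "\<dots> = (\<integral>\<^sup>+\<xi>. u \<xi> r \<partial>\<sigma>)"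
      by (intro nn_integral_cong diff_add_cancel_ennreal *(4) r \<open>r \<le> r / b\<close>) (simp add: sp)
    also have "\<dots> = ennreal (K r - K (r / b)) + ennreal (K (r / b))"
      unfolding N(2)[OF r(1,2)] using K0[OF \<open>r / b > 0\<close>] Kanti r \<open>r \<le> r / b\<close>
      by (subst ennreal_plus[symmetric]) (auto simp: monotone_on_def)
    finally have "(\<integral>\<^sup>+\<xi>. ?D \<xi> r \<partial>\<sigma>) + ennreal (K (r / b)) = ennreal (K r - K (r / b)) + ennreal (K (r / b))" .
    from arg_cong[OF this, of "\<lambda>x. x - ennreal (K (r / b))"] show ?thesis by simp
  qed
  \<comment> \<open>These are the radii \<open>r\<close> with \<open>r / b \<in> N\<close>; together
    with \<open>N\<close> they form the exceptional set for the difference kernel.\<close>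
  have N': "countable ((\<lambda>r. b * r) ` N)" using N(1) by simp
  show ?thesis
  proof (rule that[of "polar_measure \<sigma> ?D"])
    show "sets (polar_measure \<sigma> ?D) = sets borel" by (simp add: polar_measure_def)
    show "(\<integral>\<^sup>+x. f x \<partial>\<nu>) = (\<integral>\<^sup>+x. f x \<partial>polar_measure \<sigma> ?D) + (\<integral>\<^sup>+x. f (b *\<^sub>R x) \<partial>\<nu>)"
      if "f \<in> borel_measurable borel" for f
      unfolding *(5) by (rule polar_measure_split[OF *(1,2) b *(3,4) that])
    show "(\<integral>\<^sup>+x\<in>{x. norm x > 1}. F (norm x) \<partial>polar_measure \<sigma> ?D) = (\<integral>\<^sup>+r\<in>{1..}. F r * ennreal ((K r - K (r / b)) / r) \<partial>lborel)"
      if [measurable]: "F \<in> borel_measurable borel" for F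
    proof -
      have "(\<integral>\<^sup>+x\<in>{x. norm x > 1}. F (norm x) \<partial>polar_measure \<sigma> ?D) = (\<integral>\<^sup>+x. (\<lambda>r. F r * indicator {1<..} r) (norm x) \<partial>polar_measure \<sigma> ?D)"
        by (intro nn_integral_cong) (auto simp: indicator_def)
      also have "\<dots> = (\<integral>\<^sup>+r. (F r * indicator {1<..} r) * (ennreal (1 / r) * indicator {0<..} r) * (\<integral>\<^sup>+\<xi>. ?D \<xi> r \<partial>\<sigma>) \<partial>lborel)"
        by (rule nn_integral_polar_measure_radial[OF *(1,2) Dm]) measurable
      also have "\<dots> = (\<integral>\<^sup>+r\<in>{1..}. F r * ennreal ((K r - K (r / b)) / r) \<partial>lborel)"
      proof (rule nn_integral_cong_AE)
        have "AE r in lborel. r \<noteq> (1::real)" using countable_real_AE_lborel[of "{1}"] by simp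
        with countable_real_AE_lborel[OF N(1)] countable_real_AE_lborel[OF N']
        show "AE r in lborel. (F r * indicator {1<..} r) * (ennreal (1 / r) * indicator {0<..} r) * (\<integral>\<^sup>+\<xi>. ?D \<xi> r \<partial>\<sigma>) = F r * ennreal ((K r - K (r / b)) / r) * indicator {1..} r"
        proof eventually_elim
          case (elim r)
          show ?case
          proof (cases "r > 1")
            case True
            have "r / b \<notin> N" using elim(2) b by (auto simp: image_iff)
            moreover have "K (r / b) \<le> K r"
              using True b by (intro monotone_onD[OF Kanti]) (auto simp: field_simps)
            then have "ennreal (1 / r) * ennreal (K r - K (r / b)) = ennreal ((K r - K (r / b)) / r)"
              using True by (subst ennreal_mult''[symmetric]) (auto simp: divide_nonneg_pos mult.commute)
            ultimately show ?thesis using D[of r] elim True by (simp add: mult.assoc)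
          qed (use elim in auto)
        qed
      qed
      finally show ?thesis .
    qed
  qed (use K0 Kanti in auto)
qed

section \<open>The radial integral test\<close>

text \<open>Taylor's formula gives a quadratic bound inside the unit ball, and outside it the
  modulus is at most 2. Integrability permits taking the real part under the integral.\<close>

lemma integrable_levy_integrand:
  fixes \<nu> :: "'v::euclidean_space measure"
  assumes s: "sets \<nu> = sets borel" and levy: "(\<integral>\<^sup>+x. ennreal (min 1 ((norm x)\<^sup>2)) \<partial>\<nu>) < \<infinity>"
  shows "integrable \<nu> (\<lambda>x. iexp (z \<bullet> x) - 1 - (if norm x \<le> 1 then \<i> * complex_of_real (z \<bullet> x) else 0))"
proof (rule Bochner_Integration.integrable_bound[OF levy_integrable(1)[OF s levy, of z]])
  have [measurable_cong]: "sets \<nu> = sets borel" by (rule s)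
  show "(\<lambda>x. iexp (z \<bullet> x) - 1 - (if norm x \<le> 1 then \<i> * complex_of_real (z \<bullet> x) else 0)) \<in> borel_measurable \<nu>"
    by measurable
  show "AE x in \<nu>. norm (iexp (z \<bullet> x) - 1 - (if norm x \<le> 1 then \<i> * complex_of_real (z \<bullet> x) else 0)) \<le> norm ((2 + (norm z)\<^sup>2) * min 1 ((norm x)\<^sup>2))"
  proof (rule AE_I2)
    fix x
    show "norm (iexp (z \<bullet> x) - 1 - (if norm x \<le> 1 then \<i> * complex_of_real (z \<bullet> x) else 0)) \<le> norm ((2 + (norm z)\<^sup>2) * min 1 ((norm x)\<^sup>2))"
    proof (cases "norm x \<le> 1")
      case True
      have "norm (iexp (z \<bullet> x) - (\<Sum>k\<le>1. (\<i> * complex_of_real (z \<bullet> x)) ^ k / fact k)) \<le> \<bar>z \<bullet> x\<bar> ^ Suc 1 / fact (Suc 1)"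
        by (rule iexp_approx1)
      then have "norm (iexp (z \<bullet> x) - 1 - \<i> * complex_of_real (z \<bullet> x)) \<le> (z \<bullet> x)\<^sup>2 / 2"
        by (simp add: diff_diff_eq power2_eq_square)
      also have "(z \<bullet> x)\<^sup>2 \<le> (norm z * norm x)\<^sup>2"
        using Cauchy_Schwarz_ineq2[of z x] by (simp add: abs_le_square_iff[symmetric])
      finally have "norm (iexp (z \<bullet> x) - 1 - \<i> * complex_of_real (z \<bullet> x)) \<le> (norm z * norm x)\<^sup>2 / 2" by simp
      also have "\<dots> \<le> (norm z)\<^sup>2 * (norm x)\<^sup>2" by (simp add: power_mult_distrib)
      also have "\<dots> \<le> (2 + (norm z)\<^sup>2) * (norm x)\<^sup>2" by (intro mult_right_mono) auto
      finally have "norm (iexp (z \<bullet> x) - 1 - \<i> * complex_of_real (z \<bullet> x)) \<le> (2 + (norm z)\<^sup>2) * (norm x)\<^sup>2" .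
      moreover have "min 1 ((norm x)\<^sup>2) = (norm x)\<^sup>2" using True by (intro min_absorb2 power_le_one) auto
      ultimately show ?thesis using True by (simp add: abs_mult)
    next
      case False
      have "norm (iexp (z \<bullet> x) - 1) \<le> norm (iexp (z \<bullet> x)) + norm (1::complex)" by (rule norm_triangle_ineq4)
      then have "norm (iexp (z \<bullet> x) - 1) \<le> 2" by simp
      also have "2 \<le> 2 + (norm z)\<^sup>2" by simp
      finally have "norm (iexp (z \<bullet> x) - 1) \<le> 2 + (norm z)\<^sup>2" .
      moreover have "min 1 ((norm x)\<^sup>2) = 1" using False by (simp add: min_def)
      ultimately show ?thesis using False by (simp add: abs_mult)
    qed
  qed
qed

text \<open>The drift and the centring term are purely imaginary and vanish from the modulus. Its
  square is the characteristic function of the symmetrized law, hence the factor 2.\<close>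

lemma norm_char_fun_levy:
  fixes \<mu> \<nu> :: "'v::euclidean_space measure"
  assumes "levy_measure_of \<mu> \<nu>"
  obtains A where "linear A" "\<And>x y. A x \<bullet> y = x \<bullet> A y" "\<And>x. 0 \<le> x \<bullet> A x"
    "\<And>z. (norm (char_fun \<mu> z))\<^sup>2 = exp (- (z \<bullet> A z) - 2 * (\<integral>x. 1 - cos (z \<bullet> x) \<partial>\<nu>))"
proof -
  let ?g = "\<lambda>z x. iexp (z \<bullet> x) - 1 - (if norm x \<le> 1 then \<i> * complex_of_real (z \<bullet> x) else 0)"
  from assms obtain A \<gamma> where s: "sets \<nu> = sets borel" and levy: "(\<integral>\<^sup>+x. ennreal (min 1 ((norm x)\<^sup>2)) \<partial>\<nu>) < \<infinity>"
    and A: "linear A" "\<And>x y. A x \<bullet> y = x \<bullet> A y" "\<And>x. 0 \<le> x \<bullet> A x"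
    and char: "\<And>z. char_fun \<mu> z = exp (- complex_of_real ((z \<bullet> A z) / 2) + \<i> * complex_of_real (\<gamma> \<bullet> z) + (CLINT x|\<nu>. ?g z x))"
    unfolding levy_measure_of_def by blast
  show ?thesis
  proof (rule that[OF A])
    fix z
    have "Re (CLINT x|\<nu>. ?g z x) = (\<integral>x. Re (?g z x) \<partial>\<nu>)"
      by (rule integral_Re[OF integrable_levy_integrand[OF s levy], symmetric])
    also have "\<dots> = (\<integral>x. - (1 - cos (z \<bullet> x)) \<partial>\<nu>)"
      by (intro Bochner_Integration.integral_cong) (auto simp: Re_exp)
    also have "\<dots> = - (\<integral>x. 1 - cos (z \<bullet> x) \<partial>\<nu>)" by (rule integral_minus)
    finally have Re: "Re (CLINT x|\<nu>. ?g z x) = - (\<integral>x. 1 - cos (z \<bullet> x) \<partial>\<nu>)" .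
    have "norm (char_fun \<mu> z) = exp (- (z \<bullet> A z) / 2 - (\<integral>x. 1 - cos (z \<bullet> x) \<partial>\<nu>))"
      unfolding char norm_exp_eq_Re by (simp add: Re)
    then show "(norm (char_fun \<mu> z))\<^sup>2 = exp (- (z \<bullet> A z) - 2 * (\<integral>x. 1 - cos (z \<bullet> x) \<partial>\<nu>))"
      by (simp add: exp_double[symmetric] algebra_simps)
  qed
qed

section \<open>The increment law and its Levy measure\<close>

context ss_additive
begin

text \<open>Time 0 is fixed under scaling, so \<open>X 0\<close> has the law of every multiple
  \<open>c powr H *\<^sub>R X 0\<close>; the probability of exceeding a positive level equals that
  of exceeding arbitrarily large levels.\<close>

lemma AE_X0: "AE \<omega> in M. X 0 \<omega> = 0"
proof -
  have zero: "prob {\<omega>\<in>space M. norm (X 0 \<omega>) > a} = 0" if a: "a > 0" for a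
  proof -
    have "prob {\<omega>\<in>space M. norm (X 0 \<omega>) > a} = prob {\<omega>\<in>space M. norm (X 0 \<omega>) > a * real (Suc n)}" for n
    proof -
      define c where "c = (1 / real (Suc n)) powr (1 / H)"
      have c: "c > 0" "c powr H = 1 / real (Suc n)" using H_pos by (auto simp: c_def powr_powr)
      have "prob {\<omega>\<in>space M. norm (X 0 \<omega>) > a} = prob {\<omega>\<in>space M. norm (c powr H *\<^sub>R X 0 \<omega>) > a}"
        by (intro prob_norm_eq_if_distr_eq distr_scale_value(2) c borel_measurable_scaleR borel_measurable_const X_measurable) auto
      also have "{\<omega>\<in>space M. norm (c powr H *\<^sub>R X 0 \<omega>) > a} = {\<omega>\<in>space M. norm (X 0 \<omega>) > a * real (Suc n)}"
        unfolding c(2) by (auto simp: field_simps)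
      finally show ?thesis .
    qed
    moreover have "(\<lambda>n. prob {\<omega>\<in>space M. norm (X 0 \<omega>) > a * real (Suc n)}) \<longlonglongrightarrow> 0"
    proof (rule filterlim_compose[OF prob_norm_gt_tendsto_0])
      show "X 0 \<in> borel_measurable M" by (rule X_measurable) simp
      show "filterlim (\<lambda>n. a * real (Suc n)) at_top sequentially" using a by real_asymp
    qed
    ultimately have "(\<lambda>n::nat. prob {\<omega>\<in>space M. norm (X 0 \<omega>) > a}) \<longlonglongrightarrow> 0" by simp
    then show ?thesis by (simp add: LIMSEQ_const_iff)
  qed
  have "AE \<omega> in M. norm (X 0 \<omega>) \<le> 1 / real (Suc n)" for n
  proof -
    have [measurable]: "X 0 \<in> borel_measurable M" by (rule X_measurable) simp
    have "prob {\<omega>\<in>space M. norm (X 0 \<omega>) > 1 / real (Suc n)} = 0" by (rule zero) simp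
    then have "{\<omega>\<in>space M. norm (X 0 \<omega>) > 1 / real (Suc n)} \<in> null_sets M"
      by (auto simp: null_sets_def emeasure_eq_measure)
    then have "AE \<omega> in M. \<omega> \<notin> {\<omega>\<in>space M. norm (X 0 \<omega>) > 1 / real (Suc n)}" by (rule AE_not_in)
    with AE_space show ?thesis by eventually_elim (auto simp: not_less)
  qed
  then have "AE \<omega> in M. \<forall>n. norm (X 0 \<omega>) \<le> 1 / real (Suc n)" by (simp add: AE_all_countable)
  then show ?thesis
  proof eventually_elim
    case (elim \<omega>)
    have "norm (X 0 \<omega>) \<le> 0"
      by (rule LIMSEQ_le_const[OF LIMSEQ_Suc[OF lim_1_over_n]]) (use elim in auto)
    then show ?case by simp
  qed
qed

text \<open>\<open>X 1\<close> is the sum of its value at time \<open>b = exp (- real l)\<close> and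
  an increment. Independence is available for increments only, so the value is read as an increment
  from time 0, where \<open>X\<close> vanishes almost surely; its law is that of
  \<open>b powr H *\<^sub>R X 1\<close>.\<close>

lemma char_fun_decomposition:
  assumes l: "l \<ge> 1"
  shows "char_fun (distr M borel (X 1)) z = char_fun (distr M borel (X 1)) (exp (- (H * real l)) *\<^sub>R z) * char_fun (rho M X l) z"
proof -
  define b where "b = exp (- real l)"
  have b: "0 < b" "b < 1" "b powr H = exp (- (H * real l))" using l by (auto simp: b_def powr_def mult.commute)
  define t where "t i = (if i = 0 then 0 else if i = 1 then b else 1)" for i :: nat
  define D where "D i \<omega> = X (t (Suc i)) \<omega> - X (t i) \<omega>" for i \<omega>
  have ind: "indep_vars (\<lambda>_. borel) D {..<2}"
    unfolding D_def using b by (intro indep_increments) (auto simp: t_def less_2_cases_iff)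
  have D: "D 0 = (\<lambda>\<omega>. X b \<omega> - X 0 \<omega>)" "D 1 = (\<lambda>\<omega>. X 1 \<omega> - X b \<omega>)" by (auto simp: D_def t_def)
  have Xm [measurable]: "X b \<in> borel_measurable M" "X 0 \<in> borel_measurable M" "X 1 \<in> borel_measurable M"
    using b by (auto intro!: X_measurable)
  have Dm [measurable]: "D 0 \<in> borel_measurable M" "D 1 \<in> borel_measurable M" unfolding D by measurable
  have "indep_var (PiM {0} (\<lambda>_. borel)) (\<lambda>\<omega>. restrict (\<lambda>i. D i \<omega>) {0}) (PiM {1} (\<lambda>_. borel)) (\<lambda>\<omega>. restrict (\<lambda>i. D i \<omega>) {1})"
    by (rule indep_var_restrict[OF ind]) auto
  then have "indep_var borel ((\<lambda>w. w 0) \<circ> (\<lambda>\<omega>. restrict (\<lambda>i. D i \<omega>) {0})) borel ((\<lambda>w. w 1) \<circ> (\<lambda>\<omega>. restrict (\<lambda>i. D i \<omega>) {1}))"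
    by (rule indep_var_compose) (auto intro: measurable_component_singleton)
  then have "indep_var borel (D 0) borel (D 1)" by (simp add: comp_def)
  then have pair: "distr M borel (D 0) \<Otimes>\<^sub>M distr M borel (D 1) = distr M (borel \<Otimes>\<^sub>M borel) (\<lambda>\<omega>. (D 0 \<omega>, D 1 \<omega>))"
    by (subst (asm) indep_var_distribution_eq) simp
  have prob: "borel_prob (distr M borel Y)" if "Y \<in> borel_measurable M" for Y :: "'w \<Rightarrow> 'v"
    using that by (simp add: borel_prob_def prob_space_distr)
  have "distr M borel (X 1) = distr M borel (\<lambda>\<omega>. D 0 \<omega> + D 1 \<omega>)"
  proof (rule distr_cong_AE)
    show "AE \<omega> in M. X 1 \<omega> = D 0 \<omega> + D 1 \<omega>" unfolding D using AE_X0 by eventually_elim simp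
    show "(\<lambda>\<omega>. D 0 \<omega> + D 1 \<omega>) \<in> borel_measurable M" by measurable
  qed auto
  also have "\<dots> = conv (distr M borel (D 0)) (distr M borel (D 1))"
  proof -
    have "(\<lambda>(x, y). x + y) \<in> borel_measurable (borel \<Otimes>\<^sub>M (borel :: 'v measure))" by measurable
    moreover have "(\<lambda>\<omega>. (D 0 \<omega>, D 1 \<omega>)) \<in> M \<rightarrow>\<^sub>M borel \<Otimes>\<^sub>M borel" by (intro measurable_Pair Dm)
    ultimately show ?thesis unfolding conv_def pair by (subst distr_distr) (assumption | simp add: comp_def)+
  qed
  finally have "char_fun (distr M borel (X 1)) z = char_fun (distr M borel (D 0)) z * char_fun (distr M borel (D 1)) z"
    by (simp only: char_fun_conv[OF prob[OF Dm(1)] prob[OF Dm(2)]])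
  moreover have "distr M borel (D 0) = distr M borel (X b)"
    using AE_X0 by (intro distr_cong_AE) (auto simp: D elim!: eventually_mono)
  moreover have "char_fun (distr M borel (X b)) z = char_fun (distr M borel (X 1)) (exp (- (H * real l)) *\<^sub>R z)"
  proof -
    have "char_fun (distr M borel (X b)) z = char_fun (distr M borel (\<lambda>\<omega>. b powr H *\<^sub>R X 1 \<omega>)) z"
      by (simp add: distr_scale_value(1)[OF b(1)])
    also have "\<dots> = (CLINT \<omega>|M. iexp (z \<bullet> (b powr H *\<^sub>R X 1 \<omega>)))"
      unfolding char_fun_def by (rule integral_distr) measurable
    also have "\<dots> = (CLINT \<omega>|M. iexp ((b powr H *\<^sub>R z) \<bullet> X 1 \<omega>))" by simp
    also have "\<dots> = char_fun (distr M borel (X 1)) (b powr H *\<^sub>R z)"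
      unfolding char_fun_def by (rule integral_distr[symmetric]) measurable
    finally show ?thesis by (simp add: b)
  qed
  moreover have "rho M X l = distr M borel (D 1)" unfolding rho_def D(2) b_def ..
  ultimately show ?thesis by simp
qed

text \<open>The squared moduli for \<open>X 1\<close> are exponentials and never vanish, so dividing
  in the decomposition identifies the symmetrized increment law: quadratic form
  \<open>(1 - b\<^sup>2)\<close> times the Gaussian one, Levy measure \<open>\<nu>'\<close>. The
  second claim says that \<open>\<nu>'\<close> has finite mass outside the unit ball; it absorbs the
  constant in the weight later.\<close>

lemma rho_moment_iff:
  assumes l: "l \<ge> 1" and \<nu>: "levy_measure_of (distr M borel (X 1)) \<nu>" and K: "radial_function \<nu> K"
    and \<phi>: "submult_weight \<phi> c"
  shows "(\<integral>\<^sup>+x. ennreal (\<phi> (norm x)) \<partial>rho M X l) < \<infinity> \<longleftrightarrow>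
      (\<integral>\<^sup>+r\<in>{1..}. ennreal (\<phi> r) * ennreal ((K r - K (exp (H * real l) * r)) / r) \<partial>lborel) < \<infinity>"
    and "(\<integral>\<^sup>+r\<in>{1..}. ennreal ((K r - K (exp (H * real l) * r)) / r) \<partial>lborel) < \<infinity>"
    and "\<And>r. r > 0 \<Longrightarrow> K r \<ge> 0" "antimono_on {0<..} K"
proof -
  interpret submult_weight \<phi> c by (rule \<phi>)
  define b where "b = exp (- (H * real l))"
  have b: "0 < b" "b < 1" using l H_pos by (auto simp: b_def)
  have rb: "r / b = exp (H * real l) * r" for r by (simp add: b_def exp_minus field_simps)
  have s: "sets \<nu> = sets borel" and levy: "(\<integral>\<^sup>+x. ennreal (min 1 ((norm x)\<^sup>2)) \<partial>\<nu>) < \<infinity>"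
    using \<nu> by (auto simp: levy_measure_of_def)
  have [measurable_cong]: "sets \<nu> = sets borel" by (rule s)
  obtain \<nu>' where s': "sets \<nu>' = sets borel"
    and split: "\<And>f. f \<in> borel_measurable borel \<Longrightarrow> (\<integral>\<^sup>+x. f x \<partial>\<nu>) = (\<integral>\<^sup>+x. f x \<partial>\<nu>') + (\<integral>\<^sup>+x. f (b *\<^sub>R x) \<partial>\<nu>)"
    and rad: "\<And>F. F \<in> borel_measurable borel \<Longrightarrow> (\<integral>\<^sup>+x\<in>{x. norm x > 1}. F (norm x) \<partial>\<nu>') = (\<integral>\<^sup>+r\<in>{1..}. F r * ennreal ((K r - K (r / b)) / r) \<partial>lborel)"
    and K0: "\<And>r. r > 0 \<Longrightarrow> K r \<ge> 0" and Kanti: "antimono_on {0<..} K"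
    by (rule radial_function_split[OF s levy K b]) (rule that)
  have [measurable_cong]: "sets \<nu>' = sets borel" by (rule s')
  have levy': "(\<integral>\<^sup>+x. ennreal (min 1 ((norm x)\<^sup>2)) \<partial>\<nu>') < \<infinity>"
    using levy by (subst (asm) split) (auto simp: ennreal_add_less_top)
  obtain A where A: "linear A" "\<And>x y. A x \<bullet> y = x \<bullet> A y" "\<And>x. 0 \<le> x \<bullet> A x"
    and char_\<mu>: "\<And>z. (norm (char_fun (distr M borel (X 1)) z))\<^sup>2 = exp (- (z \<bullet> A z) - 2 * (\<integral>x. 1 - cos (z \<bullet> x) \<partial>\<nu>))"
    by (rule norm_char_fun_levy[OF \<nu>]) (rule that)
  interpret A: linear A by (rule A(1))
  have b2: "b\<^sup>2 \<le> 1" using b by (intro power_le_one) auto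
  \<comment> \<open>Replacing \<open>z\<close> by \<open>b *\<^sub>R z\<close> multiplies the
    quadratic form by \<open>b\<^sup>2\<close>; the difference remains nonnegative because
    \<open>b < 1\<close>.\<close>
  obtain bs where bs: "\<And>z. z \<bullet> ((1 - b\<^sup>2) *\<^sub>R A z) = (\<Sum>v\<leftarrow>bs. (z \<bullet> v)\<^sup>2)"
    using psd_form_eq_sum_squares[of "\<lambda>z. (1 - b\<^sup>2) *\<^sub>R A z"] A b2
    by (auto intro: linear_compose_scale_right)
  have rho: "borel_prob (rho M X l)" using rho_prob_space[of l] by (simp add: borel_prob_def rho_def)
  \<comment> \<open>\<open>split\<close> concerns nonnegative integrals, so the real integrals are
    routed through \<open>ennreal\<close>, all of them being finite.\<close>
  have cos_split: "(\<integral>x. 1 - cos (z \<bullet> x) \<partial>\<nu>) = (\<integral>x. 1 - cos (z \<bullet> x) \<partial>\<nu>') + (\<integral>x. 1 - cos ((b *\<^sub>R z) \<bullet> x) \<partial>\<nu>)" for z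
  proof -
    have nn: "(\<integral>\<^sup>+x. ennreal (1 - cos (z \<bullet> x)) \<partial>N) = ennreal (\<integral>x. 1 - cos (z \<bullet> x) \<partial>N)"
      if "sets N = sets borel" "(\<integral>\<^sup>+x. ennreal (min 1 ((norm x)\<^sup>2)) \<partial>N) < \<infinity>" for N and z :: 'v
      by (rule nn_integral_eq_integral[OF levy_integrable(2)[OF that]]) auto
    have pos: "0 \<le> (\<integral>x. 1 - cos (z \<bullet> x) \<partial>N)" for N and z :: 'v by (rule integral_nonneg_AE) auto
    have "ennreal (\<integral>x. 1 - cos (z \<bullet> x) \<partial>\<nu>) = (\<integral>\<^sup>+x. ennreal (1 - cos (z \<bullet> x)) \<partial>\<nu>') + (\<integral>\<^sup>+x. ennreal (1 - cos (z \<bullet> (b *\<^sub>R x))) \<partial>\<nu>)"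
      unfolding nn[OF s levy, symmetric] by (rule split) measurable
    also have "\<dots> = ennreal (\<integral>x. 1 - cos (z \<bullet> x) \<partial>\<nu>') + ennreal (\<integral>x. 1 - cos ((b *\<^sub>R z) \<bullet> x) \<partial>\<nu>)"
      using nn[OF s' levy', of z] nn[OF s levy, of "b *\<^sub>R z"] by simp
    also have "\<dots> = ennreal ((\<integral>x. 1 - cos (z \<bullet> x) \<partial>\<nu>') + (\<integral>x. 1 - cos ((b *\<^sub>R z) \<bullet> x) \<partial>\<nu>))"
      by (rule ennreal_plus[symmetric]) (rule pos)+
    finally show ?thesis by (subst (asm) ennreal_inj) (intro pos add_nonneg_nonneg)+
  qed
  have "char_fun (conv (rho M X l) (distr (rho M X l) borel uminus)) z
      = of_real (exp (- (\<Sum>v\<leftarrow>bs. (z \<bullet> v)\<^sup>2) - 2 * (\<integral>x. 1 - cos (z \<bullet> x) \<partial>\<nu>')))" for z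
  proof -
    let ?N = "\<lambda>z. (norm (char_fun (distr M borel (X 1)) z))\<^sup>2"
    have "char_fun (conv (rho M X l) (distr (rho M X l) borel uminus)) z = char_fun (rho M X l) z * cnj (char_fun (rho M X l) z)"
      by (simp add: char_fun_conv rho borel_prob_distr char_fun_uminus)
    also have "\<dots> = of_real ((norm (char_fun (rho M X l) z))\<^sup>2)" by (rule complex_norm_square[symmetric])
    also have "(norm (char_fun (rho M X l) z))\<^sup>2 = exp (- (\<Sum>v\<leftarrow>bs. (z \<bullet> v)\<^sup>2) - 2 * (\<integral>x. 1 - cos (z \<bullet> x) \<partial>\<nu>'))"
    proof -
      have "?N z = ?N (b *\<^sub>R z) * (norm (char_fun (rho M X l) z))\<^sup>2"
        unfolding b_def by (subst char_fun_decomposition[OF l]) (simp add: norm_mult power_mult_distrib)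
      moreover have "?N z = ?N (b *\<^sub>R z) * exp (- (\<Sum>v\<leftarrow>bs. (z \<bullet> v)\<^sup>2) - 2 * (\<integral>x. 1 - cos (z \<bullet> x) \<partial>\<nu>'))"
        unfolding char_\<mu> exp_add[symmetric] bs[symmetric] cos_split[of z]
        by (simp add: A.scale power2_eq_square algebra_simps)
      moreover have "?N (b *\<^sub>R z) \<noteq> 0" unfolding char_\<mu> by simp
      ultimately show ?thesis by (metis mult_cancel_left)
    qed
    finally show ?thesis .
  qed
  from levy_moment[OF borel_prob_conv[OF rho borel_prob_distr[OF rho]] s' levy' this]
  have "(\<integral>\<^sup>+x. wt x \<partial>conv (rho M X l) (distr (rho M X l) borel uminus)) < \<infinity> \<longleftrightarrow> (\<integral>\<^sup>+x\<in>{x. norm x > 1}. wt x \<partial>\<nu>') < \<infinity>"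
    by simp
  then show "(\<integral>\<^sup>+x. ennreal (\<phi> (norm x)) \<partial>rho M X l) < \<infinity> \<longleftrightarrow>
      (\<integral>\<^sup>+r\<in>{1..}. ennreal (\<phi> r) * ennreal ((K r - K (exp (H * real l) * r)) / r) \<partial>lborel) < \<infinity>"
    unfolding wt_integral_symmetrization[OF rho] using rad[of "\<lambda>r. ennreal (\<phi> r)"] by (simp add: wt_def[abs_def] rb)
  have "(\<integral>\<^sup>+r\<in>{1..}. ennreal ((K r - K (exp (H * real l) * r)) / r) \<partial>lborel) = (\<integral>\<^sup>+x\<in>{x. norm x > 1}. 1 \<partial>\<nu>')"
    using rad[of "\<lambda>_. 1"] by (simp add: rb)
  also have "\<dots> \<le> (\<integral>\<^sup>+x. ennreal (min 1 ((norm x)\<^sup>2)) \<partial>\<nu>')"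
    by (intro nn_integral_mono) (auto simp: indicator_def min_def)
  finally show "(\<integral>\<^sup>+r\<in>{1..}. ennreal ((K r - K (exp (H * real l) * r)) / r) \<partial>lborel) < \<infinity>"
    using levy' by (rule le_less_trans)
  show "\<And>r. r > 0 \<Longrightarrow> K r \<ge> 0" "antimono_on {0<..} K" by (fact K0, fact Kanti)
qed

end

text \<open>Restriction to a ray gives a submultiplicative \<open>\<eta>\<close> on the whole real
  line that equals \<open>ginv g\<close> outside a bounded interval. Inside, its values are not
  prescribed, but shifting by \<open>3 * R1\<close> leads to known ones and bounds
  \<open>\<eta>\<close> from both sides. Hence \<open>\<eta>\<close> is comparable to
  \<open>1 + ginv g\<close> on the half-line, and comparability transfers submultiplicativity;
  rescaling by \<open>\<delta>\<close> preserves it.\<close>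

lemma submult_weight_of_submultiplicative:
  fixes g :: "real \<Rightarrow> real"
  assumes g: "g \<in> G1" and sub: "submultiplicative_off_ball (\<lambda>x::'v::euclidean_space. ginv g (norm x))" and d: "\<delta> > 0"
  shows "\<exists>c. submult_weight (\<lambda>r. 1 + ginv g (r / \<delta>)) c"
proof -
  obtain h :: "'v \<Rightarrow> real" and R c where h: "\<And>x. h x > 0" "c > 0" "\<And>x y. h (x + y) \<le> c * h x * h y"
    "\<And>x. norm x > R \<Longrightarrow> h x = ginv g (norm x)"
    using sub unfolding submultiplicative_off_ball_def submultiplicative_def by blast
  obtain e :: 'v where e: "norm e = 1" using vector_choose_size[of 1] by auto
  define \<eta> where "\<eta> t = h (t *\<^sub>R e)" for t
  define f where "f = ginv g"
  define R1 where "R1 = max R 0 + 1"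
  have R1: "R1 > 0" "R1 > R" by (auto simp: R1_def)
  have \<eta>: "\<eta> t > 0" "\<eta> (s + t) \<le> c * \<eta> s * \<eta> t" for s t
    using h(1,3) by (auto simp: \<eta>_def scaleR_left_distrib)
  have \<eta>f: "\<eta> t = f \<bar>t\<bar>" if "\<bar>t\<bar> \<ge> R1" for t
    using h(4)[of "t *\<^sub>R e"] that R1 e by (simp add: \<eta>_def f_def)
  have f: "f r \<ge> 0" "r \<le> s \<Longrightarrow> f r \<le> f s" for r s using ginv_nonneg[OF g] ginv_mono[OF g] by (auto simp: f_def)
  have fpos: "f r > 0" if "r \<ge> R1" for r using \<eta>f[of r] \<eta>(1)[of r] that R1 by simp
  \<comment> \<open>For \<open>0 \<le> t < R1\<close>, writing \<open>t\<close> as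
    \<open>t + 3 * R1\<close> plus \<open>- (3 * R1)\<close> gives two arguments where
    \<open>\<eta>\<close> is known, the first of them below \<open>4 * R1\<close>.\<close>
  define a where "a = max 1 (c * f (4 * R1) * f (3 * R1))"
  have a: "a \<ge> 1" by (simp add: a_def)
  have upper: "\<eta> t \<le> a * (1 + f t)" if t: "t \<ge> 0" for t
  proof (cases "t \<ge> R1")
    case True
    have "\<eta> t = f t" using \<eta>f[of t] True t by simp
    also have "\<dots> \<le> 1 * (1 + f t)" by simp
    also have "\<dots> \<le> a * (1 + f t)" using a f(1)[of t] by (intro mult_right_mono) auto
    finally show ?thesis .
  next
    case False
    have "\<eta> t \<le> c * \<eta> (t + 3 * R1) * \<eta> (- (3 * R1))" using \<eta>(2)[of "t + 3 * R1" "- (3 * R1)"] by simp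
    also have "\<dots> = c * f (t + 3 * R1) * f (3 * R1)" using R1 t \<eta>f[of "t + 3 * R1"] \<eta>f[of "- (3 * R1)"] by simp
    also have "\<dots> \<le> c * f (4 * R1) * f (3 * R1)"
      using False h(2) f(1)[of "3 * R1"] by (intro mult_right_mono mult_left_mono f(2)) auto
    also have "\<dots> \<le> a * 1" by (simp add: a_def)
    also have "\<dots> \<le> a * (1 + f t)" using a f(1)[of t] by (intro mult_left_mono) auto
    finally show ?thesis .
  qed
  \<comment> \<open>A lower bound of \<open>\<eta>\<close> for \<open>0 \<le> t < R1\<close>: split
    \<open>3 * R1\<close> into \<open>3 * R1 - t\<close> and \<open>t\<close>, where
    \<open>\<eta> (3 * R1 - t)\<close> is known and at most \<open>f (4 * R1)\<close>.\<close>
  define m where "m = f (3 * R1) / (c * f (4 * R1))"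
  have m: "m > 0" unfolding m_def using fpos[of "3 * R1"] fpos[of "4 * R1"] R1 h(2) by simp
  define a' where "a' = max (1 / f R1 + 1) ((1 + f R1) / m)"
  have a': "a' \<ge> 1 / f R1 + 1" "a' \<ge> (1 + f R1) / m" by (auto simp: a'_def)
  have "a' > 0" using a'(1) fpos[of R1] by (smt (verit) divide_pos_pos)
  have lower: "1 + f t \<le> a' * \<eta> t" if t: "t \<ge> 0" for t
  proof (cases "t \<ge> R1")
    case True
    have "f R1 \<le> f t" using True by (rule f(2))
    then have "1 \<le> (1 / f R1) * f t" using fpos[of R1] by (simp add: field_simps)
    then have "1 + f t \<le> (1 / f R1 + 1) * f t" by (simp add: ring_distribs)
    also have "\<dots> \<le> a' * f t" using a'(1) f(1)[of t] by (intro mult_right_mono)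
    finally show ?thesis using \<eta>f[of t] True t by simp
  next
    case False
    have "f (3 * R1) = \<eta> (3 * R1)" using \<eta>f[of "3 * R1"] R1 by simp
    also have "\<dots> \<le> c * \<eta> (3 * R1 - t) * \<eta> t" using \<eta>(2)[of "3 * R1 - t" t] by simp
    also have "\<eta> (3 * R1 - t) = f (3 * R1 - t)" using \<eta>f[of "3 * R1 - t"] False R1 by simp
    also have "c * f (3 * R1 - t) * \<eta> t \<le> c * f (4 * R1) * \<eta> t"
      using t R1 h(2) \<eta>(1)[of t] by (intro mult_right_mono mult_left_mono f(2)) auto
    finally have "m \<le> \<eta> t" using fpos[of "4 * R1"] R1 h(2) by (simp add: m_def divide_le_eq mult_ac)
    have "1 + f t \<le> 1 + f R1" using False by (simp add: f(2))
    also have "\<dots> = ((1 + f R1) / m) * m" using m by simp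
    also have "\<dots> \<le> a' * \<eta> t" using a'(2) \<open>m \<le> \<eta> t\<close> m \<open>a' > 0\<close> by (intro mult_mono) auto
    finally show ?thesis .
  qed
  show ?thesis
  proof (intro exI[of _ "a' * c * (a * a)"] submult_weight.intro)
    show "mono (\<lambda>r. 1 + ginv g (r / \<delta>))" using d f(2) by (auto intro!: monoI simp: f_def divide_right_mono)
    show "1 \<le> 1 + ginv g (r / \<delta>)" for r using f(1) by (simp add: f_def)
    show "0 < a' * c * (a * a)" using \<open>a' > 0\<close> h(2) a by simp
    fix r s :: real assume rs: "0 \<le> r" "0 \<le> s"
    then have rs': "0 \<le> r / \<delta>" "0 \<le> s / \<delta>" using d by auto
    have "1 + f (r / \<delta> + s / \<delta>) \<le> a' * \<eta> (r / \<delta> + s / \<delta>)" using rs' by (intro lower) auto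
    also have "\<dots> \<le> a' * (c * \<eta> (r / \<delta>) * \<eta> (s / \<delta>))" using \<open>a' > 0\<close> by (intro mult_left_mono \<eta>) auto
    also have "\<dots> \<le> a' * (c * (a * (1 + f (r / \<delta>))) * (a * (1 + f (s / \<delta>))))"
      using \<open>a' > 0\<close> h(2) a f(1) rs' \<eta>(1)[of "s / \<delta>"] by (intro mult_left_mono mult_mono upper) (auto intro!: mult_nonneg_nonneg add_nonneg_nonneg less_imp_le)
    finally show "1 + ginv g ((r + s) / \<delta>) \<le> a' * c * (a * a) * (1 + ginv g (r / \<delta>)) * (1 + ginv g (s / \<delta>))"
      by (simp add: f_def add_divide_distrib mult_ac)
  qed
qed

section \<open>Reduction to one window and to the integral without difference\<close>

lemma critical_value_cong:
  assumes "\<And>\<delta>. \<delta> > 0 \<Longrightarrow> I \<delta> < \<infinity> \<longleftrightarrow> J \<delta> < \<infinity>"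
  shows "critical_value C I \<longleftrightarrow> critical_value C J"
proof -
  have "I \<delta> = \<infinity> \<longleftrightarrow> J \<delta> = \<infinity>" if "\<delta> > 0" for \<delta>
    using assms[OF that] by (auto simp: less_top[symmetric])
  with assms show ?thesis unfolding critical_value_def by auto
qed

lemma antimono_measurable_pos:
  fixes K :: "real \<Rightarrow> real"
  assumes "antimono_on {0<..} K"
  shows "(\<lambda>r. K r * indicator {0<..} r) \<in> borel_measurable borel"
proof -
  have "mono_on {0<..} (\<lambda>r. - K r)" using assms by (auto simp: monotone_on_def)
  then have "(\<lambda>r. - K r) \<in> borel_measurable (restrict_space borel {0<..})"
    by (rule borel_measurable_mono_on_fnc)
  then have "(\<lambda>r. indicator {0<..} r *\<^sub>R (- K r)) \<in> borel_measurable borel"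
    by (subst (asm) borel_measurable_restrict_space_iff) auto
  then have "(\<lambda>r. - (indicator {0<..} r *\<^sub>R (- K r))) \<in> borel_measurable borel" by (rule borel_measurable_uminus)
  then show ?thesis by (simp add: mult.commute)
qed

lemma radial_difference_measurable:
  fixes K f :: "real \<Rightarrow> real"
  assumes K: "antimono_on {0<..} K" and c: "c > 0" and [measurable]: "f \<in> borel_measurable borel"
  shows "(\<lambda>r. (K r - K (c * r)) / r * f r * indicator {1..} r) \<in> borel_measurable borel"
proof -
  define L where "L r = K r * indicator {0<..} r" for r
  have [measurable]: "L \<in> borel_measurable borel"
    unfolding L_def[abs_def] by (rule antimono_measurable_pos[OF K])
  have "(\<lambda>r. (L r - L (c * r)) / r * f r * indicator {1..} r) \<in> borel_measurable borel" by measurable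
  also have "(\<lambda>r. (L r - L (c * r)) / r * f r * indicator {1..} r) = (\<lambda>r. (K r - K (c * r)) / r * f r * indicator {1..} r)"
    using c by (auto simp: fun_eq_iff indicator_def L_def)
  finally show ?thesis .
qed

context ss_additive
begin

definition radial_integral :: "(real \<Rightarrow> real) \<Rightarrow> (real \<Rightarrow> real) \<Rightarrow> nat \<Rightarrow> real \<Rightarrow> ennreal" where
  "radial_integral g K l \<delta> = (\<integral>\<^sup>+r\<in>{1..}. ennreal ((K r - K (exp (H * real l) * r)) / r * ginv g (r / \<delta>)) \<partial>lborel)"

text \<open>The constant 1 in the weight adds the total mass of \<open>rho\<close> on one side and
  the mass of its Levy measure outside the unit ball on the other; both are finite.\<close>

lemma tail_integral_iff_radial_integral:
  assumes g: "g \<in> G1" and sub: "submultiplicative_off_ball (\<lambda>x::'v. ginv g (norm x))"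
    and \<nu>: "levy_measure_of (distr M borel (X 1)) \<nu>" and K: "radial_function \<nu> K"
    and d: "\<delta> > 0" and l: "l \<ge> 1"
  shows "tail_integral g l \<delta> < \<infinity> \<longleftrightarrow> radial_integral g K l \<delta> < \<infinity>"
proof -
  obtain c where c: "submult_weight (\<lambda>r. 1 + ginv g (r / \<delta>)) c"
    using submult_weight_of_submultiplicative[OF g sub d] by blast
  note m = rho_moment_iff[OF l \<nu> K c]
  let ?D = "\<lambda>r. (K r - K (exp (H * real l) * r)) / r"
  have [measurable]: "ginv g \<in> borel_measurable borel" by (rule ginv_measurable[OF g])
  have Dm: "(\<lambda>r. ?D r * indicator {1..} r) \<in> borel_measurable borel"
    using radial_difference_measurable[OF m(4), of "exp (H * real l)" "\<lambda>_. 1"] by simp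
  have D0: "?D r \<ge> 0" if "r \<ge> 1" for r
  proof -
    have "1 * r \<le> exp (H * real l) * r" using that H_pos by (intro mult_right_mono) auto
    then have "K (exp (H * real l) * r) \<le> K r" using that by (intro monotone_onD[OF m(4)]) auto
    then show ?thesis using that by simp
  qed
  have rho_sets: "sets (rho M X l) = sets borel" by (simp add: rho_def)
  have [measurable_cong]: "sets (rho M X l) = sets borel" by (rule rho_sets)
  interpret R: prob_space "rho M X l" by (rule rho_prob_space)
  have "(\<integral>\<^sup>+x. ennreal (1 + ginv g (norm x / \<delta>)) \<partial>rho M X l) = (\<integral>\<^sup>+x. 1 + ennreal (ginv g (norm x / \<delta>)) \<partial>rho M X l)"
    by (intro nn_integral_cong) (subst ennreal_plus, simp_all add: ginv_nonneg[OF g])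
  also have "\<dots> = 1 + tail_integral g l \<delta>"
    unfolding tail_integral_eq_rho_integral[OF g d] by (subst nn_integral_add) (auto simp: R.emeasure_space_1)
  finally have 1: "(\<integral>\<^sup>+x. ennreal (1 + ginv g (norm x / \<delta>)) \<partial>rho M X l) < \<infinity> \<longleftrightarrow> tail_integral g l \<delta> < \<infinity>"
    by (simp add: ennreal_add_less_top)
  have "(\<integral>\<^sup>+r\<in>{1..}. ennreal (1 + ginv g (r / \<delta>)) * ennreal (?D r) \<partial>lborel)
      = (\<integral>\<^sup>+r. ennreal (?D r * indicator {1..} r) + ennreal (?D r * indicator {1..} r * ginv g (r / \<delta>)) \<partial>lborel)"
  proof (intro nn_integral_cong)
    fix r :: real
    have "ennreal (1 + ginv g (r / \<delta>)) * ennreal (?D r) = ennreal (?D r) + ennreal (?D r * ginv g (r / \<delta>))" if "r \<ge> 1"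
    proof -
      have "ennreal (1 + ginv g (r / \<delta>)) * ennreal (?D r) = ennreal ((1 + ginv g (r / \<delta>)) * ?D r)"
        using ginv_nonneg[OF g] D0[OF that] by (intro ennreal_mult[symmetric]) auto
      also have "(1 + ginv g (r / \<delta>)) * ?D r = ?D r + ?D r * ginv g (r / \<delta>)"
        by (simp only: distrib_right mult_1_left mult.commute)
      also have "ennreal \<dots> = ennreal (?D r) + ennreal (?D r * ginv g (r / \<delta>))"
        using ginv_nonneg[OF g] D0[OF that] by (intro ennreal_plus mult_nonneg_nonneg)
      finally show ?thesis .
    qed
    then show "ennreal (1 + ginv g (r / \<delta>)) * ennreal (?D r) * indicator {1..} r
      = ennreal (?D r * indicator {1..} r) + ennreal (?D r * indicator {1..} r * ginv g (r / \<delta>))"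
      by (auto simp: indicator_def)
  qed
  also have "\<dots> = (\<integral>\<^sup>+r. ennreal (?D r * indicator {1..} r) \<partial>lborel) + (\<integral>\<^sup>+r. ennreal (?D r * indicator {1..} r * ginv g (r / \<delta>)) \<partial>lborel)"
  proof (rule nn_integral_add)
    show "(\<lambda>r. ennreal (?D r * indicator {1..} r)) \<in> borel_measurable lborel"
      using measurable_compose[OF Dm measurable_ennreal] by simp
    have "(\<lambda>r. ginv g (r / \<delta>)) \<in> borel_measurable borel" by measurable
    from measurable_compose[OF borel_measurable_times[OF Dm this] measurable_ennreal]
    show "(\<lambda>r. ennreal (?D r * indicator {1..} r * ginv g (r / \<delta>))) \<in> borel_measurable lborel" by simp
  qed
  also have "(\<integral>\<^sup>+r. ennreal (?D r * indicator {1..} r) \<partial>lborel) = (\<integral>\<^sup>+r\<in>{1..}. ennreal (?D r) \<partial>lborel)"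
    by (intro nn_integral_cong) (auto simp: indicator_def)
  also have "(\<integral>\<^sup>+r. ennreal (?D r * indicator {1..} r * ginv g (r / \<delta>)) \<partial>lborel) = radial_integral g K l \<delta>"
    unfolding radial_integral_def by (intro nn_integral_cong) (auto simp: indicator_def)
  finally have 2: "(\<integral>\<^sup>+r\<in>{1..}. ennreal (1 + ginv g (r / \<delta>)) * ennreal (?D r) \<partial>lborel) < \<infinity> \<longleftrightarrow> radial_integral g K l \<delta> < \<infinity>"
    using m(2) by (simp add: ennreal_add_less_top)
  show ?thesis using m(1) 1 2 by simp
qed

text \<open>The difference over \<open>Suc l\<close> windows is that over one window plus, at
  \<open>exp H * r\<close>, that over \<open>l\<close> windows. The substitution by
  \<open>exp H\<close> leaves dr / r unchanged, and \<open>ginv g\<close> only increases when its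
  argument is enlarged.\<close>

lemma radial_integral_Suc_finite:
  assumes g: "g \<in> G1" and K: "antimono_on {0<..} K" and d: "\<delta> > 0" and l: "l \<ge> 1"
    and fin: "radial_integral g K 1 \<delta> < \<infinity>" "radial_integral g K l \<delta> < \<infinity>"
  shows "radial_integral g K (Suc l) \<delta> < \<infinity>"
proof -
  define q where "q = exp H"
  define Q where "Q = exp (H * real l)"
  have q: "q > 1" "Q \<ge> 1" using H_pos by (auto simp: q_def Q_def)
  have [measurable]: "ginv g \<in> borel_measurable borel" by (rule ginv_measurable[OF g])
  define D where "D c r = (K r - K (c * r)) / r * ginv g (r / \<delta>) * indicator {1..} r" for c r
  have Dm [measurable]: "D c \<in> borel_measurable borel" if "c > 0" for c
    unfolding D_def[abs_def] by (rule radial_difference_measurable[OF K that]) measurable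
  have D0: "D c r \<ge> 0" if "c \<ge> 1" for c r
  proof (cases "r \<ge> 1")
    case True
    have "1 * r \<le> c * r" using that True by (intro mult_right_mono) auto
    then have "K (c * r) \<le> K r" using that True by (intro monotone_onD[OF K]) auto
    then show ?thesis using True ginv_nonneg[OF g] by (simp add: D_def)
  qed (simp add: D_def)
  have R: "radial_integral g K j \<delta> = (\<integral>\<^sup>+r. ennreal (D (exp (H * real j)) r) \<partial>lborel)" for j
    unfolding radial_integral_def D_def by (intro nn_integral_cong) (auto simp: indicator_def)
  have expS: "exp (H * real (Suc l)) = Q * q" by (simp add: q_def Q_def exp_add[symmetric] algebra_simps)
  have bound: "D (Q * q) r \<le> D q r + q * D Q (q * r)" for r
  proof (cases "r \<ge> 1")
    case True
    have "1 * 1 \<le> q * r" using q True by (intro mult_mono) auto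
    then have qr: "q * r \<ge> 1" by simp
    have "1 * r \<le> q * r" using q True by (intro mult_right_mono) auto
    then have "r / \<delta> \<le> q * r / \<delta>" using d by (intro divide_right_mono) auto
    then have gi: "ginv g (r / \<delta>) \<le> ginv g (q * r / \<delta>)" by (rule ginv_mono[OF g])
    have "1 * (q * r) \<le> Q * (q * r)" using q qr by (intro mult_right_mono) auto
    then have "K (Q * (q * r)) \<le> K (q * r)" using q qr by (intro monotone_onD[OF K]) auto
    then have "(K (q * r) - K (Q * (q * r))) / r * ginv g (r / \<delta>) \<le> (K (q * r) - K (Q * (q * r))) / r * ginv g (q * r / \<delta>)"
      using True gi by (intro mult_left_mono) auto
    moreover have "D (Q * q) r = D q r + (K (q * r) - K (Q * (q * r))) / r * ginv g (r / \<delta>)"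
      using True by (simp add: D_def mult.assoc diff_divide_distrib ring_distribs)
    moreover have "q * D Q (q * r) = (K (q * r) - K (Q * (q * r))) / r * ginv g (q * r / \<delta>)"
      using True qr q by (simp add: D_def)
    ultimately show ?thesis by simp
  next
    case False
    then have "D (Q * q) r = 0" "D q r = 0" by (auto simp: D_def)
    then show ?thesis using D0[of Q "q * r"] q by simp
  qed
  have "radial_integral g K (Suc l) \<delta> \<le> (\<integral>\<^sup>+r. ennreal (D q r) + ennreal (q * D Q (q * r)) \<partial>lborel)"
    unfolding R expS
  proof (intro nn_integral_mono)
    fix r
    have "ennreal (D (Q * q) r) \<le> ennreal (D q r + q * D Q (q * r))" by (rule ennreal_leI[OF bound])
    then show "ennreal (D (Q * q) r) \<le> ennreal (D q r) + ennreal (q * D Q (q * r))"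
      using D0 q by (subst (asm) ennreal_plus) auto
  qed
  also have "\<dots> = (\<integral>\<^sup>+r. ennreal (D q r) \<partial>lborel) + (\<integral>\<^sup>+r. ennreal (q * D Q (q * r)) \<partial>lborel)"
    using q Dm[of q] measurable_compose[OF _ Dm[of Q], of "\<lambda>r. q * r" borel] by (intro nn_integral_add) auto
  also have "(\<integral>\<^sup>+r. ennreal (D q r) \<partial>lborel) = radial_integral g K 1 \<delta>" by (simp add: R q_def)
  also have "(\<integral>\<^sup>+r. ennreal (q * D Q (q * r)) \<partial>lborel) = radial_integral g K l \<delta>"
  proof -
    have "radial_integral g K l \<delta> = ennreal \<bar>q\<bar> * (\<integral>\<^sup>+r. ennreal (D Q (0 + q * r)) \<partial>lborel)"
      unfolding R Q_def[symmetric] using q Dm[of Q] by (intro nn_integral_real_affine) auto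
    also have "\<dots> = (\<integral>\<^sup>+r. ennreal q * ennreal (D Q (q * r)) \<partial>lborel)"
      using q measurable_compose[OF _ Dm[of Q], of "\<lambda>r. q * r" borel] by (subst nn_integral_cmult) auto
    also have "\<dots> = (\<integral>\<^sup>+r. ennreal (q * D Q (q * r)) \<partial>lborel)"
      using q D0[of Q] by (intro nn_integral_cong) (simp add: ennreal_mult)
    finally show ?thesis by simp
  qed
  finally show ?thesis using fin by (auto simp: ennreal_add_less_top intro: le_less_trans)
qed

lemma radial_integral_finite:
  assumes g: "g \<in> G1" and K: "antimono_on {0<..} K" and d: "\<delta> > 0" and l: "l \<ge> 1"
    and fin: "radial_integral g K 1 \<delta> < \<infinity>"
  shows "radial_integral g K l \<delta> < \<infinity>"
  using l by (induction l rule: dec_induct) (use fin radial_integral_Suc_finite[OF g K d] in auto)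

text \<open>Finiteness for \<open>l = 1\<close> propagates to every \<open>l\<close>, so "for all
  \<open>l\<close>" and "for some \<open>l\<close>" in the two cases collapse to one
  integral.\<close>

lemma tail_critical_iff_critical_value:
  assumes g: "g \<in> G1" and sub: "submultiplicative_off_ball (\<lambda>x::'v. ginv g (norm x))"
    and \<nu>: "levy_measure_of (distr M borel (X 1)) \<nu>" and K: "radial_function \<nu> K"
  shows "tail_critical g C \<longleftrightarrow> critical_value C (radial_integral g K 1)"
proof -
  obtain c where c: "submult_weight (\<lambda>r. 1 + ginv g (r / 1)) c"
    using submult_weight_of_submultiplicative[OF g sub, of 1] by auto
  have Kanti: "antimono_on {0<..} K" by (rule rho_moment_iff(4)[OF order_refl \<nu> K c])
  have *: "tail_integral g l \<delta> < \<infinity> \<longleftrightarrow> radial_integral g K l \<delta> < \<infinity>" if "\<delta> > 0" "l \<ge> 1" for l \<delta>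
    using tail_integral_iff_radial_integral[OF g sub \<nu> K that] .
  have all: "(\<forall>l\<ge>1. tail_integral g l \<delta> < \<infinity>) \<longleftrightarrow> radial_integral g K 1 \<delta> < \<infinity>" if "\<delta> > 0" for \<delta>
    using *[OF that] radial_integral_finite[OF g Kanti that] by blast
  have ex: "(\<exists>l\<ge>1. tail_integral g l \<delta> = \<infinity>) \<longleftrightarrow> radial_integral g K 1 \<delta> = \<infinity>" if "\<delta> > 0" for \<delta>
    using all[OF that] by (metis infinity_ennreal_def less_top)
  show ?thesis
    unfolding tail_critical_def critical_value_def using all ex by auto
qed

text \<open>Beyond some \<open>R\<close> the value \<open>K (exp H * r)\<close> is at most a fixed
  fraction of \<open>K r\<close>, so \<open>K r\<close> is bounded by a multiple of the difference.
  On the bounded range up to \<open>R\<close> monotonicity makes the integrand bounded.\<close>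

lemma critical_value_iff_if_Limsup_less_1:
  assumes g: "g \<in> G1" and K0: "\<And>r. r > 0 \<Longrightarrow> K r \<ge> 0" and K: "antimono_on {0<..} K"
    and lim: "Limsup at_top (\<lambda>r. ereal (K (exp H * r) / K r)) < 1"
  shows "critical_value C (radial_integral g K 1) \<longleftrightarrow>
    critical_value C (\<lambda>\<delta>. \<integral>\<^sup>+r\<in>{1..}. ennreal (K r * ginv g (r / \<delta>) / r) \<partial>lborel)"
proof (rule critical_value_cong)
  fix \<delta> :: real assume d: "\<delta> > 0"
  have [measurable]: "ginv g \<in> borel_measurable borel" by (rule ginv_measurable[OF g])
  define I2 where "I2 = (\<integral>\<^sup>+r\<in>{1..}. ennreal (K r * ginv g (r / \<delta>) / r) \<partial>lborel)"
  have le: "K (exp H * r) \<le> K r" if "r \<ge> 1" for r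
  proof -
    have "1 * r \<le> exp H * r" using that H_pos by (intro mult_right_mono) auto
    then show ?thesis using that by (intro monotone_onD[OF K]) auto
  qed
  obtain \<theta> where \<theta>: "Limsup at_top (\<lambda>r. ereal (K (exp H * r) / K r)) < ereal \<theta>" "\<theta> < 1"
    using ereal_dense2[OF lim] by auto
  define \<theta>' where "\<theta>' = max 0 \<theta>"
  have "\<forall>\<^sub>F r in at_top. ereal (K (exp H * r) / K r) < ereal \<theta>" by (rule Limsup_lessD[OF \<theta>(1)])
  then obtain R0 where R0: "\<And>r. r \<ge> R0 \<Longrightarrow> K (exp H * r) / K r < \<theta>" by (auto simp: eventually_at_top_linorder)
  define R where "R = max 1 R0"
  have big: "K r \<le> 1 / (1 - \<theta>') * (K r - K (exp H * r))" if "r \<ge> R" for r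
  proof -
    have r: "r \<ge> 1" "r \<ge> R0" using that by (auto simp: R_def)
    have "K (exp H * r) \<le> \<theta>' * K r"
    \<comment> \<open>Where \<open>K r = 0\<close> the quotient is 0 by the convention for division
      and carries no information; there \<open>K (exp H * r)\<close> is at most 0 by
      monotonicity.\<close>
    proof (cases "K r = 0")
      case True
      then show ?thesis using le[OF r(1)] by simp
    next
      case False
      then have "K r > 0" using K0[of r] r by simp
      then have "K (exp H * r) < \<theta> * K r" using R0[OF r(2)] by (simp add: divide_less_eq)
      also have "\<dots> \<le> \<theta>' * K r" using \<open>K r > 0\<close> by (intro mult_right_mono) (auto simp: \<theta>'_def)
      finally show ?thesis by simp
    qed
    then have "(1 - \<theta>') * K r \<le> K r - K (exp H * r)" by (simp add: algebra_simps)
    moreover have "1 - \<theta>' > 0" using \<theta>(2) by (simp add: \<theta>'_def)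
    ultimately show ?thesis by (simp add: field_simps)
  qed
  show "radial_integral g K 1 \<delta> < \<infinity> \<longleftrightarrow> (\<integral>\<^sup>+r\<in>{1..}. ennreal (K r * ginv g (r / \<delta>) / r) \<partial>lborel) < \<infinity>"
    unfolding I2_def[symmetric]
  proof
    assume fin: "I2 < \<infinity>"
    have "radial_integral g K 1 \<delta> \<le> I2"
      unfolding radial_integral_def I2_def
    proof (intro nn_integral_mono)
      fix r :: real
      have "(K r - K (exp (H * real 1) * r)) / r * ginv g (r / \<delta>) \<le> K r * ginv g (r / \<delta>) / r" if "r \<ge> 1"
      proof -
        have "K r - K (exp (H * real 1) * r) \<le> K r" using K0[of "exp H * r"] that by simp
        then have "(K r - K (exp (H * real 1) * r)) * ginv g (r / \<delta>) / r \<le> K r * ginv g (r / \<delta>) / r"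
          using ginv_nonneg[OF g] that by (intro divide_right_mono mult_right_mono) auto
        then show ?thesis by simp
      qed
      then show "ennreal ((K r - K (exp (H * real 1) * r)) / r * ginv g (r / \<delta>)) * indicator {1..} r \<le> ennreal (K r * ginv g (r / \<delta>) / r) * indicator {1..} r"
        by (auto simp: indicator_def intro: ennreal_leI)
    qed
    with fin show "radial_integral g K 1 \<delta> < \<infinity>" by (rule le_less_trans[rotated])
  next
    assume fin: "radial_integral g K 1 \<delta> < \<infinity>"
    let ?D = "\<lambda>r. (K r - K (exp (H * real 1) * r)) / r * ginv g (r / \<delta>)"
    have Dm: "(\<lambda>r. ?D r * indicator {1..} r) \<in> borel_measurable borel"
      by (rule radial_difference_measurable[OF K]) (simp, measurable)
    have Dm': "(\<lambda>r. ennreal (?D r * indicator {1..} r)) \<in> borel_measurable lborel"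
      using measurable_compose[OF Dm measurable_ennreal] by simp
    have "I2 \<le> (\<integral>\<^sup>+r. ennreal (K 1 * ginv g (R / \<delta>)) * indicator {1..R} r + ennreal (1 / (1 - \<theta>')) * ennreal (?D r * indicator {1..} r) \<partial>lborel)"
      unfolding I2_def
    proof (intro nn_integral_mono)
      fix r :: real
      show "ennreal (K r * ginv g (r / \<delta>) / r) * indicator {1..} r \<le> ennreal (K 1 * ginv g (R / \<delta>)) * indicator {1..R} r + ennreal (1 / (1 - \<theta>')) * ennreal (?D r * indicator {1..} r)"
      proof (cases "r \<ge> 1")
        case r: True
        show ?thesis
        proof (cases "r \<le> R")
          case True
          have "K r \<le> K 1" using r by (intro monotone_onD[OF K]) auto
          moreover have "ginv g (r / \<delta>) \<le> ginv g (R / \<delta>)" using True d by (intro ginv_mono[OF g] divide_right_mono) auto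
          ultimately have "K r * ginv g (r / \<delta>) \<le> K 1 * ginv g (R / \<delta>)"
            using K0[of 1] ginv_nonneg[OF g] by (intro mult_mono) auto
          moreover have "K r * ginv g (r / \<delta>) / r \<le> K r * ginv g (r / \<delta>) / 1"
            using r K0[of r] ginv_nonneg[OF g] by (intro divide_left_mono) auto
          ultimately have "ennreal (K r * ginv g (r / \<delta>) / r) \<le> ennreal (K 1 * ginv g (R / \<delta>))" by (intro ennreal_leI) simp
          then show ?thesis using r True by (simp add: add_increasing2)
        next
          case False
          have "K r * ginv g (r / \<delta>) / r \<le> 1 / (1 - \<theta>') * (K r - K (exp H * r)) * ginv g (r / \<delta>) / r"
            using False r big[of r] ginv_nonneg[OF g] by (intro divide_right_mono mult_right_mono) auto
          also have "\<dots> = 1 / (1 - \<theta>') * ?D r" by simp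
          finally have "ennreal (K r * ginv g (r / \<delta>) / r) \<le> ennreal (1 / (1 - \<theta>') * ?D r)" by (rule ennreal_leI)
          also have "\<dots> = ennreal (1 / (1 - \<theta>')) * ennreal (?D r)"
            using \<theta>(2) le[OF r] r ginv_nonneg[OF g] by (intro ennreal_mult) (auto simp: \<theta>'_def)
          finally show ?thesis using r False by (simp add: add_increasing)
        qed
      qed simp
    qed
    also have "\<dots> = (\<integral>\<^sup>+r. ennreal (K 1 * ginv g (R / \<delta>)) * indicator {1..R} r \<partial>lborel) + (\<integral>\<^sup>+r. ennreal (1 / (1 - \<theta>')) * ennreal (?D r * indicator {1..} r) \<partial>lborel)"
      using Dm' by (intro nn_integral_add) (auto intro: borel_measurable_times_ennreal)
    also have "(\<integral>\<^sup>+r. ennreal (1 / (1 - \<theta>')) * ennreal (?D r * indicator {1..} r) \<partial>lborel) = ennreal (1 / (1 - \<theta>')) * (\<integral>\<^sup>+r. ennreal (?D r * indicator {1..} r) \<partial>lborel)"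
      by (rule nn_integral_cmult[OF Dm'])
    also have "(\<integral>\<^sup>+r. ennreal (?D r * indicator {1..} r) \<partial>lborel) = radial_integral g K 1 \<delta>"
      unfolding radial_integral_def by (intro nn_integral_cong) (auto simp: indicator_def)
    also have "(\<integral>\<^sup>+r. ennreal (K 1 * ginv g (R / \<delta>)) * indicator {1..R} r \<partial>lborel) = ennreal (K 1 * ginv g (R / \<delta>)) * emeasure lborel {1..R}"
      by (rule nn_integral_cmult_indicator) simp
    also have "ennreal (K 1 * ginv g (R / \<delta>)) * emeasure lborel {1..R} + ennreal (1 / (1 - \<theta>')) * radial_integral g K 1 \<delta> < \<infinity>"
      using fin by (simp add: ennreal_mult_less_top ennreal_add_less_top R_def)
    finally show "I2 < \<infinity>" .
  qed
qed

end

theorem theorem2p11: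
  fixes M :: "'w measure" and X :: "real \<Rightarrow> 'w \<Rightarrow> 'v::euclidean_space"
    and H :: real and g :: "real \<Rightarrow> real"
  assumes "selfsimilar_additive_process M H X"
    and "\<not> deterministic_process M H X"
    and "g \<in> G1"
  shows
    "(\<exists>C. limsup_law M H X g C) \<and>
     (\<forall>l\<ge>1. \<forall>\<delta>>0.
        (\<integral>\<^sup>+x\<in>{0..}. ennreal (G_tail M X l (\<delta> * g x)) \<partial>lborel) =
        (\<integral>\<^sup>+x. ennreal (ginv g (norm x / \<delta>)) \<partial>(rho M X l))) \<and>
     (\<forall>C. limsup_law M H X g C \<longleftrightarrow>
        (\<forall>\<delta>>0. ennreal \<delta> > C \<longrightarrow>
           (\<forall>l\<ge>1. (\<integral>\<^sup>+x\<in>{0..}. ennreal (G_tail M X l (\<delta> * g x)) \<partial>lborel) < \<infinity>)) \<and>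
        (\<forall>\<delta>>0. ennreal \<delta> < C \<longrightarrow>
           (\<exists>l\<ge>1. (\<integral>\<^sup>+x\<in>{0..}. ennreal (G_tail M X l (\<delta> * g x)) \<partial>lborel) = \<infinity>))) \<and>
     (submultiplicative_off_ball (\<lambda>x::'v. ginv g (norm x)) \<longrightarrow>
        (\<forall>\<nu> K. levy_measure_of (distr M borel (X 1)) \<nu> \<and> radial_function \<nu> K \<longrightarrow>
           (\<forall>C. limsup_law M H X g C \<longleftrightarrow>
              critical_value C (\<lambda>\<delta>. \<integral>\<^sup>+r\<in>{1..}.
                ennreal ((K r - K (exp H * r)) / r * ginv g (r / \<delta>)) \<partial>lborel)) \<and>
           (Limsup at_top (\<lambda>r. ereal (K (exp H * r) / K r)) < 1 \<longrightarrow>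
              (\<forall>C. critical_value C (\<lambda>\<delta>. \<integral>\<^sup>+r\<in>{1..}.
                      ennreal ((K r - K (exp H * r)) / r * ginv g (r / \<delta>)) \<partial>lborel) \<longleftrightarrow>
                   critical_value C (\<lambda>\<delta>. \<integral>\<^sup>+r\<in>{1..}.
                      ennreal (K r * ginv g (r / \<delta>) / r) \<partial>lborel)))))"
proof -
  interpret prob_space M using assms(1) by (simp add: selfsimilar_additive_process_def)
  interpret ss_additive M X H by standard (rule assms(1))
  note g = assms(3)
  have radial: "radial_integral g K 1 = (\<lambda>\<delta>. \<integral>\<^sup>+r\<in>{1..}. ennreal ((K r - K (exp H * r)) / r * ginv g (r / \<delta>)) \<partial>lborel)" for K
    by (simp add: fun_eq_iff radial_integral_def)
  show ?thesis
  proof (intro conjI allI impI)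
    show "\<exists>C. limsup_law M H X g C" using ex_tail_critical[OF g] limsup_law_if_tail_critical[OF g] by blast
    show "(\<integral>\<^sup>+x\<in>{0..}. ennreal (G_tail M X l (\<delta> * g x)) \<partial>lborel) = (\<integral>\<^sup>+x. ennreal (ginv g (norm x / \<delta>)) \<partial>(rho M X l))"
      if "\<delta> > 0" for l \<delta>
      using tail_integral_eq_rho_integral[OF g that] by (simp only: tail_integral_def)
    show "limsup_law M H X g C \<longleftrightarrow>
        (\<forall>\<delta>>0. ennreal \<delta> > C \<longrightarrow>
           (\<forall>l\<ge>1. (\<integral>\<^sup>+x\<in>{0..}. ennreal (G_tail M X l (\<delta> * g x)) \<partial>lborel) < \<infinity>)) \<and>
        (\<forall>\<delta>>0. ennreal \<delta> < C \<longrightarrow>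
           (\<exists>l\<ge>1. (\<integral>\<^sup>+x\<in>{0..}. ennreal (G_tail M X l (\<delta> * g x)) \<partial>lborel) = \<infinity>))" for C
      using limsup_law_iff_tail_critical[OF g, of C] by (simp only: tail_critical_def tail_integral_def)
  next
    fix \<nu> K C
    assume sub: "submultiplicative_off_ball (\<lambda>x::'v. ginv g (norm x))"
      and \<nu>K: "levy_measure_of (distr M borel (X 1)) \<nu> \<and> radial_function \<nu> K"
    show "limsup_law M H X g C \<longleftrightarrow> critical_value C (\<lambda>\<delta>. \<integral>\<^sup>+r\<in>{1..}. ennreal ((K r - K (exp H * r)) / r * ginv g (r / \<delta>)) \<partial>lborel)"
      using limsup_law_iff_tail_critical[OF g, of C] tail_critical_iff_critical_value[OF g sub, of \<nu> K C] \<nu>K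
      unfolding radial[symmetric] by simp
  next
    fix \<nu> K C
    assume sub: "submultiplicative_off_ball (\<lambda>x::'v. ginv g (norm x))"
      and \<nu>K: "levy_measure_of (distr M borel (X 1)) \<nu> \<and> radial_function \<nu> K"
      and lim: "Limsup at_top (\<lambda>r. ereal (K (exp H * r) / K r)) < 1"
    \<comment> \<open>The weight serves only to give access to the sign and monotonicity of
      \<open>K\<close> in \<open>rho_moment_iff\<close>; the level 1 is an arbitrary choice.\<close>
    obtain c where c: "submult_weight (\<lambda>r. 1 + ginv g (r / 1)) c"
      using submult_weight_of_submultiplicative[OF g sub, of 1] by auto
    have "levy_measure_of (distr M borel (X 1)) \<nu>" "radial_function \<nu> K" using \<nu>K by auto
    note K = rho_moment_iff(3,4)[OF order_refl this c]
    show "critical_value C (\<lambda>\<delta>. \<integral>\<^sup>+r\<in>{1..}. ennreal ((K r - K (exp H * r)) / r * ginv g (r / \<delta>)) \<partial>lborel) \<longleftrightarrow>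
      critical_value C (\<lambda>\<delta>. \<integral>\<^sup>+r\<in>{1..}. ennreal (K r * ginv g (r / \<delta>) / r) \<partial>lborel)"
      unfolding radial[symmetric] by (rule critical_value_iff_if_Limsup_less_1[OF g K lim])
  qed
qed

end
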